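(* Let $d=3$ and $K(y_1,y_2)=(y_1^{1/3}+y_2^{1/3})^2\sqrt{\frac{1}{y_1}+\frac{1}{y_2}}$, and let $a(y)=y^{-1/3}$ or $a(y)=y^{-2/3}$. Let $\mu_0$ be an initial kernel such that $\mu_0\mathbf{1}_{y<\delta}=0$ for some $\delta>0$, $\sup_{t>0}\|\langle y^{4/3},P_t(\mu_0)\rangle\|_\infty<\infty$ and $\|\langle y,\mu_0\rangle\|_1<\infty$. Then there exists $T>0$ such that there exists a unique solution of the coagulation-diffusion equation up to time $T$.
   Context: For $t>0$ and $x,x'\in\mathbb{R}^d$ put $p^{t,x',x}(y)=(2\pi a(y)t)^{-d/2}e^{-|x'-x|^2/(2a(y)t)}$, and for a kernel $\mu$ on $\mathbb{R}^d\times\mathcal{B}(0,\infty)$ put $P_t\mu(x,dy)=\int_{\mathbb{R}^d}\mu(x',dy)p^{t,x',x}(y)\,dx'$ ($P_0$ is the identity). Put $$K^+(\mu)(x,A)=\tfrac12\int_0^\infty\!\!\int_0^\infty\mathbf{1}_{y+y'\in A}K(y,y')\mu(x,dy)\mu(x,dy'),\qquad K^-(\mu)(x,A)=\int_{y\in A}\int_0^\infty K(y,y')\mu(x,dy)\mu(x,dy').$$ The coagulation-diffusion equation with initial kernel $\mu_0$ is $$\mu_t+\int_0^tP_{t-s}K^-(\mu_s)\,ds=P_t\mu_0+\int_0^tP_{t-s}K^+(\mu_s)\,ds.$$ $\mathcal{M}[0,T]$ is the set of measurable kernels $\mu:[0,T]\times\mathbb{R}^d\times\mathcal{B}(0,\infty)\to[0,\infty]$.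 For $f:(0,\infty)\to(0,\infty)$, $\langle f,\mu_t\rangle(x)=\int_0^\infty f(y)\mu_t(x,dy)$ (so $\langle y,\mu_t\rangle$, $\langle y^{4/3},\mu_t\rangle$ mean $f(y)=y$, $f(y)=y^{4/3}$). $\|\cdot\|_1$ and $\|\cdot\|_\infty$ are the $L^1$ and $L^\infty$ norms over $x\in\mathbb{R}^d$. A solution up to time $T$ is a $\mu\in\mathcal{M}[0,T]$ satisfying the equation for $t\leq T$ and $\sup_{t\leq T}\|\langle y,\mu_t\rangle\|_1<\infty$.
   Formalization: A solution is also required to have finite loss term ∫_0^t P_{t-s}K^-(μ_s)(x,(0,∞))ds for all t≤T and x; otherwise the equation may read ∞=∞ and uniqueness fails, e.g. for μ_0=0 with μ_t(x,dy)=e^{-|x|^2-y}y^{-3/2}dy, t>0. *)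

theory Defs
  imports "HOL-Analysis.Analysis" "HOL-Probability.Essential_Supremum"
begin

text \<open>Sizes live in \<open>(0,\<infinity>)\<close>; measures on sizes are measures on this space.\<close>

definition sizes :: "real measure" where
  "sizes = restrict_space borel {0<..}"

text \<open>
  A kernel from \<open>M\<close> to \<open>(0,\<infinity>)\<close> with values in \<open>[0,\<infinity>]\<close>.  No finiteness is imposed.
\<close>

definition measurable_kernel :: "'b measure \<Rightarrow> ('b \<Rightarrow> real measure) \<Rightarrow> bool" where
  "measurable_kernel M \<mu> \<longleftrightarrow>
     (\<forall>z\<in>space M. sets (\<mu> z) = sets sizes) \<and>
     (\<forall>A\<in>sets sizes. (\<lambda>z. emeasure (\<mu> z) A) \<in> borel_measurable M)"

definition time_kernels :: "real \<Rightarrow> (real \<Rightarrow> 'a::euclidean_space \<Rightarrow> real measure) set" where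
  "time_kernels T = {\<mu>. measurable_kernel (restrict_space borel {0..T} \<Otimes>\<^sub>M borel) (\<lambda>(t, x). \<mu> t x)}"

definition moment :: "(real \<Rightarrow> real) \<Rightarrow> real measure \<Rightarrow> ennreal" where
  "moment f m = (\<integral>\<^sup>+ y. ennreal (f y) \<partial>m)"

definition diffusion_density ::
    "(real \<Rightarrow> real) \<Rightarrow> real \<Rightarrow> 'a::euclidean_space \<Rightarrow> 'a \<Rightarrow> real \<Rightarrow> real" where
  "diffusion_density a t x' x y =
     (2 * pi * a y * t) powr (- (real DIM('a) / 2)) * exp (- ((norm (x' - x))\<^sup>2 / (2 * a y * t)))"

text \<open>
  The operators below are given by their values on Borel sets \<open>A\<close>.  Recall that \<^const>\<open>measure_of\<close>
  yields the null measure if the given set function is not countably additive.  This does not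
  happen for \<open>\<sigma>\<close>-finite kernels, hence not for kernels of finite total mass outside a null set of
  \<open>x\<close>; see the lemmas at the end for \<open>coag_loss\<close> and \<open>coag_gain\<close>.
\<close>

definition diffuse ::
    "(real \<Rightarrow> real) \<Rightarrow> real \<Rightarrow> ('a::euclidean_space \<Rightarrow> real measure) \<Rightarrow> 'a \<Rightarrow> real measure" where
  "diffuse a t \<mu> x =
     (if t = 0 then \<mu> x
      else measure_of (space sizes) (sets sizes)
        (\<lambda>A. \<integral>\<^sup>+ x'. (\<integral>\<^sup>+ y\<in>A. ennreal (diffusion_density a t x' x y) \<partial>\<mu> x') \<partial>lborel))"

definition coag_gain ::
    "(real \<Rightarrow> real \<Rightarrow> real) \<Rightarrow> ('a \<Rightarrow> real measure) \<Rightarrow> 'a \<Rightarrow> real measure" where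
  "coag_gain K \<mu> x = measure_of (space sizes) (sets sizes)
     (\<lambda>A. 1 / 2 * (\<integral>\<^sup>+ y'. (\<integral>\<^sup>+ y. indicator A (y + y') * ennreal (K y y') \<partial>\<mu> x) \<partial>\<mu> x))"

definition coag_loss ::
    "(real \<Rightarrow> real \<Rightarrow> real) \<Rightarrow> ('a \<Rightarrow> real measure) \<Rightarrow> 'a \<Rightarrow> real measure" where
  "coag_loss K \<mu> x = measure_of (space sizes) (sets sizes)
     (\<lambda>A. \<integral>\<^sup>+ y\<in>A. (\<integral>\<^sup>+ y'. ennreal (K y y') \<partial>\<mu> x) \<partial>\<mu> x)"

definition total_gain ::
    "(real \<Rightarrow> real) \<Rightarrow> (real \<Rightarrow> real \<Rightarrow> real) \<Rightarrow> (real \<Rightarrow> 'a::euclidean_space \<Rightarrow> real measure)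
      \<Rightarrow> real \<Rightarrow> 'a \<Rightarrow> real set \<Rightarrow> ennreal" where
  "total_gain a K \<mu> t x A =
     (\<integral>\<^sup>+ s\<in>{0..t}. emeasure (diffuse a (t - s) (coag_gain K (\<mu> s)) x) A \<partial>lborel)"

definition total_loss ::
    "(real \<Rightarrow> real) \<Rightarrow> (real \<Rightarrow> real \<Rightarrow> real) \<Rightarrow> (real \<Rightarrow> 'a::euclidean_space \<Rightarrow> real measure)
      \<Rightarrow> real \<Rightarrow> 'a \<Rightarrow> real set \<Rightarrow> ennreal" where
  "total_loss a K \<mu> t x A =
     (\<integral>\<^sup>+ s\<in>{0..t}. emeasure (diffuse a (t - s) (coag_loss K (\<mu> s)) x) A \<partial>lborel)"

text \<open>
  The equation at time \<open>t\<close> is an identity of kernels, whose loss term has to converge.  All terms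
  are \<open>[0,\<infinity>]\<close>-valued, so without convergence the identity would be void wherever it reads
  \<open>\<infinity> = \<infinity>\<close>.  This does occur when \<open>K\<close> is unbounded near \<open>0\<close>: for
  \<open>K y y' = (y powr (1/3) + y' powr (1/3))\<^sup>2 * sqrt (1/y + 1/y')\<close>
  and \<open>\<mu>\<^sub>0 = 0\<close>, put \<open>\<mu>\<^sub>t(x,dy) = exp (-\<bar>x\<bar>\<^sup>2 - y) y powr (-3/2) dy\<close> for \<open>t > 0\<close>.  The loss and gain
  terms are infinite on every \<open>A\<close> of positive Lebesgue measure and vanish on null sets, and the
  total mass is finite.
\<close>

definition coag_diffusion_eq ::
    "(real \<Rightarrow> real) \<Rightarrow> (real \<Rightarrow> real \<Rightarrow> real) \<Rightarrow> ('a::euclidean_space \<Rightarrow> real measure)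
      \<Rightarrow> (real \<Rightarrow> 'a \<Rightarrow> real measure) \<Rightarrow> real \<Rightarrow> bool" where
  "coag_diffusion_eq a K \<mu>\<^sub>0 \<mu> t \<longleftrightarrow>
     (\<forall>x. total_loss a K \<mu> t x (space sizes) < \<infinity> \<and>
       (\<forall>A\<in>sets sizes.
          emeasure (\<mu> t x) A + total_loss a K \<mu> t x A
            = emeasure (diffuse a t \<mu>\<^sub>0 x) A + total_gain a K \<mu> t x A))"

definition coag_diffusion_solution ::
    "(real \<Rightarrow> real) \<Rightarrow> (real \<Rightarrow> real \<Rightarrow> real) \<Rightarrow> ('a::euclidean_space \<Rightarrow> real measure)
      \<Rightarrow> real \<Rightarrow> (real \<Rightarrow> 'a \<Rightarrow> real measure) \<Rightarrow> bool" where
  "coag_diffusion_solution a K \<mu>\<^sub>0 T \<mu> \<longleftrightarrow>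
     \<mu> \<in> time_kernels T \<and>
     (\<forall>t\<in>{0..T}. coag_diffusion_eq a K \<mu>\<^sub>0 \<mu> t) \<and>
     (SUP t\<in>{0..T}. \<integral>\<^sup>+ x. moment (\<lambda>y. y) (\<mu> t x) \<partial>lborel) < \<infinity>"

lemma space_sizes: "space sizes = {0<..}"
  by (simp add: sizes_def space_restrict_space)

lemma emeasure_measure_of_sizes:
  assumes "A \<in> sets sizes" "F {} = 0"
    and "\<And>B::nat \<Rightarrow> real set. range B \<subseteq> sets sizes \<Longrightarrow> disjoint_family B
           \<Longrightarrow> F (\<Union>i. B i) = (\<Sum>i. F (B i))"
  shows "emeasure (measure_of (space sizes) (sets sizes) F) A = F A"
proof (rule emeasure_measure_of[OF refl])
  show "positive (sets (measure_of (space sizes) (sets sizes) F)) F"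
    using assms(2) by (simp add: positive_def)
  show "countably_additive (sets (measure_of (space sizes) (sets sizes) F)) F"
    using assms(3) by (auto simp: countably_additive_def)
qed (use assms(1) sets.sets_into_space in auto)

lemma emeasure_coag_loss:
  assumes "A \<in> sets sizes" "sets (\<mu> x) = sets sizes" "sigma_finite_measure (\<mu> x)"
    and [measurable]: "(\<lambda>(y, y'). K y y') \<in> borel_measurable (sizes \<Otimes>\<^sub>M sizes)"
  shows "emeasure (coag_loss K \<mu> x) A = (\<integral>\<^sup>+ y\<in>A. (\<integral>\<^sup>+ y'. ennreal (K y y') \<partial>\<mu> x) \<partial>\<mu> x)"
proof -
  interpret sigma_finite_measure "\<mu> x" by fact
  note [measurable_cong] = assms(2)
  show ?thesis
    unfolding coag_loss_def
  proof (rule emeasure_measure_of_sizes[OF assms(1)], goal_cases)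
    case (2 B)
    then have [measurable]: "\<And>i. B i \<in> sets sizes" by auto
    have "(\<integral>\<^sup>+ y. (\<integral>\<^sup>+ y'. ennreal (K y y') \<partial>\<mu> x) * indicator (\<Union>i. B i) y \<partial>\<mu> x)
        = (\<integral>\<^sup>+ y. (\<Sum>i. (\<integral>\<^sup>+ y'. ennreal (K y y') \<partial>\<mu> x) * indicator (B i) y) \<partial>\<mu> x)"
      by (simp flip: suminf_indicator[OF 2(2)])
    also have "\<dots> = (\<Sum>i. \<integral>\<^sup>+ y. (\<integral>\<^sup>+ y'. ennreal (K y y') \<partial>\<mu> x) * indicator (B i) y \<partial>\<mu> x)"
      by (rule nn_integral_suminf) measurable
    finally show ?case .
  qed simp
qed

lemma emeasure_coag_gain:
  assumes "A \<in> sets sizes" "sets (\<mu> x) = sets sizes" "sigma_finite_measure (\<mu> x)"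
    and [measurable]: "(\<lambda>(y, y'). K y y') \<in> borel_measurable (sizes \<Otimes>\<^sub>M sizes)"
  shows "emeasure (coag_gain K \<mu> x) A =
    1 / 2 * (\<integral>\<^sup>+ y'. (\<integral>\<^sup>+ y. indicator A (y + y') * ennreal (K y y') \<partial>\<mu> x) \<partial>\<mu> x)"
proof -
  interpret sigma_finite_measure "\<mu> x" by fact
  note [measurable_cong] = assms(2)
  have plus [measurable]: "(\<lambda>(y, y'). y + y') \<in> sizes \<Otimes>\<^sub>M sizes \<rightarrow>\<^sub>M sizes"
    unfolding sizes_def
  proof (rule measurable_restrict_space2)
    have "fst \<in> borel_measurable (restrict_space borel {0<..} \<Otimes>\<^sub>M restrict_space borel {0::real<..})"
      "snd \<in> borel_measurable (restrict_space borel {0::real<..} \<Otimes>\<^sub>M restrict_space borel {0<..})"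
      using measurable_compose[OF measurable_fst measurable_restrict_space1[OF measurable_ident]]
        measurable_compose[OF measurable_snd measurable_restrict_space1[OF measurable_ident]]
      by (auto simp: id_def)
    then show "(\<lambda>(y, y'). y + y')
        \<in> borel_measurable (restrict_space borel {0<..} \<Otimes>\<^sub>M restrict_space borel {0::real<..})"
      unfolding split_beta by (rule borel_measurable_add)
  qed (auto simp: space_pair_measure space_restrict_space)
  have [measurable]: "(\<lambda>(y', y). K y y') \<in> borel_measurable (sizes \<Otimes>\<^sub>M sizes)"
    using measurable_pair_swap[OF assms(4)] by simp
  have [measurable]: "(\<lambda>(y', y). y + y') \<in> sizes \<Otimes>\<^sub>M sizes \<rightarrow>\<^sub>M sizes"
    using measurable_pair_swap[OF plus] by simp
  have ind [measurable]: "(\<lambda>(y', y). indicator B (y + y') * ennreal (K y y'))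
      \<in> borel_measurable (sizes \<Otimes>\<^sub>M sizes)" if [measurable]: "B \<in> sets sizes" for B
    by measurable
  have m1: "(\<lambda>y. indicator B (y + y') * ennreal (K y y')) \<in> borel_measurable (\<mu> x)"
    if "B \<in> sets sizes" "y' \<in> space (\<mu> x)" for B y'
    using measurable_compose_Pair1[of y' sizes _ sizes, OF _ ind[OF that(1)]] that(2)
    by (simp add: measurable_cong_sets[OF assms(2) refl] sets_eq_imp_space_eq[OF assms(2)])
  show ?thesis
    unfolding coag_gain_def
  proof (rule emeasure_measure_of_sizes[OF assms(1)], goal_cases)
    case (2 B)
    then have B [measurable]: "\<And>i. B i \<in> sets sizes" by auto
    have "(\<integral>\<^sup>+ y. indicator (\<Union>i. B i) (y + y') * ennreal (K y y') \<partial>\<mu> x)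
        = (\<Sum>i. \<integral>\<^sup>+ y. indicator (B i) (y + y') * ennreal (K y y') \<partial>\<mu> x)"
      if "y' \<in> space (\<mu> x)" for y'
      by (subst nn_integral_suminf[symmetric, OF m1[OF B that]])
         (simp add: suminf_indicator[OF 2(2)] ennreal_suminf_multc)
    then have "(\<integral>\<^sup>+ y'. (\<integral>\<^sup>+ y. indicator (\<Union>i. B i) (y + y') * ennreal (K y y') \<partial>\<mu> x) \<partial>\<mu> x)
        = (\<integral>\<^sup>+ y'. (\<Sum>i. \<integral>\<^sup>+ y. indicator (B i) (y + y') * ennreal (K y y') \<partial>\<mu> x) \<partial>\<mu> x)"
      by (rule nn_integral_cong)
    also have "\<dots> = (\<Sum>i. \<integral>\<^sup>+ y'. (\<integral>\<^sup>+ y. indicator (B i) (y + y') * ennreal (K y y') \<partial>\<mu> x) \<partial>\<mu> x)"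
      by (rule nn_integral_suminf) measurable
    finally show ?case by simp
  qed simp
qed

end

theory Submission
  imports Defs "HOL-Probability.Probability"
begin

text \<open>
  Put \<open>w(y) = y\<^sup>2\<^sup>/\<^sup>3\<close> and \<open>phi = w\<^sup>2\<close>. Above \<open>\<delta>\<close> the coagulation kernel is at most \<open>C w(y) w(y')\<close>, and
  the heat kernel satisfies \<open>y p\<^sub>z \<le> z p\<^sub>y\<close> for \<open>y \<le> z\<close>. Hence a coagulation of \<open>y\<close> with a smaller \<open>y'\<close> raises
  the \<open>phi\<close> moment, observed after any further diffusion, by at most a multiple of \<open>phi(y) phi(y')\<close>,
  and this quadratic inequality keeps the moment below \<open>2 g0\<close>, twice its bound for the diffused initial kernel, up to
  \<open>T = 1 / (100 C g0)\<close>.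

  If the gain is written as a sum over ordered pairs \<open>y' \<le> y\<close>, then freezing the smaller partner and the loss
  rate gives a linear problem for the larger one. Once a damping rate above all loss rates is added on both
  sides, this problem is monotone, and it is solved by iteration from \<open>0\<close>. Its solution decreases with the
  loss rate and increases with the frozen kernel. So two solutions, or two Picard iterates, have a common lower
  bound, driven by the larger of their loss rates, and the \<open>L\<^sup>1\<close> distance to it, weighted by \<open>w\<close>, halves from one
  iteration to the next. This yields uniqueness; existence follows by letting the lower bounds of all
  later Picard iterates increase to a solution.

  An arbitrary solution is brought into this class by testing with downward closed sets of sizes: there
  coagulation creates no more particles than it destroys, so the solution stays above \<open>\<delta>\<close> and is locally
  bounded, and the quadratic moment inequality applies to it.
\<close>

text \<open>The loss rates grow like \<open>w\<close>, so the \<open>w\<close> norm of a difference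
  does not control its loss term: tested with \<open>w\<close>, that term carries
  \<open>w * w = phi\<close>. A difference from a lower bound is a nonnegative measure, and its own
  loss absorbs the uncontrolled part of its gain. What remains is the excess due to the smaller
  partner, and here the exponents fit. For \<open>y' \<le> y\<close> the relative excess of every
  weight used is at most a multiple of (y'/y)^(2/3), and (y'/y)^(2/3) w(y) w(y') = phi(y'). This
  also closes the moment inequality, where the heat kernel contributes one more factor (y + y')/y.

  All quantities are [0,\<infinity>]-valued, so each cancellation needs the finiteness of the
  cancelled term first. Truncation to sizes in (0,R] supplies it. Coagulation only increases sizes,
  so a particle below R arises only from partners below R, and the moments cut at R obey the same
  inequalities with constants independent of R.\<close>

section \<open>Kernels\<close>

type_synonym 'x kernel = "real \<times> 'x \<Rightarrow> real measure"
type_synonym 'x rate = "real \<times> 'x \<Rightarrow> real \<Rightarrow> ennreal"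

lemma measurable_sizes_borel [measurable (raw)]: "f \<in> M \<rightarrow>\<^sub>M sizes \<Longrightarrow> f \<in> M \<rightarrow>\<^sub>M borel"
  unfolding sizes_def measurable_restrict_space2_iff by simp

lemma measurable_into_sizes:
  assumes "f \<in> borel_measurable M" "\<And>z. z \<in> space M \<Longrightarrow> f z > 0"
  shows "f \<in> M \<rightarrow>\<^sub>M sizes"
  unfolding sizes_def using assms by (intro measurable_restrict_space2) auto

lemma sizes_plus [measurable (raw)]:
  assumes [measurable]: "f \<in> M \<rightarrow>\<^sub>M sizes" "g \<in> M \<rightarrow>\<^sub>M sizes"
  shows "(\<lambda>z. f z + g z) \<in> M \<rightarrow>\<^sub>M sizes"
proof (rule measurable_into_sizes)
  fix z assume "z \<in> space M"
  with measurable_space[OF assms(1)] measurable_space[OF assms(2)]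
  show "0 < f z + g z" by (fastforce simp: space_sizes)
qed measurable

lemma sets_sizesI: "A \<in> sets borel \<Longrightarrow> A \<subseteq> {0<..} \<Longrightarrow> A \<in> sets sizes"
  by (auto simp: sizes_def sets_restrict_space)

text \<open>The integrand does not depend on the parameter, so induction on the integrand works for
  kernels of infinite mass. Arbitrary solutions enter through this lemma before they are known to be
  locally finite.\<close>

lemma kernel_nn_integral_measurable:
  assumes s: "\<And>z. z \<in> space N \<Longrightarrow> sets (M z) = sets sizes"
    and m: "\<And>A. A \<in> sets sizes \<Longrightarrow> (\<lambda>z. emeasure (M z) A) \<in> borel_measurable N"
    and f: "f \<in> borel_measurable sizes"
  shows "(\<lambda>z. \<integral>\<^sup>+y. f y \<partial>M z) \<in> borel_measurable N"
  using f
proof (induction rule: borel_measurable_induct)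
  case (cong f g)
  have "(\<integral>\<^sup>+y. f y \<partial>M z) = (\<integral>\<^sup>+y. g y \<partial>M z)" if "z \<in> space N" for z
    using cong(3) sets_eq_imp_space_eq[OF s[OF that]] by (intro nn_integral_cong) auto
  with cong(4) show ?case by (simp cong: measurable_cong)
next
  case (set A)
  have "(\<integral>\<^sup>+y. indicator A y \<partial>M z) = emeasure (M z) A" if "z \<in> space N" for z
    using s[OF that] set by (intro nn_integral_indicator) auto
  with m[OF set] show ?case by (simp cong: measurable_cong)
next
  case (mult u c)
  have "(\<integral>\<^sup>+y. c * u y \<partial>M z) = c * (\<integral>\<^sup>+y. u y \<partial>M z)" if "z \<in> space N" for z
    using mult(2) s[OF that] by (intro nn_integral_cmult) (simp cong: measurable_cong_sets)
  moreover have "(\<lambda>z. c * (\<integral>\<^sup>+y. u y \<partial>M z)) \<in> borel_measurable N" using mult by measurable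
  ultimately show ?case by (simp cong: measurable_cong)
next
  case (add u v)
  have "(\<integral>\<^sup>+y. v y + u y \<partial>M z) = (\<integral>\<^sup>+y. v y \<partial>M z) + (\<integral>\<^sup>+y. u y \<partial>M z)" if "z \<in> space N" for z
    using add s[OF that] by (intro nn_integral_add) (simp_all cong: measurable_cong_sets)
  moreover have "(\<lambda>z. (\<integral>\<^sup>+y. v y \<partial>M z) + (\<integral>\<^sup>+y. u y \<partial>M z)) \<in> borel_measurable N" using add by measurable
  ultimately show ?case by (simp cong: measurable_cong)
next
  case (seq U)
  have "(\<integral>\<^sup>+y. (SUP i. U i) y \<partial>M z) = (SUP i. \<integral>\<^sup>+y. U i y \<partial>M z)" if "z \<in> space N" for z
    using seq s[OF that] unfolding SUP_apply
    by (intro nn_integral_monotone_convergence_SUP) (simp_all cong: measurable_cong_sets)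
  moreover have "(\<lambda>z. SUP i. \<integral>\<^sup>+y. U i y \<partial>M z) \<in> borel_measurable N" using seq by measurable
  ultimately show ?case by (simp cong: measurable_cong)
qed

section \<open>Mixtures (barycentres) of measures\<close>

definition mix :: "'z measure \<Rightarrow> ('z \<Rightarrow> real measure) \<Rightarrow> real measure" where
  "mix N M = measure_of (space sizes) (sets sizes) (\<lambda>A. \<integral>\<^sup>+z. emeasure (M z) A \<partial>N)"

lemma sets_mix [simp, measurable_cong]: "sets (mix N M) = sets sizes"
  by (simp add: mix_def)

lemma space_mix [simp]: "space (mix N M) = space sizes"
  by (simp add: mix_def)

lemma emeasure_mix:
  assumes s: "\<And>z. z \<in> space N \<Longrightarrow> sets (M z) = sets sizes"
    and m: "\<And>A. A \<in> sets sizes \<Longrightarrow> (\<lambda>z. emeasure (M z) A) \<in> borel_measurable N"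
    and A: "A \<in> sets sizes"
  shows "emeasure (mix N M) A = (\<integral>\<^sup>+z. emeasure (M z) A \<partial>N)"
  unfolding mix_def
proof (rule emeasure_measure_of_sizes[OF A])
  fix B :: "nat \<Rightarrow> real set" assume B: "range B \<subseteq> sets sizes" "disjoint_family B"
  then have "emeasure (M z) (\<Union>i. B i) = (\<Sum>i. emeasure (M z) (B i))" if "z \<in> space N" for z
    using s[OF that] by (simp add: suminf_emeasure)
  then have "(\<integral>\<^sup>+z. emeasure (M z) (\<Union>i. B i) \<partial>N) = (\<integral>\<^sup>+z. (\<Sum>i. emeasure (M z) (B i)) \<partial>N)"
    by (rule nn_integral_cong)
  also have "\<dots> = (\<Sum>i. \<integral>\<^sup>+z. emeasure (M z) (B i) \<partial>N)"
    using B m by (intro nn_integral_suminf) auto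
  finally show "(\<integral>\<^sup>+z. emeasure (M z) (\<Union>i. B i) \<partial>N) = (\<Sum>i. \<integral>\<^sup>+z. emeasure (M z) (B i) \<partial>N)" .
qed simp

lemma nn_integral_mix:
  assumes s: "\<And>z. z \<in> space N \<Longrightarrow> sets (M z) = sets sizes"
    and m: "\<And>A. A \<in> sets sizes \<Longrightarrow> (\<lambda>z. emeasure (M z) A) \<in> borel_measurable N"
    and f: "f \<in> borel_measurable sizes"
  shows "(\<integral>\<^sup>+y. f y \<partial>mix N M) = (\<integral>\<^sup>+z. (\<integral>\<^sup>+y. f y \<partial>M z) \<partial>N)"
  using f
proof (induction rule: borel_measurable_induct)
  case (cong f g)
  have "(\<integral>\<^sup>+z. (\<integral>\<^sup>+y. f y \<partial>M z) \<partial>N) = (\<integral>\<^sup>+z. (\<integral>\<^sup>+y. g y \<partial>M z) \<partial>N)"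
    using cong(3) sets_eq_imp_space_eq[OF s] by (intro nn_integral_cong) auto
  moreover have "(\<integral>\<^sup>+y. f y \<partial>mix N M) = (\<integral>\<^sup>+y. g y \<partial>mix N M)"
    using cong(3) by (intro nn_integral_cong) auto
  ultimately show ?case using cong(4) by simp
next
  case (set A)
  have "(\<integral>\<^sup>+y. indicator A y \<partial>mix N M) = emeasure (mix N M) A"
    using set by (intro nn_integral_indicator) auto
  also have "\<dots> = (\<integral>\<^sup>+z. emeasure (M z) A \<partial>N)" by (rule emeasure_mix[OF s m set])
  also have "\<dots> = (\<integral>\<^sup>+z. (\<integral>\<^sup>+y. indicator A y \<partial>M z) \<partial>N)"
    using s set by (intro nn_integral_cong) simp
  finally show ?case .
next
  case (mult u c)
  note [measurable] = mult(2) and [measurable] = kernel_nn_integral_measurable[OF s m mult(2)]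
  have "(\<integral>\<^sup>+z. (\<integral>\<^sup>+y. c * u y \<partial>M z) \<partial>N) = (\<integral>\<^sup>+z. c * (\<integral>\<^sup>+y. u y \<partial>M z) \<partial>N)"
    using mult(2) s by (intro nn_integral_cong nn_integral_cmult) (simp cong: measurable_cong_sets)
  also have "\<dots> = c * (\<integral>\<^sup>+z. (\<integral>\<^sup>+y. u y \<partial>M z) \<partial>N)"
    by (intro nn_integral_cmult kernel_nn_integral_measurable[OF s m mult(2)])
  finally show ?case using mult by (simp add: nn_integral_cmult)
next
  case (add u v)
  note [measurable] = add(1,3) and
    [measurable] = kernel_nn_integral_measurable[OF s m add(1)] kernel_nn_integral_measurable[OF s m add(3)]
  have "(\<integral>\<^sup>+z. (\<integral>\<^sup>+y. v y + u y \<partial>M z) \<partial>N) = (\<integral>\<^sup>+z. (\<integral>\<^sup>+y. v y \<partial>M z) + (\<integral>\<^sup>+y. u y \<partial>M z) \<partial>N)"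
    using add s by (intro nn_integral_cong nn_integral_add) (simp_all cong: measurable_cong_sets)
  also have "\<dots> = (\<integral>\<^sup>+z. (\<integral>\<^sup>+y. v y \<partial>M z) \<partial>N) + (\<integral>\<^sup>+z. (\<integral>\<^sup>+y. u y \<partial>M z) \<partial>N)"
    by (intro nn_integral_add kernel_nn_integral_measurable[OF s m add(1)] kernel_nn_integral_measurable[OF s m add(3)])
  finally show ?case using add by (simp add: nn_integral_add)
next
  case (seq U)
  note [measurable] = seq(1) and [measurable] = kernel_nn_integral_measurable[OF s m seq(1)]
  have "(\<integral>\<^sup>+z. (\<integral>\<^sup>+y. (SUP i. U i) y \<partial>M z) \<partial>N) = (\<integral>\<^sup>+z. (SUP i. \<integral>\<^sup>+y. U i y \<partial>M z) \<partial>N)"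
    using seq s unfolding SUP_apply
    by (intro nn_integral_cong nn_integral_monotone_convergence_SUP) (simp_all cong: measurable_cong_sets)
  also have "\<dots> = (SUP i. \<integral>\<^sup>+z. (\<integral>\<^sup>+y. U i y \<partial>M z) \<partial>N)"
    using seq(3) by (intro nn_integral_monotone_convergence_SUP kernel_nn_integral_measurable[OF s m seq(1)])
      (auto simp: incseq_def le_fun_def intro!: nn_integral_mono)
  also have "\<dots> = (SUP i. \<integral>\<^sup>+y. U i y \<partial>mix N M)" using seq by simp
  also have "\<dots> = (\<integral>\<^sup>+y. (SUP i. U i y) \<partial>mix N M)"
    using seq by (intro nn_integral_monotone_convergence_SUP[symmetric]) auto
  finally show ?case unfolding SUP_apply by simp
qed

text \<open>The windows stay away from 0 because a finite first moment bounds the mass of each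
  window but not the number of small particles.\<close>

definition size_window :: "nat \<Rightarrow> real set" where
  "size_window n = {1 / real (Suc n)..real (Suc n)}"

lemma size_window_sets [measurable]: "size_window n \<in> sets sizes"
  unfolding size_window_def by (rule sets_sizesI) (auto simp: field_simps intro: less_le_trans[of 0 "1 / real (Suc n)"])

lemma size_window_mono: "m \<le> n \<Longrightarrow> size_window m \<subseteq> size_window n"
  by (auto simp: size_window_def frac_le intro: order_trans[of "1 / real (Suc n)" "1 / real (Suc m)"])

lemma UN_size_window: "(\<Union>n. size_window n) = space sizes"
proof -
  have "\<exists>n. y \<in> size_window n" if "0 < y" for y
  proof -
    obtain n where n: "max y (1 / y) \<le> real n" using real_arch_simple by blast
    then have "1 / real (Suc n) \<le> y" using that by (simp add: field_simps)
    with n show ?thesis by (intro exI[of _ n]) (auto simp: size_window_def)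
  qed
  then show ?thesis
    using sets.sets_into_space[OF size_window_sets] by (auto simp: space_sizes)
qed

section \<open>Locally finite kernels\<close>

definition locally_finite_kernel :: "('z::topological_space \<Rightarrow> real measure) \<Rightarrow> bool" where
  "locally_finite_kernel \<kappa> \<longleftrightarrow> measurable_kernel borel \<kappa> \<and> (\<forall>z n. emeasure (\<kappa> z) (size_window n) < \<infinity>)"

lemma lfk_sets: "locally_finite_kernel \<kappa> \<Longrightarrow> sets (\<kappa> z) = sets sizes"
  by (simp add: locally_finite_kernel_def measurable_kernel_def)

lemma lfk_space: "locally_finite_kernel \<kappa> \<Longrightarrow> space (\<kappa> z) = {0<..}"
  using sets_eq_imp_space_eq[OF lfk_sets] by (metis space_sizes)

lemma sigma_finite_sizesI:
  assumes s: "sets M = sets sizes" and f: "\<And>n. emeasure M (size_window n) < \<infinity>"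
  shows "sigma_finite_measure M"
proof
  show "\<exists>A. countable A \<and> A \<subseteq> sets M \<and> \<Union> A = space M \<and> (\<forall>a\<in>A. emeasure M a \<noteq> \<infinity>)"
    using f s UN_size_window sets_eq_imp_space_eq[OF s]
    by (intro exI[of _ "range size_window"]) (auto simp: less_top)
qed

lemma lfk_sigma_finite: "locally_finite_kernel \<kappa> \<Longrightarrow> sigma_finite_measure (\<kappa> z)"
  using lfk_sets by (intro sigma_finite_sizesI) (auto simp: locally_finite_kernel_def)

lemma lfk_emeasure_measurable:
  assumes "locally_finite_kernel \<kappa>" "A \<in> sets sizes" "g \<in> M \<rightarrow>\<^sub>M borel"
  shows "(\<lambda>m. emeasure (\<kappa> (g m)) A) \<in> borel_measurable M"
  using assms measurable_compose[OF assms(3)] by (auto simp: locally_finite_kernel_def measurable_kernel_def)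

text \<open>Restricting to a size window and normalising turns the kernel into a sub-probability kernel,
  for which the Giry monad provides joint measurability.\<close>

lemma lfk_integral_measurable:
  assumes \<kappa>: "locally_finite_kernel \<kappa>" and g: "g \<in> M \<rightarrow>\<^sub>M borel"
    and f: "(\<lambda>(m, y). f m y) \<in> borel_measurable (M \<Otimes>\<^sub>M sizes)"
  shows "(\<lambda>m. \<integral>\<^sup>+y. f m y \<partial>\<kappa> (g m)) \<in> borel_measurable M"
proof -
  note [measurable] = f g
  have [measurable_cong]: "sets (\<kappa> z) = sets sizes" for z by (rule lfk_sets[OF \<kappa>])
  define c where "c n m = emeasure (\<kappa> (g m)) (size_window n)" for n m
  have [measurable]: "c n \<in> borel_measurable M" for n
    unfolding c_def by (rule lfk_emeasure_measurable[OF \<kappa> _ g]) measurable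
  have cfin: "c n m < \<infinity>" for n m using \<kappa> by (simp add: c_def locally_finite_kernel_def)
  \<comment> \<open>Where \<open>c n m = 0\<close> the factor is infinite, but it multiplies the
    null measure, and \<infinity> times 0 is 0.\<close>
  define P where "P n m = scale_measure (inverse (c n m)) (density (\<kappa> (g m)) (indicator (size_window n)))" for n m
  have setsP [simp]: "sets (P n m) = sets sizes" for n m
    unfolding P_def by (simp add: lfk_sets[OF \<kappa>])
  have [measurable]: "f m \<in> borel_measurable sizes" if "m \<in> space M" for m
    using measurable_compose_Pair1[OF that f] by simp
  have fin_inv: "inverse (c n m) * c n m \<le> 1" for n m
    using cfin[of n m] by (cases "c n m = 0") (auto simp: ennreal_inverse_mult mult.commute[of "inverse _"] ennreal_mult_divide_eq divide_ennreal_def[symmetric] less_top ennreal_divide_self)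
  have eP: "emeasure (P n m) A = inverse (c n m) * emeasure (\<kappa> (g m)) (size_window n \<inter> A)"
    if [measurable]: "A \<in> sets sizes" for A n m
  proof -
    have "(\<integral>\<^sup>+y\<in>A. indicator (size_window n) y \<partial>\<kappa> (g m)) = (\<integral>\<^sup>+y. indicator (size_window n \<inter> A) y \<partial>\<kappa> (g m))"
      by (intro nn_integral_cong) (simp split: split_indicator)
    then show ?thesis unfolding P_def by (simp add: emeasure_density)
  qed
  have Pm: "P n \<in> M \<rightarrow>\<^sub>M subprob_algebra sizes" for n
  proof (rule measurable_subprob_algebra)
    fix m assume "m \<in> space M"
    show "subprob_space (P n m)"
    proof
      have "space (P n m) = space sizes" using setsP by (rule sets_eq_imp_space_eq)
      moreover have "size_window n \<inter> space sizes = size_window n"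
        using sets.sets_into_space[OF size_window_sets] by auto
      ultimately show "emeasure (P n m) (space (P n m)) \<le> 1"
        using fin_inv[of n m] by (simp add: eP c_def)
      show "space (P n m) \<noteq> {}" using \<open>space (P n m) = space sizes\<close> by (simp add: space_sizes)
    qed
  next
    fix A assume A [measurable]: "A \<in> sets sizes"
    have [measurable]: "(\<lambda>m. emeasure (\<kappa> (g m)) (size_window n \<inter> A)) \<in> borel_measurable M"
      by (rule lfk_emeasure_measurable[OF \<kappa> _ g]) measurable
    show "(\<lambda>m. emeasure (P n m) A) \<in> borel_measurable M" unfolding eP[OF A] by measurable
  qed simp
  have [measurable]: "(\<lambda>m. \<integral>\<^sup>+y. f m y \<partial>P n m) \<in> borel_measurable M" for n
    by (rule nn_integral_measurable_subprob_algebra2[OF f Pm])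
  have "(\<integral>\<^sup>+y. f m y \<partial>\<kappa> (g m)) = (SUP n. c n m * (\<integral>\<^sup>+y. f m y \<partial>P n m))" if m: "m \<in> space M" for m
  proof -
    note [measurable] = \<open>\<And>m. m \<in> space M \<Longrightarrow> f m \<in> borel_measurable sizes\<close>[OF m]
    have "c n m * (\<integral>\<^sup>+y. f m y \<partial>P n m) = (\<integral>\<^sup>+y. f m y * indicator (size_window n) y \<partial>\<kappa> (g m))" for n
    proof (cases "c n m = 0")
      case True
      then have "AE y in \<kappa> (g m). y \<notin> size_window n"
        unfolding c_def by (intro AE_I[where N="size_window n"]) auto
      then have "(\<integral>\<^sup>+y. f m y * indicator (size_window n) y \<partial>\<kappa> (g m)) = (\<integral>\<^sup>+y. 0 \<partial>\<kappa> (g m))"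
        by (intro nn_integral_cong_AE) (auto split: split_indicator)
      with True show ?thesis by simp
    next
      case False
      have "c n m * inverse (c n m) = 1"
        using False cfin[of n m] by (simp add: divide_ennreal_def[symmetric] ennreal_divide_self less_top)
      then show ?thesis
        by (simp add: P_def nn_integral_scale_measure nn_integral_density mult.assoc[symmetric])
          (simp add: mult.commute)
    qed
    then have "(SUP n. c n m * (\<integral>\<^sup>+y. f m y \<partial>P n m)) = (SUP n. \<integral>\<^sup>+y. f m y * indicator (size_window n) y \<partial>\<kappa> (g m))"
      by simp
    also have "\<dots> = (\<integral>\<^sup>+y. (SUP n. f m y * indicator (size_window n) y) \<partial>\<kappa> (g m))"
    proof (rule nn_integral_monotone_convergence_SUP[symmetric])
      show "incseq (\<lambda>n y. f m y * indicator (size_window n) y)"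
        using size_window_mono by (fastforce simp: incseq_def le_fun_def split: split_indicator)
    qed measurable
    also have "\<dots> = (\<integral>\<^sup>+y. f m y \<partial>\<kappa> (g m))"
    proof (rule nn_integral_cong)
      fix y assume "y \<in> space (\<kappa> (g m))"
      then have "y \<in> (\<Union>n. size_window n)" using lfk_space[OF \<kappa>] by (simp add: UN_size_window space_sizes)
      then obtain n where "y \<in> size_window n" by blast
      then show "(SUP n. f m y * indicator (size_window n) y) = f m y"
        by (intro antisym SUP_least SUP_upper2[of n]) (auto split: split_indicator)
    qed
    finally show ?thesis by simp
  qed
  then show ?thesis by (simp cong: measurable_cong)
qed

lemma lfk_comp:
  fixes g :: "'a::topological_space \<Rightarrow> 'b::topological_space"
  assumes "locally_finite_kernel \<kappa>" "g \<in> borel_measurable borel"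
  shows "locally_finite_kernel (\<lambda>z. \<kappa> (g z))"
  using lfk_emeasure_measurable[OF assms(1) _ assms(2)] assms(1)
  by (auto simp: locally_finite_kernel_def measurable_kernel_def)

text \<open>The endpoint \<open>t\<close> often varies together with \<open>s\<close>. Written as a
  conditional, the indicator is visibly measurable in both.\<close>

lemma indicator_if: "indicator {..<t} s = (if s < t then 1 else (0::ennreal))" for s t :: real
  by (simp add: indicator_def)

lemma nn_integral_swap:
  assumes "sigma_finite_measure A" "sigma_finite_measure B"
    and f: "(\<lambda>(a, b). f a b) \<in> borel_measurable (A \<Otimes>\<^sub>M B)"
  shows "(\<integral>\<^sup>+a. \<integral>\<^sup>+b. f a b \<partial>B \<partial>A) = (\<integral>\<^sup>+b. \<integral>\<^sup>+a. f a b \<partial>A \<partial>B)"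
proof -
  interpret pair_sigma_finite A B using assms by (simp add: pair_sigma_finite_def)
  show ?thesis using Fubini[OF f] by simp
qed

section \<open>Diffusion\<close>

text \<open>The last axiom is the only link between different sizes. In dimension \<open>3\<close>, the Gaussian kernel with
  diffusivity \<open>y powr (- c)\<close> satisfies it if and only if \<open>0 \<le> c \<le> 2/3\<close>.\<close>

locale heat =
  fixes p :: "real \<Rightarrow> 'x::euclidean_space \<Rightarrow> 'x \<Rightarrow> real \<Rightarrow> ennreal"
  assumes p_measurable': "(\<lambda>(\<tau>, x', x, y). p \<tau> x' x y) \<in> borel_measurable (borel \<Otimes>\<^sub>M borel \<Otimes>\<^sub>M borel \<Otimes>\<^sub>M borel)"
    and p_int_fst: "\<And>\<tau> x y. 0 < \<tau> \<Longrightarrow> 0 < y \<Longrightarrow> (\<integral>\<^sup>+x'. p \<tau> x' x y \<partial>lborel) = 1"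
    and p_int_snd: "\<And>\<tau> x' y. 0 < \<tau> \<Longrightarrow> 0 < y \<Longrightarrow> (\<integral>\<^sup>+x. p \<tau> x' x y \<partial>lborel) = 1"
    and p_semigroup: "\<And>\<tau> r x'' x y. 0 < \<tau> \<Longrightarrow> 0 < r \<Longrightarrow> 0 < y \<Longrightarrow>
      (\<integral>\<^sup>+x'. p r x' x y * p \<tau> x'' x' y \<partial>lborel) = p (\<tau> + r) x'' x y"
    and p_mono: "\<And>\<tau> x' x y z. 0 < \<tau> \<Longrightarrow> 0 < y \<Longrightarrow> y \<le> z \<Longrightarrow> ennreal y * p \<tau> x' x z \<le> ennreal z * p \<tau> x' x y"
begin

lemma p_measurable [measurable (raw)]:
  assumes "f \<in> borel_measurable M" "g \<in> borel_measurable M" "h \<in> borel_measurable M" "i \<in> borel_measurable M"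
  shows "(\<lambda>m. p (f m) (g m) (h m) (i m)) \<in> borel_measurable M"
  using measurable_compose[OF measurable_Pair[OF assms(1) measurable_Pair[OF assms(2) measurable_Pair[OF assms(3,4)]]] p_measurable']
  by simp

text \<open>The kernel \<open>\<kappa>\<close>, with density \<open>\<omega>\<close>, is emitted at times \<open>s < t\<close> distributed like the first marginal of
  \<open>N\<close>, then diffuses for time \<open>t - s\<close> and is damped by \<open>c (t - s)\<close>.\<close>

definition evolve :: "(real \<times> 'x) measure \<Rightarrow> (real \<Rightarrow> real \<Rightarrow> ennreal) \<Rightarrow> 'x rate
    \<Rightarrow> 'x kernel \<Rightarrow> real \<Rightarrow> 'x \<Rightarrow> real measure" where
  "evolve N c \<omega> \<kappa> t x = mix N (\<lambda>(s, x'). density (\<kappa> (s, x'))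
     (\<lambda>y. indicator {..<t} s * c (t - s) y * \<omega> (s, x') y * p (t - s) x' x y))"

lemma sets_evolve [simp, measurable_cong]: "sets (evolve N c \<omega> \<kappa> t x) = sets sizes"
  by (simp add: evolve_def)

lemma space_evolve [simp]: "space (evolve N c \<omega> \<kappa> t x) = space sizes"
  by (simp add: evolve_def)

definition ok_index :: "(real \<times> 'x) measure \<Rightarrow> bool" where
  "ok_index N \<longleftrightarrow> sets N = sets (borel \<Otimes>\<^sub>M borel) \<and> sigma_finite_measure N"

definition ok_source :: "(real \<times> 'x) measure \<Rightarrow> (real \<Rightarrow> real \<Rightarrow> ennreal) \<Rightarrow> 'x rate
    \<Rightarrow> 'x kernel \<Rightarrow> bool" where
  "ok_source N c \<omega> \<kappa> \<longleftrightarrow> ok_index N \<and> (\<lambda>(\<tau>, y). c \<tau> y) \<in> borel_measurable (borel \<Otimes>\<^sub>M sizes) \<and>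
     (\<lambda>(z, y). \<omega> z y) \<in> borel_measurable (borel \<Otimes>\<^sub>M sizes) \<and> locally_finite_kernel \<kappa>"

lemma ok_sourceD:
  assumes "ok_source N c \<omega> \<kappa>"
  shows "sets N = sets (borel \<Otimes>\<^sub>M borel)" "sigma_finite_measure N" "locally_finite_kernel \<kappa>"
    and "f \<in> borel_measurable M \<Longrightarrow> h \<in> M \<rightarrow>\<^sub>M sizes \<Longrightarrow> (\<lambda>m. c (f m) (h m)) \<in> borel_measurable M"
    and "g \<in> borel_measurable M \<Longrightarrow> h \<in> M \<rightarrow>\<^sub>M sizes \<Longrightarrow> (\<lambda>m. \<omega> (g m) (h m)) \<in> borel_measurable M"
proof -
  show "sets N = sets (borel \<Otimes>\<^sub>M borel)" "sigma_finite_measure N" "locally_finite_kernel \<kappa>"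
    using assms by (auto simp: ok_source_def ok_index_def)
  have c: "(\<lambda>(\<tau>, y). c \<tau> y) \<in> borel_measurable (borel \<Otimes>\<^sub>M sizes)"
    and w: "(\<lambda>(z, y). \<omega> z y) \<in> borel_measurable (borel \<Otimes>\<^sub>M sizes)"
    using assms by (auto simp: ok_source_def)
  show "f \<in> borel_measurable M \<Longrightarrow> h \<in> M \<rightarrow>\<^sub>M sizes \<Longrightarrow> (\<lambda>m. c (f m) (h m)) \<in> borel_measurable M"
    using measurable_compose[OF measurable_Pair c] by simp
  show "g \<in> borel_measurable M \<Longrightarrow> h \<in> M \<rightarrow>\<^sub>M sizes \<Longrightarrow> (\<lambda>m. \<omega> (g m) (h m)) \<in> borel_measurable M"
    using measurable_compose[OF measurable_Pair w] by simp
qed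

text \<open>All four arguments vary with \<open>m\<close>, so that the measurability statements
  about \<open>evolve\<close> are instances of this one.\<close>

lemma evolve_density_measurable:
  assumes ok: "ok_source N c \<omega> \<kappa>" and f: "(\<lambda>(m, y). f m y) \<in> borel_measurable (M \<Otimes>\<^sub>M sizes)"
    and t: "t \<in> borel_measurable M" and x: "x \<in> borel_measurable M"
    and s: "s \<in> borel_measurable M" and x': "x' \<in> borel_measurable M"
  shows "(\<lambda>m. \<integral>\<^sup>+y. f m y * (indicator {..<t m} (s m) * c (t m - s m) y * \<omega> (s m, x' m) y * p (t m - s m) (x' m) (x m) y)
     \<partial>\<kappa> (s m, x' m)) \<in> borel_measurable M"
proof -
  note [measurable] = f t x s x' and [measurable (raw)] = ok_sourceD(4,5)[OF ok]
  have [measurable]: "Measurable.pred (M \<Otimes>\<^sub>M sizes) (\<lambda>m. s (fst m) < t (fst m))" by measurable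
  have ind: "indicator {..<t m} (s m) = (if s m < t m then 1 else (0::ennreal))" for m
    by (simp add: indicator_def)
  show ?thesis unfolding ind
    by (rule lfk_integral_measurable[OF ok_sourceD(3)[OF ok]]) measurable
qed

lemma nn_integral_evolve:
  assumes ok: "ok_source N c \<omega> \<kappa>" and f: "f \<in> borel_measurable sizes"
  shows "(\<integral>\<^sup>+y. f y \<partial>evolve N c \<omega> \<kappa> t x) = (\<integral>\<^sup>+(s, x'). \<integral>\<^sup>+y. f y *
     (indicator {..<t} s * c (t - s) y * \<omega> (s, x') y * p (t - s) x' x y) \<partial>\<kappa> (s, x') \<partial>N)"
proof -
  note [measurable] = f and [measurable (raw)] = ok_sourceD(4,5)[OF ok]
  have [measurable_cong]: "sets (\<kappa> z) = sets sizes" for z by (rule lfk_sets[OF ok_sourceD(3)[OF ok]])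
  note [measurable_cong] = ok_sourceD(1)[OF ok]
  have [measurable]: "(\<lambda>y. indicator {..<t} s * c (t - s) y * \<omega> (s, x') y * p (t - s) x' x y) \<in> borel_measurable sizes" for s x'
    by measurable
  have *: "emeasure (case z of (s, x') \<Rightarrow> density (\<kappa> (s, x')) (\<lambda>y. indicator {..<t} s * c (t - s) y * \<omega> (s, x') y * p (t - s) x' x y)) A
      = (\<integral>\<^sup>+y. indicator A y * (indicator {..<t} (fst z) * c (t - fst z) y * \<omega> (fst z, snd z) y * p (t - fst z) (snd z) x y) \<partial>\<kappa> (fst z, snd z))"
    if [measurable]: "A \<in> sets sizes" for z A
    by (simp add: emeasure_density case_prod_beta) (simp add: mult.commute)
  have "(\<lambda>z. emeasure (case z of (s, x') \<Rightarrow> density (\<kappa> (s, x')) (\<lambda>y. indicator {..<t} s * c (t - s) y * \<omega> (s, x') y * p (t - s) x' x y)) A)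
     \<in> borel_measurable N" if [measurable]: "A \<in> sets sizes" for A
    unfolding *[OF that] by (rule evolve_density_measurable[OF ok]) measurable
  then show ?thesis unfolding evolve_def
    by (subst nn_integral_mix)
      (auto simp: lfk_sets[OF ok_sourceD(3)[OF ok]] nn_integral_density mult.commute intro!: nn_integral_cong)
qed

lemma emeasure_evolve:
  assumes ok: "ok_source N c \<omega> \<kappa>" and A: "A \<in> sets sizes"
  shows "emeasure (evolve N c \<omega> \<kappa> t x) A = (\<integral>\<^sup>+(s, x'). \<integral>\<^sup>+y. indicator A y *
     (indicator {..<t} s * c (t - s) y * \<omega> (s, x') y * p (t - s) x' x y) \<partial>\<kappa> (s, x') \<partial>N)"
  using nn_integral_evolve[OF ok borel_measurable_indicator[OF A]] A by simp

lemma evolve_emeasure_measurable: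
  assumes ok: "ok_source N c \<omega> \<kappa>" and A [measurable]: "A \<in> sets sizes"
    and t [measurable]: "t \<in> borel_measurable M" and x [measurable]: "x \<in> borel_measurable M"
  shows "(\<lambda>m. emeasure (evolve N c \<omega> \<kappa> (t m) (x m)) A) \<in> borel_measurable M"
proof -
  interpret sigma_finite_measure N by (rule ok_sourceD(2)[OF ok])
  note [measurable_cong] = ok_sourceD(1)[OF ok]
  have "(\<lambda>m. \<integral>\<^sup>+y. indicator A y * (indicator {..<t (fst m)} (fst (snd m)) * c (t (fst m) - fst (snd m)) y *
      \<omega> (fst (snd m), snd (snd m)) y * p (t (fst m) - fst (snd m)) (snd (snd m)) (x (fst m)) y) \<partial>\<kappa> (fst (snd m), snd (snd m)))
    \<in> borel_measurable (M \<Otimes>\<^sub>M N)"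
    by (rule evolve_density_measurable[OF ok]) measurable
  then show ?thesis
    unfolding emeasure_evolve[OF ok A] case_prod_beta
    by (intro borel_measurable_nn_integral) (simp add: case_prod_beta')
qed

text \<open>Tonelli moves the integral over the final position onto the heat kernel, so that the
  test function is evolved backwards. The choice \<open>q x y = f y * p r x z y\<close> leads to the
  semigroup law in \<open>evolve_space\<close>, and \<open>q x y = f y\<close> to conservation of
  particles in \<open>evolve_total\<close>.\<close>

lemma evolve_test:
  assumes ok: "ok_source N c \<omega> \<kappa>" and q: "(\<lambda>(x, y). q x y) \<in> borel_measurable (borel \<Otimes>\<^sub>M sizes)"
  shows "(\<integral>\<^sup>+x. \<integral>\<^sup>+y. q x y \<partial>evolve N c \<omega> \<kappa> t x \<partial>lborel) = (\<integral>\<^sup>+(s, x'). \<integral>\<^sup>+y.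
     indicator {..<t} s * c (t - s) y * \<omega> (s, x') y * (\<integral>\<^sup>+x. q x y * p (t - s) x' x y \<partial>lborel) \<partial>\<kappa> (s, x') \<partial>N)"
proof -
  note [measurable_cong] = ok_sourceD(1)[OF ok] lfk_sets[OF ok_sourceD(3)[OF ok]]
  note [measurable (raw)] = ok_sourceD(4,5)[OF ok]
  note [measurable] = q
  have [measurable (raw)]: "g \<in> borel_measurable M \<Longrightarrow> h \<in> M \<rightarrow>\<^sub>M sizes \<Longrightarrow> (\<lambda>m. q (g m) (h m)) \<in> borel_measurable M"
    for g h and M :: "'b measure"
    using measurable_compose[OF measurable_Pair q] by simp
  have "(\<integral>\<^sup>+x. \<integral>\<^sup>+y. q x y \<partial>evolve N c \<omega> \<kappa> t x \<partial>lborel) =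
     (\<integral>\<^sup>+x. (\<integral>\<^sup>+z. \<integral>\<^sup>+y. q x y * (indicator {..<t} (fst z) * c (t - fst z) y * \<omega> (fst z, snd z) y * p (t - fst z) (snd z) x y)
        \<partial>\<kappa> (fst z, snd z) \<partial>N) \<partial>lborel)"
    by (simp add: nn_integral_evolve[OF ok] case_prod_beta')
  also have "\<dots> = (\<integral>\<^sup>+z. (\<integral>\<^sup>+x. \<integral>\<^sup>+y. q x y * (indicator {..<t} (fst z) * c (t - fst z) y * \<omega> (fst z, snd z) y * p (t - fst z) (snd z) x y)
        \<partial>\<kappa> (fst z, snd z) \<partial>lborel) \<partial>N)"
  proof (rule nn_integral_swap[OF lborel.sigma_finite_measure_axioms ok_sourceD(2)[OF ok]])
    show "(\<lambda>(x, z). \<integral>\<^sup>+y. q x y * (indicator {..<t} (fst z) * c (t - fst z) y * \<omega> (fst z, snd z) y * p (t - fst z) (snd z) x y)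
        \<partial>\<kappa> (fst z, snd z)) \<in> borel_measurable (lborel \<Otimes>\<^sub>M N)"
      unfolding case_prod_beta by (rule evolve_density_measurable[OF ok]) measurable
  qed
  also have "\<dots> = (\<integral>\<^sup>+z. (\<integral>\<^sup>+y. \<integral>\<^sup>+x. q x y * (indicator {..<t} (fst z) * c (t - fst z) y * \<omega> (fst z, snd z) y * p (t - fst z) (snd z) x y)
        \<partial>lborel \<partial>\<kappa> (fst z, snd z)) \<partial>N)"
    by (intro nn_integral_cong nn_integral_swap lborel.sigma_finite_measure_axioms lfk_sigma_finite[OF ok_sourceD(3)[OF ok]]) measurable
  also have "\<dots> = (\<integral>\<^sup>+z. (\<integral>\<^sup>+y. indicator {..<t} (fst z) * c (t - fst z) y * \<omega> (fst z, snd z) y *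
      (\<integral>\<^sup>+x. q x y * p (t - fst z) (snd z) x y \<partial>lborel) \<partial>\<kappa> (fst z, snd z)) \<partial>N)"
  proof (intro nn_integral_cong)
    fix z y assume "y \<in> space (\<kappa> (fst z, snd z))"
    then have [measurable]: "(\<lambda>x. q x y) \<in> borel_measurable borel"
      using measurable_compose[OF measurable_Pair2' q, of y] lfk_space[OF ok_sourceD(3)[OF ok]] by (simp add: space_sizes)
    show "(\<integral>\<^sup>+x. q x y * (indicator {..<t} (fst z) * c (t - fst z) y * \<omega> (fst z, snd z) y * p (t - fst z) (snd z) x y) \<partial>lborel)
      = indicator {..<t} (fst z) * c (t - fst z) y * \<omega> (fst z, snd z) y * (\<integral>\<^sup>+x. q x y * p (t - fst z) (snd z) x y \<partial>lborel)"
      by (subst nn_integral_cmult[symmetric]) (auto intro!: nn_integral_cong simp: ac_simps)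
  qed
  finally show ?thesis by (simp add: case_prod_beta')
qed

text \<open>Chapman-Kolmogorov in the position. The additional time \<open>r\<close> enters only the
  heat kernel, while the damping keeps the age \<open>t - s\<close>.\<close>

lemma evolve_space:
  assumes ok: "ok_source N c \<omega> \<kappa>" and f [measurable]: "f \<in> borel_measurable sizes" and r: "0 < r"
  shows "(\<integral>\<^sup>+x'. \<integral>\<^sup>+y. f y * p r x' x y \<partial>evolve N c \<omega> \<kappa> t x' \<partial>lborel) = (\<integral>\<^sup>+(s, x'). \<integral>\<^sup>+y. f y *
     (indicator {..<t} s * c (t - s) y * \<omega> (s, x') y * p (t + r - s) x' x y) \<partial>\<kappa> (s, x') \<partial>N)"
proof -
  have "(\<integral>\<^sup>+x'. \<integral>\<^sup>+y. f y * p r x' x y \<partial>evolve N c \<omega> \<kappa> t x' \<partial>lborel) = (\<integral>\<^sup>+(s, x'). \<integral>\<^sup>+y.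
     indicator {..<t} s * c (t - s) y * \<omega> (s, x') y * (\<integral>\<^sup>+z. f y * p r z x y * p (t - s) x' z y \<partial>lborel) \<partial>\<kappa> (s, x') \<partial>N)"
    by (rule evolve_test[OF ok]) measurable
  also have "\<dots> = (\<integral>\<^sup>+(s, x'). \<integral>\<^sup>+y. f y *
     (indicator {..<t} s * c (t - s) y * \<omega> (s, x') y * p (t + r - s) x' x y) \<partial>\<kappa> (s, x') \<partial>N)"
  proof (intro nn_integral_cong, clarify, intro nn_integral_cong)
    fix s x' y assume "y \<in> space (\<kappa> (s, x'))"
    then have y: "0 < y" using lfk_space[OF ok_sourceD(3)[OF ok]] by simp
    show "indicator {..<t} s * c (t - s) y * \<omega> (s, x') y * (\<integral>\<^sup>+z. f y * p r z x y * p (t - s) x' z y \<partial>lborel) =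
       f y * (indicator {..<t} s * c (t - s) y * \<omega> (s, x') y * p (t + r - s) x' x y)"
    proof (cases "s < t")
      case True
      have "(\<integral>\<^sup>+z. f y * p r z x y * p (t - s) x' z y \<partial>lborel) = f y * p (t + r - s) x' x y"
        using p_semigroup[of "t - s" r y x x'] True r y
        by (simp add: mult.assoc nn_integral_cmult) (simp add: algebra_simps)
      then show ?thesis by (simp add: ac_simps)
    qed simp
  qed
  finally show ?thesis .
qed

lemma evolve_total:
  assumes ok: "ok_source N c \<omega> \<kappa>" and f [measurable]: "f \<in> borel_measurable sizes"
  shows "(\<integral>\<^sup>+x. \<integral>\<^sup>+y. f y \<partial>evolve N c \<omega> \<kappa> t x \<partial>lborel) = (\<integral>\<^sup>+(s, x'). \<integral>\<^sup>+y. f y *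
     (indicator {..<t} s * c (t - s) y * \<omega> (s, x') y) \<partial>\<kappa> (s, x') \<partial>N)"
proof -
  have "(\<integral>\<^sup>+x. \<integral>\<^sup>+y. f y \<partial>evolve N c \<omega> \<kappa> t x \<partial>lborel) = (\<integral>\<^sup>+(s, x'). \<integral>\<^sup>+y.
     indicator {..<t} s * c (t - s) y * \<omega> (s, x') y * (\<integral>\<^sup>+x. f y * p (t - s) x' x y \<partial>lborel) \<partial>\<kappa> (s, x') \<partial>N)"
    by (rule evolve_test[OF ok]) measurable
  also have "\<dots> = (\<integral>\<^sup>+(s, x'). \<integral>\<^sup>+y. f y *
     (indicator {..<t} s * c (t - s) y * \<omega> (s, x') y) \<partial>\<kappa> (s, x') \<partial>N)"
  proof (intro nn_integral_cong, clarify, intro nn_integral_cong)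
    fix s x' y assume "y \<in> space (\<kappa> (s, x'))"
    then have y: "0 < y" using lfk_space[OF ok_sourceD(3)[OF ok]] by simp
    show "indicator {..<t} s * c (t - s) y * \<omega> (s, x') y * (\<integral>\<^sup>+x. f y * p (t - s) x' x y \<partial>lborel) =
       f y * (indicator {..<t} s * c (t - s) y * \<omega> (s, x') y)"
      using p_int_snd[of "t - s" y x'] y by (cases "s < t") (auto simp: nn_integral_cmult ac_simps)
  qed
  finally show ?thesis .
qed

section \<open>Sources spread over time and sources emitted at time 0\<close>

definition time_space :: "(real \<times> 'x) measure" where
  "time_space = lborel \<Otimes>\<^sub>M lborel"

text \<open>The Dirac mass at time 0 turns the initial kernel into a source emitted at that time, so
  that \<open>evolve\<close> treats the initial term and the Duhamel terms alike.\<close>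

definition initial_space :: "(real \<times> 'x) measure" where
  "initial_space = return borel 0 \<Otimes>\<^sub>M lborel"

lemma ok_index_time_space: "ok_index time_space"
proof -
  show ?thesis using sigma_finite_pair_measure[OF lborel.sigma_finite_measure_axioms lborel.sigma_finite_measure_axioms]
    by (auto simp: ok_index_def time_space_def intro!: sets_pair_measure_cong)
qed

lemma ok_index_initial_space: "ok_index initial_space"
proof -
  interpret R: prob_space "return borel (0::real)" by (rule prob_space_return) simp
  show ?thesis using sigma_finite_pair_measure[OF R.sigma_finite_measure_axioms lborel.sigma_finite_measure_axioms]
    by (auto simp: ok_index_def initial_space_def intro!: sets_pair_measure_cong)
qed

lemma nn_integral_time_space:
  assumes "(\<lambda>(s, x). f s x) \<in> borel_measurable (borel \<Otimes>\<^sub>M borel)"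
  shows "(\<integral>\<^sup>+(s, x). f s x \<partial>time_space) = (\<integral>\<^sup>+s. \<integral>\<^sup>+x. f s x \<partial>lborel \<partial>lborel)"
proof -
  have "(\<lambda>(s, x). f s x) \<in> borel_measurable (lborel \<Otimes>\<^sub>M lborel)"
    using assms by (simp cong: measurable_cong_sets sets_pair_measure_cong)
  from lborel.nn_integral_fst[OF this] show ?thesis by (simp add: time_space_def)
qed

lemma nn_integral_initial_space:
  assumes f: "(\<lambda>(s, x). f s x) \<in> borel_measurable (borel \<Otimes>\<^sub>M borel)"
  shows "(\<integral>\<^sup>+(s, x). f s x \<partial>initial_space) = (\<integral>\<^sup>+x. f 0 x \<partial>lborel)"
proof -
  have f': "(\<lambda>(s, x). f s x) \<in> borel_measurable (return borel 0 \<Otimes>\<^sub>M lborel)"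
    using f by (simp cong: measurable_cong_sets sets_pair_measure_cong)
  have "(\<integral>\<^sup>+(s, x). f s x \<partial>initial_space) = (\<integral>\<^sup>+s. \<integral>\<^sup>+x. f s x \<partial>lborel \<partial>return borel 0)"
    using lborel.nn_integral_fst[OF f'] by (simp add: initial_space_def)
  also have "\<dots> = (\<integral>\<^sup>+x. f 0 x \<partial>lborel)"
  proof (rule nn_integral_return)
    show "(\<lambda>s. \<integral>\<^sup>+x. f s x \<partial>lborel) \<in> borel_measurable borel"
      using lborel.borel_measurable_nn_integral_fst[OF f'] by (simp cong: measurable_cong_sets)
  qed simp
  finally show ?thesis .
qed

text \<open>The heat kernels before and after the intermediate time \<open>u\<close> compose by the
  semigroup law to one that does not see \<open>u\<close>. Only the damping factors depend on
  \<open>u\<close>, and integrating over it gives their convolution \<open>d\<close>.\<close>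

lemma evolve_time:
  assumes ok: "ok_source N c \<omega> \<kappa>" and f [measurable]: "f \<in> borel_measurable sizes"
    and g: "(\<lambda>(\<tau>, y). g \<tau> y) \<in> borel_measurable (borel \<Otimes>\<^sub>M sizes)"
  defines "d \<equiv> \<lambda>\<tau> y. \<integral>\<^sup>+v. indicator {0<..<\<tau>} v * g (\<tau> - v) y * c v y \<partial>lborel"
  assumes okd: "ok_source N d \<omega> \<kappa>"
  shows "(\<integral>\<^sup>+(u, x'). \<integral>\<^sup>+y. f y * (indicator {..<t} u * g (t - u) y * p (t - u) x' x y) \<partial>evolve N c \<omega> \<kappa> u x' \<partial>time_space)
    = (\<integral>\<^sup>+y. f y \<partial>evolve N d \<omega> \<kappa> t x)"
proof -
  interpret N: sigma_finite_measure N by (rule ok_sourceD(2)[OF ok])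
  note [measurable_cong] = ok_sourceD(1)[OF ok] lfk_sets[OF ok_sourceD(3)[OF ok]]
  note [measurable (raw)] = ok_sourceD(4,5)[OF ok]
  have [measurable (raw)]: "a \<in> borel_measurable M \<Longrightarrow> h \<in> M \<rightarrow>\<^sub>M sizes \<Longrightarrow> (\<lambda>m. g (a m) (h m)) \<in> borel_measurable M"
    for a h and M :: "'b measure"
    using measurable_compose[OF measurable_Pair g] by simp
  let ?q = "\<lambda>u x' y. f y * (indicator {..<t} u * g (t - u) y * p (t - u) x' x y)"
  have q1: "?q u x' \<in> borel_measurable sizes" for u x' by measurable
  have inner: "(\<integral>\<^sup>+y. ?q u x' y \<partial>evolve N c \<omega> \<kappa> u x') =
      (\<integral>\<^sup>+z. \<integral>\<^sup>+y. ?q u x' y * (indicator {..<u} (fst z) * c (u - fst z) y * \<omega> (fst z, snd z) y * p (u - fst z) (snd z) x' y) \<partial>\<kappa> (fst z, snd z) \<partial>N)" for u x'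
    by (simp add: nn_integral_evolve[OF ok q1] case_prod_beta')
  have meas: "(\<lambda>(u, x'). \<integral>\<^sup>+y. ?q u x' y \<partial>evolve N c \<omega> \<kappa> u x') \<in> borel_measurable (borel \<Otimes>\<^sub>M borel)"
  proof -
    have "(\<lambda>m. \<integral>\<^sup>+y. ?q (fst (fst m)) (snd (fst m)) y *
        (indicator {..<fst (fst m)} (fst (snd m)) * c (fst (fst m) - fst (snd m)) y * \<omega> (fst (snd m), snd (snd m)) y
          * p (fst (fst m) - fst (snd m)) (snd (snd m)) (snd (fst m)) y)
        \<partial>\<kappa> (fst (snd m), snd (snd m))) \<in> borel_measurable ((borel \<Otimes>\<^sub>M borel) \<Otimes>\<^sub>M N)"
      unfolding indicator_if[where t=t] by (rule evolve_density_measurable[OF ok]) measurable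
    then show ?thesis
      unfolding inner case_prod_beta'
      by (intro N.borel_measurable_nn_integral) (simp add: case_prod_beta')
  qed
  have "(\<integral>\<^sup>+(u, x'). \<integral>\<^sup>+y. ?q u x' y \<partial>evolve N c \<omega> \<kappa> u x' \<partial>time_space)
      = (\<integral>\<^sup>+u. \<integral>\<^sup>+x'. \<integral>\<^sup>+y. ?q u x' y \<partial>evolve N c \<omega> \<kappa> u x' \<partial>lborel \<partial>lborel)"
    by (rule nn_integral_time_space[OF meas])
  also have "\<dots> = (\<integral>\<^sup>+u. \<integral>\<^sup>+z. \<integral>\<^sup>+y. (f y * (indicator {..<t} u * g (t - u) y)) *
      (indicator {..<u} (fst z) * c (u - fst z) y * \<omega> (fst z, snd z) y * p (t - fst z) (snd z) x y) \<partial>\<kappa> (fst z, snd z) \<partial>N \<partial>lborel)"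
  proof (intro nn_integral_cong)
    fix u :: real
    show "(\<integral>\<^sup>+x'. \<integral>\<^sup>+y. ?q u x' y \<partial>evolve N c \<omega> \<kappa> u x' \<partial>lborel) =
      (\<integral>\<^sup>+z. \<integral>\<^sup>+y. (f y * (indicator {..<t} u * g (t - u) y)) *
      (indicator {..<u} (fst z) * c (u - fst z) y * \<omega> (fst z, snd z) y * p (t - fst z) (snd z) x y) \<partial>\<kappa> (fst z, snd z) \<partial>N)"
    proof (cases "u < t")
      case True
      have "(\<integral>\<^sup>+x'. \<integral>\<^sup>+y. (f y * (indicator {..<t} u * g (t - u) y)) * p (t - u) x' x y \<partial>evolve N c \<omega> \<kappa> u x' \<partial>lborel) =
        (\<integral>\<^sup>+(s, x'). \<integral>\<^sup>+y. (f y * (indicator {..<t} u * g (t - u) y)) *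
         (indicator {..<u} s * c (u - s) y * \<omega> (s, x') y * p (u + (t - u) - s) x' x y) \<partial>\<kappa> (s, x') \<partial>N)"
      proof (rule evolve_space[OF ok])
        show "(\<lambda>y. f y * (indicator {..<t} u * g (t - u) y)) \<in> borel_measurable sizes" by measurable
        show "0 < t - u" using True by simp
      qed
      then show ?thesis by (simp add: case_prod_beta' mult.assoc)
    qed simp
  qed
  also have "\<dots> = (\<integral>\<^sup>+z. \<integral>\<^sup>+u. \<integral>\<^sup>+y. (f y * (indicator {..<t} u * g (t - u) y)) *
      (indicator {..<u} (fst z) * c (u - fst z) y * \<omega> (fst z, snd z) y * p (t - fst z) (snd z) x y) \<partial>\<kappa> (fst z, snd z) \<partial>lborel \<partial>N)"
    unfolding indicator_if
    by (intro nn_integral_swap lborel.sigma_finite_measure_axioms N.sigma_finite_measure_axioms,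
        unfold case_prod_beta', intro lfk_integral_measurable[OF ok_sourceD(3)[OF ok]]) measurable
  also have "\<dots> = (\<integral>\<^sup>+z. \<integral>\<^sup>+y. \<integral>\<^sup>+u. (f y * (indicator {..<t} u * g (t - u) y)) *
      (indicator {..<u} (fst z) * c (u - fst z) y * \<omega> (fst z, snd z) y * p (t - fst z) (snd z) x y) \<partial>lborel \<partial>\<kappa> (fst z, snd z) \<partial>N)"
    unfolding indicator_if
    by (intro nn_integral_cong nn_integral_swap lborel.sigma_finite_measure_axioms lfk_sigma_finite[OF ok_sourceD(3)[OF ok]]) measurable
  also have "\<dots> = (\<integral>\<^sup>+z. \<integral>\<^sup>+y. f y * (indicator {..<t} (fst z) * d (t - fst z) y * \<omega> (fst z, snd z) y * p (t - fst z) (snd z) x y)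
     \<partial>\<kappa> (fst z, snd z) \<partial>N)"
  proof (intro nn_integral_cong)
    fix z y assume "y \<in> space (\<kappa> (fst z, snd z))"
    then have y [measurable]: "y \<in> space sizes" using lfk_space[OF ok_sourceD(3)[OF ok]] by (simp add: space_sizes)
    let ?s = "fst z"
    let ?h = "\<lambda>u. indicator {..<t} u * g (t - u) y * (indicator {..<u} ?s * c (u - ?s) y)"
    have [measurable]: "?h \<in> borel_measurable borel" unfolding indicator_if by measurable
    let ?C = "f y * \<omega> (?s, snd z) y * p (t - ?s) (snd z) x y"
    have h': "?h \<in> borel_measurable lborel" by simp
    have "(\<integral>\<^sup>+u. (f y * (indicator {..<t} u * g (t - u) y)) *
      (indicator {..<u} ?s * c (u - ?s) y * \<omega> (?s, snd z) y * p (t - ?s) (snd z) x y) \<partial>lborel)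
      = (\<integral>\<^sup>+u. ?C * ?h u \<partial>lborel)"
      by (intro nn_integral_cong) (simp add: ac_simps)
    also have "\<dots> = ?C * (\<integral>\<^sup>+u. ?h u \<partial>lborel)" by (rule nn_integral_cmult[OF h'])
    \<comment> \<open>Substituting the age \<open>v = u - s\<close> since the emission turns the
      integral into the convolution that defines \<open>d\<close>.\<close>
    also have "(\<integral>\<^sup>+u. ?h u \<partial>lborel) = (\<integral>\<^sup>+v. ?h (?s + v) \<partial>lborel)"
      using nn_integral_real_affine[of ?h 1 ?s] by simp
    also have "\<dots> = indicator {..<t} ?s * d (t - ?s) y"
    proof (cases "?s < t")
      case True
      then show ?thesis unfolding d_def
        by (auto intro!: nn_integral_cong simp: algebra_simps split: split_indicator)
    next
      case False
      then have "(\<integral>\<^sup>+v. ?h (?s + v) \<partial>lborel) = (\<integral>\<^sup>+(v::real). 0 \<partial>lborel)"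
        by (intro nn_integral_cong) (simp split: split_indicator)
      with False show ?thesis by simp
    qed
    finally show "(\<integral>\<^sup>+u. (f y * (indicator {..<t} u * g (t - u) y)) *
      (indicator {..<u} ?s * c (u - ?s) y * \<omega> (?s, snd z) y * p (t - ?s) (snd z) x y) \<partial>lborel)
      = f y * (indicator {..<t} ?s * d (t - ?s) y * \<omega> (?s, snd z) y * p (t - ?s) (snd z) x y)"
      by (simp add: ac_simps)
  qed
  also have "\<dots> = (\<integral>\<^sup>+y. f y \<partial>evolve N d \<omega> \<kappa> t x)"
    by (simp add: nn_integral_evolve[OF okd] case_prod_beta')
  finally show ?thesis .
qed

end

text \<open>The two partners come from separate kernels because the linear problem freezes the
  second one. With \<open>h = kk\<close> the first argument is the larger partner.\<close>

definition gain_kernel :: "(real \<Rightarrow> real \<Rightarrow> ennreal) \<Rightarrow> ('z \<Rightarrow> real measure) \<Rightarrow> ('z \<Rightarrow> real measure) \<Rightarrow> 'z \<Rightarrow> real measure" where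
  "gain_kernel h \<alpha> \<beta> z = mix (\<alpha> z) (\<lambda>y. distr (density (\<beta> z) (h y)) sizes (\<lambda>y'. y + y'))"

lemma sets_gain_kernel [simp, measurable_cong]: "sets (gain_kernel h \<alpha> \<beta> z) = sets sizes"
  by (simp add: gain_kernel_def)

lemma gain_kernel_aux:
  assumes \<beta>: "locally_finite_kernel \<beta>" and h: "(\<lambda>(y, y'). h y y') \<in> borel_measurable (sizes \<Otimes>\<^sub>M sizes)"
    and f [measurable]: "f \<in> borel_measurable sizes" and y [measurable]: "y \<in> space sizes"
  shows "(\<integral>\<^sup>+u. f u \<partial>distr (density (\<beta> z) (h y)) sizes (\<lambda>y'. y + y')) = (\<integral>\<^sup>+y'. f (y + y') * h y y' \<partial>\<beta> z)"
proof -
  note [measurable_cong] = lfk_sets[OF \<beta>]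
  have [measurable]: "h y \<in> borel_measurable sizes"
    using measurable_compose[OF measurable_Pair1'[OF y] h] by simp
  show ?thesis
    by (simp add: nn_integral_distr nn_integral_density mult.commute)
qed

lemma
  assumes \<alpha>: "locally_finite_kernel \<alpha>" and \<beta>: "locally_finite_kernel \<beta>"
    and h: "(\<lambda>(y, y'). h y y') \<in> borel_measurable (sizes \<Otimes>\<^sub>M sizes)"
    and f [measurable]: "f \<in> borel_measurable sizes"
  shows nn_integral_gain_kernel:
      "(\<integral>\<^sup>+y. f y \<partial>gain_kernel h \<alpha> \<beta> z) = (\<integral>\<^sup>+y. \<integral>\<^sup>+y'. f (y + y') * h y y' \<partial>\<beta> z \<partial>\<alpha> z)"
    and gain_kernel_aux_measurable:
      "g \<in> borel_measurable M \<Longrightarrow> (\<lambda>m. \<integral>\<^sup>+y. \<integral>\<^sup>+y'. f (y + y') * h y y' \<partial>\<beta> (g m) \<partial>\<alpha> (g m)) \<in> borel_measurable M"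
proof -
  note [measurable_cong] = lfk_sets[OF \<beta>] lfk_sets[OF \<alpha>]
  have [measurable (raw)]: "a \<in> M \<rightarrow>\<^sub>M sizes \<Longrightarrow> b \<in> M \<rightarrow>\<^sub>M sizes \<Longrightarrow> (\<lambda>m. h (a m) (b m)) \<in> borel_measurable M"
    for a b and M :: "'c measure"
    using measurable_compose[OF measurable_Pair h] by simp
  have [measurable]: "(\<lambda>y. \<integral>\<^sup>+y'. F (y + y') * h y y' \<partial>\<beta> z) \<in> borel_measurable sizes"
    if [measurable]: "F \<in> borel_measurable sizes" for F z
    by (rule lfk_integral_measurable[OF \<beta>]) measurable
  have em: "emeasure (distr (density (\<beta> z) (h y)) sizes (\<lambda>y'. y + y')) A = (\<integral>\<^sup>+y'. indicator A (y + y') * h y y' \<partial>\<beta> z)"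
    if A [measurable]: "A \<in> sets sizes" and y: "y \<in> space sizes" for A y
    using gain_kernel_aux[OF \<beta> h _ y, of "indicator A" z] A by simp
  show "(\<integral>\<^sup>+y. f y \<partial>gain_kernel h \<alpha> \<beta> z) = (\<integral>\<^sup>+y. \<integral>\<^sup>+y'. f (y + y') * h y y' \<partial>\<beta> z \<partial>\<alpha> z)"
    unfolding gain_kernel_def
  proof (subst nn_integral_mix[OF _ _ f])
    show "(\<lambda>y. emeasure (distr (density (\<beta> z) (h y)) sizes (\<lambda>y'. y + y')) A) \<in> borel_measurable (\<alpha> z)"
      if [measurable]: "A \<in> sets sizes" for A
    proof -
      have "(\<lambda>y. \<integral>\<^sup>+y'. indicator A (y + y') * h y y' \<partial>\<beta> z) \<in> borel_measurable (\<alpha> z)" by measurable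
      then show ?thesis
        by (subst measurable_cong[OF em[OF that]]) (auto simp: lfk_space[OF \<alpha>] space_sizes)
    qed
  qed (auto intro!: nn_integral_cong gain_kernel_aux[OF \<beta> h f] simp: lfk_space[OF \<alpha>] space_sizes)
  assume g [measurable]: "g \<in> borel_measurable M"
  have [measurable]: "(\<lambda>m. \<integral>\<^sup>+y'. f (snd m + y') * h (snd m) y' \<partial>\<beta> (g (fst m))) \<in> borel_measurable (M \<Otimes>\<^sub>M sizes)"
    by (rule lfk_integral_measurable[OF \<beta>]) measurable
  show "(\<lambda>m. \<integral>\<^sup>+y. \<integral>\<^sup>+y'. f (y + y') * h y y' \<partial>\<beta> (g m) \<partial>\<alpha> (g m)) \<in> borel_measurable M"
    by (rule lfk_integral_measurable[OF \<alpha>]) (auto simp: case_prod_beta')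
qed

lemma gain_kernel_measurable_kernel:
  assumes \<alpha>: "locally_finite_kernel \<alpha>" and \<beta>: "locally_finite_kernel \<beta>"
    and h: "(\<lambda>(y, y'). h y y') \<in> borel_measurable (sizes \<Otimes>\<^sub>M sizes)"
  shows "measurable_kernel borel (gain_kernel h \<alpha> \<beta>)"
  unfolding measurable_kernel_def
proof (intro conjI ballI)
  fix A assume A [measurable]: "A \<in> sets sizes"
  have "emeasure (gain_kernel h \<alpha> \<beta> z) A = (\<integral>\<^sup>+y. \<integral>\<^sup>+y'. indicator A (y + y') * h y y' \<partial>\<beta> z \<partial>\<alpha> z)" for z
    using nn_integral_gain_kernel[OF \<alpha> \<beta> h, of "indicator A"] A by simp
  then show "(\<lambda>z. emeasure (gain_kernel h \<alpha> \<beta> z) A) \<in> borel_measurable borel"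
    using gain_kernel_aux_measurable[OF \<alpha> \<beta> h, of "indicator A" "\<lambda>z. z"] by simp
qed simp

section \<open>Monotone limits of kernels\<close>

definition kernel_le :: "('z \<Rightarrow> real measure) \<Rightarrow> ('z \<Rightarrow> real measure) \<Rightarrow> bool" where
  "kernel_le \<alpha> \<beta> \<longleftrightarrow> (\<forall>z. \<forall>A\<in>sets sizes. emeasure (\<alpha> z) A \<le> emeasure (\<beta> z) A)"

lemma kernel_le_refl: "kernel_le \<alpha> \<alpha>"
  by (simp add: kernel_le_def)

lemma kernel_le_nn_integral:
  assumes "kernel_le \<alpha> \<beta>" "sets (\<alpha> z) = sets sizes" "sets (\<beta> z) = sets sizes"
  shows "(\<integral>\<^sup>+y. f y \<partial>\<alpha> z) \<le> (\<integral>\<^sup>+y. f y \<partial>\<beta> z)"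
proof (rule nn_integral_mono_measure)
  show "\<alpha> z \<le> \<beta> z"
    using assms by (subst le_measure) (auto simp: kernel_le_def)
qed (simp add: assms)

text \<open>A setwise supremum of measures is countably additive along increasing sequences, and the
  lemmas about its values are restricted to these.\<close>

definition kernel_sup :: "(nat \<Rightarrow> 'z \<Rightarrow> real measure) \<Rightarrow> 'z \<Rightarrow> real measure" where
  "kernel_sup F z = measure_of (space sizes) (sets sizes) (\<lambda>A. SUP n. emeasure (F n z) A)"

lemma sets_kernel_sup [simp, measurable_cong]: "sets (kernel_sup F z) = sets sizes"
  by (simp add: kernel_sup_def)

lemma
  assumes s: "\<And>n. sets (F n z) = sets sizes" and i: "\<And>n. kernel_le (F n) (F (Suc n))"
  shows kernel_sup_incseq: "incseq (\<lambda>n. \<integral>\<^sup>+y. f y \<partial>F n z)"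
    and emeasure_kernel_sup: "A \<in> sets sizes \<Longrightarrow> emeasure (kernel_sup F z) A = (SUP n. emeasure (F n z) A)"
    and nn_integral_kernel_sup: "f \<in> borel_measurable sizes \<Longrightarrow> (\<integral>\<^sup>+y. f y \<partial>kernel_sup F z) = (SUP n. \<integral>\<^sup>+y. f y \<partial>F n z)"
proof -
  have inc: "incseq (\<lambda>n. \<integral>\<^sup>+y. f y \<partial>F n z)" for f :: "real \<Rightarrow> ennreal"
    using kernel_le_nn_integral[OF i s s] by (intro incseq_SucI)
  then show "incseq (\<lambda>n. \<integral>\<^sup>+y. f y \<partial>F n z)" .
  have incA: "incseq (\<lambda>n. emeasure (F n z) A)" if "A \<in> sets sizes" for A
    using i that by (intro incseq_SucI) (auto simp: kernel_le_def)
  have em: "emeasure (kernel_sup F z) A = (SUP n. emeasure (F n z) A)" if A: "A \<in> sets sizes" for A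
    unfolding kernel_sup_def
  proof (rule emeasure_measure_of_sizes[OF A])
    fix B :: "nat \<Rightarrow> real set" assume B: "range B \<subseteq> sets sizes" "disjoint_family B"
    have "(SUP n. emeasure (F n z) (\<Union>i. B i)) = (SUP n. \<Sum>i. emeasure (F n z) (B i))"
      using B s by (intro SUP_cong) (auto simp: suminf_emeasure)
    also have "\<dots> = (\<Sum>i. SUP n. emeasure (F n z) (B i))"
      using B incA by (intro ennreal_suminf_SUP_eq[symmetric]) auto
    finally show "(SUP n. emeasure (F n z) (\<Union>i. B i)) = (\<Sum>i. SUP n. emeasure (F n z) (B i))" .
  qed simp
  then show "A \<in> sets sizes \<Longrightarrow> emeasure (kernel_sup F z) A = (SUP n. emeasure (F n z) A)" .
  have sp: "space (F n z) = space sizes" for n using s by (rule sets_eq_imp_space_eq)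
  have sp': "space (kernel_sup F z) = space sizes" by (intro sets_eq_imp_space_eq) simp
  note [measurable_cong] = s
  show "f \<in> borel_measurable sizes \<Longrightarrow> (\<integral>\<^sup>+y. f y \<partial>kernel_sup F z) = (SUP n. \<integral>\<^sup>+y. f y \<partial>F n z)"
  proof (induction rule: borel_measurable_induct)
    case (cong f g)
    have "(\<integral>\<^sup>+y. f y \<partial>kernel_sup F z) = (\<integral>\<^sup>+y. g y \<partial>kernel_sup F z)"
      using cong(3) by (intro nn_integral_cong) (simp add: sp')
    moreover have "(\<integral>\<^sup>+y. f y \<partial>F n z) = (\<integral>\<^sup>+y. g y \<partial>F n z)" for n
      using cong(3) by (intro nn_integral_cong) (simp add: sp)
    ultimately show ?case using cong(4) by simp
  next
    case (set A)
    then show ?case using em[OF set] s by simp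
  next
    case (mult u c)
    then show ?case by (simp add: nn_integral_cmult SUP_mult_left_ennreal)
  next
    case (add u v)
    then show ?case using inc by (simp add: nn_integral_add ennreal_SUP_add)
  next
    case (seq U)
    have "(\<integral>\<^sup>+y. (SUP i. U i y) \<partial>kernel_sup F z) = (SUP i. SUP n. \<integral>\<^sup>+y. U i y \<partial>F n z)"
      using seq by (subst nn_integral_monotone_convergence_SUP) auto
    also have "\<dots> = (SUP n. SUP i. \<integral>\<^sup>+y. U i y \<partial>F n z)" by (rule SUP_commute)
    also have "\<dots> = (SUP n. \<integral>\<^sup>+y. (SUP i. U i y) \<partial>F n z)"
      using seq by (subst nn_integral_monotone_convergence_SUP) auto
    finally show ?case by (simp add: image_comp)
  qed
qed

lemma SUP_diag_ennreal:
  fixes a :: "nat \<Rightarrow> nat \<Rightarrow> ennreal"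
  assumes "\<And>i. incseq (a i)" "\<And>j. incseq (\<lambda>i. a i j)"
  shows "(SUP i. SUP j. a i j) = (SUP i. a i i)"
proof (rule antisym)
  show "(SUP i. SUP j. a i j) \<le> (SUP i. a i i)"
  proof (intro SUP_least)
    fix i j
    have "a i j \<le> a (max i j) j" using assms(2)[of j] by (simp add: incseq_def)
    also have "\<dots> \<le> a (max i j) (max i j)" using assms(1) by (simp add: incseq_def)
    finally show "a i j \<le> (SUP i. a i i)" by (rule SUP_upper2[rotated]) simp
  qed
  show "(SUP i. a i i) \<le> (SUP i. SUP j. a i j)" by (auto intro!: SUP_least SUP_upper2)
qed

text \<open>Monotone convergence in integrand and measure at once: the double supremum over an array
  increasing in both indices is reached on the diagonal.\<close>

lemma nn_integral_kernel_sup2: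
  assumes s: "\<And>n. sets (F n z) = sets sizes" and i: "\<And>n. kernel_le (F n) (F (Suc n))"
    and f: "\<And>n. f n \<in> borel_measurable sizes" and fi: "\<And>y. y > 0 \<Longrightarrow> incseq (\<lambda>n. f n y)"
  shows "(\<integral>\<^sup>+y. (SUP n. f n y) \<partial>kernel_sup F z) = (SUP n. \<integral>\<^sup>+y. f n y \<partial>F n z)"
    and "incseq (\<lambda>n. \<integral>\<^sup>+y. f n y \<partial>F n z)"
proof -
  note [measurable] = f
  have sp: "space (F n z) = space sizes" for n using s by (rule sets_eq_imp_space_eq)
  have sp': "space (kernel_sup F z) = space sizes" by (intro sets_eq_imp_space_eq) simp
  have inc1: "incseq (\<lambda>j. \<integral>\<^sup>+y. f i y \<partial>F j z)" for i by (rule kernel_sup_incseq[where F=F, OF s i])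
  have inc2: "incseq (\<lambda>i. \<integral>\<^sup>+y. f i y \<partial>F j z)" for j
    using fi by (auto simp: incseq_def sp space_sizes intro!: nn_integral_mono)
  have "(\<integral>\<^sup>+y. (SUP n. f n y) \<partial>kernel_sup F z) = (SUP n. \<integral>\<^sup>+y. f n y \<partial>kernel_sup F z)"
    using fi by (intro nn_integral_monotone_convergence_SUP_AE) (auto simp: incseq_def sp' space_sizes)
  also have "\<dots> = (SUP n. SUP j. \<integral>\<^sup>+y. f n y \<partial>F j z)"
    by (simp add: nn_integral_kernel_sup[where F=F, OF s i f])
  also have "\<dots> = (SUP n. \<integral>\<^sup>+y. f n y \<partial>F n z)"
    by (rule SUP_diag_ennreal[OF inc1 inc2])
  finally show "(\<integral>\<^sup>+y. (SUP n. f n y) \<partial>kernel_sup F z) = (SUP n. \<integral>\<^sup>+y. f n y \<partial>F n z)" .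
  show "incseq (\<lambda>n. \<integral>\<^sup>+y. f n y \<partial>F n z)"
  proof (rule incseq_SucI)
    fix n
    have "(\<integral>\<^sup>+y. f n y \<partial>F n z) \<le> (\<integral>\<^sup>+y. f n y \<partial>F (Suc n) z)" using inc1[of n] by (simp add: incseq_Suc_iff)
    also have "\<dots> \<le> (\<integral>\<^sup>+y. f (Suc n) y \<partial>F (Suc n) z)" using inc2[of "Suc n"] by (simp add: incseq_Suc_iff)
    finally show "(\<integral>\<^sup>+y. f n y \<partial>F n z) \<le> (\<integral>\<^sup>+y. f (Suc n) y \<partial>F (Suc n) z)" .
  qed
qed

lemma kernel_sup_least:
  assumes "\<And>n z. sets (F n z) = sets sizes" and "\<And>n. kernel_le (F n) (F (Suc n))"
    and "\<And>n. kernel_le (F n) \<beta>"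
  shows "kernel_le (kernel_sup F) \<beta>"
  using assms(3) unfolding kernel_le_def by (auto simp: emeasure_kernel_sup[where F=F, OF assms(1,2)] intro: SUP_least)

lemma kernel_sup_measurable_kernel:
  assumes "\<And>n. measurable_kernel borel (F n)" and i: "\<And>n. kernel_le (F n) (F (Suc n))"
  shows "measurable_kernel borel (kernel_sup F)"
proof -
  have s: "sets (F n z) = sets sizes" for n z using assms(1) by (simp add: measurable_kernel_def)
  have "(\<lambda>z. SUP n. emeasure (F n z) A) \<in> borel_measurable borel" if "A \<in> sets sizes" for A
    using assms(1) that by (intro borel_measurable_SUP) (auto simp: measurable_kernel_def)
  then show ?thesis
    by (simp add: measurable_kernel_def emeasure_kernel_sup[where F=F, OF s i])
qed

lemma gain_kernel_mono:
  assumes "locally_finite_kernel \<alpha>" "locally_finite_kernel \<beta>" "locally_finite_kernel \<alpha>'" "locally_finite_kernel \<beta>'"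
    and h: "(\<lambda>(y, y'). h y y') \<in> borel_measurable (sizes \<Otimes>\<^sub>M sizes)"
    and "kernel_le \<alpha> \<alpha>'" "kernel_le \<beta> \<beta>'"
  shows "kernel_le (gain_kernel h \<alpha> \<beta>) (gain_kernel h \<alpha>' \<beta>')"
  unfolding kernel_le_def
proof (intro allI ballI)
  fix z A assume A: "A \<in> sets sizes"
  have "(\<integral>\<^sup>+y. indicator A y \<partial>gain_kernel h \<alpha> \<beta> z) \<le> (\<integral>\<^sup>+y. indicator A y \<partial>gain_kernel h \<alpha>' \<beta>' z)"
    unfolding nn_integral_gain_kernel[OF assms(1,2) h borel_measurable_indicator[OF A]]
      nn_integral_gain_kernel[OF assms(3,4) h borel_measurable_indicator[OF A]]
    by (rule order_trans[OF kernel_le_nn_integral[OF assms(6)] nn_integral_mono])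
      (auto intro: kernel_le_nn_integral[OF assms(7)] simp: assms(1-4)[THEN lfk_sets])
  then show "emeasure (gain_kernel h \<alpha> \<beta> z) A \<le> emeasure (gain_kernel h \<alpha>' \<beta>' z) A"
    using A by simp
qed

lemma gain_kernel_sup:
  assumes F: "\<And>n. locally_finite_kernel (F n)" "\<And>n. kernel_le (F n) (F (Suc n))" "locally_finite_kernel (kernel_sup F)"
    and G: "\<And>n. locally_finite_kernel (G n)" "\<And>n. kernel_le (G n) (G (Suc n))" "locally_finite_kernel (kernel_sup G)"
    and h: "(\<lambda>(y, y'). h y y') \<in> borel_measurable (sizes \<Otimes>\<^sub>M sizes)"
    and A: "A \<in> sets sizes"
  shows "emeasure (gain_kernel h (kernel_sup F) (kernel_sup G) z) A = (SUP n. emeasure (gain_kernel h (F n) (G n) z) A)"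
proof -
  note [measurable] = A
  have [measurable (raw)]: "a \<in> M \<rightarrow>\<^sub>M sizes \<Longrightarrow> b \<in> M \<rightarrow>\<^sub>M sizes \<Longrightarrow> (\<lambda>m. h (a m) (b m)) \<in> borel_measurable M"
    for a b and M :: "'c measure"
    using measurable_compose[OF measurable_Pair h] by simp
  have em: "emeasure (gain_kernel h \<alpha> \<beta> z) A = (\<integral>\<^sup>+y. \<integral>\<^sup>+y'. indicator A (y + y') * h y y' \<partial>\<beta> z \<partial>\<alpha> z)"
    if "locally_finite_kernel \<alpha>" "locally_finite_kernel \<beta>" for \<alpha> \<beta> :: "'a \<Rightarrow> real measure"
    using nn_integral_gain_kernel[OF that h borel_measurable_indicator[OF A]] A by simp
  have "emeasure (gain_kernel h (kernel_sup F) (kernel_sup G) z) A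
    = (\<integral>\<^sup>+y. (SUP n. \<integral>\<^sup>+y'. indicator A (y + y') * h y y' \<partial>G n z) \<partial>kernel_sup F z)"
    unfolding em[OF F(3) G(3)]
  proof (intro nn_integral_cong nn_integral_kernel_sup lfk_sets G(1,2))
    fix y assume "y \<in> space (kernel_sup F z)"
    then have [measurable]: "y \<in> space sizes" using lfk_space[OF F(3)] by (simp add: space_sizes)
    show "(\<lambda>y'. indicator A (y + y') * h y y') \<in> borel_measurable sizes" by measurable
  qed
  also have "\<dots> = (SUP n. \<integral>\<^sup>+y. \<integral>\<^sup>+y'. indicator A (y + y') * h y y' \<partial>G n z \<partial>F n z)"
  proof (rule nn_integral_kernel_sup2(1))
    show "(\<lambda>y. \<integral>\<^sup>+y'. indicator A (y + y') * h y y' \<partial>G n z) \<in> borel_measurable sizes" for n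
      by (rule lfk_integral_measurable[OF G(1)]) measurable
    show "incseq (\<lambda>n. \<integral>\<^sup>+y'. indicator A (y + y') * h y y' \<partial>G n z)" for y
      by (rule kernel_sup_incseq[where F=G, OF lfk_sets[OF G(1)] G(2)])
  qed (simp_all add: lfk_sets[OF F(1)] F(2))
  finally show ?thesis by (simp add: em F G)
qed

context heat
begin

lemma evolve_mono:
  assumes ok: "ok_source N c \<omega> \<kappa>" and ok': "ok_source N c \<omega>' \<kappa>'" and f: "f \<in> borel_measurable sizes"
    and \<kappa>: "kernel_le \<kappa> \<kappa>'" and \<omega>: "\<And>z y. y > 0 \<Longrightarrow> \<omega> z y \<le> \<omega>' z y"
  shows "(\<integral>\<^sup>+y. f y \<partial>evolve N c \<omega> \<kappa> t x) \<le> (\<integral>\<^sup>+y. f y \<partial>evolve N c \<omega>' \<kappa>' t x)"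
proof -
  note l = ok_sourceD(3)[OF ok] ok_sourceD(3)[OF ok']
  show ?thesis
    unfolding nn_integral_evolve[OF ok f] nn_integral_evolve[OF ok' f]
    by (intro nn_integral_mono, clarify,
        rule order_trans[OF nn_integral_mono kernel_le_nn_integral[OF \<kappa>]])
      (auto simp: l[THEN lfk_sets] l[THEN lfk_space] intro!: mult_mono \<omega>)
qed

lemma evolve_sup:
  assumes ok: "\<And>n. ok_source N c (\<omega> n) (F n)" and ok': "ok_source N c \<omega>' (kernel_sup F)"
    and f: "f \<in> borel_measurable sizes"
    and i: "\<And>n. kernel_le (F n) (F (Suc n))"
    and \<omega>i: "\<And>z y. y > 0 \<Longrightarrow> incseq (\<lambda>n. \<omega> n z y)" and \<omega>: "\<And>z y. y > 0 \<Longrightarrow> \<omega>' z y = (SUP n. \<omega> n z y)"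
  shows "(\<integral>\<^sup>+y. f y \<partial>evolve N c \<omega>' (kernel_sup F) t x) = (SUP n. \<integral>\<^sup>+y. f y \<partial>evolve N c (\<omega> n) (F n) t x)"
proof -
  note l = ok_sourceD(3)[OF ok] and l' = ok_sourceD(3)[OF ok']
  note [measurable (raw)] = ok_sourceD(4,5)[OF ok] and [measurable_cong] = ok_sourceD(1)[OF ok]
  note [measurable] = f
  have s: "sets (F n z) = sets sizes" for n z by (rule lfk_sets[OF l])
  define h where "h n z y = f y * (indicator {..<t} (fst z) * c (t - fst z) y * \<omega> n (fst z, snd z) y * p (t - fst z) (snd z) x y)" for n z y
  have [measurable]: "h n z \<in> borel_measurable sizes" for n z unfolding h_def by measurable
  have hi: "incseq (\<lambda>n. h n z y)" if "y > 0" for z y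
    using \<omega>i[OF that, of "(fst z, snd z)"] unfolding h_def incseq_def by (cases z) (auto intro!: mult_mono)
  have hs: "f y * (indicator {..<t} (fst z) * c (t - fst z) y * \<omega>' (fst z, snd z) y * p (t - fst z) (snd z) x y) = (SUP n. h n z y)" if "y > 0" for z y
    unfolding h_def using \<omega>[OF that]
    by (simp add: SUP_mult_left_ennreal SUP_mult_right_ennreal)
  have "(\<integral>\<^sup>+y. f y \<partial>evolve N c \<omega>' (kernel_sup F) t x) = (\<integral>\<^sup>+z. \<integral>\<^sup>+y. (SUP n. h n z y) \<partial>kernel_sup F (fst z, snd z) \<partial>N)"
    unfolding nn_integral_evolve[OF ok' f] case_prod_beta'
    by (intro nn_integral_cong hs) (simp add: lfk_space[OF l'])
  also have "\<dots> = (\<integral>\<^sup>+z. (SUP n. \<integral>\<^sup>+y. h n z y \<partial>F n (fst z, snd z)) \<partial>N)"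
    by (intro nn_integral_cong nn_integral_kernel_sup2(1) s i hi) auto
  also have "\<dots> = (SUP n. \<integral>\<^sup>+z. \<integral>\<^sup>+y. h n z y \<partial>F n (fst z, snd z) \<partial>N)"
  proof (rule nn_integral_monotone_convergence_SUP)
    show "incseq (\<lambda>n z. \<integral>\<^sup>+y. h n z y \<partial>F n (fst z, snd z))"
      using nn_integral_kernel_sup2(2)[where F=F, OF s i, of "\<lambda>n. h n z" "(fst z, snd z)" for z] hi
      by (simp add: incseq_def le_fun_def)
    show "(\<lambda>z. \<integral>\<^sup>+y. h n z y \<partial>F n (fst z, snd z)) \<in> borel_measurable N" for n
      unfolding h_def by (rule evolve_density_measurable[OF ok]) measurable
  qed
  finally show ?thesis
    by (simp add: nn_integral_evolve[OF ok f] case_prod_beta' h_def)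
qed

end

section \<open>The linear problem\<close>

definition w :: "real \<Rightarrow> ennreal" where "w y = ennreal (y powr (2/3))"
definition phi :: "real \<Rightarrow> ennreal" where "phi y = ennreal (y powr (4/3))"

lemma w_measurable [measurable]: "w \<in> borel_measurable sizes"
  unfolding w_def by measurable

lemma phi_measurable [measurable]: "phi \<in> borel_measurable sizes"
  unfolding phi_def by measurable

lemma fst_borel_prod [measurable]: "fst \<in> borel_measurable (borel :: ('a::second_countable_topology \<times> 'b::second_countable_topology) measure)"
  unfolding borel_prod[symmetric] by simp

lemma snd_borel_prod [measurable]: "snd \<in> borel_measurable (borel :: ('a::second_countable_topology \<times> 'b::second_countable_topology) measure)"
  unfolding borel_prod[symmetric] by simp

lemma Ioc_sizes [measurable]: "{0<..R} \<in> sets sizes" "{0<..<R} \<in> sets sizes"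
  by (auto intro!: sets_sizesI)

lemma AE_size_ge:
  assumes "sets M = sets sizes" "emeasure M {0<..<d} = 0"
  shows "AE y in M. d \<le> y"
proof (rule AE_I)
  show "{y \<in> space M. \<not> d \<le> y} \<subseteq> {0<..<d}"
    by (auto simp: sets_eq_imp_space_eq[OF assms(1)] space_sizes)
qed (use assms Ioc_sizes in simp_all)

text \<open>The function \<open>A * exp (c * s)\<close> is the fixed point of Gronwall's integral
  inequality, so a bound of this form passes from one iterate to the next without loss.\<close>

lemma exp_integral:
  assumes "0 \<le> c" "0 \<le> A" "0 \<le> t"
  shows "(\<integral>\<^sup>+s. indicator {0<..<t} s * ennreal (c * (A * exp (c * s))) \<partial>lborel) \<le> ennreal (A * exp (c * t) - A)"
proof -
  have "(\<integral>\<^sup>+s. indicator {0<..<t} s * ennreal (c * (A * exp (c * s))) \<partial>lborel)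
      \<le> (\<integral>\<^sup>+s. ennreal (c * (A * exp (c * s))) * indicator {0..t} s \<partial>lborel)"
    by (intro nn_integral_mono) (auto split: split_indicator)
  also have "\<dots> = ennreal (A * exp (c * t) - A * exp (c * 0))"
    using assms by (intro nn_integral_FTC_Icc) (auto intro!: derivative_eq_intros)
  finally show ?thesis by simp
qed

text \<open>The kernel \<open>k\<close> is cut off below \<open>\<delta>\<close>, which makes
  \<open>k_bound\<close> hold for all sizes; kernels supported above \<open>\<delta>\<close> do not
  notice the cut. The bound \<open>\<mu>0_phi\<close> is required at every position, since suprema
  over positions are used throughout. \<open>T\<close> is an arbitrary horizon here, as the linear
  problem is solvable for all times; smallness enters with the moment bounds.\<close>

locale coag = heat p for p :: "real \<Rightarrow> 'x::euclidean_space \<Rightarrow> 'x \<Rightarrow> real \<Rightarrow> ennreal" +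
  fixes k :: "real \<Rightarrow> real \<Rightarrow> ennreal" and \<delta> C g0 m0 T :: real and \<mu>0 :: "'x \<Rightarrow> real measure"
  assumes pos: "0 < \<delta>" "0 < C" "0 < g0" "0 < m0" "0 < T"
    and k_measurable': "(\<lambda>(y, y'). k y y') \<in> borel_measurable (sizes \<Otimes>\<^sub>M sizes)"
    and k_sym: "\<And>y y'. k y y' = k y' y"
    and k_bound: "\<And>y y'. 0 < y \<Longrightarrow> 0 < y' \<Longrightarrow> k y y' \<le> ennreal (C * (y powr (2/3) * y' powr (2/3)))"
    and k_zero: "\<And>y y'. y < \<delta> \<Longrightarrow> k y y' = 0"
    and \<mu>0_lfk: "locally_finite_kernel \<mu>0"
    and \<mu>0_supp: "\<And>x. emeasure (\<mu>0 x) {0<..<\<delta>} = 0"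
    and \<mu>0_phi: "\<And>t x. 0 < t \<Longrightarrow> (\<integral>\<^sup>+x'. \<integral>\<^sup>+y. phi y * p t x' x y \<partial>\<mu>0 x' \<partial>lborel) \<le> ennreal g0"
    and \<mu>0_mass: "(\<integral>\<^sup>+x. \<integral>\<^sup>+y. ennreal y \<partial>\<mu>0 x \<partial>lborel) \<le> ennreal m0"
begin

text \<open>Ordering the pairs, with ties counted half, replaces the factor \<open>1/2\<close> in the gain.\<close>

definition kk :: "real \<Rightarrow> real \<Rightarrow> ennreal" where
  "kk y y' = (if y' < y then k y y' else if y' = y then k y y' / 2 else 0)"

text \<open>This is \<open>C w(y)\<close> times \<open>2 g0 \<delta> powr (- 2/3)\<close>, the bound of the \<open>w\<close> moment that a bound \<open>2 g0\<close> of
  the \<open>phi\<close> moment implies for sizes above \<open>\<delta>\<close>.\<close>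

definition vb :: "real \<Rightarrow> real" where
  "vb y = (if y < \<delta> then 0 else 2 * C * g0 * \<delta> powr (- 2/3) * y powr (2/3))"

definition ee :: "real \<Rightarrow> real \<Rightarrow> ennreal" where
  "ee \<tau> y = ennreal (exp (- (vb y * \<tau>)))"

abbreviation one :: "'x rate" where "one \<equiv> \<lambda>_ _. 1"
abbreviation ini :: "'x kernel" where "ini \<equiv> \<lambda>z. \<mu>0 (snd z)"
abbreviation gain :: "'x kernel \<Rightarrow> 'x kernel \<Rightarrow> 'x kernel" where
  "gain \<equiv> gain_kernel kk"

text \<open>The equation damped by \<open>vb\<close>; here \<open>U\<close> is \<open>vb\<close> minus the loss rate.\<close>

definition step :: "'x kernel \<Rightarrow> 'x rate \<Rightarrow> 'x kernel
    \<Rightarrow> 'x kernel" where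
  "step \<beta> U \<alpha> z = (if 0 < fst z \<and> fst z \<le> T then
     mix (count_space {0, 1, 2::nat}) (\<lambda>i. if i = 0 then evolve initial_space ee one ini (fst z) (snd z)
       else if i = 1 then evolve time_space ee U \<alpha> (fst z) (snd z)
       else evolve time_space ee one (gain \<alpha> \<beta>) (fst z) (snd z))
     else null_measure sizes)"

text \<open>Time \<open>0\<close> is excluded because the initial kernel satisfies bounds only after diffusion.\<close>

definition nice :: "'x kernel \<Rightarrow> bool" where
  "nice \<alpha> \<longleftrightarrow> measurable_kernel borel \<alpha> \<and> (\<forall>t x. \<not> (0 < t \<and> t \<le> T) \<longrightarrow> \<alpha> (t, x) = null_measure sizes) \<and>
     (\<forall>z. emeasure (\<alpha> z) {0<..<\<delta>} = 0) \<and> (\<forall>R. \<exists>B::real. \<forall>z. emeasure (\<alpha> z) {0<..R} \<le> ennreal B)"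

definition ok_rate :: "'x rate \<Rightarrow> bool" where
  "ok_rate U \<longleftrightarrow> (\<lambda>(z, y). U z y) \<in> borel_measurable (borel \<Otimes>\<^sub>M sizes) \<and> (\<forall>z y. 0 < y \<longrightarrow> U z y \<le> ennreal (vb y))"

lemma k_measurable [measurable (raw)]:
  "a \<in> M \<rightarrow>\<^sub>M sizes \<Longrightarrow> b \<in> M \<rightarrow>\<^sub>M sizes \<Longrightarrow> (\<lambda>m. k (a m) (b m)) \<in> borel_measurable M"
  using measurable_compose[OF measurable_Pair k_measurable'] by simp

lemma kk_measurable': "(\<lambda>(y, y'). kk y y') \<in> borel_measurable (sizes \<Otimes>\<^sub>M sizes)"
  unfolding kk_def by measurable

lemma kk_measurable [measurable (raw)]:
  "a \<in> M \<rightarrow>\<^sub>M sizes \<Longrightarrow> b \<in> M \<rightarrow>\<^sub>M sizes \<Longrightarrow> (\<lambda>m. kk (a m) (b m)) \<in> borel_measurable M"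
  using measurable_compose[OF measurable_Pair kk_measurable'] by simp

lemma kk_le_k: "kk y y' \<le> k y y'"
proof -
  have "a / 2 \<le> a" for a :: ennreal
    by (cases a) (auto simp: divide_ennreal top_unique simp flip: ennreal_numeral)
  then show ?thesis by (auto simp: kk_def)
qed

lemma kk_eq_0: "y < \<delta> \<or> y' < \<delta> \<or> y < y' \<Longrightarrow> kk y y' = 0"
  using k_zero k_sym[of y y'] by (auto simp: kk_def)

lemma vb_nonneg: "0 \<le> vb y"
  using pos by (simp add: vb_def)

lemma vb_mono: "0 < y \<Longrightarrow> y \<le> z \<Longrightarrow> vb y \<le> vb z"
  using pos by (auto simp: vb_def intro!: mult_left_mono powr_mono2)

lemma vb_measurable [measurable (raw)]:
  assumes [measurable]: "a \<in> M \<rightarrow>\<^sub>M sizes"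
  shows "(\<lambda>m. vb (a m)) \<in> borel_measurable M"
  unfolding vb_def by measurable

lemma ee_le_1: "0 \<le> \<tau> \<Longrightarrow> ee \<tau> y \<le> 1"
  using vb_nonneg[of y] by (simp add: ee_def)

lemma ee_measurable: "(\<lambda>(\<tau>, y). ee \<tau> y) \<in> borel_measurable (borel \<Otimes>\<^sub>M sizes)"
  unfolding ee_def by measurable

lemma nice_supp: "nice \<alpha> \<Longrightarrow> emeasure (\<alpha> z) {0<..<\<delta>} = 0"
  unfolding nice_def by blast

lemma nice_null: "nice \<alpha> \<Longrightarrow> \<not> (0 < t \<and> t \<le> T) \<Longrightarrow> \<alpha> (t, x) = null_measure sizes"
  by (auto simp: nice_def)

lemma nice_bound: assumes "nice \<alpha>" obtains B where "0 \<le> B" "\<And>z. emeasure (\<alpha> z) {0<..R} \<le> ennreal B"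
proof -
  obtain B where B: "\<And>z. emeasure (\<alpha> z) {0<..R} \<le> ennreal B" using assms unfolding nice_def by blast
  have "emeasure (\<alpha> z) {0<..R} \<le> ennreal (max 0 B)" for z
    using B[of z] ennreal_leI[of B "max 0 B"] by (meson max.cobounded2 order_trans)
  then show ?thesis using that[of "max 0 B"] by simp
qed

lemma nice_lfk: assumes "nice \<alpha>" shows "locally_finite_kernel \<alpha>"
  unfolding locally_finite_kernel_def
proof (intro conjI allI)
  show mk: "measurable_kernel borel \<alpha>" using assms by (simp add: nice_def)
  fix z n
  obtain B where B: "\<And>z. emeasure (\<alpha> z) {0<..real (Suc n)} \<le> ennreal B"
    using nice_bound[OF assms, of "real (Suc n)"] by blast
  have "size_window n \<subseteq> {0<..real (Suc n)}"
    using sets.sets_into_space[OF size_window_sets, of n] unfolding space_sizes by (auto simp: size_window_def)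
  moreover have "{0<..real (Suc n)} \<in> sets (\<alpha> z)"
    using mk Ioc_sizes(1) unfolding measurable_kernel_def space_borel by blast
  ultimately have "emeasure (\<alpha> z) (size_window n) \<le> emeasure (\<alpha> z) {0<..real (Suc n)}"
    by (rule emeasure_mono)
  with B[of z] show "emeasure (\<alpha> z) (size_window n) < \<infinity>"
    by (auto simp: less_top[symmetric] top_unique)
qed

section \<open>Crude bounds for sizes at most R\<close>

lemma kk_crude:
  assumes "0 < y" "0 < y'" "y + y' \<le> R"
  shows "kk y y' \<le> ennreal (C * R powr (4/3))"
proof -
  have "y powr (2/3) * y' powr (2/3) \<le> R powr (2/3) * R powr (2/3)"
    using assms by (intro mult_mono powr_mono2) auto
  also have "\<dots> = R powr (4/3)" by (simp flip: powr_add)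
  finally have "C * (y powr (2/3) * y' powr (2/3)) \<le> C * R powr (4/3)" using pos by simp
  then show ?thesis using kk_le_k[of y y'] k_bound[OF assms(1,2)] by (meson ennreal_leI order_trans)
qed

text \<open>A sum at most \<open>R\<close> forces both partners to be at most \<open>R\<close>, so
  the mass below \<open>R\<close> satisfies a closed inequality.\<close>

lemma gain_crude:
  assumes "locally_finite_kernel \<alpha>" "locally_finite_kernel \<beta>"
  shows "emeasure (gain \<alpha> \<beta> z) {0<..R} \<le> ennreal (C * R powr (4/3)) * emeasure (\<beta> z) {0<..R} * emeasure (\<alpha> z) {0<..R}"
proof -
  note [measurable_cong] = assms[THEN lfk_sets]
  have "emeasure (gain \<alpha> \<beta> z) {0<..R} = (\<integral>\<^sup>+y. \<integral>\<^sup>+y'. indicator {0<..R} (y + y') * kk y y' \<partial>\<beta> z \<partial>\<alpha> z)"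
    using nn_integral_gain_kernel[OF assms kk_measurable', of "indicator {0<..R}"] by simp
  also have "\<dots> \<le> (\<integral>\<^sup>+y. \<integral>\<^sup>+y'. ennreal (C * R powr (4/3)) * indicator {0<..R} y * indicator {0<..R} y' \<partial>\<beta> z \<partial>\<alpha> z)"
    using kk_crude[of _ _ R] by (intro nn_integral_mono) (auto simp: assms[THEN lfk_space] split: split_indicator)
  also have "\<dots> = ennreal (C * R powr (4/3)) * emeasure (\<beta> z) {0<..R} * emeasure (\<alpha> z) {0<..R}"
    by (simp add: nn_integral_cmult nn_integral_multc ac_simps)
  finally show ?thesis .
qed

lemma gain_supp:
  assumes "locally_finite_kernel \<alpha>" "locally_finite_kernel \<beta>"
  shows "emeasure (gain \<alpha> \<beta> z) {0<..<\<delta>} = 0"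
proof -
  have "emeasure (gain \<alpha> \<beta> z) {0<..<\<delta>} = (\<integral>\<^sup>+y. \<integral>\<^sup>+y'. indicator {0<..<\<delta>} (y + y') * kk y y' \<partial>\<beta> z \<partial>\<alpha> z)"
    using nn_integral_gain_kernel[OF assms kk_measurable', of "indicator {0<..<\<delta>}"] by simp
  also have "\<dots> = (\<integral>\<^sup>+y. \<integral>\<^sup>+y'. 0 \<partial>\<beta> z \<partial>\<alpha> z)"
    by (intro nn_integral_cong) (auto simp: assms[THEN lfk_space] kk_eq_0 split: split_indicator)
  finally show ?thesis by simp
qed

lemma gain_nice:
  assumes \<alpha>: "nice \<alpha>" and \<beta>: "nice \<beta>"
  shows "nice (gain \<alpha> \<beta>)"
  unfolding nice_def
proof (intro conjI allI impI)
  note l = nice_lfk[OF \<alpha>] nice_lfk[OF \<beta>]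
  show "measurable_kernel borel (gain \<alpha> \<beta>)" by (rule gain_kernel_measurable_kernel[OF l kk_measurable'])
  show "emeasure (gain \<alpha> \<beta> z) {0<..<\<delta>} = 0" for z by (rule gain_supp[OF l])
  fix t x assume "\<not> (0 < t \<and> t \<le> T)"
  then have n: "\<alpha> (t, x) = null_measure sizes" by (rule nice_null[OF \<alpha>])
  show "gain \<alpha> \<beta> (t, x) = null_measure sizes"
  proof (rule measure_eqI)
    fix A assume "A \<in> sets (gain \<alpha> \<beta> (t, x))"
    then have A: "A \<in> sets sizes" by simp
    then show "emeasure (gain \<alpha> \<beta> (t, x)) A = emeasure (null_measure sizes) A"
      using nn_integral_gain_kernel[OF l kk_measurable' borel_measurable_indicator[OF A], of "(t, x)"] by (simp add: n)
  qed simp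
next
  fix R
  obtain B where B: "0 \<le> B" "\<And>z. emeasure (\<alpha> z) {0<..R} \<le> ennreal B" using nice_bound[OF \<alpha>] by blast
  obtain D where D: "0 \<le> D" "\<And>z. emeasure (\<beta> z) {0<..R} \<le> ennreal D" using nice_bound[OF \<beta>] by blast
  have "emeasure (gain \<alpha> \<beta> z) {0<..R} \<le> ennreal (C * R powr (4/3)) * ennreal D * ennreal B" for z
    by (rule order_trans[OF gain_crude[OF nice_lfk[OF \<alpha>] nice_lfk[OF \<beta>]]]) (intro mult_mono B D; simp)
  then show "\<exists>B. \<forall>z. emeasure (gain \<alpha> \<beta> z) {0<..R} \<le> ennreal B"
    using B(1) D(1) pos by (intro exI[of _ "C * R powr (4/3) * D * B"]) (simp add: ennreal_mult)
qed

lemma ini_lfk: "locally_finite_kernel ini"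
  by (rule lfk_comp[OF \<mu>0_lfk]) measurable

lemma one_measurable: "(\<lambda>(z, y). one z y) \<in> borel_measurable (borel \<Otimes>\<^sub>M sizes)"
  by simp

lemma ok_sources:
  assumes c: "(\<lambda>(\<tau>, y). c \<tau> y) \<in> borel_measurable (borel \<Otimes>\<^sub>M sizes)"
  shows "ok_source initial_space c one ini"
    and "nice \<alpha> \<Longrightarrow> ok_rate U \<Longrightarrow> ok_source time_space c U \<alpha>"
    and "nice \<alpha> \<Longrightarrow> nice \<beta> \<Longrightarrow> ok_source time_space c one (gain \<alpha> \<beta>)"
  using c ok_index_initial_space ok_index_time_space ini_lfk nice_lfk gain_nice one_measurable
  by (auto simp: ok_source_def ok_rate_def)

lemma nn_integral_step:
  assumes "0 < t" "t \<le> T" and f: "f \<in> borel_measurable sizes"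
  shows "(\<integral>\<^sup>+y. f y \<partial>step \<beta> U \<alpha> (t, x)) = (\<integral>\<^sup>+y. f y \<partial>evolve initial_space ee one ini t x)
     + (\<integral>\<^sup>+y. f y \<partial>evolve time_space ee U \<alpha> t x) + (\<integral>\<^sup>+y. f y \<partial>evolve time_space ee one (gain \<alpha> \<beta>) t x)"
  unfolding step_def using assms(1,2)
  by (simp, subst nn_integral_mix[OF _ _ f]) (auto simp: nn_integral_count_space_finite add.assoc)

lemma sets_step [simp, measurable_cong]: "sets (step \<beta> U \<alpha> z) = sets sizes"
  by (simp add: step_def)

lemma emeasure_step:
  assumes "0 < t" "t \<le> T" and A: "A \<in> sets sizes"
  shows "emeasure (step \<beta> U \<alpha> (t, x)) A = emeasure (evolve initial_space ee one ini t x) A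
     + emeasure (evolve time_space ee U \<alpha> t x) A + emeasure (evolve time_space ee one (gain \<alpha> \<beta>) t x) A"
  using nn_integral_step[OF assms(1,2) borel_measurable_indicator[OF A], of \<beta> U \<alpha> x] A by simp

lemma step_measurable_kernel:
  assumes "nice \<alpha>" "nice \<beta>" "ok_rate U"
  shows "measurable_kernel borel (step \<beta> U \<alpha>)"
  unfolding measurable_kernel_def
proof (intro conjI ballI)
  fix A assume A: "A \<in> sets sizes"
  note [measurable] = evolve_emeasure_measurable[OF ok_sources(1)[OF ee_measurable] A fst_borel_prod snd_borel_prod]
    evolve_emeasure_measurable[OF ok_sources(2)[OF ee_measurable assms(1,3)] A fst_borel_prod snd_borel_prod]
    evolve_emeasure_measurable[OF ok_sources(3)[OF ee_measurable assms(1,2)] A fst_borel_prod snd_borel_prod]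
  have "(\<lambda>z. emeasure (step \<beta> U \<alpha> z) A) = (\<lambda>z. if 0 < fst z \<and> fst z \<le> T then
     emeasure (evolve initial_space ee one ini (fst z) (snd z)) A
     + emeasure (evolve time_space ee U \<alpha> (fst z) (snd z)) A + emeasure (evolve time_space ee one (gain \<alpha> \<beta>) (fst z) (snd z)) A else 0)"
    using emeasure_step[OF _ _ A, of "fst z" \<beta> U \<alpha> "snd z" for z] by (auto simp: step_def)
  also have "\<dots> \<in> borel_measurable borel" by measurable
  finally show "(\<lambda>z. emeasure (step \<beta> U \<alpha> z) A) \<in> borel_measurable borel" .
qed simp

text \<open>By \<open>p_mono\<close> one heat kernel, that of the size \<open>\<delta>\<close>,
  dominates those of all sizes in [\<delta>,R] up to a constant. The evolution below
  \<open>R\<close> is thereby compared with a scalar heat flow.\<close>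

lemma p_crude:
  assumes "0 < \<tau>" "\<delta> \<le> y" "y \<le> R"
  shows "p \<tau> x' x y \<le> ennreal (R / \<delta>) * p \<tau> x' x \<delta>"
proof -
  have "ennreal \<delta> * p \<tau> x' x y \<le> ennreal R * p \<tau> x' x \<delta>"
    using p_mono[of \<tau> \<delta> y x' x] assms pos by (meson order_trans mult_right_mono ennreal_leI zero_le)
  then have "ennreal (1 / \<delta>) * (ennreal \<delta> * p \<tau> x' x y) \<le> ennreal (1 / \<delta>) * (ennreal R * p \<tau> x' x \<delta>)"
    by (rule mult_left_mono) simp
  then show ?thesis
    using pos assms by (simp add: mult.assoc[symmetric] flip: ennreal_mult)
qed

text \<open>The Duhamel integral for the single size \<open>\<delta>\<close>. Unit mass of the heat
  kernel in its first position gives the supremum bound \<open>conv_le\<close>, and unit mass in the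
  second the L1 identity \<open>conv_total\<close>.\<close>

definition conv :: "(real \<Rightarrow> 'x \<Rightarrow> ennreal) \<Rightarrow> real \<Rightarrow> 'x \<Rightarrow> ennreal" where
  "conv h t x = (\<integral>\<^sup>+s. \<integral>\<^sup>+x'. indicator {..<t} s * p (t - s) x' x \<delta> * h s x' \<partial>lborel \<partial>lborel)"

lemma conv_le:
  assumes h: "\<And>s x'. h s x' \<le> indicator {0<..} s * H s"
  shows "conv h t x \<le> (\<integral>\<^sup>+s. indicator {0<..<t} s * H s \<partial>lborel)"
  unfolding conv_def
proof (rule nn_integral_mono)
  fix s :: real
  have "(\<integral>\<^sup>+x'. indicator {..<t} s * p (t - s) x' x \<delta> * h s x' \<partial>lborel)
      \<le> (\<integral>\<^sup>+x'. (indicator {0<..<t} s * H s) * p (t - s) x' x \<delta> \<partial>lborel)"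
    using h[of s] by (intro nn_integral_mono) (auto split: split_indicator simp: mult.commute[of "p _ _ _ _"] intro!: mult_right_mono)
  also have "\<dots> = indicator {0<..<t} s * H s"
    using pos p_int_fst[of "t - s" \<delta> x] by (subst nn_integral_cmult) (auto split: split_indicator)
  finally show "(\<integral>\<^sup>+x'. indicator {..<t} s * p (t - s) x' x \<delta> * h s x' \<partial>lborel) \<le> indicator {0<..<t} s * H s" .
qed

lemma conv_total:
  assumes [measurable]: "(\<lambda>(s, x). h s x) \<in> borel_measurable (borel \<Otimes>\<^sub>M borel)"
  shows "(\<integral>\<^sup>+x. conv h t x \<partial>lborel) = (\<integral>\<^sup>+s. indicator {..<t} s * (\<integral>\<^sup>+x'. h s x' \<partial>lborel) \<partial>lborel)"
proof -
  have [measurable (raw)]: "a \<in> borel_measurable M \<Longrightarrow> b \<in> borel_measurable M \<Longrightarrow> (\<lambda>m. h (a m) (b m)) \<in> borel_measurable M"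
    for a b and M :: "'c measure"
    using measurable_compose[OF measurable_Pair assms] by simp
  have "(\<integral>\<^sup>+x. conv h t x \<partial>lborel)
    = (\<integral>\<^sup>+s. \<integral>\<^sup>+x. \<integral>\<^sup>+x'. indicator {..<t} s * p (t - s) x' x \<delta> * h s x' \<partial>lborel \<partial>lborel \<partial>lborel)"
    unfolding conv_def indicator_if
    by (intro nn_integral_swap lborel.sigma_finite_measure_axioms) measurable
  also have "\<dots> = (\<integral>\<^sup>+s. \<integral>\<^sup>+x'. \<integral>\<^sup>+x. indicator {..<t} s * p (t - s) x' x \<delta> * h s x' \<partial>lborel \<partial>lborel \<partial>lborel)"
    unfolding indicator_if
    by (intro nn_integral_cong nn_integral_swap lborel.sigma_finite_measure_axioms) measurable
  also have "\<dots> = (\<integral>\<^sup>+s. \<integral>\<^sup>+x'. indicator {..<t} s * h s x' \<partial>lborel \<partial>lborel)"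
  proof (intro nn_integral_cong)
    fix s :: real and x' :: 'x
    have "(\<integral>\<^sup>+x. indicator {..<t} s * p (t - s) x' x \<delta> * h s x' \<partial>lborel)
       = (\<integral>\<^sup>+x. (indicator {..<t} s * h s x') * p (t - s) x' x \<delta> \<partial>lborel)"
      by (intro nn_integral_cong) (simp add: ac_simps)
    also have "\<dots> = indicator {..<t} s * h s x'"
      using pos p_int_snd[of "t - s" \<delta> x'] by (subst nn_integral_cmult) (auto split: split_indicator)
    finally show "(\<integral>\<^sup>+x. indicator {..<t} s * p (t - s) x' x \<delta> * h s x' \<partial>lborel) = indicator {..<t} s * h s x'" .
  qed
  also have "\<dots> = (\<integral>\<^sup>+s. indicator {..<t} s * (\<integral>\<^sup>+x'. h s x' \<partial>lborel) \<partial>lborel)"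
    by (intro nn_integral_cong nn_integral_cmult) simp
  finally show ?thesis .
qed

lemma evolve_crude:
  assumes ok: "ok_source time_space c \<omega> \<kappa>" and supp: "\<And>z. emeasure (\<kappa> z) {0<..<\<delta>} = 0"
    and c: "\<And>\<tau> y. 0 < \<tau> \<Longrightarrow> c \<tau> y \<le> 1"
    and \<omega>: "\<And>z y. \<delta> \<le> y \<Longrightarrow> y \<le> R \<Longrightarrow> \<omega> z y \<le> ennreal D" and "0 \<le> D" "0 \<le> R"
  shows "emeasure (evolve time_space c \<omega> \<kappa> t x) {0<..R} \<le> conv (\<lambda>s x'. ennreal (R / \<delta> * D) * emeasure (\<kappa> (s, x')) {0<..R}) t x"
proof -
  note l = ok_sourceD(3)[OF ok]
  note [measurable_cong] = lfk_sets[OF l]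
  have [measurable (raw)]: "(\<lambda>m. emeasure (\<kappa> (a m, b m)) {0<..R}) \<in> borel_measurable M"
    if [measurable]: "a \<in> borel_measurable M" "b \<in> borel_measurable M" for a b and M :: "'b measure"
    by (rule lfk_emeasure_measurable[OF l]) measurable
  have "emeasure (evolve time_space c \<omega> \<kappa> t x) {0<..R} \<le> (\<integral>\<^sup>+(s, x'). indicator {..<t} s * p (t - s) x' x \<delta> *
      (ennreal (R / \<delta> * D) * emeasure (\<kappa> (s, x')) {0<..R}) \<partial>time_space)"
    unfolding emeasure_evolve[OF ok Ioc_sizes(1)]
  proof (intro nn_integral_mono, clarify)
    fix s x'
    have "(\<integral>\<^sup>+y. indicator {0<..R} y * (indicator {..<t} s * c (t - s) y * \<omega> (s, x') y * p (t - s) x' x y) \<partial>\<kappa> (s, x'))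
      \<le> (\<integral>\<^sup>+y. (indicator {..<t} s * p (t - s) x' x \<delta> * ennreal (R / \<delta> * D)) * indicator {0<..R} y \<partial>\<kappa> (s, x'))"
    proof (rule nn_integral_mono_AE)
      show "AE y in \<kappa> (s, x'). indicator {0<..R} y * (indicator {..<t} s * c (t - s) y * \<omega> (s, x') y * p (t - s) x' x y)
         \<le> (indicator {..<t} s * p (t - s) x' x \<delta> * ennreal (R / \<delta> * D)) * indicator {0<..R} y"
        using AE_size_ge[OF lfk_sets[OF l] supp]
      proof eventually_elim
        case (elim y)
        show ?case
        proof (cases "s < t \<and> y \<in> {0<..R}")
          case True
          have "c (t - s) y * \<omega> (s, x') y * p (t - s) x' x y \<le> 1 * ennreal D * (ennreal (R / \<delta>) * p (t - s) x' x \<delta>)"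
            using True elim by (intro mult_mono c \<omega> p_crude) auto
          also have "\<dots> = p (t - s) x' x \<delta> * ennreal (R / \<delta> * D)"
            using assms(5,6) pos ennreal_mult[of "R / \<delta>" D] by (simp only: ac_simps mult_1) (simp add: ac_simps)
          finally show ?thesis using True by simp
        qed (auto split: split_indicator)
      qed
    qed
    then show "(\<integral>\<^sup>+y. indicator {0<..R} y * (indicator {..<t} s * c (t - s) y * \<omega> (s, x') y * p (t - s) x' x y) \<partial>\<kappa> (s, x'))
      \<le> indicator {..<t} s * p (t - s) x' x \<delta> * (ennreal (R / \<delta> * D) * emeasure (\<kappa> (s, x')) {0<..R})"
      by (subst (asm) nn_integral_cmult) (auto simp: ac_simps)
  qed
  also have "\<dots> = conv (\<lambda>s x'. ennreal (R / \<delta> * D) * emeasure (\<kappa> (s, x')) {0<..R}) t x"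
    unfolding conv_def indicator_if by (intro nn_integral_time_space) measurable
  finally show ?thesis .
qed

lemma lfk_emeasure_pair_measurable:
  assumes "locally_finite_kernel (\<kappa> :: 'x kernel)" "A \<in> sets sizes"
  shows "(\<lambda>(s, x). emeasure (\<kappa> (s, x)) A) \<in> borel_measurable (borel \<Otimes>\<^sub>M borel)"
  using lfk_emeasure_measurable[OF assms, of "\<lambda>z. z" "borel \<Otimes>\<^sub>M borel"]
  by (simp add: borel_prod case_prod_beta')

lemma conv_add:
  assumes "(\<lambda>(s, x). h s x) \<in> borel_measurable (borel \<Otimes>\<^sub>M borel)" "(\<lambda>(s, x). h' s x) \<in> borel_measurable (borel \<Otimes>\<^sub>M borel)"
  shows "conv (\<lambda>s x. h s x + h' s x) t x = conv h t x + conv h' t x"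
proof -
  have [measurable (raw)]: "a \<in> borel_measurable M \<Longrightarrow> b \<in> borel_measurable M \<Longrightarrow> (\<lambda>m. h (a m) (b m)) \<in> borel_measurable M"
    "a \<in> borel_measurable M \<Longrightarrow> b \<in> borel_measurable M \<Longrightarrow> (\<lambda>m. h' (a m) (b m)) \<in> borel_measurable M"
    for a b and M :: "'c measure"
    using measurable_compose[OF measurable_Pair assms(1)] measurable_compose[OF measurable_Pair assms(2)] by simp_all
  have "conv (\<lambda>s x. h s x + h' s x) t x = (\<integral>\<^sup>+s. (\<integral>\<^sup>+x'. indicator {..<t} s * p (t - s) x' x \<delta> * h s x' \<partial>lborel)
      + (\<integral>\<^sup>+x'. indicator {..<t} s * p (t - s) x' x \<delta> * h' s x' \<partial>lborel) \<partial>lborel)"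
    unfolding conv_def distrib_left by (intro nn_integral_cong nn_integral_add) measurable
  also have "\<dots> = conv h t x + conv h' t x"
    unfolding conv_def indicator_if by (intro nn_integral_add) measurable
  finally show ?thesis .
qed

lemma conv_mono: "(\<And>s x. h s x \<le> h' s x) \<Longrightarrow> conv h t x \<le> conv h' t x"
  unfolding conv_def by (intro nn_integral_mono mult_left_mono) auto

lemma evolve_supp:
  assumes ok: "ok_source N c \<omega> \<kappa>" and supp: "\<And>z. emeasure (\<kappa> z) {0<..<\<delta>} = 0"
  shows "emeasure (evolve N c \<omega> \<kappa> t x) {0<..<\<delta>} = 0"
proof -
  note l = ok_sourceD(3)[OF ok]
  have "(\<integral>\<^sup>+y. indicator {0<..<\<delta>} y * (indicator {..<t} s * c (t - s) y * \<omega> (s, x') y * p (t - s) x' x y) \<partial>\<kappa> (s, x'))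
     = (\<integral>\<^sup>+y. 0 \<partial>\<kappa> (s, x'))" for s x'
    using AE_size_ge[OF lfk_sets[OF l] supp[of "(s, x')"]] by (intro nn_integral_cong_AE) (auto split: split_indicator)
  then show ?thesis
    unfolding emeasure_evolve[OF ok Ioc_sizes(2)] by (simp add: case_prod_beta')
qed

lemma nn_integral_evolve_initial:
  assumes c: "(\<lambda>(\<tau>, y). c \<tau> y) \<in> borel_measurable (borel \<Otimes>\<^sub>M sizes)" and f [measurable]: "f \<in> borel_measurable sizes"
    and t: "0 < t"
  shows "(\<integral>\<^sup>+y. f y \<partial>evolve initial_space c one ini t x) = (\<integral>\<^sup>+x'. \<integral>\<^sup>+y. f y * (c t y * p t x' x y) \<partial>\<mu>0 x' \<partial>lborel)"
proof -
  note ok = ok_sources(1)[OF c]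
  have "(\<lambda>m. \<integral>\<^sup>+y. f y * (indicator {..<t} (fst m) * c (t - fst m) y * one (fst m, snd m) y * p (t - fst m) (snd m) x y)
     \<partial>ini (fst m, snd m)) \<in> borel_measurable (borel \<Otimes>\<^sub>M borel)"
    by (rule evolve_density_measurable[OF ok]) measurable
  then show ?thesis
    unfolding nn_integral_evolve[OF ok f] using t
    by (subst nn_integral_initial_space) (simp_all add: case_prod_beta')
qed

lemma initial_phi: "0 < t \<Longrightarrow> (\<integral>\<^sup>+y. phi y \<partial>evolve initial_space ee one ini t x) \<le> ennreal g0"
  unfolding nn_integral_evolve_initial[OF ee_measurable phi_measurable]
  by (rule order_trans[OF _ \<mu>0_phi[of t x]], intro nn_integral_mono mult_left_mono)
    (use mult_right_mono[OF ee_le_1] in fastforce)+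

lemma ini_supp: "emeasure (ini z) {0<..<\<delta>} = 0"
  by (rule \<mu>0_supp)

lemma le_phi: "\<delta> \<le> y \<Longrightarrow> 1 \<le> ennreal (\<delta> powr (- (4/3))) * phi y"
  using pos unfolding phi_def
  by (subst ennreal_mult[symmetric]) (auto simp: powr_minus field_simps ennreal_ge_1 intro!: powr_mono2)

lemma initial_crude:
  assumes "0 < t"
  shows "emeasure (evolve initial_space ee one ini t x) {0<..R} \<le> ennreal (\<delta> powr (- (4/3)) * g0)"
proof -
  note ok = ok_sources(1)[OF ee_measurable]
  let ?M = "evolve initial_space ee one ini t x"
  have "emeasure ?M {0<..R} = (\<integral>\<^sup>+y. indicator {0<..R} y \<partial>?M)" by simp
  also have "\<dots> \<le> (\<integral>\<^sup>+y. ennreal (\<delta> powr (- (4/3))) * phi y \<partial>?M)"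
    by (rule nn_integral_mono_AE, rule AE_mp[OF AE_size_ge[OF sets_evolve evolve_supp[OF ok ini_supp]]], intro AE_I2)
      (auto split: split_indicator simp: le_phi)
  also have "\<dots> \<le> ennreal (\<delta> powr (- (4/3))) * ennreal g0"
    using initial_phi[OF assms] by (subst nn_integral_cmult) (auto intro!: mult_left_mono)
  finally show ?thesis using pos by (simp add: ennreal_mult)
qed

lemma evolve_initial_total:
  assumes c: "(\<lambda>(\<tau>, y). c \<tau> y) \<in> borel_measurable (borel \<Otimes>\<^sub>M sizes)" and c1: "\<And>\<tau> y. 0 < \<tau> \<Longrightarrow> c \<tau> y \<le> 1"
    and f [measurable]: "f \<in> borel_measurable sizes" and t: "0 < t"
  shows "(\<integral>\<^sup>+x. \<integral>\<^sup>+y. f y \<partial>evolve initial_space c one ini t x \<partial>lborel) \<le> (\<integral>\<^sup>+x. \<integral>\<^sup>+y. f y \<partial>\<mu>0 x \<partial>lborel)"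
proof -
  note ok = ok_sources(1)[OF c]
  note [measurable (raw)] = ok_sourceD(4)[OF ok]
  have "(\<lambda>m. \<integral>\<^sup>+y. f y * (indicator {..<t} (fst m) * c (t - fst m) y * one (fst m, snd m) y)
     \<partial>ini (fst m, snd m)) \<in> borel_measurable (borel \<Otimes>\<^sub>M borel)"
    unfolding indicator_if by (rule lfk_integral_measurable[OF ini_lfk]) measurable
  then have "(\<integral>\<^sup>+x. \<integral>\<^sup>+y. f y \<partial>evolve initial_space c one ini t x \<partial>lborel) = (\<integral>\<^sup>+x. \<integral>\<^sup>+y. f y * c t y \<partial>\<mu>0 x \<partial>lborel)"
    unfolding evolve_total[OF ok f] using t
    by (subst nn_integral_initial_space) (simp_all add: case_prod_beta')
  also have "\<dots> \<le> (\<integral>\<^sup>+x. \<integral>\<^sup>+y. f y \<partial>\<mu>0 x \<partial>lborel)"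
    using c1[OF t] by (intro nn_integral_mono) (simp add: mult_left_le)
  finally show ?thesis .
qed

lemma initial_crude_total:
  assumes "0 < t"
  shows "(\<integral>\<^sup>+x. emeasure (evolve initial_space ee one ini t x) {0<..R} \<partial>lborel) \<le> ennreal (m0 / \<delta>)"
proof -
  have "(\<integral>\<^sup>+x. emeasure (evolve initial_space ee one ini t x) {0<..R} \<partial>lborel) = (\<integral>\<^sup>+x. \<integral>\<^sup>+y. indicator {0<..R} y \<partial>evolve initial_space ee one ini t x \<partial>lborel)"
    by simp
  also have "\<dots> \<le> (\<integral>\<^sup>+x. \<integral>\<^sup>+y. indicator {0<..R} y \<partial>\<mu>0 x \<partial>lborel)"
    using assms by (intro evolve_initial_total[OF ee_measurable]) (auto simp: ee_le_1)
  also have "\<dots> \<le> (\<integral>\<^sup>+x. ennreal (1 / \<delta>) * (\<integral>\<^sup>+y. ennreal y \<partial>\<mu>0 x) \<partial>lborel)"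
  proof (intro nn_integral_mono)
    fix x
    note [measurable_cong] = lfk_sets[OF \<mu>0_lfk]
    have "(\<integral>\<^sup>+y. indicator {0<..R} y \<partial>\<mu>0 x) \<le> (\<integral>\<^sup>+y. ennreal (1 / \<delta>) * ennreal y \<partial>\<mu>0 x)"
    proof (rule nn_integral_mono_AE)
      have y1: "1 \<le> ennreal (1 / \<delta>) * ennreal y" if "\<delta> \<le> y" for y
        using that pos by (subst ennreal_mult[symmetric]) (auto simp: field_simps)
      show "AE y in \<mu>0 x. indicator {0<..R} y \<le> ennreal (1 / \<delta>) * ennreal y"
        by (rule AE_mp[OF AE_size_ge[OF lfk_sets[OF \<mu>0_lfk] \<mu>0_supp[of x]]], intro AE_I2) (auto simp: y1 split: split_indicator)
    qed
    then show "(\<integral>\<^sup>+y. indicator {0<..R} y \<partial>\<mu>0 x) \<le> ennreal (1 / \<delta>) * (\<integral>\<^sup>+y. ennreal y \<partial>\<mu>0 x)"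
      by (subst (asm) nn_integral_cmult) auto
  qed
  also have "\<dots> = ennreal (1 / \<delta>) * (\<integral>\<^sup>+x. \<integral>\<^sup>+y. ennreal y \<partial>\<mu>0 x \<partial>lborel)"
    using lfk_integral_measurable[OF \<mu>0_lfk, of "\<lambda>x. x" borel "\<lambda>x y. ennreal y"] by (intro nn_integral_cmult) auto
  also have "\<dots> \<le> ennreal (1 / \<delta>) * ennreal m0" by (intro mult_left_mono \<mu>0_mass) simp
  finally show ?thesis using pos by (simp flip: ennreal_mult)
qed

lemma step_crude:
  assumes \<alpha>: "nice \<alpha>" and \<beta>: "nice \<beta>" and U: "ok_rate U" and B: "0 \<le> B" "\<And>z. emeasure (\<beta> z) {0<..R} \<le> ennreal B"
    and t: "0 < t" "t \<le> T" and R: "0 \<le> R"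
  defines "c \<equiv> R / \<delta> * (vb R + C * R powr (4/3) * B)"
  shows "emeasure (step \<beta> U \<alpha> (t, x)) {0<..R} \<le> emeasure (evolve initial_space ee one ini t x) {0<..R} +
    conv (\<lambda>s x'. ennreal c * emeasure (\<alpha> (s, x')) {0<..R}) t x"
proof -
  note [measurable] = lfk_emeasure_pair_measurable[OF nice_lfk[OF \<alpha>] Ioc_sizes(1)]
  let ?a = "\<lambda>s x'. emeasure (\<alpha> (s, x')) {0<..R}"
  have m: "(\<lambda>(s, x'). ennreal e * ?a s x') \<in> borel_measurable (borel \<Otimes>\<^sub>M borel)" for e
    using lfk_emeasure_pair_measurable[OF nice_lfk[OF \<alpha>] Ioc_sizes(1)] by (simp add: case_prod_beta')
  have 1: "emeasure (evolve time_space ee U \<alpha> t x) {0<..R} \<le> conv (\<lambda>s x'. ennreal (R / \<delta> * vb R) * ?a s x') t x"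
  proof (rule evolve_crude[OF ok_sources(2)[OF ee_measurable \<alpha> U] nice_supp[OF \<alpha>] _ _ vb_nonneg R])
    fix z y assume "\<delta> \<le> y" "y \<le> R"
    then show "U z y \<le> ennreal (vb R)"
      using U vb_mono[of y R] pos unfolding ok_rate_def by (meson ennreal_leI less_le_trans order_trans)
  qed (simp add: ee_le_1)
  have "emeasure (evolve time_space ee one (gain \<alpha> \<beta>) t x) {0<..R} \<le> conv (\<lambda>s x'. ennreal (R / \<delta> * 1) * emeasure (gain \<alpha> \<beta> (s, x')) {0<..R}) t x"
    by (rule evolve_crude[OF ok_sources(3)[OF ee_measurable \<alpha> \<beta>] gain_supp[OF nice_lfk[OF \<alpha>] nice_lfk[OF \<beta>]] _ _ _ R])
      (auto simp: ee_le_1)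
  also have "\<dots> \<le> conv (\<lambda>s x'. ennreal (R / \<delta> * (C * R powr (4/3) * B)) * ?a s x') t x"
  proof (rule conv_mono)
    fix s x'
    have "emeasure (gain \<alpha> \<beta> (s, x')) {0<..R} \<le> ennreal (C * R powr (4/3)) * ennreal B * ?a s x'"
      by (rule order_trans[OF gain_crude[OF nice_lfk[OF \<alpha>] nice_lfk[OF \<beta>]]]) (intro mult_mono B; simp)
    then have "ennreal (R / \<delta>) * emeasure (gain \<alpha> \<beta> (s, x')) {0<..R} \<le> ennreal (R / \<delta>) * (ennreal (C * R powr (4/3)) * ennreal B * ?a s x')"
      by (rule mult_left_mono) simp
    also have "\<dots> = ennreal (R / \<delta> * (C * R powr (4/3) * B)) * ?a s x'"
    proof -
      have "ennreal (R / \<delta> * (C * R powr (4/3) * B)) = ennreal (R / \<delta>) * (ennreal (C * R powr (4/3)) * ennreal B)"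
      proof -
        have "ennreal (C * R powr (4/3) * B) = ennreal (C * R powr (4/3)) * ennreal B"
          using B by (intro ennreal_mult'') simp
        moreover have "ennreal (R / \<delta> * (C * R powr (4/3) * B)) = ennreal (R / \<delta>) * ennreal (C * R powr (4/3) * B)"
          using B pos by (intro ennreal_mult'') simp
        ultimately show ?thesis by simp
      qed
      then show ?thesis by (simp add: mult.assoc)
    qed
    finally show "ennreal (R / \<delta> * 1) * emeasure (gain \<alpha> \<beta> (s, x')) {0<..R} \<le> ennreal (R / \<delta> * (C * R powr (4/3) * B)) * ?a s x'" by simp
  qed
  finally have 2: "emeasure (evolve time_space ee one (gain \<alpha> \<beta>) t x) {0<..R} \<le> conv (\<lambda>s x'. ennreal (R / \<delta> * (C * R powr (4/3) * B)) * ?a s x') t x" .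
  have "conv (\<lambda>s x'. ennreal c * ?a s x') t x = conv (\<lambda>s x'. ennreal (R / \<delta> * vb R) * ?a s x') t x + conv (\<lambda>s x'. ennreal (R / \<delta> * (C * R powr (4/3) * B)) * ?a s x') t x"
  proof -
    have "ennreal c = ennreal (R / \<delta> * vb R) + ennreal (R / \<delta> * (C * R powr (4/3) * B))"
    proof -
      have "0 \<le> R / \<delta> * vb R" "0 \<le> R / \<delta> * (C * R powr (4/3) * B)"
        using B(1) pos R vb_nonneg[of R] by simp_all
      then show ?thesis unfolding c_def distrib_left by (rule ennreal_plus)
    qed
    then show ?thesis by (simp add: distrib_right conv_add[OF m m])
  qed
  with 1 2 show ?thesis
    unfolding emeasure_step[OF t Ioc_sizes(1)] by (simp add: add.assoc add_mono)
qed

section \<open>Iteration of the damped linear problem\<close>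

primrec iter :: "'x kernel \<Rightarrow> 'x rate \<Rightarrow> nat \<Rightarrow> 'x kernel" where
  "iter \<beta> U 0 = (\<lambda>_. null_measure sizes)"
| "iter \<beta> U (Suc n) = step \<beta> U (iter \<beta> U n)"

lemma null_nice: "nice (\<lambda>_. null_measure sizes)"
  by (auto simp: nice_def measurable_kernel_def)

lemma step_supp:
  assumes "nice \<alpha>" "nice \<beta>" "ok_rate U"
  shows "emeasure (step \<beta> U \<alpha> z) {0<..<\<delta>} = 0"
proof (cases "0 < fst z \<and> fst z \<le> T")
  case True
  then show ?thesis
    using emeasure_step[of "fst z" "{0<..<\<delta>}" \<beta> U \<alpha> "snd z"]
      evolve_supp[OF ok_sources(1)[OF ee_measurable] ini_supp]
      evolve_supp[OF ok_sources(2)[OF ee_measurable assms(1,3)] nice_supp[OF assms(1)]]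
      evolve_supp[OF ok_sources(3)[OF ee_measurable assms(1,2)] nice_supp[OF gain_nice[OF assms(1,2)]]] by simp
qed (auto simp: step_def)

text \<open>Gronwall by induction on \<open>n\<close>. The exponential bounds are reproduced exactly
  by the integral inequality of \<open>step_crude\<close> and so are uniform in \<open>n\<close>.
  The rate \<open>c R\<close> has to depend on \<open>R\<close>, because \<open>vb\<close> and the
  coagulation kernel are unbounded. The L1 version later makes truncated masses finite.\<close>

lemma iter_bound:
  assumes \<beta>: "nice \<beta>" and U: "ok_rate U"
  obtains c :: "real \<Rightarrow> real" where "\<And>R. 0 \<le> c R"
    and "\<And>n. nice (iter \<beta> U n)"
    and "\<And>n R t x. 0 < t \<Longrightarrow> emeasure (iter \<beta> U n (t, x)) {0<..R} \<le> ennreal (\<delta> powr (- (4/3)) * g0 * exp (c R * t))"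
    and "\<And>n R t. 0 < t \<Longrightarrow> (\<integral>\<^sup>+x. emeasure (iter \<beta> U n (t, x)) {0<..R} \<partial>lborel) \<le> ennreal (m0 / \<delta> * exp (c R * t))"
proof -
  obtain B where B: "\<And>R. 0 \<le> B R" "\<And>R z. emeasure (\<beta> z) {0<..R} \<le> ennreal (B R)"
  proof -
    have "\<exists>B. 0 \<le> B \<and> (\<forall>z. emeasure (\<beta> z) {0<..R} \<le> ennreal B)" for R
      by (rule nice_bound[OF \<beta>, of R]) blast
    then show ?thesis using that by metis
  qed
  \<comment> \<open>For negative \<open>R\<close> the interval is empty and any nonnegative rate
    will do.\<close>
  define c where "c R = (if R < 0 then 0 else R / \<delta> * (vb R + C * R powr (4/3) * B R))" for R
  have c0: "0 \<le> c R" for R using pos B vb_nonneg unfolding c_def by auto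
  let ?A = "\<delta> powr (- (4/3)) * g0" and ?M = "m0 / \<delta>"
  have A0: "0 \<le> ?A" "0 \<le> ?M" using pos by auto
  have main: "nice (iter \<beta> U n) \<and> (\<forall>R t x. 0 < t \<longrightarrow> emeasure (iter \<beta> U n (t, x)) {0<..R} \<le> ennreal (?A * exp (c R * t)))
    \<and> (\<forall>R t. 0 < t \<longrightarrow> (\<integral>\<^sup>+x. emeasure (iter \<beta> U n (t, x)) {0<..R} \<partial>lborel) \<le> ennreal (?M * exp (c R * t)))" for n
  proof (induction n)
    case 0
    show ?case using null_nice by simp
  next
    case (Suc n)
    let ?\<alpha> = "iter \<beta> U n"
    have n: "nice ?\<alpha>" using Suc by simp
    note [measurable] = lfk_emeasure_pair_measurable[OF nice_lfk[OF n] Ioc_sizes(1)]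
    have 1: "emeasure (step \<beta> U ?\<alpha> (t, x)) {0<..R} \<le> ennreal (?A * exp (c R * t))" if t: "0 < t" for R t x
    proof (cases "R < 0 \<or> T < t")
      case False
      have h: "ennreal (c R) * emeasure (?\<alpha> (s, x')) {0<..R} \<le> indicator {0<..} s * ennreal (c R * (?A * exp (c R * s)))" for s x'
      proof (cases "0 < s")
        case True
        then have "emeasure (?\<alpha> (s, x')) {0<..R} \<le> ennreal (?A * exp (c R * s))" using Suc by blast
        then show ?thesis using True c0[of R] A0 by (simp add: ennreal_mult mult_left_mono)
      qed (simp add: nice_null[OF n])
      have "emeasure (step \<beta> U ?\<alpha> (t, x)) {0<..R} \<le> ennreal ?A + conv (\<lambda>s x'. ennreal (c R) * emeasure (?\<alpha> (s, x')) {0<..R}) t x"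
        using step_crude[OF n \<beta> U B(1)[of R] B(2)[of _ R] t, of x] initial_crude[OF t, of x R] False
        by (auto simp: c_def intro: order_trans add_right_mono)
      also have "\<dots> \<le> ennreal ?A + ennreal (?A * exp (c R * t) - ?A)"
        by (intro add_left_mono order_trans[OF conv_le[OF h]] exp_integral c0 A0) (use t in auto)
      also have "\<dots> = ennreal (?A * exp (c R * t))"
        using A0 c0[of R] t by (subst ennreal_plus[symmetric]) (auto intro!: mult_left_le_one_le simp: mult_le_cancel_left1)
      finally show ?thesis .
    qed (use t in \<open>auto simp: step_def\<close>)
    have 2: "(\<integral>\<^sup>+x. emeasure (step \<beta> U ?\<alpha> (t, x)) {0<..R} \<partial>lborel) \<le> ennreal (?M * exp (c R * t))" if t: "0 < t" for R t
    proof (cases "R < 0 \<or> T < t")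
      case False
      have mh: "(\<lambda>(s, x'). ennreal (c R) * emeasure (?\<alpha> (s, x')) {0<..R}) \<in> borel_measurable (borel \<Otimes>\<^sub>M borel)"
        using lfk_emeasure_pair_measurable[OF nice_lfk[OF n] Ioc_sizes(1)] by (simp add: case_prod_beta')
      have h: "(\<integral>\<^sup>+x'. ennreal (c R) * emeasure (?\<alpha> (s, x')) {0<..R} \<partial>lborel) \<le> indicator {0<..} s * ennreal (c R * (?M * exp (c R * s)))" for s
      proof (cases "0 < s")
        case True
        have [measurable]: "(\<lambda>x'. emeasure (?\<alpha> (s, x')) {0<..R}) \<in> borel_measurable borel"
          by (rule lfk_emeasure_measurable[OF nice_lfk[OF n] Ioc_sizes(1)]) measurable
        have "(\<integral>\<^sup>+x'. emeasure (?\<alpha> (s, x')) {0<..R} \<partial>lborel) \<le> ennreal (?M * exp (c R * s))" using Suc True by blast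
        then have "ennreal (c R) * (\<integral>\<^sup>+x'. emeasure (?\<alpha> (s, x')) {0<..R} \<partial>lborel) \<le> ennreal (c R) * ennreal (?M * exp (c R * s))"
          by (rule mult_left_mono) simp
        also have "\<dots> = ennreal (c R * (?M * exp (c R * s)))" by (rule ennreal_mult'[OF c0, symmetric])
        finally show ?thesis using True by (simp add: nn_integral_cmult)
      qed (simp add: nice_null[OF n])
      have "(\<integral>\<^sup>+x. emeasure (step \<beta> U ?\<alpha> (t, x)) {0<..R} \<partial>lborel) \<le>
        (\<integral>\<^sup>+x. emeasure (evolve initial_space ee one ini t x) {0<..R} + conv (\<lambda>s x'. ennreal (c R) * emeasure (?\<alpha> (s, x')) {0<..R}) t x \<partial>lborel)"
        using step_crude[OF n \<beta> U B(1)[of R] B(2)[of _ R] t] False by (intro nn_integral_mono) (auto simp: c_def)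
      also have "\<dots> = (\<integral>\<^sup>+x. emeasure (evolve initial_space ee one ini t x) {0<..R} \<partial>lborel) + (\<integral>\<^sup>+x. conv (\<lambda>s x'. ennreal (c R) * emeasure (?\<alpha> (s, x')) {0<..R}) t x \<partial>lborel)"
      proof (rule nn_integral_add)
        show "(\<lambda>x. emeasure (evolve initial_space ee one ini t x) {0<..R}) \<in> borel_measurable lborel"
          by (simp, rule evolve_emeasure_measurable[OF ok_sources(1)[OF ee_measurable]]) auto
              have [measurable (raw)]: "(\<lambda>m. emeasure (?\<alpha> (a m, b m)) {0<..R}) \<in> borel_measurable M"
          if [measurable]: "a \<in> borel_measurable M" "b \<in> borel_measurable M" for a b and M :: "'b measure"
          by (rule lfk_emeasure_measurable[OF nice_lfk[OF n]]) measurable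
        show "(\<lambda>x. conv (\<lambda>s x'. ennreal (c R) * emeasure (?\<alpha> (s, x')) {0<..R}) t x) \<in> borel_measurable lborel"
          unfolding conv_def indicator_if by measurable
      qed
      also have "\<dots> \<le> ennreal ?M + (\<integral>\<^sup>+s. indicator {..<t} s * (indicator {0<..} s * ennreal (c R * (?M * exp (c R * s)))) \<partial>lborel)"
        unfolding conv_total[OF mh] by (intro add_mono initial_crude_total[OF t] nn_integral_mono mult_left_mono h) auto
      also have "(\<integral>\<^sup>+s. indicator {..<t} s * (indicator {0<..} s * ennreal (c R * (?M * exp (c R * s)))) \<partial>lborel)
        = (\<integral>\<^sup>+s. indicator {0<..<t} s * ennreal (c R * (?M * exp (c R * s))) \<partial>lborel)"
        by (intro nn_integral_cong) (simp split: split_indicator)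
      also have "ennreal ?M + \<dots> \<le> ennreal ?M + ennreal (?M * exp (c R * t) - ?M)"
        by (intro add_left_mono exp_integral c0 A0) (use t in auto)
      also have "\<dots> = ennreal (?M * exp (c R * t))"
      proof -
        have "?M \<le> ?M * exp (c R * t)"
          using mult_left_mono[of 1 "exp (c R * t)" ?M] A0 c0[of R] t by simp
        then show ?thesis using A0 by (subst ennreal_plus[symmetric]) auto
      qed
      finally show ?thesis .
    qed (use t in \<open>auto simp: step_def\<close>)
    have "nice (step \<beta> U ?\<alpha>)"
      unfolding nice_def
    proof (intro conjI allI impI)
      show "\<exists>B. \<forall>z. emeasure (step \<beta> U ?\<alpha> z) {0<..R} \<le> ennreal B" for R
      proof (intro exI allI)
        fix z
        show "emeasure (step \<beta> U ?\<alpha> z) {0<..R} \<le> ennreal (?A * exp (c R * T))"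
        proof (cases "0 < fst z \<and> fst z \<le> T")
          case True
          then have "emeasure (step \<beta> U ?\<alpha> z) {0<..R} \<le> ennreal (?A * exp (c R * fst z))"
            using 1[of "fst z" "snd z" R] by simp
          also have "\<dots> \<le> ennreal (?A * exp (c R * T))"
            using True A0 c0[of R] by (intro ennreal_leI mult_left_mono) (auto intro!: mult_left_mono)
          finally show ?thesis .
        qed (auto simp: step_def)
      qed
      show "step \<beta> U ?\<alpha> (t, x) = null_measure sizes" if "\<not> (0 < t \<and> t \<le> T)" for t x
        using that by (auto simp: step_def)
    qed (rule step_supp[OF n \<beta> U] step_measurable_kernel[OF n \<beta> U])+
    with 1 2 show ?case by simp
  qed
  show ?thesis by (rule that[of c]) (use main c0 in blast)+
qed

end

section \<open>Damped and undamped equations\<close>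

text \<open>The equations below are obtained by cancelling a term, which has to be finite. It is
  finite for bounded \<open>f\<close> supported in (0,n], and truncating a general \<open>f\<close>
  to min(f,n) on (0,n] extends the result by monotone convergence.\<close>

lemma eq_extend:
  assumes s: "sets M1 = sets sizes" "sets M2 = sets sizes" "sets M3 = sets sizes" "sets M4 = sets sizes"
    and eq: "\<And>n f. f \<in> borel_measurable sizes \<Longrightarrow> (\<And>y. f y \<le> of_nat n * indicator {0<..real n} y) \<Longrightarrow>
      (\<integral>\<^sup>+y. f y \<partial>M1) + (\<integral>\<^sup>+y. f y \<partial>M2) = (\<integral>\<^sup>+y. f y \<partial>M3) + (\<integral>\<^sup>+y. f y \<partial>M4)"
    and f: "f \<in> borel_measurable sizes"
  shows "(\<integral>\<^sup>+y. f y \<partial>M1) + (\<integral>\<^sup>+y. f y \<partial>M2) = (\<integral>\<^sup>+y. f y \<partial>M3) + (\<integral>\<^sup>+y. f y \<partial>M4)"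
proof -
  define F where "F n y = min (f y) (of_nat n) * indicator {0<..real n} y" for n :: nat and y
  note [measurable] = f
  have [measurable]: "F n \<in> borel_measurable sizes" for n unfolding F_def by measurable
  have le: "F n y \<le> of_nat n * indicator {0<..real n} y" for n y
    unfolding F_def by (intro mult_right_mono) auto
  have inc: "F m y \<le> F n y" if "m \<le> n" for m n y
  proof (cases "y \<in> {0<..real m}")
    case True
    have "min (f y) (of_nat m) \<le> min (f y) (of_nat n)" using that by (intro min.mono of_nat_mono) auto
    with True that show ?thesis by (simp add: F_def)
  qed (simp add: F_def)
  have sup: "(SUP n. F n y) = f y" if "y > 0" for y
  proof (rule antisym)
    show "(SUP n. F n y) \<le> f y" by (rule SUP_least) (auto simp: F_def split: split_indicator)
    obtain N :: nat where N: "y \<le> real N" using real_arch_simple by blast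
    have "f y = (SUP n::nat. min (f y) (of_nat n))"
    proof -
      have "(SUP n::nat. min (f y) (of_nat n)) = min (f y) (SUP n::nat. of_nat n)"
        by (simp add: inf_min[symmetric] inf_SUP)
      then show ?thesis by (simp add: ennreal_SUP_of_nat_eq_top)
    qed
    also have "\<dots> \<le> (SUP n. F n y)"
    proof (rule SUP_mono)
      fix n :: nat
      have "min (f y) (of_nat n) \<le> F (max n N) y"
        using N that by (auto simp: F_def intro: min.mono of_nat_mono min.coboundedI2 split: split_indicator)
      then show "\<exists>m\<in>UNIV. min (f y) (of_nat n) \<le> F m y" by blast
    qed
    finally show "f y \<le> (SUP n. F n y)" .
  qed
  have lim: "(\<integral>\<^sup>+y. f y \<partial>M) = (SUP n. \<integral>\<^sup>+y. F n y \<partial>M)" and incM: "incseq (\<lambda>n. \<integral>\<^sup>+y. F n y \<partial>M)" if sM: "sets M = sets sizes" for M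
  proof -
    have [measurable_cong]: "sets M = sets sizes" by (rule sM)
    have "(\<integral>\<^sup>+y. f y \<partial>M) = (\<integral>\<^sup>+y. (SUP n. F n y) \<partial>M)"
      using sup by (intro nn_integral_cong) (simp add: sets_eq_imp_space_eq[OF sM] space_sizes)
    also have "\<dots> = (SUP n. \<integral>\<^sup>+y. F n y \<partial>M)"
      using inc by (intro nn_integral_monotone_convergence_SUP) (auto simp: incseq_def le_fun_def)
    finally show "(\<integral>\<^sup>+y. f y \<partial>M) = (SUP n. \<integral>\<^sup>+y. F n y \<partial>M)" .
    show "incseq (\<lambda>n. \<integral>\<^sup>+y. F n y \<partial>M)" using inc by (auto simp: incseq_def intro!: nn_integral_mono)
  qed
  show ?thesis
    unfolding lim[OF s(1)] lim[OF s(2)] lim[OF s(3)] lim[OF s(4)]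
      ennreal_SUP_add[OF incM[OF s(1)] incM[OF s(2)], symmetric] ennreal_SUP_add[OF incM[OF s(3)] incM[OF s(4)], symmetric]
    by (intro SUP_cong refl, rule eq[OF _ le]) measurable
qed

context heat
begin

lemma nn_integral_evolve_add:
  assumes ok: "ok_source N c \<omega> \<kappa>" and ok1: "ok_source N c1 \<omega>1 \<kappa>" and ok2: "ok_source N c2 \<omega>2 \<kappa>"
    and f: "f \<in> borel_measurable sizes"
    and eq: "\<And>\<tau> z y. 0 < \<tau> \<Longrightarrow> 0 < y \<Longrightarrow> c \<tau> y * \<omega> z y = c1 \<tau> y * \<omega>1 z y + c2 \<tau> y * \<omega>2 z y"
  shows "(\<integral>\<^sup>+y. f y \<partial>evolve N c \<omega> \<kappa> t x) = (\<integral>\<^sup>+y. f y \<partial>evolve N c1 \<omega>1 \<kappa> t x) + (\<integral>\<^sup>+y. f y \<partial>evolve N c2 \<omega>2 \<kappa> t x)"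
proof -
  note l = ok_sourceD(3)[OF ok]
  note [measurable (raw)] = ok_sourceD(4,5)[OF ok1] ok_sourceD(4,5)[OF ok2]
  note [measurable_cong] = ok_sourceD(1)[OF ok] lfk_sets[OF l]
  note [measurable] = f
  let ?g = "\<lambda>c \<omega> z y. f y * (indicator {..<t} (fst z) * c (t - fst z) y * \<omega> (fst z, snd z) y * p (t - fst z) (snd z) x y)"
  have 1: "?g c \<omega> z y = ?g c1 \<omega>1 z y + ?g c2 \<omega>2 z y" if "0 < y" for z y
  proof (cases "fst z < t")
    case True
    then have "?g c \<omega> z y = f y * p (t - fst z) (snd z) x y * (c (t - fst z) y * \<omega> (fst z, snd z) y)"
      by (simp add: ac_simps)
    also have "\<dots> = f y * p (t - fst z) (snd z) x y * (c1 (t - fst z) y * \<omega>1 (fst z, snd z) y + c2 (t - fst z) y * \<omega>2 (fst z, snd z) y)"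
      using True that by (subst eq) auto
    also have "\<dots> = ?g c1 \<omega>1 z y + ?g c2 \<omega>2 z y" using True by (simp add: distrib_left ac_simps)
    finally show ?thesis .
  qed simp
  have "(\<integral>\<^sup>+y. f y \<partial>evolve N c \<omega> \<kappa> t x) = (\<integral>\<^sup>+z. \<integral>\<^sup>+y. ?g c1 \<omega>1 z y + ?g c2 \<omega>2 z y \<partial>\<kappa> (fst z, snd z) \<partial>N)"
    unfolding nn_integral_evolve[OF ok f] case_prod_beta'
    by (intro nn_integral_cong 1) (simp add: lfk_space[OF l])
  also have "\<dots> = (\<integral>\<^sup>+z. (\<integral>\<^sup>+y. ?g c1 \<omega>1 z y \<partial>\<kappa> (fst z, snd z)) + (\<integral>\<^sup>+y. ?g c2 \<omega>2 z y \<partial>\<kappa> (fst z, snd z)) \<partial>N)"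
    by (intro nn_integral_cong nn_integral_add) measurable
  also have "\<dots> = (\<integral>\<^sup>+z. (\<integral>\<^sup>+y. ?g c1 \<omega>1 z y \<partial>\<kappa> (fst z, snd z)) \<partial>N) + (\<integral>\<^sup>+z. (\<integral>\<^sup>+y. ?g c2 \<omega>2 z y \<partial>\<kappa> (fst z, snd z)) \<partial>N)"
    by (intro nn_integral_add evolve_density_measurable[OF ok1] evolve_density_measurable[OF ok2]) measurable
  finally show ?thesis
    by (simp add: nn_integral_evolve[OF ok1 f] nn_integral_evolve[OF ok2 f] case_prod_beta')
qed

lemma nn_integral_evolve_cong:
  assumes ok: "ok_source N c \<omega> \<kappa>" and ok': "ok_source N c' \<omega>' \<kappa>"
    and f: "f \<in> borel_measurable sizes"
    and eq: "\<And>\<tau> z y. 0 < \<tau> \<Longrightarrow> 0 < y \<Longrightarrow> c \<tau> y * \<omega> z y = c' \<tau> y * \<omega>' z y"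
  shows "(\<integral>\<^sup>+y. f y \<partial>evolve N c \<omega> \<kappa> t x) = (\<integral>\<^sup>+y. f y \<partial>evolve N c' \<omega>' \<kappa> t x)"
proof -
  have "indicator {..<t} s * c (t - s) y * \<omega> z y * q = indicator {..<t} s * c' (t - s) y * \<omega>' z y * q" if "0 < y" for s y z q
    using eq[of "t - s" y z] that by (cases "s < t") (auto simp: mult.assoc)
  then show ?thesis
    unfolding nn_integral_evolve[OF ok f] nn_integral_evolve[OF ok' f]
    by (intro nn_integral_cong) (auto simp: lfk_space[OF ok_sourceD(3)[OF ok]] intro!: nn_integral_cong)
qed

lemma evolve_time_measurable:
  assumes ok: "ok_source N c \<omega> \<kappa>" and f [measurable]: "f \<in> borel_measurable sizes"
    and g: "(\<lambda>(\<tau>, y). g \<tau> y) \<in> borel_measurable (borel \<Otimes>\<^sub>M sizes)"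
  shows "(\<lambda>z. \<integral>\<^sup>+y. f y * (indicator {..<t} (fst z) * g (t - fst z) y * p (t - fst z) (snd z) x y) \<partial>evolve N c \<omega> \<kappa> (fst z) (snd z))
    \<in> borel_measurable (borel \<Otimes>\<^sub>M borel)"
proof -
  interpret N: sigma_finite_measure N by (rule ok_sourceD(2)[OF ok])
  note [measurable_cong] = ok_sourceD(1)[OF ok] lfk_sets[OF ok_sourceD(3)[OF ok]]
  note [measurable (raw)] = ok_sourceD(4,5)[OF ok]
  have [measurable (raw)]: "a \<in> borel_measurable M \<Longrightarrow> h \<in> M \<rightarrow>\<^sub>M sizes \<Longrightarrow> (\<lambda>m. g (a m) (h m)) \<in> borel_measurable M"
    for a h and M :: "'b measure"
    using measurable_compose[OF measurable_Pair g] by simp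
  let ?q = "\<lambda>u x' y. f y * (indicator {..<t} u * g (t - u) y * p (t - u) x' x y)"
  have q1: "?q u x' \<in> borel_measurable sizes" for u x' by measurable
  have inner: "(\<integral>\<^sup>+y. ?q u x' y \<partial>evolve N c \<omega> \<kappa> u x') =
      (\<integral>\<^sup>+z. \<integral>\<^sup>+y. ?q u x' y * (indicator {..<u} (fst z) * c (u - fst z) y * \<omega> (fst z, snd z) y * p (u - fst z) (snd z) x' y) \<partial>\<kappa> (fst z, snd z) \<partial>N)" for u x'
    by (simp add: nn_integral_evolve[OF ok q1] case_prod_beta')
  have "(\<lambda>m. \<integral>\<^sup>+y. ?q (fst (fst m)) (snd (fst m)) y *
      (indicator {..<fst (fst m)} (fst (snd m)) * c (fst (fst m) - fst (snd m)) y * \<omega> (fst (snd m), snd (snd m)) y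
        * p (fst (fst m) - fst (snd m)) (snd (snd m)) (snd (fst m)) y)
      \<partial>\<kappa> (fst (snd m), snd (snd m))) \<in> borel_measurable ((borel \<Otimes>\<^sub>M borel) \<Otimes>\<^sub>M N)"
    unfolding indicator_if[where t=t] by (rule evolve_density_measurable[OF ok]) measurable
  then show ?thesis
    unfolding inner by (intro N.borel_measurable_nn_integral) (simp add: case_prod_beta')
qed

end

context coag
begin

section \<open>Complementary damping factors\<close>

definition res :: "'x rate \<Rightarrow> 'x rate" where
  "res W z y = ennreal (vb y) - W z y"

definition uno :: "real \<Rightarrow> real \<Rightarrow> ennreal" where "uno \<tau> y = 1"

text \<open>The probability that an exponential clock of rate \<open>vb y\<close> rings before the
  age \<open>\<tau>\<close>, complementary to the survival factor \<open>ee\<close>. It is also the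
  convolution of \<open>ee\<close> with the constant \<open>vb y\<close>, in either order.\<close>

definition ff :: "real \<Rightarrow> real \<Rightarrow> ennreal" where
  "ff \<tau> y = ennreal (1 - exp (- (vb y * \<tau>)))"

definition vbr :: "'x rate" where "vbr z y = ennreal (vb y)"

lemma uno_measurable: "(\<lambda>(\<tau>, y). uno \<tau> y) \<in> borel_measurable (borel \<Otimes>\<^sub>M sizes)"
  unfolding uno_def by measurable

lemma ff_measurable: "(\<lambda>(\<tau>, y). ff \<tau> y) \<in> borel_measurable (borel \<Otimes>\<^sub>M sizes)"
  unfolding ff_def by measurable

lemma vbr_rate: "ok_rate vbr"
  by (auto simp: ok_rate_def vbr_def)

lemma res_rate:
  assumes "ok_rate W" shows "ok_rate (res W)"
proof -
  have [measurable]: "(\<lambda>z. W (fst z) (snd z)) \<in> borel_measurable (borel \<Otimes>\<^sub>M sizes)"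
    using assms by (simp add: ok_rate_def case_prod_beta')
  have "(\<lambda>z. res W (fst z) (snd z)) \<in> borel_measurable (borel \<Otimes>\<^sub>M sizes)"
    unfolding res_def by measurable
  then show ?thesis by (simp add: ok_rate_def case_prod_beta' res_def diff_le_self_ennreal)
qed

lemma res_add: "ok_rate W \<Longrightarrow> 0 < y \<Longrightarrow> res W z y + W z y = vbr z y"
  by (cases z) (auto simp: ok_rate_def res_def vbr_def diff_add_cancel_ennreal)

lemma ee_ff: "0 < \<tau> \<Longrightarrow> ee \<tau> y + ff \<tau> y = 1"
  using vb_nonneg[of y] unfolding ee_def ff_def by (subst ennreal_plus[symmetric]) auto

lemma ff_integral:
  assumes "0 < \<tau>"
  shows "(\<integral>\<^sup>+v. indicator {0<..<\<tau>} v * vbr z y * ee v y \<partial>lborel) = ff \<tau> y"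
proof -
  have "(\<integral>\<^sup>+v. indicator {0<..<\<tau>} v * vbr z y * ee v y \<partial>lborel)
      = (\<integral>\<^sup>+v. ennreal (vb y * exp (- (vb y * v))) * indicator {0..\<tau>} v \<partial>lborel)"
  proof (rule nn_integral_cong_AE)
    have "AE v in lborel. v \<noteq> (0::real)" "AE v in lborel. v \<noteq> \<tau>" by (simp_all add: AE_lborel_singleton)
    then show "AE v in lborel. indicator {0<..<\<tau>} v * vbr z y * ee v y = ennreal (vb y * exp (- (vb y * v))) * indicator {0..\<tau>} v"
      by eventually_elim (auto simp: vbr_def ee_def ennreal_mult vb_nonneg split: split_indicator)
  qed
  also have "\<dots> = ennreal ((- exp (- (vb y * \<tau>))) - (- exp (- (vb y * 0))))"
    using assms vb_nonneg[of y]
    by (intro nn_integral_FTC_Icc) (auto intro!: derivative_eq_intros)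
  finally show ?thesis by (simp add: ff_def)
qed

lemma ff_integral':
  assumes "0 < \<tau>"
  shows "(\<integral>\<^sup>+v. indicator {0<..<\<tau>} v * (vbr z y * ee (\<tau> - v) y) * uno v y \<partial>lborel) = ff \<tau> y"
proof -
  let ?h = "\<lambda>v. indicator {0<..<\<tau>} v * vbr z y * ee v y"
  have [measurable]: "?h \<in> borel_measurable borel" unfolding vbr_def ee_def by measurable
  have "(\<integral>\<^sup>+v. ?h v \<partial>lborel) = (\<integral>\<^sup>+v. ?h (\<tau> - v) \<partial>lborel)"
    using nn_integral_real_affine[of ?h "-1" \<tau>] by simp
  also have "\<dots> = (\<integral>\<^sup>+v. indicator {0<..<\<tau>} v * (vbr z y * ee (\<tau> - v) y) * uno v y \<partial>lborel)"
    by (intro nn_integral_cong) (auto simp: uno_def split: split_indicator)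
  finally show ?thesis using ff_integral[OF assms] by simp
qed

text \<open>The three terms of \<open>step\<close> with a free damping factor, so that the damped
  (\<open>ee\<close>), the undamped (\<open>uno\<close>) and the complementary (\<open>ff\<close>)
  version can be compared.\<close>

definition tot :: "(real \<Rightarrow> real \<Rightarrow> ennreal) \<Rightarrow> 'x kernel \<Rightarrow> 'x rate \<Rightarrow> 'x kernel
    \<Rightarrow> real \<Rightarrow> 'x \<Rightarrow> (real \<Rightarrow> ennreal) \<Rightarrow> ennreal" where
  "tot c \<beta> U \<alpha> t x f = (\<integral>\<^sup>+y. f y \<partial>evolve initial_space c one ini t x)
     + (\<integral>\<^sup>+y. f y \<partial>evolve time_space c U \<alpha> t x) + (\<integral>\<^sup>+y. f y \<partial>evolve time_space c one (gain \<alpha> \<beta>) t x)"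

lemma tot_add:
  assumes \<alpha>: "nice \<alpha>" and \<beta>: "nice \<beta>" and U: "ok_rate U" and f: "f \<in> borel_measurable sizes"
  shows "tot uno \<beta> U \<alpha> t x f = tot ee \<beta> U \<alpha> t x f + tot ff \<beta> U \<alpha> t x f"
proof -
  have *: "uno \<tau> y * q = ee \<tau> y * q + ff \<tau> y * q" if "0 < \<tau>" for \<tau> y q
    using ee_ff[OF that, of y] by (simp add: uno_def flip: distrib_right)
  have 1: "(\<integral>\<^sup>+y. f y \<partial>evolve N uno \<omega> \<kappa> t x) = (\<integral>\<^sup>+y. f y \<partial>evolve N ee \<omega> \<kappa> t x) + (\<integral>\<^sup>+y. f y \<partial>evolve N ff \<omega> \<kappa> t x)"
    if "ok_source N uno \<omega> \<kappa>" "ok_source N ee \<omega> \<kappa>" "ok_source N ff \<omega> \<kappa>" for N \<omega> \<kappa>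
    by (rule nn_integral_evolve_add[OF that f]) (rule *)
  show ?thesis unfolding tot_def
    1[OF ok_sources(1)[OF uno_measurable] ok_sources(1)[OF ee_measurable] ok_sources(1)[OF ff_measurable]]
    1[OF ok_sources(2)[OF uno_measurable \<alpha> U] ok_sources(2)[OF ee_measurable \<alpha> U] ok_sources(2)[OF ff_measurable \<alpha> U]]
    1[OF ok_sources(3)[OF uno_measurable \<alpha> \<beta>] ok_sources(3)[OF ee_measurable \<alpha> \<beta>] ok_sources(3)[OF ff_measurable \<alpha> \<beta>]]
    by (simp add: ac_simps)
qed

text \<open>The composition of the two propagators, for both orders in which the factor
  \<open>exp (- vb \<tau>)\<close> can enter; the integral over the intermediate time gives \<open>1 - exp (- vb \<tau>)\<close>.\<close>

lemma evolve_compose: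
  assumes ok: "ok_source N c \<omega> \<kappa>" and okf: "ok_source N ff \<omega> \<kappa>"
    and g: "(\<lambda>(\<tau>, y). g \<tau> y) \<in> borel_measurable (borel \<Otimes>\<^sub>M sizes)"
    and f: "f \<in> borel_measurable sizes"
    and d: "\<And>\<tau> y. 0 < \<tau> \<Longrightarrow> (\<integral>\<^sup>+v. indicator {0<..<\<tau>} v * g (\<tau> - v) y * c v y \<partial>lborel) = ff \<tau> y"
  shows "(\<integral>\<^sup>+(u, x'). \<integral>\<^sup>+y. f y * (indicator {..<t} u * g (t - u) y * p (t - u) x' x y) \<partial>evolve N c \<omega> \<kappa> u x' \<partial>time_space)
    = (\<integral>\<^sup>+y. f y \<partial>evolve N ff \<omega> \<kappa> t x)"
proof -
  have [measurable (raw)]: "a \<in> borel_measurable M \<Longrightarrow> h \<in> M \<rightarrow>\<^sub>M sizes \<Longrightarrow> (\<lambda>m. g (a m) (h m)) \<in> borel_measurable M"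
    for a h and M :: "'b measure"
    using measurable_compose[OF measurable_Pair g] by simp
  note [measurable (raw)] = ok_sourceD(4,5)[OF ok]
  have "(\<lambda>(\<tau>, y). \<integral>\<^sup>+v. indicator {0<..<\<tau>} v * g (\<tau> - v) y * c v y \<partial>lborel) \<in> borel_measurable (borel \<Otimes>\<^sub>M sizes)"
  proof -
    have ind: "indicator {0<..<\<tau>} v = (if 0 < v \<and> v < \<tau> then 1 else (0::ennreal))" for \<tau> v :: real
      by (simp add: indicator_def)
    show ?thesis unfolding ind by measurable
  qed
  then have okd: "ok_source N (\<lambda>\<tau> y. \<integral>\<^sup>+v. indicator {0<..<\<tau>} v * g (\<tau> - v) y * c v y \<partial>lborel) \<omega> \<kappa>"
    using ok by (simp add: ok_source_def)
  show ?thesis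
    unfolding evolve_time[OF ok f g okd]
    by (rule nn_integral_evolve_cong[OF okd okf f]) (simp add: d)
qed

lemma evolve_null_time:
  assumes \<alpha>: "nice \<alpha>" and \<beta>: "nice \<beta>" and U: "ok_rate U" and c: "(\<lambda>(\<tau>, y). c \<tau> y) \<in> borel_measurable (borel \<Otimes>\<^sub>M sizes)"
    and f: "f \<in> borel_measurable sizes" and t: "t \<le> 0"
  shows "tot c \<beta> U \<alpha> t x f = 0"
proof -
  have 1: "(\<integral>\<^sup>+y. f y \<partial>evolve time_space c \<omega> \<kappa> t x) = 0" if ok: "ok_source time_space c \<omega> \<kappa>" and n: "nice \<kappa>" for \<omega> \<kappa>
  proof -
    have "(\<integral>\<^sup>+y. f y * (indicator {..<t} s * c (t - s) y * \<omega> (s, x') y * p (t - s) x' x y) \<partial>\<kappa> (s, x')) = 0" for s x'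
    proof (cases "s < t")
      case True
      then have "\<kappa> (s, x') = null_measure sizes" using t by (intro nice_null[OF n]) auto
      then show ?thesis by simp
    qed simp
    then show ?thesis unfolding nn_integral_evolve[OF ok f] by (simp add: case_prod_beta')
  qed
  have "(\<lambda>m. \<integral>\<^sup>+y. f y * (indicator {..<t} (fst m) * c (t - fst m) y * one (fst m, snd m) y * p (t - fst m) (snd m) x y)
     \<partial>ini (fst m, snd m)) \<in> borel_measurable (borel \<Otimes>\<^sub>M borel)"
    using f by (intro evolve_density_measurable[OF ok_sources(1)[OF c]]) auto
  then have "(\<integral>\<^sup>+y. f y \<partial>evolve initial_space c one ini t x) = 0"
    unfolding nn_integral_evolve[OF ok_sources(1)[OF c] f] using t
    by (subst nn_integral_initial_space) (simp_all add: case_prod_beta')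
  then show ?thesis
    unfolding tot_def by (simp add: 1[OF ok_sources(2)[OF c \<alpha> U] \<alpha>] 1[OF ok_sources(3)[OF c \<alpha> \<beta>] gain_nice[OF \<alpha> \<beta>]])
qed

lemma tot_compose:
  assumes \<alpha>: "nice \<alpha>" and \<beta>: "nice \<beta>" and U: "ok_rate U"
    and c: "(\<lambda>(\<tau>, y). c \<tau> y) \<in> borel_measurable (borel \<Otimes>\<^sub>M sizes)"
    and g: "(\<lambda>(\<tau>, y). g \<tau> y) \<in> borel_measurable (borel \<Otimes>\<^sub>M sizes)"
    and f: "f \<in> borel_measurable sizes"
    and d: "\<And>\<tau> y. 0 < \<tau> \<Longrightarrow> (\<integral>\<^sup>+v. indicator {0<..<\<tau>} v * g (\<tau> - v) y * c v y \<partial>lborel) = ff \<tau> y"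
  shows "(\<integral>\<^sup>+(u, x'). tot c \<beta> U \<alpha> u x' (\<lambda>y. f y * (indicator {..<t} u * g (t - u) y * p (t - u) x' x y)) \<partial>time_space) = tot ff \<beta> U \<alpha> t x f"
proof -
  note oks = ok_sources(1)[OF c] ok_sources(2)[OF c \<alpha> U] ok_sources(3)[OF c \<alpha> \<beta>]
  have sp: "borel_measurable time_space = (borel_measurable (borel \<Otimes>\<^sub>M borel) :: (real \<times> 'x \<Rightarrow> ennreal) set)"
    using ok_index_time_space by (intro measurable_cong_sets) (auto simp: ok_index_def)
  have m: "(\<lambda>z. \<integral>\<^sup>+y. f y * (indicator {..<t} (fst z) * g (t - fst z) y * p (t - fst z) (snd z) x y) \<partial>evolve N c \<omega> \<kappa> (fst z) (snd z))
      \<in> borel_measurable time_space" if "ok_source N c \<omega> \<kappa>" for N \<omega> \<kappa>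
    using evolve_time_measurable[OF that f g] by (simp add: sp)
  have e: "(\<integral>\<^sup>+z. \<integral>\<^sup>+y. f y * (indicator {..<t} (fst z) * g (t - fst z) y * p (t - fst z) (snd z) x y) \<partial>evolve N c \<omega> \<kappa> (fst z) (snd z) \<partial>time_space)
    = (\<integral>\<^sup>+y. f y \<partial>evolve N ff \<omega> \<kappa> t x)" if "ok_source N c \<omega> \<kappa>" "ok_source N ff \<omega> \<kappa>" for N \<omega> \<kappa>
  proof -
    have "(\<integral>\<^sup>+(u, x'). \<integral>\<^sup>+y. f y * (indicator {..<t} u * g (t - u) y * p (t - u) x' x y) \<partial>evolve N c \<omega> \<kappa> u x' \<partial>time_space)
      = (\<integral>\<^sup>+y. f y \<partial>evolve N ff \<omega> \<kappa> t x)"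
      by (rule evolve_compose[OF that g f]) (rule d)
    then show ?thesis by (simp add: case_prod_beta')
  qed
  show ?thesis
    unfolding tot_def case_prod_beta'
    by (simp only: nn_integral_add borel_measurable_add m[OF oks(1)] m[OF oks(2)] m[OF oks(3)]
      e[OF oks(1) ok_sources(1)[OF ff_measurable]] e[OF oks(2) ok_sources(2)[OF ff_measurable \<alpha> U]]
      e[OF oks(3) ok_sources(3)[OF ff_measurable \<alpha> \<beta>]])
qed

section \<open>Monotonicity and the least fixed point\<close>

lemma step_mono:
  assumes n: "nice \<alpha>" "nice \<beta>" "nice \<alpha>'" "nice \<beta>'" and U: "ok_rate U" "ok_rate U'"
    and le: "kernel_le \<alpha> \<alpha>'" "kernel_le \<beta> \<beta>'" "\<And>z y. 0 < y \<Longrightarrow> U z y \<le> U' z y"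
  shows "kernel_le (step \<beta> U \<alpha>) (step \<beta>' U' \<alpha>')"
  unfolding kernel_le_def
proof (intro allI ballI)
  fix z :: "real \<times> 'x" and A assume A: "A \<in> sets sizes"
  obtain t x where z: "z = (t, x)" by (cases z)
  note f = borel_measurable_indicator[OF A]
  show "emeasure (step \<beta> U \<alpha> z) A \<le> emeasure (step \<beta>' U' \<alpha>' z) A"
  proof (cases "0 < t \<and> t \<le> T")
    case True
    have "(\<integral>\<^sup>+y. indicator A y \<partial>step \<beta> U \<alpha> (t, x)) \<le> (\<integral>\<^sup>+y. indicator A y \<partial>step \<beta>' U' \<alpha>' (t, x))"
      unfolding nn_integral_step[OF conjunct1[OF True] conjunct2[OF True] f]
      by (intro add_mono order_refl evolve_mono f ok_sources ee_measurable n U le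
          gain_kernel_mono nice_lfk kk_measurable')
    then show ?thesis using A by (simp add: z)
  qed (auto simp: step_def z)
qed

lemma step_sup:
  assumes F: "\<And>n. nice (F n)" "\<And>n. kernel_le (F n) (F (Suc n))" "nice (kernel_sup F)"
    and G: "\<And>n. nice (G n)" "\<And>n. kernel_le (G n) (G (Suc n))" "nice (kernel_sup G)"
    and U: "\<And>n. ok_rate (U n)" "ok_rate U'" "\<And>z y. 0 < y \<Longrightarrow> incseq (\<lambda>n. U n z y)" "\<And>z y. 0 < y \<Longrightarrow> U' z y = (SUP n. U n z y)"
    and A: "A \<in> sets sizes"
  shows "emeasure (step (kernel_sup G) U' (kernel_sup F) z) A = (SUP n. emeasure (step (G n) (U n) (F n) z) A)"
proof -
  obtain t x where z: "z = (t, x)" by (cases z)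
  note f = borel_measurable_indicator[OF A]
  show ?thesis
  proof (cases "0 < t \<and> t \<le> T")
    case True
    have gi: "kernel_le (gain (F n) (G n)) (gain (F (Suc n)) (G (Suc n)))" for n
      by (intro gain_kernel_mono nice_lfk kk_measurable' F G)
    have gs: "gain (kernel_sup F) (kernel_sup G) = kernel_sup (\<lambda>n. gain (F n) (G n))"
    proof (rule ext, rule measure_eqI)
      fix z B assume "B \<in> sets (gain (kernel_sup F) (kernel_sup G) z)"
      then have B: "B \<in> sets sizes" by simp
      show "emeasure (gain (kernel_sup F) (kernel_sup G) z) B = emeasure (kernel_sup (\<lambda>n. gain (F n) (G n)) z) B"
        using gain_kernel_sup[OF nice_lfk[OF F(1)] F(2) nice_lfk[OF F(3)] nice_lfk[OF G(1)] G(2) nice_lfk[OF G(3)] kk_measurable' B]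
          emeasure_kernel_sup[where F="\<lambda>n. gain (F n) (G n)", OF sets_gain_kernel gi B] by simp
    qed simp
    have 1: "(\<integral>\<^sup>+y. indicator A y \<partial>evolve time_space ee U' (kernel_sup F) t x) = (SUP n. \<integral>\<^sup>+y. indicator A y \<partial>evolve time_space ee (U n) (F n) t x)"
      by (intro evolve_sup ok_sources ee_measurable F U f)
    have 2: "(\<integral>\<^sup>+y. indicator A y \<partial>evolve time_space ee one (gain (kernel_sup F) (kernel_sup G)) t x)
        = (SUP n. \<integral>\<^sup>+y. indicator A y \<partial>evolve time_space ee one (gain (F n) (G n)) t x)"
      using evolve_sup[OF ok_sources(3)[OF ee_measurable F(1) G(1)] ok_sources(3)[OF ee_measurable F(3) G(3), unfolded gs] f gi, of t x]
      by (simp add: gs incseq_def)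
    have i1: "incseq (\<lambda>n. \<integral>\<^sup>+y. indicator A y \<partial>evolve time_space ee (U n) (F n) t x)"
      using U(3) by (intro incseq_SucI evolve_mono ok_sources ee_measurable F U f) (simp add: incseq_def)
    have i2: "incseq (\<lambda>n. \<integral>\<^sup>+y. indicator A y \<partial>evolve time_space ee one (gain (F n) (G n)) t x)"
      by (intro incseq_SucI evolve_mono ok_sources(3)[OF ee_measurable F(1) G(1)] f gi order_refl)
    have "(\<integral>\<^sup>+y. indicator A y \<partial>step (kernel_sup G) U' (kernel_sup F) (t, x)) = (SUP n. \<integral>\<^sup>+y. indicator A y \<partial>step (G n) (U n) (F n) (t, x))"
      unfolding nn_integral_step[OF conjunct1[OF True] conjunct2[OF True] f] 1 2
      by (subst ennreal_SUP_add[OF _ i2], use i1 in \<open>simp add: incseq_def add_left_mono\<close>,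
          subst ennreal_SUP_add[OF _ i1]) (auto simp: incseq_def)
    then show ?thesis using A by (simp add: z)
  qed (auto simp: step_def z)
qed

text \<open>The loss enters \<open>step\<close> only through the nonnegative \<open>res W\<close>,
  so \<open>step\<close> is monotone and continuous along increasing sequences, and iteration from 0
  yields its least fixed point.\<close>

definition lin :: "'x kernel \<Rightarrow> 'x rate \<Rightarrow> 'x kernel" where
  "lin \<beta> W = kernel_sup (iter \<beta> (res W))"

definition exp_sol :: "'x kernel \<Rightarrow> 'x rate \<Rightarrow> 'x kernel \<Rightarrow> bool" where
  "exp_sol \<beta> W \<alpha> \<longleftrightarrow> nice \<alpha> \<and> nice \<beta> \<and> ok_rate W \<and> step \<beta> (res W) \<alpha> = \<alpha>"

lemma nice_sets: "nice \<alpha> \<Longrightarrow> sets (\<alpha> z) = sets sizes"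
  by (rule lfk_sets[OF nice_lfk])

lemma kernel_sup_nice:
  assumes F: "\<And>n. nice (F n)" "\<And>n. kernel_le (F n) (F (Suc n))"
    and b: "\<And>R. \<exists>B::real. \<forall>n z. emeasure (F n z) {0<..R} \<le> ennreal B"
  shows "nice (kernel_sup F)"
proof -
  have em: "emeasure (kernel_sup F z) A = (SUP n. emeasure (F n z) A)" if "A \<in> sets sizes" for z A
    by (rule emeasure_kernel_sup[where F=F, OF nice_sets[OF F(1)] F(2) that])
  show ?thesis unfolding nice_def
  proof (intro conjI allI impI)
    show "measurable_kernel borel (kernel_sup F)"
      using F by (intro kernel_sup_measurable_kernel) (auto simp: nice_def)
    show "kernel_sup F (t, x) = null_measure sizes" if "\<not> (0 < t \<and> t \<le> T)" for t x
      by (rule measure_eqI) (simp_all add: em nice_null[OF F(1) that])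
    show "emeasure (kernel_sup F z) {0<..<\<delta>} = 0" for z by (simp add: em nice_supp[OF F(1)])
    show "\<exists>B. \<forall>z. emeasure (kernel_sup F z) {0<..R} \<le> ennreal B" for R
    proof -
      obtain B where "emeasure (F n z) {0<..R} \<le> ennreal B" for n z using b by blast
      then show ?thesis by (intro exI[of _ B]) (auto simp: em intro: SUP_least)
    qed
  qed
qed

text \<open>The comparison \<open>lin_least\<close> is induction over the iterates: a solution with
  a larger frozen kernel and a smaller loss rate lies above each of them by
  \<open>step_mono\<close>. The bounds on the limit are those of \<open>iter_bound\<close>, which do
  not depend on the iterate.\<close>

lemma
  assumes \<beta>: "nice \<beta>" and W: "ok_rate W"
  shows lin_exp_sol: "exp_sol \<beta> W (lin \<beta> W)"
    and lin_total: "\<And>R. \<exists>B::real. \<forall>t. (\<integral>\<^sup>+x. emeasure (lin \<beta> W (t, x)) {0<..R} \<partial>lborel) \<le> ennreal B"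
    and lin_least: "\<And>\<beta>' W' \<alpha>. exp_sol \<beta>' W' \<alpha> \<Longrightarrow> kernel_le \<beta> \<beta>' \<Longrightarrow> (\<And>z y. 0 < y \<Longrightarrow> W' z y \<le> W z y) \<Longrightarrow> kernel_le (lin \<beta> W) \<alpha>"
proof -
  note U = res_rate[OF W]
  let ?F = "iter \<beta> (res W)"
  obtain c :: "real \<Rightarrow> real" where c: "\<And>R. 0 \<le> c R"
    and n: "\<And>n. nice (?F n)"
    and b1: "\<And>n R t x. 0 < t \<Longrightarrow> emeasure (?F n (t, x)) {0<..R} \<le> ennreal (\<delta> powr (- (4/3)) * g0 * exp (c R * t))"
    and b2: "\<And>n R t. 0 < t \<Longrightarrow> (\<integral>\<^sup>+x. emeasure (?F n (t, x)) {0<..R} \<partial>lborel) \<le> ennreal (m0 / \<delta> * exp (c R * t))"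
    using iter_bound[OF \<beta> U] by blast
  have inc: "kernel_le (?F n) (?F (Suc n))" for n
  proof (induction n)
    case (Suc n)
    then show ?case using step_mono[OF n \<beta> n \<beta> U U Suc kernel_le_refl] by simp
  qed (simp add: kernel_le_def)
  have b: "emeasure (?F n z) {0<..R} \<le> ennreal (\<delta> powr (- (4/3)) * g0 * exp (c R * T))" for n z R
  proof (cases "0 < fst z \<and> fst z \<le> T")
    case True
    then have "emeasure (?F n (fst z, snd z)) {0<..R} \<le> ennreal (\<delta> powr (- (4/3)) * g0 * exp (c R * fst z))"
      by (intro b1) simp
    then have "emeasure (?F n z) {0<..R} \<le> ennreal (\<delta> powr (- (4/3)) * g0 * exp (c R * fst z))" by simp
    also have "\<dots> \<le> ennreal (\<delta> powr (- (4/3)) * g0 * exp (c R * T))"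
      using True pos c[of R] by (intro ennreal_leI mult_left_mono) (auto intro!: mult_left_mono)
    finally show ?thesis .
  next
    case False
    then show ?thesis using nice_null[OF n[of n], where t="fst z" and x="snd z"] by simp
  qed
  have nl: "nice (lin \<beta> W)" unfolding lin_def by (rule kernel_sup_nice[where F="?F", OF n inc]) (use b in blast)
  have em: "emeasure (lin \<beta> W z) A = (SUP n. emeasure (?F n z) A)" if "A \<in> sets sizes" for z A
    unfolding lin_def by (rule emeasure_kernel_sup[where F="?F", OF nice_sets[OF n] inc that])
  have "step \<beta> (res W) (lin \<beta> W) z = lin \<beta> W z" for z
  proof (rule measure_eqI)
    fix A assume "A \<in> sets (step \<beta> (res W) (lin \<beta> W) z)"
    then have A: "A \<in> sets sizes" by simp
    have kb: "kernel_sup (\<lambda>_. \<beta>) = \<beta>"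
    proof (rule ext, rule measure_eqI)
      fix z B assume "B \<in> sets (kernel_sup (\<lambda>_. \<beta>) z)"
      then show "emeasure (kernel_sup (\<lambda>_. \<beta>) z) B = emeasure (\<beta> z) B"
        using emeasure_kernel_sup[where F="\<lambda>_. \<beta>", OF nice_sets[OF \<beta>] kernel_le_refl, of B z] by simp
    qed (simp add: nice_sets[OF \<beta>])
    have "emeasure (step \<beta> (res W) (lin \<beta> W) z) A = (SUP n. emeasure (step \<beta> (res W) (?F n) z) A)"
      using step_sup[of ?F "\<lambda>_. \<beta>" "\<lambda>_. res W" "res W" A z] n inc nl \<beta> U A
      by (simp add: kb lin_def[symmetric] kernel_le_refl incseq_def)
    also have "\<dots> = (SUP n. emeasure (?F (Suc n) z) A)" by simp
    also have "\<dots> = (SUP n. emeasure (?F n z) A)"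
    proof -
      have le: "emeasure (?F n z) A \<le> emeasure (?F (Suc n) z) A" for n
        using inc A unfolding kernel_le_def by blast
      show ?thesis by (intro antisym SUP_mono) (auto intro: le simp del: iter.simps)
    qed
    finally show "emeasure (step \<beta> (res W) (lin \<beta> W) z) A = emeasure (lin \<beta> W z) A" by (simp add: em[OF A])
  qed (simp add: lin_def)
  then show "exp_sol \<beta> W (lin \<beta> W)" using nl \<beta> W by (auto simp: exp_sol_def)
  show "\<exists>B::real. \<forall>t. (\<integral>\<^sup>+x. emeasure (lin \<beta> W (t, x)) {0<..R} \<partial>lborel) \<le> ennreal B" for R
  proof (intro exI allI)
    fix t
    show "(\<integral>\<^sup>+x. emeasure (lin \<beta> W (t, x)) {0<..R} \<partial>lborel) \<le> ennreal (m0 / \<delta> * exp (c R * T))"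
    proof (cases "0 < t \<and> t \<le> T")
      case True
      have "(\<integral>\<^sup>+x. emeasure (lin \<beta> W (t, x)) {0<..R} \<partial>lborel) = (SUP n. \<integral>\<^sup>+x. emeasure (?F n (t, x)) {0<..R} \<partial>lborel)"
        unfolding em[OF Ioc_sizes(1)]
      proof (rule nn_integral_monotone_convergence_SUP)
        show "incseq (\<lambda>n x. emeasure (?F n (t, x)) {0<..R})"
          using inc Ioc_sizes(1) by (intro incseq_SucI) (auto simp: kernel_le_def le_fun_def)
        show "(\<lambda>x. emeasure (?F n (t, x)) {0<..R}) \<in> borel_measurable lborel" for n
          by (simp, rule lfk_emeasure_measurable[OF nice_lfk[OF n]]) auto
      qed
      also have "\<dots> \<le> ennreal (m0 / \<delta> * exp (c R * t))" by (rule SUP_least, rule b2) (use True in simp)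
      also have "\<dots> \<le> ennreal (m0 / \<delta> * exp (c R * T))"
        using True pos c[of R] by (intro ennreal_leI mult_left_mono) (auto intro!: mult_left_mono)
      finally show ?thesis .
    next
      case False
      then show ?thesis using nice_null[OF nl False] by simp
    qed
  qed
  show "kernel_le (lin \<beta> W) \<alpha>" if \<alpha>: "exp_sol \<beta>' W' \<alpha>" and le: "kernel_le \<beta> \<beta>'" "\<And>z y. 0 < y \<Longrightarrow> W' z y \<le> W z y" for \<beta>' W' \<alpha>
  proof -
    have a: "nice \<alpha>" "nice \<beta>'" "ok_rate W'" "step \<beta>' (res W') \<alpha> = \<alpha>" using \<alpha> by (auto simp: exp_sol_def)
    have r: "res W z y \<le> res W' z y" if "0 < y" for z y
      unfolding res_def using le(2)[OF that] by (rule ennreal_minus_mono[OF order_refl])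
    have "kernel_le (?F n) \<alpha>" for n
    proof (induction n)
      case (Suc n)
      show ?case using step_mono[OF n \<beta> a(1,2) U res_rate[OF a(3)] Suc le(1) r] by (simp add: a)
    qed (simp add: kernel_le_def)
    then show ?thesis unfolding lin_def by (intro kernel_sup_least[where F="?F"] nice_sets n inc)
  qed
qed

lemma exp_sol_tot:
  assumes "exp_sol \<beta> W \<alpha>" "0 < t" "t \<le> T" and f: "f \<in> borel_measurable sizes"
  shows "(\<integral>\<^sup>+y. f y \<partial>\<alpha> (t, x)) = tot ee \<beta> (res W) \<alpha> t x f"
proof -
  have "\<alpha> (t, x) = step \<beta> (res W) \<alpha> (t, x)" using assms(1) by (simp add: exp_sol_def)
  then have "(\<integral>\<^sup>+y. f y \<partial>\<alpha> (t, x)) = (\<integral>\<^sup>+y. f y \<partial>step \<beta> (res W) \<alpha> (t, x))" by (rule arg_cong)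
  then show ?thesis unfolding nn_integral_step[OF assms(2,3) f] tot_def .
qed

lemma evolve_finite:
  assumes \<alpha>: "nice \<alpha>" and U: "ok_rate U" and c: "(\<lambda>(\<tau>, y). c \<tau> y) \<in> borel_measurable (borel \<Otimes>\<^sub>M sizes)"
    and c1: "\<And>\<tau> y. 0 < \<tau> \<Longrightarrow> c \<tau> y \<le> 1" and R: "0 \<le> R"
  shows "emeasure (evolve time_space c U \<alpha> t x) {0<..R} < \<infinity>"
proof -
  obtain B where B: "0 \<le> B" "\<And>z. emeasure (\<alpha> z) {0<..R} \<le> ennreal B" using nice_bound[OF \<alpha>] by blast
  let ?D = "R / \<delta> * vb R"
  have D0: "0 \<le> ?D" using R pos vb_nonneg by simp
  have "emeasure (evolve time_space c U \<alpha> t x) {0<..R} \<le> conv (\<lambda>s x'. ennreal ?D * emeasure (\<alpha> (s, x')) {0<..R}) t x"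
  proof (rule evolve_crude[OF ok_sources(2)[OF c \<alpha> U] nice_supp[OF \<alpha>] c1 _ vb_nonneg R])
    fix z y assume "\<delta> \<le> y" "y \<le> R"
    then show "U z y \<le> ennreal (vb R)"
      using U vb_mono[of y R] pos unfolding ok_rate_def by (meson ennreal_leI less_le_trans order_trans)
  qed
  also have "\<dots> \<le> (\<integral>\<^sup>+s. indicator {0<..<t} s * ennreal (?D * B) \<partial>lborel)"
  proof (rule conv_le)
    fix s x'
    show "ennreal ?D * emeasure (\<alpha> (s, x')) {0<..R} \<le> indicator {0<..} s * ennreal (?D * B)"
    proof (cases "0 < s")
      case True
      have "ennreal ?D * emeasure (\<alpha> (s, x')) {0<..R} \<le> ennreal ?D * ennreal B" by (intro mult_left_mono B) simp
      also have "\<dots> = ennreal (?D * B)" by (rule ennreal_mult'[OF D0, symmetric])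
      finally show ?thesis using True by simp
    qed (simp add: nice_null[OF \<alpha>])
  qed
  also have "\<dots> = ennreal (?D * B) * emeasure lborel {0<..<t}"
    by (subst mult.commute, rule nn_integral_cmult_indicator) simp
  also have "\<dots> < \<infinity>" using emeasure_bounded_finite[of "{0<..<t}"] by (auto simp: ennreal_mult_less_top)
  finally show ?thesis .
qed

lemma evolve_bounded_finite:
  assumes \<alpha>: "nice \<alpha>" and U: "ok_rate U" and c: "(\<lambda>(\<tau>, y). c \<tau> y) \<in> borel_measurable (borel \<Otimes>\<^sub>M sizes)"
    and c1: "\<And>\<tau> y. 0 < \<tau> \<Longrightarrow> c \<tau> y \<le> 1"
    and f: "\<And>y. f y \<le> of_nat n * indicator {0<..real n} y"
  shows "(\<integral>\<^sup>+y. f y \<partial>evolve time_space c U \<alpha> t x) \<noteq> \<infinity>"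
proof -
  have "(\<integral>\<^sup>+y. f y \<partial>evolve time_space c U \<alpha> t x) \<le> (\<integral>\<^sup>+y. of_nat n * indicator {0<..real n} y \<partial>evolve time_space c U \<alpha> t x)"
    by (intro nn_integral_mono f)
  also have "\<dots> = of_nat n * emeasure (evolve time_space c U \<alpha> t x) {0<..real n}"
    by (rule nn_integral_cmult_indicator) simp
  also have "\<dots> < \<infinity>" using evolve_finite[OF \<alpha> U c c1, of "real n" t x] by (auto simp: ennreal_mult_less_top of_nat_less_top)
  finally show ?thesis by simp
qed

lemma evolve_vbr_eq:
  assumes \<alpha>: "nice \<alpha>" and c: "(\<lambda>(\<tau>, y). c \<tau> y) \<in> borel_measurable (borel \<Otimes>\<^sub>M sizes)" and f: "f \<in> borel_measurable sizes"
  shows "(\<integral>\<^sup>+y. f y \<partial>evolve time_space c vbr \<alpha> t x) =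
    (\<integral>\<^sup>+(u, x'). \<integral>\<^sup>+y. f y * (indicator {..<t} u * (ennreal (vb y) * c (t - u) y) * p (t - u) x' x y) \<partial>\<alpha> (u, x') \<partial>time_space)"
  unfolding nn_integral_evolve[OF ok_sources(2)[OF c \<alpha> vbr_rate] f]
  by (intro nn_integral_cong) (auto simp: vbr_def ac_simps)

section \<open>Equivalence of the mild and the damped equation\<close>

definition mild :: "'x kernel \<Rightarrow> 'x rate \<Rightarrow> 'x kernel \<Rightarrow> bool" where
  "mild \<beta> W \<alpha> \<longleftrightarrow> (\<forall>t x f. 0 < t \<longrightarrow> t \<le> T \<longrightarrow> f \<in> borel_measurable sizes \<longrightarrow>
     (\<integral>\<^sup>+y. f y \<partial>\<alpha> (t, x)) + (\<integral>\<^sup>+y. f y \<partial>evolve time_space uno W \<alpha> t x)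
     = (\<integral>\<^sup>+y. f y \<partial>evolve initial_space uno one ini t x) + (\<integral>\<^sup>+y. f y \<partial>evolve time_space uno one (gain \<alpha> \<beta>) t x))"

lemma vb_uno_res:
  assumes \<alpha>: "nice \<alpha>" and W: "ok_rate W" and f: "f \<in> borel_measurable sizes"
  shows "(\<integral>\<^sup>+y. f y \<partial>evolve time_space uno vbr \<alpha> t x) =
    (\<integral>\<^sup>+y. f y \<partial>evolve time_space uno (res W) \<alpha> t x) + (\<integral>\<^sup>+y. f y \<partial>evolve time_space uno W \<alpha> t x)"
  by (intro nn_integral_evolve_add ok_sources uno_measurable \<alpha> W f vbr_rate res_rate)
    (simp add: uno_def res_add[OF W])

text \<open>Let every particle be re-emitted at rate \<open>vb\<close> and diffuse undamped.
  Inserting the damped equation for the emitting kernel changes the factor \<open>ee\<close> into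
  \<open>ff\<close>, and \<open>ee + ff = uno\<close>. So adding this emission to the damped
  equation gives the undamped one with source \<open>res W\<close>; splitting
  \<open>vb = res W + W\<close> and cancelling the \<open>res W\<close> term leaves the mild
  equation.\<close>

lemma exp_sol_mild:
  assumes sol: "exp_sol \<beta> W \<alpha>"
  shows "mild \<beta> W \<alpha>"
  unfolding mild_def
proof (intro allI impI)
  fix t x and f :: "real \<Rightarrow> ennreal" assume t: "0 < t" "t \<le> T" and f: "f \<in> borel_measurable sizes"
  have a: "nice \<alpha>" "nice \<beta>" "ok_rate W" using sol by (auto simp: exp_sol_def)
  note U = res_rate[OF a(3)]
  show "(\<integral>\<^sup>+y. f y \<partial>\<alpha> (t, x)) + (\<integral>\<^sup>+y. f y \<partial>evolve time_space uno W \<alpha> t x)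
     = (\<integral>\<^sup>+y. f y \<partial>evolve initial_space uno one ini t x) + (\<integral>\<^sup>+y. f y \<partial>evolve time_space uno one (gain \<alpha> \<beta>) t x)"
  proof (rule eq_extend[OF nice_sets[OF a(1)] sets_evolve sets_evolve sets_evolve _ f])
    fix n and f :: "real \<Rightarrow> ennreal" assume f: "f \<in> borel_measurable sizes" and fb: "\<And>y. f y \<le> of_nat n * indicator {0<..real n} y"
    let ?q = "\<lambda>u x' y. f y * (indicator {..<t} u * ennreal (vb y) * p (t - u) x' x y)"
    have q: "?q u x' \<in> borel_measurable sizes" for u x'
    proof -
      note [measurable] = f
      show ?thesis by measurable
    qed
    have "(\<integral>\<^sup>+y. f y \<partial>evolve time_space uno vbr \<alpha> t x) = (\<integral>\<^sup>+(u, x'). \<integral>\<^sup>+y. ?q u x' y \<partial>\<alpha> (u, x') \<partial>time_space)"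
      unfolding evolve_vbr_eq[OF a(1) uno_measurable f] by (simp add: uno_def)
    also have "\<dots> = (\<integral>\<^sup>+(u, x'). tot ee \<beta> (res W) \<alpha> u x' (?q u x') \<partial>time_space)"
    proof (intro nn_integral_cong, clarify)
      fix u x'
      consider "u \<le> 0" | "0 < u" "u < t" | "t \<le> u" by linarith
      then show "(\<integral>\<^sup>+y. ?q u x' y \<partial>\<alpha> (u, x')) = tot ee \<beta> (res W) \<alpha> u x' (?q u x')"
      proof cases
        case 1
        then show ?thesis by (simp add: evolve_null_time[OF a(1,2) U ee_measurable q] nice_null[OF a(1)])
      next
        case 2
        then show ?thesis using t by (intro exp_sol_tot[OF sol _ _ q]) auto
      next
        case 3
        then show ?thesis by (simp add: tot_def)
      qed
    qed
    also have "\<dots> = tot ff \<beta> (res W) \<alpha> t x f"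
    proof (rule tot_compose[OF a(1,2) U ee_measurable _ f])
      show "(\<lambda>(\<tau>, y). ennreal (vb y)) \<in> borel_measurable (borel \<Otimes>\<^sub>M sizes)" by measurable
      show "(\<integral>\<^sup>+v. indicator {0<..<\<tau>} v * ennreal (vb y) * ee v y \<partial>lborel) = ff \<tau> y" if "0 < \<tau>" for \<tau> y
        using ff_integral[OF that] by (simp add: vbr_def)
    qed
    finally have L: "(\<integral>\<^sup>+y. f y \<partial>evolve time_space uno vbr \<alpha> t x) = tot ff \<beta> (res W) \<alpha> t x f" .
    have "(\<integral>\<^sup>+y. f y \<partial>\<alpha> (t, x)) + (\<integral>\<^sup>+y. f y \<partial>evolve time_space uno vbr \<alpha> t x) = tot uno \<beta> (res W) \<alpha> t x f"
      unfolding L exp_sol_tot[OF sol t f] tot_add[OF a(1,2) U f] ..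
    \<comment> \<open>Both sides contain the \<open>res W\<close> term, which is finite because
      \<open>f\<close> is bounded and vanishes beyond \<open>n\<close>.\<close>
    then have "(\<integral>\<^sup>+y. f y \<partial>evolve time_space uno (res W) \<alpha> t x) + ((\<integral>\<^sup>+y. f y \<partial>\<alpha> (t, x)) + (\<integral>\<^sup>+y. f y \<partial>evolve time_space uno W \<alpha> t x))
      = (\<integral>\<^sup>+y. f y \<partial>evolve time_space uno (res W) \<alpha> t x) + ((\<integral>\<^sup>+y. f y \<partial>evolve initial_space uno one ini t x) + (\<integral>\<^sup>+y. f y \<partial>evolve time_space uno one (gain \<alpha> \<beta>) t x))"
      unfolding vb_uno_res[OF a(1,3) f] tot_def by (simp add: ac_simps)
    moreover have "(\<integral>\<^sup>+y. f y \<partial>evolve time_space uno (res W) \<alpha> t x) \<noteq> \<infinity>"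
      by (rule evolve_bounded_finite[OF a(1) U uno_measurable _ fb]) (simp add: uno_def)
    ultimately show "(\<integral>\<^sup>+y. f y \<partial>\<alpha> (t, x)) + (\<integral>\<^sup>+y. f y \<partial>evolve time_space uno W \<alpha> t x)
      = (\<integral>\<^sup>+y. f y \<partial>evolve initial_space uno one ini t x) + (\<integral>\<^sup>+y. f y \<partial>evolve time_space uno one (gain \<alpha> \<beta>) t x)"
      by (simp add: ennreal_add_left_cancel)
  qed
qed

text \<open>The reverse of \<open>exp_sol_mild\<close>: the emission at rate \<open>vb\<close> is
  now damped by \<open>ee\<close>, and the undamped equation is inserted for the emitting kernel.
  The \<open>ee\<close> and \<open>ff\<close> parts of the emission add up to the undamped emission,
  so the latter equals the \<open>ff\<close> version of the right-hand side. Cancelling both leaves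
  the \<open>ee\<close> version, which is \<open>step\<close>.\<close>

lemma mild_exp_sol:
  assumes a: "nice \<alpha>" "nice \<beta>" "ok_rate W" and m: "mild \<beta> W \<alpha>"
  shows "exp_sol \<beta> W \<alpha>"
proof -
  note U = res_rate[OF a(3)]
  have M: "(\<integral>\<^sup>+y. f y \<partial>\<alpha> (t, x)) + (\<integral>\<^sup>+y. f y \<partial>evolve time_space uno vbr \<alpha> t x) = tot uno \<beta> (res W) \<alpha> t x f"
    if "0 < t" "t \<le> T" "f \<in> borel_measurable sizes" for t x f
    using m that unfolding mild_def tot_def vb_uno_res[OF a(1,3) that(3)] by (simp add: ac_simps)
  have sp: "borel_measurable time_space = (borel_measurable (borel \<Otimes>\<^sub>M borel) :: (real \<times> 'x \<Rightarrow> ennreal) set)"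
    using ok_index_time_space by (intro measurable_cong_sets) (auto simp: ok_index_def)
  have "(\<integral>\<^sup>+y. f y \<partial>\<alpha> (t, x)) = (\<integral>\<^sup>+y. f y \<partial>step \<beta> (res W) \<alpha> (t, x))"
    if t: "0 < t" "t \<le> T" and f: "f \<in> borel_measurable sizes" and fb: "\<And>y. f y \<le> of_nat n * indicator {0<..real n} y" for t x f n
  proof -
    let ?g = "\<lambda>\<tau> y. ennreal (vb y) * ee \<tau> y"
    let ?q = "\<lambda>u x' y. f y * (indicator {..<t} u * ?g (t - u) y * p (t - u) x' x y)"
    have g: "(\<lambda>(\<tau>, y). ?g \<tau> y) \<in> borel_measurable (borel \<Otimes>\<^sub>M sizes)"
      using ee_measurable by (simp add: case_prod_beta')
    have d: "(\<integral>\<^sup>+v. indicator {0<..<\<tau>} v * ?g (\<tau> - v) y * uno v y \<partial>lborel) = ff \<tau> y" if "0 < \<tau>" for \<tau> y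
      using ff_integral'[OF that] by (simp add: vbr_def)
    have q: "?q u x' \<in> borel_measurable sizes" for u x'
    proof -
      note [measurable] = f
      show ?thesis unfolding ee_def by measurable
    qed
    have "tot ff \<beta> (res W) \<alpha> t x f = (\<integral>\<^sup>+(u, x'). tot uno \<beta> (res W) \<alpha> u x' (?q u x') \<partial>time_space)"
      by (rule tot_compose[OF a(1,2) U uno_measurable g f d, symmetric])
    also have "\<dots> = (\<integral>\<^sup>+(u, x'). (\<integral>\<^sup>+y. ?q u x' y \<partial>\<alpha> (u, x')) + (\<integral>\<^sup>+y. ?q u x' y \<partial>evolve time_space uno vbr \<alpha> u x') \<partial>time_space)"
    proof (intro nn_integral_cong, clarify)
      fix u x'
      consider "u \<le> 0" | "0 < u" "u < t" | "t \<le> u" by linarith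
      then show "tot uno \<beta> (res W) \<alpha> u x' (?q u x') = (\<integral>\<^sup>+y. ?q u x' y \<partial>\<alpha> (u, x')) + (\<integral>\<^sup>+y. ?q u x' y \<partial>evolve time_space uno vbr \<alpha> u x')"
      proof cases
        case 1
        moreover have "(\<integral>\<^sup>+y. ?q u x' y \<partial>evolve time_space uno vbr \<alpha> u x') = 0"
          using evolve_null_time[OF a(1,2) vbr_rate uno_measurable q 1] by (simp add: tot_def)
        ultimately show ?thesis by (simp add: evolve_null_time[OF a(1,2) U uno_measurable q] nice_null[OF a(1)])
      next
        case 2
        then show ?thesis using t by (intro M[symmetric] q) auto
      next
        case 3
        then show ?thesis by (simp add: tot_def)
      qed
    qed
    also have "\<dots> = (\<integral>\<^sup>+(u, x'). (\<integral>\<^sup>+y. ?q u x' y \<partial>\<alpha> (u, x')) \<partial>time_space) + (\<integral>\<^sup>+(u, x'). (\<integral>\<^sup>+y. ?q u x' y \<partial>evolve time_space uno vbr \<alpha> u x') \<partial>time_space)"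
      unfolding case_prod_beta'
    proof (rule nn_integral_add)
      show "(\<lambda>z. \<integral>\<^sup>+y. ?q (fst z) (snd z) y \<partial>evolve time_space uno vbr \<alpha> (fst z) (snd z)) \<in> borel_measurable time_space"
        using evolve_time_measurable[OF ok_sources(2)[OF uno_measurable a(1) vbr_rate] f g] by (simp add: sp)
      have "(\<lambda>z. \<integral>\<^sup>+y. f y * (indicator {..<t} (fst z) * ee (t - fst z) y * vbr (fst z, snd z) y * p (t - fst z) (snd z) x y) \<partial>\<alpha> (fst z, snd z)) \<in> borel_measurable time_space"
        using f unfolding sp by (intro evolve_density_measurable[OF ok_sources(2)[OF ee_measurable a(1) vbr_rate]]) auto
      then show "(\<lambda>z. \<integral>\<^sup>+y. ?q (fst z) (snd z) y \<partial>\<alpha> (fst z, snd z)) \<in> borel_measurable time_space"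
        by (simp add: vbr_def ac_simps)
    qed
    also have "\<dots> = (\<integral>\<^sup>+y. f y \<partial>evolve time_space ee vbr \<alpha> t x) + (\<integral>\<^sup>+y. f y \<partial>evolve time_space ff vbr \<alpha> t x)"
    proof -
      have "(\<integral>\<^sup>+(u, x'). (\<integral>\<^sup>+y. ?q u x' y \<partial>evolve time_space uno vbr \<alpha> u x') \<partial>time_space) = (\<integral>\<^sup>+y. f y \<partial>evolve time_space ff vbr \<alpha> t x)"
        by (rule evolve_compose[OF ok_sources(2)[OF uno_measurable a(1) vbr_rate] ok_sources(2)[OF ff_measurable a(1) vbr_rate] g f]) (rule d)
      then show ?thesis unfolding evolve_vbr_eq[OF a(1) ee_measurable f] by simp
    qed
    also have "\<dots> = (\<integral>\<^sup>+y. f y \<partial>evolve time_space uno vbr \<alpha> t x)"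
      by (rule nn_integral_evolve_add[OF ok_sources(2)[OF uno_measurable a(1) vbr_rate] ok_sources(2)[OF ee_measurable a(1) vbr_rate]
          ok_sources(2)[OF ff_measurable a(1) vbr_rate] f, symmetric]) (simp add: uno_def ee_ff flip: distrib_right)
    finally have L: "tot ff \<beta> (res W) \<alpha> t x f = (\<integral>\<^sup>+y. f y \<partial>evolve time_space uno vbr \<alpha> t x)" .
    have "(\<integral>\<^sup>+y. f y \<partial>evolve time_space uno vbr \<alpha> t x) \<noteq> \<infinity>"
      by (rule evolve_bounded_finite[OF a(1) vbr_rate uno_measurable _ fb]) (simp add: uno_def)
    then have "(\<integral>\<^sup>+y. f y \<partial>\<alpha> (t, x)) = tot ee \<beta> (res W) \<alpha> t x f"
      using M[OF t f, of x] unfolding tot_add[OF a(1,2) U f] L by (simp add: add.commute ennreal_add_left_cancel)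
    then show ?thesis unfolding nn_integral_step[OF t f] tot_def .
  qed
  then have "(\<integral>\<^sup>+y. f y \<partial>\<alpha> (t, x)) + (\<integral>\<^sup>+y. f y \<partial>null_measure sizes) = (\<integral>\<^sup>+y. f y \<partial>step \<beta> (res W) \<alpha> (t, x)) + (\<integral>\<^sup>+y. f y \<partial>null_measure sizes)"
    if t: "0 < t" "t \<le> T" and f: "f \<in> borel_measurable sizes" for t x f
    using t by (intro eq_extend[OF nice_sets[OF a(1)] _ sets_step _ _ f]) auto
  from this[OF _ _ borel_measurable_indicator]
  have "step \<beta> (res W) \<alpha> (t, x) = \<alpha> (t, x)" if t: "0 < t" "t \<le> T" for t x
    using t by (intro measure_eqI) (auto simp: nice_sets[OF a(1)])
  moreover have "step \<beta> (res W) \<alpha> (t, x) = \<alpha> (t, x)" if "\<not> (0 < t \<and> t \<le> T)" for t x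
    using that by (auto simp: step_def nice_null[OF a(1)])
  ultimately have "step \<beta> (res W) \<alpha> = \<alpha>" by (auto simp: fun_eq_iff)
  with a show ?thesis by (simp add: exp_sol_def)
qed

end

section \<open>Moment bounds\<close>

text \<open>Half of \<open>S\<close> is absorbed into the left side. Finiteness of \<open>S\<close>
  has to be known beforehand, and truncation provides it in all applications.\<close>

lemma ennreal_absorb:
  fixes S A a :: ennreal
  assumes "S \<le> A + a * S" "a \<le> ennreal (1/2)" "S < \<infinity>"
  shows "S \<le> 2 * A"
proof (cases "A = \<infinity>")
  case False
  obtain s where s: "S = ennreal s" "0 \<le> s" using assms(3) by (cases S) auto
  obtain b where b: "A = ennreal b" "0 \<le> b" using False by (cases A) auto
  have "S \<le> A + ennreal (1/2) * S" using assms by (meson add_left_mono mult_right_mono order_trans zero_le)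
  then have "ennreal s \<le> ennreal b + ennreal (1/2) * ennreal s" by (simp only: s b)
  then have "ennreal s \<le> ennreal (b + 1/2 * s)"
  proof -
    have "ennreal (b + 1/2 * s) = ennreal b + ennreal (1/2 * s)" using s(2) b(2) by (intro ennreal_plus) auto
    also have "ennreal (1/2 * s) = ennreal (1/2) * ennreal s" by (rule ennreal_mult') simp
    finally show ?thesis using \<open>ennreal s \<le> ennreal b + ennreal (1/2) * ennreal s\<close> by simp
  qed
  then have "s \<le> b + 1/2 * s" using s b by (subst (asm) ennreal_le_iff) auto
  then have "ennreal s \<le> ennreal (2 * b)" by (intro ennreal_leI) simp
  then show ?thesis using s b by (simp add: ennreal_mult)
qed (simp add: ennreal_mult_top)

context coag
begin

text \<open>The moment inequalities are also applied to arbitrary solutions, whose loss rates are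
  not yet known to lie below \<open>vb\<close> as \<open>ok_rate\<close> demands.\<close>

definition meas_rate :: "'x rate \<Rightarrow> bool" where
  "meas_rate W \<longleftrightarrow> (\<lambda>(z, y). W z y) \<in> borel_measurable (borel \<Otimes>\<^sub>M sizes)"

lemma ok_rate_meas: "ok_rate W \<Longrightarrow> meas_rate W"
  by (simp add: ok_rate_def meas_rate_def)

lemma ok_source_meas:
  "(\<lambda>(\<tau>, y). c \<tau> y) \<in> borel_measurable (borel \<Otimes>\<^sub>M sizes) \<Longrightarrow> nice \<alpha> \<Longrightarrow> meas_rate W \<Longrightarrow> ok_source time_space c W \<alpha>"
  using ok_index_time_space nice_lfk by (auto simp: ok_source_def meas_rate_def)

text \<open>These are contributions up to time \<open>t\<close> that are observed only after diffusing until \<open>\<rho>\<close>, or for a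
  further time \<open>r\<close>. The moment bounds need all \<open>r \<ge> 0\<close>, because gains at time \<open>s\<close> enter diffused by \<open>t - s\<close>.\<close>

definition flow where
  "flow N W \<kappa> f t \<rho> x = (\<integral>\<^sup>+(s, x'). \<integral>\<^sup>+y. f y *
     (indicator {..<t} s * uno (t - s) y * W (s, x') y * p (\<rho> - s) x' x y) \<partial>\<kappa> (s, x') \<partial>N)"

definition observe where
  "observe \<alpha> f t r x = (if r = 0 then (\<integral>\<^sup>+y. f y \<partial>\<alpha> (t, x)) else (\<integral>\<^sup>+x'. \<integral>\<^sup>+y. f y * p r x' x y \<partial>\<alpha> (t, x') \<partial>lborel))"

lemma flow_evolve:
  assumes ok: "ok_source N uno W \<kappa>" and f: "f \<in> borel_measurable sizes" and r: "0 \<le> r"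
  shows "flow N W \<kappa> f t (t + r) x = (if r = 0 then (\<integral>\<^sup>+y. f y \<partial>evolve N uno W \<kappa> t x)
     else (\<integral>\<^sup>+x'. \<integral>\<^sup>+y. f y * p r x' x y \<partial>evolve N uno W \<kappa> t x' \<partial>lborel))"
  using r by (simp add: flow_def nn_integral_evolve[OF ok f] evolve_space[OF ok f])

lemma kernel_param_measurable:
  assumes "locally_finite_kernel (\<kappa> :: 'x kernel)" "(\<lambda>(x, y). f x y) \<in> borel_measurable (borel \<Otimes>\<^sub>M sizes)"
  shows "(\<lambda>x. \<integral>\<^sup>+y. f x y \<partial>\<kappa> (t, x)) \<in> borel_measurable borel"
  by (rule lfk_integral_measurable[OF assms(1) _ assms(2)]) measurable

lemma evolve_param_measurable:
  assumes ok: "ok_source N c W \<kappa>" and f: "(\<lambda>(x, y). f x y) \<in> borel_measurable (borel \<Otimes>\<^sub>M sizes)"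
  shows "(\<lambda>x'. \<integral>\<^sup>+y. f x' y \<partial>evolve N c W \<kappa> t x') \<in> borel_measurable borel"
proof -
  interpret N: sigma_finite_measure N by (rule ok_sourceD(2)[OF ok])
  note [measurable_cong] = ok_sourceD(1)[OF ok]
  have [measurable (raw)]: "a \<in> borel_measurable M \<Longrightarrow> h \<in> M \<rightarrow>\<^sub>M sizes \<Longrightarrow> (\<lambda>m. f (a m) (h m)) \<in> borel_measurable M"
    for a h and M :: "'b measure"
    using measurable_compose[OF measurable_Pair f] by simp
  have f1: "f x' \<in> borel_measurable sizes" for x' by measurable
  have "(\<lambda>m. \<integral>\<^sup>+y. f (fst m) y * (indicator {..<t} (fst (snd m)) * c (t - fst (snd m)) y *
      W (fst (snd m), snd (snd m)) y * p (t - fst (snd m)) (snd (snd m)) (fst m) y) \<partial>\<kappa> (fst (snd m), snd (snd m)))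
    \<in> borel_measurable (borel \<Otimes>\<^sub>M N)"
    by (rule evolve_density_measurable[OF ok]) measurable
  then show ?thesis
    unfolding nn_integral_evolve[OF ok f1] case_prod_beta'
    by (intro N.borel_measurable_nn_integral) (simp add: case_prod_beta')
qed

text \<open>Integrating the mild equation against \<open>p r\<close> and applying
  \<open>evolve_space\<close> replaces the diffusion time \<open>t - s\<close> by
  \<open>t + r - s\<close>, while still only emissions before \<open>t\<close> count.\<close>

lemma mild_flow:
  assumes a: "nice \<alpha>" "nice \<beta>" "meas_rate W" and m: "mild \<beta> W \<alpha>" and t: "0 < t" "t \<le> T" and r: "0 \<le> r"
    and f: "f \<in> borel_measurable sizes"
  shows "observe \<alpha> f t r x + flow time_space W \<alpha> f t (t + r) x = flow initial_space one ini f t (t + r) x + flow time_space one (gain \<alpha> \<beta>) f t (t + r) x"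
proof -
  note oks = ok_sources(1)[OF uno_measurable] ok_source_meas[OF uno_measurable a(1,3)] ok_sources(3)[OF uno_measurable a(1,2)]
  note fl = flow_evolve[OF oks(1) f r] flow_evolve[OF oks(2) f r] flow_evolve[OF oks(3) f r]
  have M: "(\<integral>\<^sup>+y. q y \<partial>\<alpha> (t, x)) + (\<integral>\<^sup>+y. q y \<partial>evolve time_space uno W \<alpha> t x)
     = (\<integral>\<^sup>+y. q y \<partial>evolve initial_space uno one ini t x) + (\<integral>\<^sup>+y. q y \<partial>evolve time_space uno one (gain \<alpha> \<beta>) t x)"
    if "q \<in> borel_measurable sizes" for q x
    using m t that by (simp add: mild_def)
  show ?thesis
  proof (cases "r = 0")
    case True
    show ?thesis unfolding fl observe_def using M[OF f] True by simp
  next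
    case False
    note [measurable] = f
    let ?q = "\<lambda>x' y. f y * p r x' x y"
    have q: "?q x' \<in> borel_measurable sizes" "(\<lambda>(x', y). ?q x' y) \<in> borel_measurable (borel \<Otimes>\<^sub>M sizes)" for x'
      by measurable
    have "(\<integral>\<^sup>+x'. (\<integral>\<^sup>+y. ?q x' y \<partial>\<alpha> (t, x')) + (\<integral>\<^sup>+y. ?q x' y \<partial>evolve time_space uno W \<alpha> t x') \<partial>lborel)
       = (\<integral>\<^sup>+x'. (\<integral>\<^sup>+y. ?q x' y \<partial>evolve initial_space uno one ini t x') + (\<integral>\<^sup>+y. ?q x' y \<partial>evolve time_space uno one (gain \<alpha> \<beta>) t x') \<partial>lborel)"
      by (intro nn_integral_cong M q)
    then show ?thesis using False unfolding fl observe_def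
      using kernel_param_measurable[OF nice_lfk[OF a(1)] q(2)] oks[THEN evolve_param_measurable, OF q(2)]
      by (simp add: nn_integral_add)
  qed
qed

lemma mild_total:
  assumes a: "nice \<alpha>" "nice \<beta>" "meas_rate W" and m: "mild \<beta> W \<alpha>" and t: "0 < t" "t \<le> T"
    and f: "f \<in> borel_measurable sizes"
  shows "(\<integral>\<^sup>+x. \<integral>\<^sup>+y. f y \<partial>\<alpha> (t, x) \<partial>lborel) + (\<integral>\<^sup>+(s, x'). \<integral>\<^sup>+y. f y * (indicator {..<t} s * W (s, x') y) \<partial>\<alpha> (s, x') \<partial>time_space)
    = (\<integral>\<^sup>+x. \<integral>\<^sup>+y. f y \<partial>evolve initial_space uno one ini t x \<partial>lborel)
      + (\<integral>\<^sup>+(s, x'). \<integral>\<^sup>+y. f y * indicator {..<t} s \<partial>gain \<alpha> \<beta> (s, x') \<partial>time_space)"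
proof -
  note oks = ok_sources(1)[OF uno_measurable] ok_source_meas[OF uno_measurable a(1,3)] ok_sources(3)[OF uno_measurable a(1,2)]
  have M: "(\<integral>\<^sup>+y. f y \<partial>\<alpha> (t, x)) + (\<integral>\<^sup>+y. f y \<partial>evolve time_space uno W \<alpha> t x)
     = (\<integral>\<^sup>+y. f y \<partial>evolve initial_space uno one ini t x) + (\<integral>\<^sup>+y. f y \<partial>evolve time_space uno one (gain \<alpha> \<beta>) t x)" for x
    using m t f by (simp add: mild_def)
  have q: "(\<lambda>(x', y). f y) \<in> borel_measurable ((borel :: 'x measure) \<Otimes>\<^sub>M sizes)" using f by simp
  have "(\<integral>\<^sup>+x. (\<integral>\<^sup>+y. f y \<partial>\<alpha> (t, x)) + (\<integral>\<^sup>+y. f y \<partial>evolve time_space uno W \<alpha> t x) \<partial>lborel)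
       = (\<integral>\<^sup>+x. (\<integral>\<^sup>+y. f y \<partial>evolve initial_space uno one ini t x) + (\<integral>\<^sup>+y. f y \<partial>evolve time_space uno one (gain \<alpha> \<beta>) t x) \<partial>lborel)"
    by (intro nn_integral_cong M)
  then show ?thesis
    using kernel_param_measurable[OF nice_lfk[OF a(1)] q] oks[THEN evolve_param_measurable, OF q]
      evolve_total[OF oks(2) f] evolve_total[OF oks(3) f]
    by (simp add: nn_integral_add uno_def)
qed

lemma nn_integral_gain:
  assumes "nice \<alpha>" "nice \<beta>" "f \<in> borel_measurable sizes"
  shows "(\<integral>\<^sup>+y. f y \<partial>gain \<alpha> \<beta> z) = (\<integral>\<^sup>+y. \<integral>\<^sup>+y'. f (y + y') * kk y y' \<partial>\<beta> z \<partial>\<alpha> z)"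
  by (rule nn_integral_gain_kernel[OF nice_lfk[OF assms(1)] nice_lfk[OF assms(2)] kk_measurable' assms(3)])

definition rate :: "'x kernel \<Rightarrow> 'x rate" where
  "rate \<beta> z y = (\<integral>\<^sup>+y'. k y y' \<partial>\<beta> z)"

lemma rate_measurable:
  assumes "nice \<beta>" shows "meas_rate (rate \<beta>)"
  unfolding meas_rate_def rate_def case_prod_beta'
  by (rule lfk_integral_measurable[OF nice_lfk[OF assms]]) measurable

text \<open>The hypothesis \<open>br\<close> compares the merged particle with its larger partner
  alone. Its first term sums up to at most the loss of that partner, because
  \<open>kk \<le> k\<close> and \<open>rate \<beta> \<le> W\<close>. After cancellation with the
  loss only the excess \<open>c * f y * h y'\<close> survives, a product of two moments.\<close>

lemma gain_le:
  assumes a: "nice \<alpha>" "nice \<beta>" "meas_rate W" and W: "\<And>y. 0 < y \<Longrightarrow> rate \<beta> z y \<le> W z y"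
    and f: "f \<in> borel_measurable sizes" and h: "h \<in> borel_measurable sizes"
    and br: "\<And>y y'. 0 < y \<Longrightarrow> 0 < y' \<Longrightarrow> f (y + y') * kk y y' \<le> f y * kk y y' + c * f y * h y'"
  shows "(\<integral>\<^sup>+y. f y \<partial>gain \<alpha> \<beta> z) \<le> (\<integral>\<^sup>+y. f y * W z y \<partial>\<alpha> z) + c * (\<integral>\<^sup>+y. h y \<partial>\<beta> z) * (\<integral>\<^sup>+y. f y \<partial>\<alpha> z)"
proof -
  note [measurable] = f h and [measurable_cong] = nice_sets[OF a(1)] nice_sets[OF a(2)]
  have [measurable]: "W z \<in> borel_measurable sizes"
    using measurable_compose[OF measurable_Pair1' a(3)[unfolded meas_rate_def], of z] by simp
  have sp: "space (\<beta> z) = {0<..}" "space (\<alpha> z) = {0<..}" using lfk_space nice_lfk a by auto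
  have "(\<integral>\<^sup>+y. f y \<partial>gain \<alpha> \<beta> z) = (\<integral>\<^sup>+y. \<integral>\<^sup>+y'. f (y + y') * kk y y' \<partial>\<beta> z \<partial>\<alpha> z)"
    by (rule nn_integral_gain[OF a(1,2) f])
  also have "\<dots> \<le> (\<integral>\<^sup>+y. f y * W z y + c * (\<integral>\<^sup>+y. h y \<partial>\<beta> z) * f y \<partial>\<alpha> z)"
  proof (rule nn_integral_mono)
    fix y assume "y \<in> space (\<alpha> z)"
    then have y: "0 < y" and [measurable]: "y \<in> space sizes" by (simp_all add: sp space_sizes)
    have "(\<integral>\<^sup>+y'. f (y + y') * kk y y' \<partial>\<beta> z) \<le> (\<integral>\<^sup>+y'. f y * k y y' + c * f y * h y' \<partial>\<beta> z)"
      using y by (intro nn_integral_mono order_trans[OF br] add_right_mono mult_left_mono kk_le_k) (auto simp: sp)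
    also have "\<dots> = f y * rate \<beta> z y + c * f y * (\<integral>\<^sup>+y. h y \<partial>\<beta> z)"
      unfolding rate_def by (subst nn_integral_add) (auto simp: nn_integral_cmult)
    also have "\<dots> \<le> f y * W z y + c * (\<integral>\<^sup>+y. h y \<partial>\<beta> z) * f y"
      using W[OF y] by (intro add_mono mult_left_mono) (auto simp: ac_simps)
    finally show "(\<integral>\<^sup>+y'. f (y + y') * kk y y' \<partial>\<beta> z) \<le> f y * W z y + c * (\<integral>\<^sup>+y. h y \<partial>\<beta> z) * f y" .
  qed
  also have "\<dots> = (\<integral>\<^sup>+y. f y * W z y \<partial>\<alpha> z) + c * (\<integral>\<^sup>+y. h y \<partial>\<beta> z) * (\<integral>\<^sup>+y. f y \<partial>\<alpha> z)"
    by (simp add: nn_integral_add nn_integral_cmult)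
  finally show ?thesis .
qed

section \<open>Excess of a weight under an ordered coagulation\<close>

lemma kk_support: "kk y y' \<noteq> 0 \<Longrightarrow> \<delta> \<le> y' \<and> y' \<le> y"
  using kk_eq_0[of y y'] by fastforce

lemma kk_bound:
  assumes "0 < y" "0 < y'" shows "kk y y' \<le> ennreal (C * (y powr (2/3) * y' powr (2/3)))"
  using kk_le_k k_bound[OF assms] by (rule order_trans)

lemma p_add:
  assumes "0 < \<tau>" "0 < y'" "y' \<le> y"
  shows "p \<tau> x' x (y + y') \<le> ennreal ((y + y') / y) * p \<tau> x' x y"
proof -
  have "ennreal y * p \<tau> x' x (y + y') \<le> ennreal (y + y') * p \<tau> x' x y" using assms by (intro p_mono) auto
  then have "ennreal (1 / y) * (ennreal y * p \<tau> x' x (y + y')) \<le> ennreal (1 / y) * (ennreal (y + y') * p \<tau> x' x y)"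
    by (rule mult_left_mono) simp
  moreover have "ennreal (1 / y) * ennreal y = 1" "ennreal (1 / y) * ennreal (y + y') = ennreal ((y + y') / y)"
    using assms by (simp_all del: ennreal_plus flip: ennreal_mult)
  ultimately show ?thesis by (simp only: mult.assoc[symmetric] mult_1)
qed

text \<open>With u = y'/y at most 1, (1 + u)^(7/3) is at most (1 + u)^3 = 1 + 3u + 3u^2 + u^3, which
  is at most 1 + 7u. This is the origin of the factor 7.\<close>

lemma bracket_real:
  fixes y y' :: real
  assumes "0 < y'" "y' \<le> y"
  shows "(y + y') powr (4/3) * ((y + y') / y) \<le> y powr (4/3) * (1 + 7 * (y' / y))"
proof -
  define u where "u = y' / y"
  have u: "0 < u" "u \<le> 1" using assms by (auto simp: u_def)
  have "(1 + u) powr (4/3) \<le> (1 + u) powr 2" using u by (intro powr_mono) auto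
  also have "\<dots> = (1 + u)\<^sup>2" using u by (simp add: powr_numeral)
  finally have "(1 + u) powr (4/3) * (1 + u) \<le> (1 + u)\<^sup>2 * (1 + u)" using u by simp
  also have "\<dots> \<le> 1 + 7 * u"
  proof -
    have "u * u \<le> u" "u * u * u \<le> u" using u by (auto simp: mult_le_one mult_left_le_one_le mult_right_le_one_le intro: mult_left_le)
    then show ?thesis by (simp add: power2_eq_square algebra_simps)
  qed
  finally have "(1 + u) powr (4/3) * (1 + u) \<le> 1 + 7 * u" .
  then have "y powr (4/3) * ((1 + u) powr (4/3) * (1 + u)) \<le> y powr (4/3) * (1 + 7 * u)"
    by (rule mult_left_mono) simp
  moreover have "(y + y') powr (4/3) = y powr (4/3) * (1 + u) powr (4/3)"
  proof -
    have "y + y' = y * (1 + u)" using assms by (simp add: u_def field_simps)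
    then show ?thesis using assms u by (simp only: powr_mult)
  qed
  moreover have "(y + y') / y = 1 + u" using assms by (simp add: u_def field_simps)
  ultimately show ?thesis by (simp add: u_def mult.assoc)
qed

text \<open>The two sides differ by the factor (y'/y)^(1/3). A relative excess y'/y is thus traded
  for phi(y'), in spite of the growth of the coagulation kernel in \<open>y\<close>.\<close>

lemma powr_swap:
  fixes y y' :: real
  assumes "0 < y'" "y' \<le> y"
  shows "(y' / y) * (y powr (2/3) * y' powr (2/3)) \<le> y' powr (4/3)"
proof -
  have "(y' / y) * (y powr (2/3) * y' powr (2/3)) = y' powr (4/3) * (y' / y) powr (1/3)"
  proof -
    have 1: "y' / y * (y powr (2/3)) = y' * y powr (- (1/3))"
      using assms powr_add[of y "-1" "2/3"] by (simp add: powr_minus field_simps)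
    have 2: "(y' / y) powr (1/3) = y' powr (1/3) * y powr (- (1/3))"
      using assms by (simp add: powr_divide powr_minus field_simps)
    have 3: "y' * y' powr (2/3) = y' powr (4/3) * y' powr (1/3)"
      using assms powr_add[of y' 1 "2/3"] powr_add[of y' "4/3" "1/3"] by simp
    have "(y' / y) * (y powr (2/3) * y' powr (2/3)) = (y' / y * (y powr (2/3))) * y' powr (2/3)" by (rule mult.assoc[symmetric])
    also have "\<dots> = (y' * y' powr (2/3)) * y powr (- (1/3))" unfolding 1 by (simp only: ac_simps)
    also have "\<dots> = y' powr (4/3) * (y' / y) powr (1/3)" unfolding 2 3 by (simp only: ac_simps)
    finally show ?thesis .
  qed
  also have "\<dots> \<le> y' powr (4/3) * 1"
  proof (rule mult_left_mono)
    show "(y' / y) powr (1/3) \<le> 1" using assms powr_mono2[of "1/3" "y' / y" 1] by simp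
  qed simp
  finally show ?thesis by simp
qed

text \<open>The weight contributes (1 + y'/y)^(4/3) and the heat kernel, by \<open>p_add\<close>,
  one more factor 1 + y'/y. Of the resulting 1 + 7y'/y the 1 is covered by the loss, and
  \<open>powr_swap\<close> handles the rest. The cut at \<open>R\<close> is harmless: if the sum is
  at most \<open>R\<close>, so are both partners.\<close>

lemma bracket_phi:
  fixes R :: real
  assumes y: "0 < y" "0 < y'" and \<tau>: "0 < \<tau>"
  defines "f \<equiv> \<lambda>y. phi y * indicator {0<..R} y"
  shows "f (y + y') * p \<tau> x' x (y + y') * kk y y' \<le> f y * p \<tau> x' x y * kk y y' + ennreal (7 * C) * (f y * p \<tau> x' x y) * f y'"
proof (cases "kk y y' = 0 \<or> R < y + y'")
  case True
  then show ?thesis by (auto simp: f_def)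
next
  case False
  then have yy: "\<delta> \<le> y'" "y' \<le> y" "y + y' \<le> R" using kk_support by auto
  let ?K = "ennreal (C * (y powr (2/3) * y' powr (2/3)))"
  have "ennreal (7 * (y' / y)) * kk y y' \<le> ennreal (7 * (y' / y)) * ?K" by (intro mult_left_mono kk_bound y) simp
  also have "\<dots> = ennreal (7 * C * ((y' / y) * (y powr (2/3) * y' powr (2/3))))"
    using y pos by (subst ennreal_mult[symmetric]) (auto simp: ac_simps)
  also have "\<dots> \<le> ennreal (7 * C * y' powr (4/3))"
    using powr_swap[OF y(2) yy(2)] pos by (intro ennreal_leI mult_left_mono) auto
  also have "\<dots> = ennreal (7 * C) * phi y'" using pos by (simp add: phi_def ennreal_mult)
  finally have K: "ennreal (7 * (y' / y)) * kk y y' \<le> ennreal (7 * C) * phi y'" .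
  have "f (y + y') * p \<tau> x' x (y + y') * kk y y' \<le> phi (y + y') * (ennreal ((y + y') / y) * p \<tau> x' x y) * kk y y'"
    using yy y \<tau> unfolding f_def by (intro mult_right_mono mult_mono p_add) auto
  also have "\<dots> = (phi (y + y') * ennreal ((y + y') / y)) * p \<tau> x' x y * kk y y'" by (simp add: mult.assoc)
  also have "\<dots> \<le> (phi y * ennreal (1 + 7 * (y' / y))) * p \<tau> x' x y * kk y y'"
  proof (intro mult_right_mono)
    have "phi (y + y') * ennreal ((y + y') / y) = ennreal ((y + y') powr (4/3) * ((y + y') / y))"
      unfolding phi_def using y by (intro ennreal_mult[symmetric]) auto
    also have "\<dots> \<le> ennreal (y powr (4/3) * (1 + 7 * (y' / y)))" by (rule ennreal_leI[OF bracket_real[OF y(2) yy(2)]])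
    also have "\<dots> = phi y * ennreal (1 + 7 * (y' / y))"
      unfolding phi_def using y by (intro ennreal_mult) auto
    finally show "phi (y + y') * ennreal ((y + y') / y) \<le> phi y * ennreal (1 + 7 * (y' / y))" .
  qed auto
  also have "\<dots> = phi y * p \<tau> x' x y * kk y y' + (phi y * p \<tau> x' x y) * (ennreal (7 * (y' / y)) * kk y y')"
    using y by (subst ennreal_plus) (auto simp: algebra_simps)
  also have "\<dots> \<le> phi y * p \<tau> x' x y * kk y y' + phi y * p \<tau> x' x y * (ennreal (7 * C) * phi y')"
    by (intro add_left_mono mult_left_mono K) simp
  finally have "f (y + y') * p \<tau> x' x (y + y') * kk y y' \<le> phi y * p \<tau> x' x y * kk y y' + phi y * p \<tau> x' x y * (ennreal (7 * C) * phi y')" .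
  moreover have "f y = phi y" "f y' = phi y'" using y yy by (auto simp: f_def)
  ultimately show ?thesis by (simp add: ac_simps)
qed

lemma bracket_mass:
  fixes R :: real
  assumes y: "0 < y" "0 < y'"
  defines "f \<equiv> \<lambda>y. ennreal y * indicator {0<..R} y"
  shows "f (y + y') * kk y y' \<le> f y * kk y y' + ennreal C * f y * phi y'"
proof (cases "kk y y' = 0 \<or> R < y + y'")
  case True
  then show ?thesis by (auto simp: f_def)
next
  case False
  then have yy: "\<delta> \<le> y'" "y' \<le> y" "y + y' \<le> R" using kk_support by auto
  let ?K = "ennreal (C * (y powr (2/3) * y' powr (2/3)))"
  have "ennreal y' * kk y y' \<le> ennreal y' * ?K" by (intro mult_left_mono kk_bound y) simp
  also have "\<dots> = ennreal (C * y * ((y' / y) * (y powr (2/3) * y' powr (2/3))))"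
    using y pos by (subst ennreal_mult[symmetric]) (auto simp: field_simps)
  also have "\<dots> \<le> ennreal (C * y * y' powr (4/3))"
    using powr_swap[OF y(2) yy(2)] pos y by (intro ennreal_leI mult_left_mono) auto
  also have "\<dots> = ennreal C * ennreal y * phi y'" using pos y by (simp add: phi_def ennreal_mult)
  finally have K: "ennreal y' * kk y y' \<le> ennreal C * ennreal y * phi y'" .
  have "f (y + y') * kk y y' = ennreal y * kk y y' + ennreal y' * kk y y'"
    using y yy by (simp add: f_def distrib_right)
  also have "\<dots> \<le> ennreal y * kk y y' + ennreal C * ennreal y * phi y'" by (intro add_left_mono K)
  finally have "f (y + y') * kk y y' \<le> ennreal y * kk y y' + ennreal C * ennreal y * phi y'" .
  moreover have "f y = ennreal y" using y yy by (auto simp: f_def)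
  ultimately show ?thesis by simp
qed

lemma flow_measurable:
  assumes ok: "ok_source N uno W \<kappa>" and f: "f \<in> borel_measurable sizes" and t: "t \<le> \<rho>"
  shows "(\<lambda>z. \<integral>\<^sup>+y. f y * (indicator {..<t} (fst z) * uno (t - fst z) y * W z y * p (\<rho> - fst z) (snd z) x y) \<partial>\<kappa> z) \<in> borel_measurable (borel \<Otimes>\<^sub>M borel)"
proof -
  note [measurable] = f
  have eq: "f y * (indicator {..<t} (fst z) * uno (t - fst z) y * W z y * p (\<rho> - fst z) (snd z) x y)
    = (f y * indicator {..<t} (fst z)) * (indicator {..<\<rho>} (fst z) * uno (\<rho> - fst z) y * W (fst z, snd z) y * p (\<rho> - fst z) (snd z) x y)" for z y
    using t by (auto simp: uno_def split: split_indicator)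
  have "(\<lambda>z. \<integral>\<^sup>+y. (f y * indicator {..<t} (fst z)) * (indicator {..<\<rho>} (fst z) * uno (\<rho> - fst z) y * W (fst z, snd z) y * p (\<rho> - fst z) (snd z) x y) \<partial>\<kappa> (fst z, snd z)) \<in> borel_measurable (borel \<Otimes>\<^sub>M borel)"
    unfolding indicator_if[of t] by (rule evolve_density_measurable[OF ok]) measurable
  then show ?thesis unfolding eq by simp
qed

lemma flow_le_evolve:
  assumes ok: "ok_source N uno W \<kappa>" and f: "f \<in> borel_measurable sizes" and t: "t \<le> \<rho>"
  shows "flow N W \<kappa> f t \<rho> x \<le> (\<integral>\<^sup>+y. f y \<partial>evolve N uno W \<kappa> \<rho> x)"
  unfolding nn_integral_evolve[OF ok f] flow_def using t
  by (intro nn_integral_mono) (auto simp: uno_def intro!: nn_integral_mono mult_left_mono mult_right_mono split: split_indicator)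

section \<open>Inequalities for truncated moments\<close>

definition cut_phi :: "real \<Rightarrow> real \<Rightarrow> ennreal" where "cut_phi R y = phi y * indicator {0<..R} y"
definition cut_id :: "real \<Rightarrow> real \<Rightarrow> ennreal" where "cut_id R y = ennreal y * indicator {0<..R} y"

lemma cut_measurable [measurable]: "cut_phi R \<in> borel_measurable sizes" "cut_id R \<in> borel_measurable sizes"
  unfolding cut_phi_def cut_id_def by measurable

lemma flow_initial_phi:
  assumes "0 < t" "t \<le> \<rho>"
  shows "flow initial_space one ini (cut_phi R) t \<rho> x \<le> ennreal g0"
proof -
  have "flow initial_space one ini (cut_phi R) t \<rho> x \<le> (\<integral>\<^sup>+y. cut_phi R y \<partial>evolve initial_space uno one ini \<rho> x)"
    by (intro flow_le_evolve ok_sources(1) uno_measurable assms) measurable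
  also have "\<dots> = (\<integral>\<^sup>+x'. \<integral>\<^sup>+y. cut_phi R y * (uno \<rho> y * p \<rho> x' x y) \<partial>\<mu>0 x' \<partial>lborel)"
    using assms by (intro nn_integral_evolve_initial uno_measurable) auto
  also have "\<dots> \<le> (\<integral>\<^sup>+x'. \<integral>\<^sup>+y. phi y * p \<rho> x' x y \<partial>\<mu>0 x' \<partial>lborel)"
    by (intro nn_integral_mono) (auto simp: cut_phi_def uno_def split: split_indicator)
  also have "\<dots> \<le> ennreal g0" using assms by (intro \<mu>0_phi) simp
  finally show ?thesis .
qed

lemma nice_zero: "nice \<alpha> \<Longrightarrow> s \<le> 0 \<Longrightarrow> (\<integral>\<^sup>+y. f y \<partial>\<alpha> (s, x)) = 0"
  by (simp add: nice_null)

lemma moment_phi: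
  assumes a: "nice \<alpha>" "nice \<beta>" "meas_rate W" and m: "mild \<beta> W \<alpha>" and W: "\<And>z y. 0 < y \<Longrightarrow> rate \<beta> z y \<le> W z y"
    and t: "0 < t" "t \<le> T" and r: "0 \<le> r"
    and fin: "flow time_space W \<alpha> (cut_phi R) t (t + r) x < \<infinity>"
    and b: "\<And>s x'. 0 < s \<Longrightarrow> s < t \<Longrightarrow> (\<integral>\<^sup>+y. cut_phi R y \<partial>\<beta> (s, x')) \<le> b s"
    and h: "\<And>s. 0 < s \<Longrightarrow> s < t \<Longrightarrow> observe \<alpha> (cut_phi R) s (t + r - s) x \<le> h s"
  shows "observe \<alpha> (cut_phi R) t r x \<le> ennreal g0 + (\<integral>\<^sup>+s. indicator {0<..<t} s * (ennreal (7 * C) * b s * h s) \<partial>lborel)"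
proof -
  note oks = ok_source_meas[OF uno_measurable a(1,3)] ok_sources(3)[OF uno_measurable a(1,2)]
  let ?f = "cut_phi R" and ?P = "\<lambda>z y. p (t + r - fst z) (snd z) x y"
  let ?ext = "\<lambda>z. indicator {..<t} (fst z) * (ennreal (7 * C) * (\<integral>\<^sup>+y. ?f y \<partial>\<beta> z) * (\<integral>\<^sup>+y. ?f y * ?P z y \<partial>\<alpha> z))"
  have [measurable]: "(\<lambda>z. \<integral>\<^sup>+y. ?f y \<partial>\<beta> z) \<in> borel_measurable (borel \<Otimes>\<^sub>M borel)"
    by (rule lfk_integral_measurable[OF nice_lfk[OF a(2)]]) (auto simp: borel_prod)
  have [measurable]: "(\<lambda>z. \<integral>\<^sup>+y. ?f y * ?P z y \<partial>\<alpha> z) \<in> borel_measurable (borel \<Otimes>\<^sub>M borel)"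
  proof (rule lfk_integral_measurable[OF nice_lfk[OF a(1)]])
    show "(\<lambda>z :: real \<times> 'x. z) \<in> borel_measurable (borel \<Otimes>\<^sub>M borel)" by (simp add: borel_prod)
  qed measurable
  have ext: "?ext \<in> borel_measurable (borel \<Otimes>\<^sub>M borel)"
    unfolding indicator_if by measurable
  have sp: "borel_measurable time_space = (borel_measurable (borel \<Otimes>\<^sub>M borel) :: (real \<times> 'x \<Rightarrow> ennreal) set)"
    using ok_index_time_space by (intro measurable_cong_sets) (auto simp: ok_index_def)
  have "flow time_space one (gain \<alpha> \<beta>) ?f t (t + r) x \<le>
    (\<integral>\<^sup>+z. (\<integral>\<^sup>+y. ?f y * (indicator {..<t} (fst z) * uno (t - fst z) y * W z y * ?P z y) \<partial>\<alpha> z) + ?ext z \<partial>time_space)"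
    unfolding flow_def
  proof (intro nn_integral_mono, clarify)
    fix s x'
    show "(\<integral>\<^sup>+y. ?f y * (indicator {..<t} s * uno (t - s) y * 1 * p (t + r - s) x' x y) \<partial>gain \<alpha> \<beta> (s, x')) \<le>
      (\<integral>\<^sup>+y. ?f y * (indicator {..<t} (fst (s, x')) * uno (t - fst (s, x')) y * W (s, x') y * ?P (s, x') y) \<partial>\<alpha> (s, x')) + ?ext (s, x')"
    proof (cases "s < t")
      case True
      have "(\<integral>\<^sup>+y. ?f y * p (t + r - s) x' x y \<partial>gain \<alpha> \<beta> (s, x')) \<le> (\<integral>\<^sup>+y. ?f y * p (t + r - s) x' x y * W (s, x') y \<partial>\<alpha> (s, x'))
        + ennreal (7 * C) * (\<integral>\<^sup>+y. ?f y \<partial>\<beta> (s, x')) * (\<integral>\<^sup>+y. ?f y * p (t + r - s) x' x y \<partial>\<alpha> (s, x'))"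
      proof (rule gain_le[OF a])
        show "?f (y + y') * p (t + r - s) x' x (y + y') * kk y y' \<le>
          ?f y * p (t + r - s) x' x y * kk y y' + ennreal (7 * C) * (?f y * p (t + r - s) x' x y) * ?f y'" if "0 < y" "0 < y'" for y y'
          using bracket_phi[OF that, of "t + r - s" R x' x] True r by (simp add: cut_phi_def)
      qed (use W in measurable)
      with True show ?thesis by (simp add: uno_def ac_simps)
    qed simp
  qed
  also have "\<dots> = flow time_space W \<alpha> ?f t (t + r) x + (\<integral>\<^sup>+z. ?ext z \<partial>time_space)"
    unfolding flow_def case_prod_beta' prod.collapse
    using flow_measurable[OF oks(1) cut_measurable(1), of t "t + r" R x] ext r by (intro nn_integral_add) (simp_all add: sp)
  also have "(\<integral>\<^sup>+z. ?ext z \<partial>time_space) = (\<integral>\<^sup>+s. \<integral>\<^sup>+x'. ?ext (s, x') \<partial>lborel \<partial>lborel)"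
    using nn_integral_time_space[of "\<lambda>s x'. ?ext (s, x')"] ext by (simp add: case_prod_beta')
  also have "\<dots> \<le> (\<integral>\<^sup>+s. indicator {0<..<t} s * (ennreal (7 * C) * b s * h s) \<partial>lborel)"
  proof (rule nn_integral_mono)
    fix s :: real
    show "(\<integral>\<^sup>+x'. ?ext (s, x') \<partial>lborel) \<le> indicator {0<..<t} s * (ennreal (7 * C) * b s * h s)"
    proof (cases "0 < s \<and> s < t")
      case True
      have "(\<integral>\<^sup>+x'. ?ext (s, x') \<partial>lborel) \<le> (\<integral>\<^sup>+x'. ennreal (7 * C) * b s * (\<integral>\<^sup>+y. ?f y * p (t + r - s) x' x y \<partial>\<alpha> (s, x')) \<partial>lborel)"
        using True b[of s] by (intro nn_integral_mono) (auto intro!: mult_mono)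
      also have "\<dots> = ennreal (7 * C) * b s * (\<integral>\<^sup>+x'. (\<integral>\<^sup>+y. ?f y * p (t + r - s) x' x y \<partial>\<alpha> (s, x')) \<partial>lborel)"
        by (rule nn_integral_cmult) (simp, rule kernel_param_measurable[OF nice_lfk[OF a(1)]], measurable)
      also have "(\<integral>\<^sup>+x'. (\<integral>\<^sup>+y. ?f y * p (t + r - s) x' x y \<partial>\<alpha> (s, x')) \<partial>lborel) = observe \<alpha> ?f s (t + r - s) x"
        using True r by (simp add: observe_def)
      also have "ennreal (7 * C) * b s * \<dots> \<le> ennreal (7 * C) * b s * h s" using True by (intro mult_left_mono h) auto
      finally show ?thesis using True by simp
    next
      case False
      then have "(\<integral>\<^sup>+x'. ?ext (s, x') \<partial>lborel) = (\<integral>\<^sup>+(x'::'x). 0 \<partial>lborel)"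
        by (intro nn_integral_cong) (auto simp: nice_zero[OF a(1)] split: split_indicator)
      then show ?thesis by simp
    qed
  qed
  finally have g: "flow time_space one (gain \<alpha> \<beta>) ?f t (t + r) x \<le> flow time_space W \<alpha> ?f t (t + r) x +
      (\<integral>\<^sup>+s. indicator {0<..<t} s * (ennreal (7 * C) * b s * h s) \<partial>lborel)" (is "_ \<le> ?L + ?X")
    by (simp add: add_left_mono)
  have i: "flow initial_space one ini ?f t (t + r) x \<le> ennreal g0"
    using t r by (intro flow_initial_phi) auto
  have "?L + observe \<alpha> ?f t r x = flow initial_space one ini ?f t (t + r) x + flow time_space one (gain \<alpha> \<beta>) ?f t (t + r) x"
    unfolding mild_flow[OF a m t r cut_measurable(1), symmetric] by (rule add.commute)
  also have "\<dots> \<le> ennreal g0 + (?L + ?X)" by (rule add_mono[OF i g])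
  also have "\<dots> = ?L + (ennreal g0 + ?X)" by (rule add.left_commute)
  finally have "?L + observe \<alpha> ?f t r x \<le> ?L + (ennreal g0 + ?X)" .
  then show ?thesis using fin by (auto simp: ennreal_add_left_cancel_le)
qed

text \<open>As in \<open>moment_phi\<close>, but integrated over all positions. The heat kernel has
  mass 1 and disappears, so \<open>bracket_mass\<close> is applied without it.\<close>

lemma moment_mass:
  assumes a: "nice \<alpha>" "nice \<beta>" "meas_rate W" and m: "mild \<beta> W \<alpha>" and W: "\<And>z y. 0 < y \<Longrightarrow> rate \<beta> z y \<le> W z y"
    and t: "0 < t" "t \<le> T"
    and fin: "(\<integral>\<^sup>+(s, x'). \<integral>\<^sup>+y. cut_id R y * (indicator {..<t} s * W (s, x') y) \<partial>\<alpha> (s, x') \<partial>time_space) < \<infinity>"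
    and b: "\<And>z. (\<integral>\<^sup>+y. phi y \<partial>\<beta> z) \<le> ennreal (2 * g0)"
    and S: "\<And>s. (\<integral>\<^sup>+x. \<integral>\<^sup>+y. cut_id R y \<partial>\<alpha> (s, x) \<partial>lborel) \<le> S"
  shows "(\<integral>\<^sup>+x. \<integral>\<^sup>+y. cut_id R y \<partial>\<alpha> (t, x) \<partial>lborel) \<le> ennreal m0 + ennreal (2 * C * g0 * T) * S"
proof -
  let ?f = "cut_id R"
  have q: "(\<lambda>(x', y). cut_id R y) \<in> borel_measurable ((borel :: 'x measure) \<Otimes>\<^sub>M sizes)" by simp
  let ?ext = "\<lambda>z. indicator {..<t} (fst z) * (ennreal C * (\<integral>\<^sup>+y. phi y \<partial>\<beta> z) * (\<integral>\<^sup>+y. ?f y \<partial>\<alpha> z))"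
  have [measurable]: "(\<lambda>z. \<integral>\<^sup>+y. phi y \<partial>\<beta> z) \<in> borel_measurable (borel \<Otimes>\<^sub>M borel)"
    by (rule lfk_integral_measurable[OF nice_lfk[OF a(2)]]) (auto simp: borel_prod)
  have [measurable]: "(\<lambda>z. \<integral>\<^sup>+y. ?f y \<partial>\<alpha> z) \<in> borel_measurable (borel \<Otimes>\<^sub>M borel)"
    by (rule lfk_integral_measurable[OF nice_lfk[OF a(1)]]) (auto simp: borel_prod)
  have ext: "?ext \<in> borel_measurable (borel \<Otimes>\<^sub>M borel)"
    unfolding indicator_if by measurable
  have sp: "borel_measurable time_space = (borel_measurable (borel \<Otimes>\<^sub>M borel) :: (real \<times> 'x \<Rightarrow> ennreal) set)"
    using ok_index_time_space by (intro measurable_cong_sets) (auto simp: ok_index_def)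
  have loss: "(\<lambda>z. \<integral>\<^sup>+y. ?f y * (indicator {..<t} (fst z) * W z y) \<partial>\<alpha> z) \<in> borel_measurable (borel \<Otimes>\<^sub>M borel)"
  proof -
    have [measurable]: "(\<lambda>z. W (fst z) (snd z)) \<in> borel_measurable ((borel \<Otimes>\<^sub>M borel) \<Otimes>\<^sub>M sizes)"
      using a(3) by (simp add: meas_rate_def case_prod_beta' borel_prod)
    show ?thesis unfolding indicator_if
    proof (rule lfk_integral_measurable[OF nice_lfk[OF a(1)]])
      show "(\<lambda>z :: real \<times> 'x. z) \<in> borel_measurable (borel \<Otimes>\<^sub>M borel)" by (simp add: borel_prod)
    qed measurable
  qed
  let ?L = "\<integral>\<^sup>+(s, x'). \<integral>\<^sup>+y. ?f y * (indicator {..<t} s * W (s, x') y) \<partial>\<alpha> (s, x') \<partial>time_space"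
  have "(\<integral>\<^sup>+(s, x'). \<integral>\<^sup>+y. ?f y * indicator {..<t} s \<partial>gain \<alpha> \<beta> (s, x') \<partial>time_space) \<le>
    (\<integral>\<^sup>+z. (\<integral>\<^sup>+y. ?f y * (indicator {..<t} (fst z) * W z y) \<partial>\<alpha> z) + ?ext z \<partial>time_space)"
  proof (intro nn_integral_mono, clarify)
    fix s x'
    show "(\<integral>\<^sup>+y. ?f y * indicator {..<t} s \<partial>gain \<alpha> \<beta> (s, x')) \<le>
      (\<integral>\<^sup>+y. ?f y * (indicator {..<t} (fst (s, x')) * W (s, x') y) \<partial>\<alpha> (s, x')) + ?ext (s, x')"
    proof (cases "s < t")
      case True
      have "(\<integral>\<^sup>+y. ?f y \<partial>gain \<alpha> \<beta> (s, x')) \<le> (\<integral>\<^sup>+y. ?f y * W (s, x') y \<partial>\<alpha> (s, x'))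
        + ennreal C * (\<integral>\<^sup>+y. phi y \<partial>\<beta> (s, x')) * (\<integral>\<^sup>+y. ?f y \<partial>\<alpha> (s, x'))"
      proof (rule gain_le[OF a])
        show "?f (y + y') * kk y y' \<le> ?f y * kk y y' + ennreal C * ?f y * phi y'" if "0 < y" "0 < y'" for y y'
          using bracket_mass[OF that, of R] by (simp add: cut_id_def)
      qed (use W in measurable)
      with True show ?thesis by (simp add: ac_simps)
    qed simp
  qed
  also have "\<dots> = ?L + (\<integral>\<^sup>+z. ?ext z \<partial>time_space)"
    unfolding case_prod_beta' prod.collapse using loss ext by (intro nn_integral_add) (simp_all add: sp)
  also have "(\<integral>\<^sup>+z. ?ext z \<partial>time_space) = (\<integral>\<^sup>+s. \<integral>\<^sup>+x'. ?ext (s, x') \<partial>lborel \<partial>lborel)"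
    using nn_integral_time_space[of "\<lambda>s x'. ?ext (s, x')"] ext by (simp add: case_prod_beta')
  also have "\<dots> \<le> (\<integral>\<^sup>+s. ennreal (2 * C * g0) * S * indicator {0<..T} s \<partial>lborel)"
  proof (rule nn_integral_mono)
    fix s :: real
    show "(\<integral>\<^sup>+x'. ?ext (s, x') \<partial>lborel) \<le> ennreal (2 * C * g0) * S * indicator {0<..T} s"
    proof (cases "0 < s \<and> s < t")
      case True
      have "(\<integral>\<^sup>+x'. ?ext (s, x') \<partial>lborel) \<le> (\<integral>\<^sup>+x'. ennreal C * ennreal (2 * g0) * (\<integral>\<^sup>+y. ?f y \<partial>\<alpha> (s, x')) \<partial>lborel)"
        using True b by (intro nn_integral_mono) (auto intro!: mult_mono)
      also have "\<dots> = ennreal C * ennreal (2 * g0) * (\<integral>\<^sup>+x'. (\<integral>\<^sup>+y. ?f y \<partial>\<alpha> (s, x')) \<partial>lborel)"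
        using kernel_param_measurable[OF nice_lfk[OF a(1)] q] by (intro nn_integral_cmult) simp
      also have "\<dots> \<le> ennreal C * ennreal (2 * g0) * S" by (intro mult_left_mono S) auto
      also have "ennreal C * ennreal (2 * g0) = ennreal (2 * C * g0)" using pos by (simp add: ac_simps flip: ennreal_mult)
      finally show ?thesis using True t by simp
    next
      case False
      then have "(\<integral>\<^sup>+x'. ?ext (s, x') \<partial>lborel) = (\<integral>\<^sup>+(x'::'x). 0 \<partial>lborel)"
        by (intro nn_integral_cong) (auto simp: nice_zero[OF a(1)] split: split_indicator)
      then show ?thesis by simp
    qed
  qed
  also have "\<dots> = ennreal (2 * C * g0) * S * ennreal T"
    using pos by (subst nn_integral_cmult_indicator) auto
  also have "\<dots> = ennreal (2 * C * g0 * T) * S" using pos by (simp add: ennreal_mult ac_simps)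
  finally have g: "(\<integral>\<^sup>+(s, x'). \<integral>\<^sup>+y. ?f y * indicator {..<t} s \<partial>gain \<alpha> \<beta> (s, x') \<partial>time_space) \<le> ?L + ennreal (2 * C * g0 * T) * S"
    by (simp add: add_left_mono)
  have i: "(\<integral>\<^sup>+x. \<integral>\<^sup>+y. ?f y \<partial>evolve initial_space uno one ini t x \<partial>lborel) \<le> ennreal m0"
  proof -
    have "(\<integral>\<^sup>+x. \<integral>\<^sup>+y. ?f y \<partial>evolve initial_space uno one ini t x \<partial>lborel) \<le> (\<integral>\<^sup>+x. \<integral>\<^sup>+y. ?f y \<partial>\<mu>0 x \<partial>lborel)"
      using t by (intro evolve_initial_total uno_measurable) (auto simp: uno_def)
    also have "\<dots> \<le> (\<integral>\<^sup>+x. \<integral>\<^sup>+y. ennreal y \<partial>\<mu>0 x \<partial>lborel)"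
      by (intro nn_integral_mono) (auto simp: cut_id_def split: split_indicator)
    finally show ?thesis using \<mu>0_mass by (rule order_trans)
  qed
  let ?O = "\<integral>\<^sup>+x. \<integral>\<^sup>+y. ?f y \<partial>\<alpha> (t, x) \<partial>lborel"
  have "?L + ?O = (\<integral>\<^sup>+x. \<integral>\<^sup>+y. ?f y \<partial>evolve initial_space uno one ini t x \<partial>lborel)
      + (\<integral>\<^sup>+(s, x'). \<integral>\<^sup>+y. ?f y * indicator {..<t} s \<partial>gain \<alpha> \<beta> (s, x') \<partial>time_space)"
    unfolding mild_total[OF a m t cut_measurable(2), symmetric] by (rule add.commute)
  also have "\<dots> \<le> ennreal m0 + (?L + ennreal (2 * C * g0 * T) * S)" by (rule add_mono[OF i g])
  also have "\<dots> = ?L + (ennreal m0 + ennreal (2 * C * g0 * T) * S)" by (rule add.left_commute)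
  finally have "?L + ?O \<le> ?L + (ennreal m0 + ennreal (2 * C * g0 * T) * S)" .
  then show ?thesis using fin by (auto simp: ennreal_add_left_cancel_le)
qed

end

text \<open>The number 100 leaves room for all absorptions: 14 C g0 T and 2 C g0 T at most 1/2 in
  \<open>phi_bound\<close> and \<open>mass_bound\<close>, 2 C g0 T at most 1/50 in
  \<open>stability\<close>, and 28 C g0 T at most 1/2 in \<open>phi_bound_self\<close>.\<close>

locale coag_small = coag +
  assumes small: "100 * C * g0 * T \<le> 1"
begin

section \<open>Bounds by twice the initial data for short times\<close>

lemma cut_phi_le: "cut_phi R y \<le> ennreal (R powr (4/3)) * indicator {0<..R} y"
  by (auto simp: cut_phi_def phi_def intro!: ennreal_leI powr_mono2 split: split_indicator)

lemma cut_bounded: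
  obtains n where "\<And>y. cut_phi R y \<le> of_nat n * indicator {0<..real n} y"
proof -
  obtain n :: nat where n: "max R (R powr (4/3)) \<le> real n" using real_arch_simple by blast
  have "cut_phi R y \<le> of_nat n * indicator {0<..real n} y" for y
    using n by (intro order_trans[OF cut_phi_le])
      (auto simp: ennreal_of_nat_eq_real_of_nat intro!: ennreal_leI split: split_indicator)
  then show ?thesis by (rule that)
qed

lemma cut_phi_incseq: "incseq (\<lambda>n. cut_phi (real n) y)"
  by (auto simp: incseq_def cut_phi_def split: split_indicator)

lemma SUP_cut:
  fixes y :: real
  assumes "0 < y"
  shows "(SUP n. c * indicator {0<..real n} y) = (c :: ennreal)"
proof -
  obtain n where "y \<le> real n" using real_arch_simple by blast
  then show ?thesis using assms
    by (intro antisym SUP_least SUP_upper2[of n]) (auto split: split_indicator)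
qed

lemma observe_bounded:
  assumes \<alpha>: "nice \<alpha>"
  obtains S where "S < \<infinity>" "\<And>t r x. 0 \<le> r \<Longrightarrow> observe \<alpha> (cut_phi R) t r x \<le> S"
proof -
  obtain B where B: "0 \<le> B" "\<And>z. emeasure (\<alpha> z) {0<..R} \<le> ennreal B" using nice_bound[OF \<alpha>] by blast
  let ?D = "ennreal (R powr (4/3)) * ennreal B"
  let ?S = "?D + ennreal (R / \<delta>) * ?D"
  note [measurable_cong] = nice_sets[OF \<alpha>]
  have 1: "(\<integral>\<^sup>+y. cut_phi R y * q y \<partial>\<alpha> z) \<le> c * ?D" if "\<And>y. \<delta> \<le> y \<Longrightarrow> y \<le> R \<Longrightarrow> q y \<le> c" for q c z
  proof -
    have "(\<integral>\<^sup>+y. cut_phi R y * q y \<partial>\<alpha> z) \<le> (\<integral>\<^sup>+y. ennreal (R powr (4/3)) * c * indicator {0<..R} y \<partial>\<alpha> z)"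
    proof (rule nn_integral_mono_AE)
      show "AE y in \<alpha> z. cut_phi R y * q y \<le> ennreal (R powr (4/3)) * c * indicator {0<..R} y"
        using AE_size_ge[OF nice_sets[OF \<alpha>] nice_supp[OF \<alpha>], of z]
      proof eventually_elim
        case (elim y)
        show ?case
        proof (cases "y \<in> {0<..R}")
          case True
          then have "cut_phi R y * q y \<le> ennreal (R powr (4/3)) * c"
            using cut_phi_le[of R y] that[OF elim] by (intro mult_mono) auto
          with True show ?thesis by simp
        qed (simp add: cut_phi_def)
      qed
    qed
    also have "\<dots> = ennreal (R powr (4/3)) * c * emeasure (\<alpha> z) {0<..R}"
      by (rule nn_integral_cmult_indicator) (simp add: nice_sets[OF \<alpha>])
    also have "\<dots> \<le> ennreal (R powr (4/3)) * c * ennreal B" by (intro mult_left_mono B) simp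
    finally show ?thesis by (simp add: ac_simps)
  qed
  have "observe \<alpha> (cut_phi R) t r x \<le> ?S" if "0 \<le> r" for t r x
  proof (cases "r = 0")
    case True
    have "observe \<alpha> (cut_phi R) t r x \<le> 1 * ?D" using 1[of "\<lambda>_. 1" 1 "(t, x)"] True by (simp add: observe_def)
    then show ?thesis by (simp add: add_increasing2)
  next
    case False
    then have r: "0 < r" using that by simp
    have "observe \<alpha> (cut_phi R) t r x \<le> (\<integral>\<^sup>+x'. (ennreal (R / \<delta>) * p r x' x \<delta>) * ?D \<partial>lborel)"
      unfolding observe_def using r by (auto intro!: nn_integral_mono 1 p_crude)
    also have "\<dots> = (\<integral>\<^sup>+x'. (ennreal (R / \<delta>) * ?D) * p r x' x \<delta> \<partial>lborel)"
      by (simp only: ac_simps)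
    also have "\<dots> = ennreal (R / \<delta>) * ?D"
      using p_int_fst[OF r, of \<delta> x] pos by (subst nn_integral_cmult) auto
    finally show ?thesis by (simp add: add_increasing)
  qed
  moreover have "?S < \<infinity>" by (simp add: ennreal_mult_less_top)
  ultimately show ?thesis by (rule that[rotated])
qed

lemma observe_sup:
  assumes \<alpha>: "nice \<alpha>" and b: "\<And>n::nat. observe \<alpha> (cut_phi (real n)) t r x \<le> B"
  shows "observe \<alpha> phi t r x \<le> B"
proof -
  note [measurable_cong] = nice_sets[OF \<alpha>]
  have phi: "phi y = (SUP n. cut_phi (real n) y)" if "0 < y" for y
    unfolding cut_phi_def by (rule SUP_cut[OF that, symmetric])
  have inner: "(\<integral>\<^sup>+y. phi y * q y \<partial>\<alpha> z) = (SUP n. \<integral>\<^sup>+y. cut_phi (real n) y * q y \<partial>\<alpha> z)"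
    if [measurable]: "q \<in> borel_measurable sizes" for q z
  proof -
    have "(\<integral>\<^sup>+y. phi y * q y \<partial>\<alpha> z) = (\<integral>\<^sup>+y. (SUP n. cut_phi (real n) y * q y) \<partial>\<alpha> z)"
      using lfk_space[OF nice_lfk[OF \<alpha>]] by (intro nn_integral_cong) (auto simp: phi SUP_mult_right_ennreal)
    also have "\<dots> = (SUP n. \<integral>\<^sup>+y. cut_phi (real n) y * q y \<partial>\<alpha> z)"
      using cut_phi_incseq by (intro nn_integral_monotone_convergence_SUP) (auto simp: incseq_def le_fun_def intro!: mult_right_mono)
    finally show ?thesis .
  qed
  have "observe \<alpha> phi t r x = (SUP n::nat. observe \<alpha> (cut_phi (real n)) t r x)"
  proof (cases "r = 0")
    case True
    then show ?thesis using inner[of "\<lambda>_. 1"] by (simp add: observe_def)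
  next
    case False
    have "(\<integral>\<^sup>+x'. \<integral>\<^sup>+y. phi y * p r x' x y \<partial>\<alpha> (t, x') \<partial>lborel) = (\<integral>\<^sup>+x'. (SUP n. \<integral>\<^sup>+y. cut_phi (real n) y * p r x' x y \<partial>\<alpha> (t, x')) \<partial>lborel)"
      by (intro nn_integral_cong inner) measurable
    also have "\<dots> = (SUP n. \<integral>\<^sup>+x'. \<integral>\<^sup>+y. cut_phi (real n) y * p r x' x y \<partial>\<alpha> (t, x') \<partial>lborel)"
    proof (rule nn_integral_monotone_convergence_SUP)
      show "incseq (\<lambda>n x'. \<integral>\<^sup>+y. cut_phi (real n) y * p r x' x y \<partial>\<alpha> (t, x'))"
        using cut_phi_incseq by (auto simp: incseq_def le_fun_def intro!: nn_integral_mono mult_right_mono)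
      show "(\<lambda>x'. \<integral>\<^sup>+y. cut_phi (real n) y * p r x' x y \<partial>\<alpha> (t, x')) \<in> borel_measurable lborel" for n
        by (simp, rule kernel_param_measurable[OF nice_lfk[OF \<alpha>]], measurable)
    qed
    finally show ?thesis using False by (simp add: observe_def)
  qed
  then show ?thesis using b by (auto intro: SUP_least)
qed

lemma const_integral: "(\<integral>\<^sup>+s. indicator {0<..<t} s * c \<partial>lborel) = ennreal t * c" if "0 \<le> t" for t :: real
  using that by (subst mult.commute, subst nn_integral_cmult_indicator) (auto simp: mult.commute)

text \<open>Let S be the supremum of the truncated observations over all times up to
  \<open>T\<close>, further diffusion times and positions. It is finite by truncation, and
  \<open>moment_phi\<close> with constant bounds 2 \<open>g0\<close> and S gives S \<le> g0 + 14 C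
  g0 T S. So S is at most 2 \<open>g0\<close>, uniformly in the truncation.\<close>

lemma phi_bound:
  assumes a: "nice \<alpha>" "nice \<beta>" "ok_rate W" and m: "mild \<beta> W \<alpha>" and W: "\<And>z y. 0 < y \<Longrightarrow> rate \<beta> z y \<le> W z y"
    and b: "\<And>z. (\<integral>\<^sup>+y. phi y \<partial>\<beta> z) \<le> ennreal (2 * g0)" and tr: "0 < t" "t \<le> T" "0 \<le> r"
  shows "observe \<alpha> phi t r x \<le> ennreal (2 * g0)"
proof (rule observe_sup[OF a(1)])
  fix n :: nat
  let ?R = "real n"
  let ?I = "{(t, r, x::'a). 0 < t \<and> t \<le> T \<and> 0 \<le> r}"
  define S where "S = (SUP (t, r, x)\<in>?I. observe \<alpha> (cut_phi ?R) t r x)"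
  have S: "observe \<alpha> (cut_phi ?R) t r x \<le> S" if "0 < t" "t \<le> T" "0 \<le> r" for t r x
    unfolding S_def using that by (intro SUP_upper2[of "(t, r, x)"]) auto
  obtain S' where S': "S' < \<infinity>" "\<And>t r x. 0 \<le> r \<Longrightarrow> observe \<alpha> (cut_phi ?R) t r x \<le> S'" by (rule observe_bounded[OF a(1)]) blast
  have "S \<le> S'" unfolding S_def by (rule SUP_least) (clarsimp simp: S'(2))
  then have Sfin: "S < \<infinity>" using S'(1) by (rule le_less_trans)
  have "S \<le> ennreal g0 + ennreal (14 * C * g0 * T) * S"
    unfolding S_def
  proof (intro SUP_least, clarify)
    fix t r x assume t: "0 < t" "t \<le> T" and r: "(0::real) \<le> r"
    obtain N where N: "\<And>y. cut_phi ?R y \<le> of_nat N * indicator {0<..real N} y" by (rule cut_bounded[of ?R]) blast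
    have "flow time_space W \<alpha> (cut_phi ?R) t (t + r) x \<le> (\<integral>\<^sup>+y. cut_phi ?R y \<partial>evolve time_space uno W \<alpha> (t + r) x)"
      using r by (intro flow_le_evolve ok_sources uno_measurable a) auto
    moreover have "(\<integral>\<^sup>+y. cut_phi ?R y \<partial>evolve time_space uno W \<alpha> (t + r) x) \<noteq> \<infinity>"
      by (rule evolve_bounded_finite[OF a(1,3) uno_measurable _ N]) (simp add: uno_def)
    ultimately have fin: "flow time_space W \<alpha> (cut_phi ?R) t (t + r) x < \<infinity>" by (simp add: less_top le_less_trans)
    have "observe \<alpha> (cut_phi ?R) t r x \<le> ennreal g0 + (\<integral>\<^sup>+s. indicator {0<..<t} s * (ennreal (7 * C) * ennreal (2 * g0) * S) \<partial>lborel)"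
    proof (rule moment_phi[OF a(1,2) ok_rate_meas[OF a(3)] m W t r fin])
      show "(\<integral>\<^sup>+y. cut_phi ?R y \<partial>\<beta> (s, x')) \<le> ennreal (2 * g0)" for s x'
        by (rule order_trans[OF nn_integral_mono b]) (auto simp: cut_phi_def split: split_indicator)
      show "observe \<alpha> (cut_phi ?R) s (t + r - s) x \<le> S" if "0 < s" "s < t" for s
        using that t r by (intro S) auto
    qed
    also have "\<dots> = ennreal g0 + ennreal t * (ennreal (7 * C) * ennreal (2 * g0) * S)"
      using t by (subst const_integral) auto
    also have "\<dots> \<le> ennreal g0 + ennreal T * (ennreal (7 * C) * ennreal (2 * g0) * S)"
      using t by (intro add_left_mono mult_right_mono ennreal_leI) auto
    also have "ennreal T * (ennreal (7 * C) * ennreal (2 * g0) * S) = ennreal (14 * C * g0 * T) * S"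
    proof -
      have "ennreal (14 * C * g0 * T) = ennreal T * (ennreal (7 * C) * ennreal (2 * g0))"
      proof -
        have "ennreal (T * ((7 * C) * (2 * g0))) = ennreal T * ennreal ((7 * C) * (2 * g0))"
          using pos by (intro ennreal_mult') simp
        also have "ennreal ((7 * C) * (2 * g0)) = ennreal (7 * C) * ennreal (2 * g0)"
          using pos by (intro ennreal_mult') simp
        finally show ?thesis by (simp add: ac_simps)
      qed
      then show ?thesis by (simp only: mult.assoc)
    qed
    finally show "observe \<alpha> (cut_phi ?R) t r x \<le> ennreal g0 + ennreal (14 * C * g0 * T) * (SUP (t, r, x)\<in>?I. observe \<alpha> (cut_phi ?R) t r x)"
      by (simp add: S_def)
  qed
  then have "S \<le> 2 * ennreal g0"
    by (rule ennreal_absorb[OF _ _ Sfin]) (rule ennreal_leI, use small in simp)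
  also have "\<dots> = ennreal (2 * g0)" using pos by (simp add: ennreal_mult)
  finally show "observe \<alpha> (cut_phi ?R) t r x \<le> ennreal (2 * g0)" using S[OF tr, of x] by (rule order_trans[rotated])
qed

text \<open>The absorption of \<open>phi_bound\<close> in L1. Here finiteness of the truncated
  supremum is the hypothesis \<open>crude\<close>, and the truncated loss is finite because
  \<open>W\<close> is at most \<open>vb R\<close> on sizes up to \<open>R\<close>.\<close>

lemma mass_bound:
  assumes a: "nice \<alpha>" "nice \<beta>" "ok_rate W" and m: "mild \<beta> W \<alpha>" and W: "\<And>z y. 0 < y \<Longrightarrow> rate \<beta> z y \<le> W z y"
    and b: "\<And>z. (\<integral>\<^sup>+y. phi y \<partial>\<beta> z) \<le> ennreal (2 * g0)"
    and crude: "\<And>R. \<exists>B::real. \<forall>t. (\<integral>\<^sup>+x. \<integral>\<^sup>+y. cut_id R y \<partial>\<alpha> (t, x) \<partial>lborel) \<le> ennreal B"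
  shows "(\<integral>\<^sup>+x. \<integral>\<^sup>+y. ennreal y \<partial>\<alpha> (t, x) \<partial>lborel) \<le> ennreal (2 * m0)"
proof -
  note [measurable_cong] = nice_sets[OF a(1)]
  have q: "(\<lambda>(x', y). cut_id R y) \<in> borel_measurable ((borel :: 'a measure) \<Otimes>\<^sub>M sizes)" for R by simp
  have cut: "(\<integral>\<^sup>+x. \<integral>\<^sup>+y. cut_id (real n) y \<partial>\<alpha> (t, x) \<partial>lborel) \<le> ennreal (2 * m0)" for n t
  proof -
    let ?R = "real n"
    define S where "S = (SUP s. \<integral>\<^sup>+x. \<integral>\<^sup>+y. cut_id ?R y \<partial>\<alpha> (s, x) \<partial>lborel)"
    have S: "(\<integral>\<^sup>+x. \<integral>\<^sup>+y. cut_id ?R y \<partial>\<alpha> (s, x) \<partial>lborel) \<le> S" for s unfolding S_def by (rule SUP_upper) simp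
    obtain B :: real where B: "\<And>t. (\<integral>\<^sup>+x. \<integral>\<^sup>+y. cut_id ?R y \<partial>\<alpha> (t, x) \<partial>lborel) \<le> ennreal B" using crude by blast
    have Sfin: "S < \<infinity>" unfolding S_def by (rule le_less_trans[of _ "ennreal B"]) (auto intro: SUP_least B)
    have "S \<le> ennreal m0 + ennreal (2 * C * g0 * T) * S"
      unfolding S_def
    proof (intro SUP_least)
      fix t
      show "(\<integral>\<^sup>+x. \<integral>\<^sup>+y. cut_id ?R y \<partial>\<alpha> (t, x) \<partial>lborel) \<le> ennreal m0 + ennreal (2 * C * g0 * T) * (SUP s. \<integral>\<^sup>+x. \<integral>\<^sup>+y. cut_id ?R y \<partial>\<alpha> (s, x) \<partial>lborel)"
      proof (cases "0 < t \<and> t \<le> T")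
        case True
        have "(\<integral>\<^sup>+(s, x'). \<integral>\<^sup>+y. cut_id ?R y * (indicator {..<t} s * W (s, x') y) \<partial>\<alpha> (s, x') \<partial>time_space)
          \<le> (\<integral>\<^sup>+(s, x'). indicator {0<..T} s * (ennreal (vb ?R) * (\<integral>\<^sup>+y. cut_id ?R y \<partial>\<alpha> (s, x'))) \<partial>time_space)"
        proof (intro nn_integral_mono, clarify)
          fix s x'
          show "(\<integral>\<^sup>+y. cut_id ?R y * (indicator {..<t} s * W (s, x') y) \<partial>\<alpha> (s, x')) \<le> indicator {0<..T} s * (ennreal (vb ?R) * (\<integral>\<^sup>+y. cut_id ?R y \<partial>\<alpha> (s, x')))"
          proof (cases "0 < s \<and> s < t")
            case s: True
            have "(\<integral>\<^sup>+y. cut_id ?R y * (indicator {..<t} s * W (s, x') y) \<partial>\<alpha> (s, x')) \<le> (\<integral>\<^sup>+y. ennreal (vb ?R) * cut_id ?R y \<partial>\<alpha> (s, x'))"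
            proof (rule nn_integral_mono)
              fix y assume "y \<in> space (\<alpha> (s, x'))"
              then have y: "0 < y" using lfk_space[OF nice_lfk[OF a(1)]] by simp
              show "cut_id ?R y * (indicator {..<t} s * W (s, x') y) \<le> ennreal (vb ?R) * cut_id ?R y"
              proof (cases "y \<le> ?R")
                case True
                have "W (s, x') y \<le> ennreal (vb y)" using a(3) y by (auto simp: ok_rate_def)
                also have "\<dots> \<le> ennreal (vb ?R)" using vb_mono[OF y True] by (rule ennreal_leI)
                finally show ?thesis using s by (simp add: mult.commute mult_left_mono)
              qed (simp add: cut_id_def)
            qed
            also have "\<dots> = ennreal (vb ?R) * (\<integral>\<^sup>+y. cut_id ?R y \<partial>\<alpha> (s, x'))" by (rule nn_integral_cmult) measurable
            finally show ?thesis using s True by simp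
          next
            case False
            then show ?thesis by (cases "0 < s") (auto simp: nice_zero[OF a(1)])
          qed
        qed
        also have "\<dots> = (\<integral>\<^sup>+s. \<integral>\<^sup>+x'. indicator {0<..T} s * (ennreal (vb ?R) * (\<integral>\<^sup>+y. cut_id ?R y \<partial>\<alpha> (s, x'))) \<partial>lborel \<partial>lborel)"
        proof (rule nn_integral_time_space)
          have [measurable]: "(\<lambda>z. \<integral>\<^sup>+y. cut_id ?R y \<partial>\<alpha> z) \<in> borel_measurable (borel \<Otimes>\<^sub>M borel)"
            by (rule lfk_integral_measurable[OF nice_lfk[OF a(1)]]) (auto simp: borel_prod)
          have "(\<lambda>z. (if 0 < fst z \<and> fst z \<le> T then 1 else 0) * (ennreal (vb ?R) * (\<integral>\<^sup>+y. cut_id ?R y \<partial>\<alpha> z))) \<in> borel_measurable (borel \<Otimes>\<^sub>M borel)"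
            by measurable
          then show "(\<lambda>(s, x'). indicator {0<..T} s * (ennreal (vb ?R) * (\<integral>\<^sup>+y. cut_id ?R y \<partial>\<alpha> (s, x')))) \<in> borel_measurable (borel \<Otimes>\<^sub>M borel)"
            by (simp add: case_prod_beta' indicator_def of_bool_def)
        qed
        also have "\<dots> \<le> (\<integral>\<^sup>+s. ennreal (vb ?R) * S * indicator {0<..T} s \<partial>lborel)"
        proof (rule nn_integral_mono)
          fix s :: real
          have "(\<integral>\<^sup>+x'. indicator {0<..T} s * (ennreal (vb ?R) * (\<integral>\<^sup>+y. cut_id ?R y \<partial>\<alpha> (s, x'))) \<partial>lborel)
            = (indicator {0<..T} s * ennreal (vb ?R)) * (\<integral>\<^sup>+x'. (\<integral>\<^sup>+y. cut_id ?R y \<partial>\<alpha> (s, x')) \<partial>lborel)"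
            using kernel_param_measurable[OF nice_lfk[OF a(1)] q] by (subst nn_integral_cmult[symmetric]) (auto simp: mult.assoc)
          also have "\<dots> \<le> (indicator {0<..T} s * ennreal (vb ?R)) * S" by (intro mult_left_mono S) simp
          finally show "(\<integral>\<^sup>+x'. indicator {0<..T} s * (ennreal (vb ?R) * (\<integral>\<^sup>+y. cut_id ?R y \<partial>\<alpha> (s, x'))) \<partial>lborel) \<le> ennreal (vb ?R) * S * indicator {0<..T} s"
            by (simp add: ac_simps)
        qed
        also have "\<dots> = ennreal (vb ?R) * S * ennreal T"
          using pos by (subst nn_integral_cmult_indicator) auto
        also have "\<dots> < \<infinity>" using Sfin by (simp add: ennreal_mult_less_top)
        finally have fin: "(\<integral>\<^sup>+(s, x'). \<integral>\<^sup>+y. cut_id ?R y * (indicator {..<t} s * W (s, x') y) \<partial>\<alpha> (s, x') \<partial>time_space) < \<infinity>" .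
        show ?thesis
          using True moment_mass[OF a(1,2) ok_rate_meas[OF a(3)] m W _ _ fin b S] by (simp add: S_def)
      qed (auto simp: nice_null[OF a(1)])
    qed
    then have "S \<le> 2 * ennreal m0"
      by (rule ennreal_absorb[OF _ _ Sfin]) (rule ennreal_leI, use small in simp)
    then show ?thesis using S[of t] pos by (auto simp: ennreal_mult intro: order_trans)
  qed
  have "(\<integral>\<^sup>+x. \<integral>\<^sup>+y. ennreal y \<partial>\<alpha> (t, x) \<partial>lborel) = (\<integral>\<^sup>+x. (SUP n. \<integral>\<^sup>+y. cut_id (real n) y \<partial>\<alpha> (t, x)) \<partial>lborel)"
  proof (intro nn_integral_cong)
    fix x
    have "(\<integral>\<^sup>+y. ennreal y \<partial>\<alpha> (t, x)) = (\<integral>\<^sup>+y. (SUP n. cut_id (real n) y) \<partial>\<alpha> (t, x))"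
      unfolding cut_id_def using lfk_space[OF nice_lfk[OF a(1)]] by (intro nn_integral_cong SUP_cut[symmetric]) auto
    also have "\<dots> = (SUP n. \<integral>\<^sup>+y. cut_id (real n) y \<partial>\<alpha> (t, x))"
      by (intro nn_integral_monotone_convergence_SUP) (auto simp: incseq_def le_fun_def cut_id_def split: split_indicator)
    finally show "(\<integral>\<^sup>+y. ennreal y \<partial>\<alpha> (t, x)) = (SUP n. \<integral>\<^sup>+y. cut_id (real n) y \<partial>\<alpha> (t, x))" .
  qed
  also have "\<dots> = (SUP n. \<integral>\<^sup>+x. \<integral>\<^sup>+y. cut_id (real n) y \<partial>\<alpha> (t, x) \<partial>lborel)"
  proof (rule nn_integral_monotone_convergence_SUP)
    show "incseq (\<lambda>n x. \<integral>\<^sup>+y. cut_id (real n) y \<partial>\<alpha> (t, x))"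
      by (auto simp: incseq_def le_fun_def cut_id_def intro!: nn_integral_mono split: split_indicator)
  qed (use kernel_param_measurable[OF nice_lfk[OF a(1)] q] in simp)
  also have "\<dots> \<le> ennreal (2 * m0)" by (rule SUP_least) (rule cut)
  finally show ?thesis .
qed

text \<open>The class in which uniqueness is shown. By \<open>lin_good\<close> it is stable under
  the linear problem with a good frozen kernel, so all iterates and lower bounds stay in it with the
  same constants.\<close>

definition good :: "'a kernel \<Rightarrow> bool" where
  "good \<alpha> \<longleftrightarrow> nice \<alpha> \<and> (\<forall>z. (\<integral>\<^sup>+y. phi y \<partial>\<alpha> z) \<le> ennreal (2 * g0)) \<and>
     (\<forall>t. (\<integral>\<^sup>+x. \<integral>\<^sup>+y. ennreal y \<partial>\<alpha> (t, x) \<partial>lborel) \<le> ennreal (2 * m0))"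

lemma goodD:
  assumes "good \<alpha>"
  shows "nice \<alpha>" "(\<integral>\<^sup>+y. phi y \<partial>\<alpha> z) \<le> ennreal (2 * g0)" "(\<integral>\<^sup>+x. \<integral>\<^sup>+y. ennreal y \<partial>\<alpha> (t, x) \<partial>lborel) \<le> ennreal (2 * m0)"
  using assms unfolding good_def by blast+

lemma w_le_phi: "\<delta> \<le> y \<Longrightarrow> w y \<le> ennreal (\<delta> powr (- (2/3))) * phi y"
proof -
  assume y: "\<delta> \<le> y"
  then have "y powr (2/3) = y powr (- (2/3)) * y powr (4/3)" using pos by (simp flip: powr_add)
  also have "\<dots> \<le> \<delta> powr (- (2/3)) * y powr (4/3)" using y pos by (intro mult_right_mono powr_mono2') auto
  finally show ?thesis unfolding w_def phi_def by (simp add: ennreal_leI flip: ennreal_mult)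
qed

lemma nice_w_le:
  assumes \<alpha>: "nice \<alpha>"
  shows "(\<integral>\<^sup>+y. w y \<partial>\<alpha> z) \<le> ennreal (\<delta> powr (- (2/3))) * (\<integral>\<^sup>+y. phi y \<partial>\<alpha> z)"
proof -
  note [measurable_cong] = nice_sets[OF \<alpha>]
  have "(\<integral>\<^sup>+y. w y \<partial>\<alpha> z) \<le> (\<integral>\<^sup>+y. ennreal (\<delta> powr (- (2/3))) * phi y \<partial>\<alpha> z)"
    using AE_size_ge[OF nice_sets[OF \<alpha>] nice_supp[OF \<alpha>], of z]
    by (intro nn_integral_mono_AE) (auto elim!: eventually_mono intro: w_le_phi)
  then show ?thesis by (simp add: nn_integral_cmult)
qed

lemma rate_le_w:
  assumes \<beta>: "nice \<beta>" and y: "0 < y"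
  shows "rate \<beta> z y \<le> ennreal C * w y * (\<integral>\<^sup>+y. w y \<partial>\<beta> z)"
proof -
  note [measurable_cong] = nice_sets[OF \<beta>]
  have "rate \<beta> z y \<le> (\<integral>\<^sup>+y'. ennreal C * w y * w y' \<partial>\<beta> z)"
    unfolding rate_def
  proof (rule nn_integral_mono)
    fix y' assume "y' \<in> space (\<beta> z)"
    then have "k y y' \<le> ennreal (C * (y powr (2/3) * y' powr (2/3)))"
      using y lfk_space[OF nice_lfk[OF \<beta>]] by (intro k_bound) auto
    also have "\<dots> = ennreal C * w y * w y'" using pos by (simp add: w_def ennreal_mult mult.assoc)
    finally show "k y y' \<le> ennreal C * w y * w y'" .
  qed
  then show ?thesis by (simp add: nn_integral_cmult)
qed

lemma rate_ok:
  assumes \<beta>: "nice \<beta>" and b: "\<And>z. (\<integral>\<^sup>+y. phi y \<partial>\<beta> z) \<le> ennreal (2 * g0)"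
  shows "ok_rate (rate \<beta>)"
proof -
  have "rate \<beta> z y \<le> ennreal (vb y)" if y: "0 < y" for z y
  proof (cases "y < \<delta>")
    case True
    then show ?thesis by (simp add: rate_def k_zero)
  next
    case False
    have "rate \<beta> z y \<le> ennreal C * w y * (ennreal (\<delta> powr (- (2/3))) * ennreal (2 * g0))"
      using b[of z] by (intro order_trans[OF rate_le_w[OF \<beta> y]] mult_left_mono order_trans[OF nice_w_le[OF \<beta>]]) auto
    also have "\<dots> = ennreal (C * y powr (2/3) * (\<delta> powr (- (2/3)) * (2 * g0)))"
      using pos by (simp add: w_def ennreal_mult)
    also have "\<dots> = ennreal (vb y)" using False by (simp add: vb_def ac_simps)
    finally show ?thesis .
  qed
  then show ?thesis using rate_measurable[OF \<beta>] by (auto simp: ok_rate_def meas_rate_def)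
qed

lemma good_rate_ok: "good \<beta> \<Longrightarrow> ok_rate (rate \<beta>)"
  by (intro rate_ok goodD)

text \<open>A rate \<open>W\<close> above \<open>rate \<beta>\<close> only adds loss, so the bounds
  persist. The lower bounds use this freedom with \<open>max_rate\<close> and
  \<open>sup_rate\<close>.\<close>

lemma lin_good:
  assumes \<beta>: "good \<beta>" and W: "ok_rate W" "\<And>z y. 0 < y \<Longrightarrow> rate \<beta> z y \<le> W z y"
  shows "good (lin \<beta> W)"
proof -
  have sol: "exp_sol \<beta> W (lin \<beta> W)" by (rule lin_exp_sol[OF goodD(1)[OF \<beta>] W(1)])
  then have n: "nice (lin \<beta> W)" by (simp add: exp_sol_def)
  note [measurable_cong] = nice_sets[OF n]
  note m = exp_sol_mild[OF sol]
  have "(\<integral>\<^sup>+y. phi y \<partial>lin \<beta> W z) \<le> ennreal (2 * g0)" for z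
  proof (cases "0 < fst z \<and> fst z \<le> T")
    case True
    then show ?thesis
      using phi_bound[OF n goodD(1)[OF \<beta>] W(1) m W(2) goodD(2)[OF \<beta>], of "fst z" 0 "snd z"] by (simp add: observe_def)
  next
    case False
    then show ?thesis using nice_null[OF n, of "fst z" "snd z"] by simp
  qed
  moreover have "(\<integral>\<^sup>+x. \<integral>\<^sup>+y. ennreal y \<partial>lin \<beta> W (t, x) \<partial>lborel) \<le> ennreal (2 * m0)" for t
  proof (rule mass_bound[OF n goodD(1)[OF \<beta>] W(1) m W(2) goodD(2)[OF \<beta>]])
    fix R
    obtain B where B: "\<And>t. (\<integral>\<^sup>+x. emeasure (lin \<beta> W (t, x)) {0<..R} \<partial>lborel) \<le> ennreal B"
      using lin_total[OF goodD(1)[OF \<beta>] W(1), of R] by blast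
    show "\<exists>B::real. \<forall>t. (\<integral>\<^sup>+x. \<integral>\<^sup>+y. cut_id R y \<partial>lin \<beta> W (t, x) \<partial>lborel) \<le> ennreal B"
    proof (intro exI allI)
      fix t
      have "(\<integral>\<^sup>+x. \<integral>\<^sup>+y. cut_id R y \<partial>lin \<beta> W (t, x) \<partial>lborel) \<le> (\<integral>\<^sup>+x. ennreal (max 0 R) * emeasure (lin \<beta> W (t, x)) {0<..R} \<partial>lborel)"
      proof (rule nn_integral_mono)
        fix x
        have "(\<integral>\<^sup>+y. cut_id R y \<partial>lin \<beta> W (t, x)) \<le> (\<integral>\<^sup>+y. ennreal (max 0 R) * indicator {0<..R} y \<partial>lin \<beta> W (t, x))"
          by (intro nn_integral_mono) (auto simp: cut_id_def intro!: ennreal_leI split: split_indicator)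
        then show "(\<integral>\<^sup>+y. cut_id R y \<partial>lin \<beta> W (t, x)) \<le> ennreal (max 0 R) * emeasure (lin \<beta> W (t, x)) {0<..R}"
          by (subst (asm) nn_integral_cmult_indicator) (auto simp: nice_sets[OF n])
      qed
      also have "\<dots> = ennreal (max 0 R) * (\<integral>\<^sup>+x. emeasure (lin \<beta> W (t, x)) {0<..R} \<partial>lborel)"
        by (rule nn_integral_cmult) (simp, rule lfk_emeasure_measurable[OF nice_lfk[OF n]], auto)
      also have "\<dots> \<le> ennreal (max 0 R) * ennreal B" by (intro mult_left_mono B) simp
      also have "\<dots> = ennreal (max 0 R * B)" by (rule ennreal_mult'[symmetric]) simp
      finally show "(\<integral>\<^sup>+x. \<integral>\<^sup>+y. cut_id R y \<partial>lin \<beta> W (t, x) \<partial>lborel) \<le> ennreal (max 0 R * B)" .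
    qed
  qed
  ultimately show ?thesis using n by (simp add: good_def)
qed

end

section \<open>Stability and uniqueness of good solutions\<close>

lemma kernel_leD: "kernel_le \<alpha> \<beta> \<Longrightarrow> A \<in> sets sizes \<Longrightarrow> emeasure (\<alpha> z) A \<le> emeasure (\<beta> z) A"
  unfolding kernel_le_def by blast

context coag_small
begin

lemma w_w: "0 < y \<Longrightarrow> w y * w y = phi y"
  by (simp add: w_def phi_def flip: ennreal_mult powr_add)

lemma good_w_fin: assumes "good \<alpha>" shows "(\<integral>\<^sup>+y. w y \<partial>\<alpha> z) \<noteq> \<infinity>"
proof -
  have "(\<integral>\<^sup>+y. w y \<partial>\<alpha> z) \<le> ennreal (\<delta> powr (- (2/3))) * ennreal (2 * g0)"
    using goodD(2)[OF assms, of z] by (intro order_trans[OF nice_w_le[OF goodD(1)[OF assms]]] mult_left_mono) auto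
  also have "\<dots> < \<infinity>" by (simp add: ennreal_mult_less_top)
  finally show ?thesis by simp
qed

lemma good_finite: assumes "good \<alpha>" shows "finite_measure (\<alpha> z)"
proof
  note n = goodD(1)[OF assms]
  note [measurable_cong] = nice_sets[OF n]
  have "emeasure (\<alpha> z) (space (\<alpha> z)) = (\<integral>\<^sup>+y. 1 \<partial>\<alpha> z)" by simp
  also have "\<dots> \<le> (\<integral>\<^sup>+y. ennreal (\<delta> powr (- (4/3))) * phi y \<partial>\<alpha> z)"
    using AE_size_ge[OF nice_sets[OF n] nice_supp[OF n], of z]
    by (intro nn_integral_mono_AE) (auto elim!: eventually_mono intro: le_phi)
  also have "\<dots> = ennreal (\<delta> powr (- (4/3))) * (\<integral>\<^sup>+y. phi y \<partial>\<alpha> z)" by (rule nn_integral_cmult) measurable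
  also have "\<dots> \<le> ennreal (\<delta> powr (- (4/3))) * ennreal (2 * g0)" by (intro mult_left_mono goodD(2)[OF assms]) simp
  also have "\<dots> < \<infinity>" by (simp add: ennreal_mult_less_top)
  finally show "emeasure (\<alpha> z) (space (\<alpha> z)) \<noteq> \<infinity>" by simp
qed

text \<open>Good kernels are finite measures at each point, so the difference from a smaller one is
  again a measure. Stated as a sum of integrals, it avoids all further subtraction in
  [0,\<infinity>].\<close>

lemma good_split:
  assumes \<alpha>: "good \<alpha>" and \<eta>: "good \<eta>" and le: "kernel_le \<eta> \<alpha>"
  obtains d where "sets d = sets sizes" "finite_measure d"
    and "\<And>f. f \<in> borel_measurable sizes \<Longrightarrow> (\<integral>\<^sup>+y. f y \<partial>\<alpha> z) = (\<integral>\<^sup>+y. f y \<partial>\<eta> z) + (\<integral>\<^sup>+y. f y \<partial>d)"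
proof -
  define d where "d = diff_measure (\<alpha> z) (\<eta> z)"
  note s = nice_sets[OF goodD(1)[OF \<alpha>], of z] nice_sets[OF goodD(1)[OF \<eta>], of z]
  have d: "emeasure d A = emeasure (\<alpha> z) A - emeasure (\<eta> z) A" if "A \<in> sets sizes" for A
    unfolding d_def using s that le
    by (intro emeasure_diff_measure good_finite[OF \<alpha>] good_finite[OF \<eta>]) (auto intro: kernel_leD)
  have sd: "sets d = sets sizes" by (simp add: d_def s)
  have "emeasure d (space d) \<le> emeasure (\<alpha> z) (space sizes)"
    using d[OF sets.top] sets_eq_imp_space_eq[OF sd] by (simp add: diff_le_self_ennreal)
  also have "\<dots> < \<infinity>"
    using finite_measure.emeasure_finite[OF good_finite[OF \<alpha>]] by (simp add: less_top)
  finally have fd: "finite_measure d" by (intro finite_measureI) simp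
  \<comment> \<open>The sum of two measures is written as a mixture over the two booleans, so that
    \<open>nn_integral_mix\<close> passes from sets to integrals.\<close>
  have "\<alpha> z = mix (count_space (UNIV :: bool set)) (\<lambda>b. if b then \<eta> z else d)"
  proof (rule measure_eqI)
    fix A assume "A \<in> sets (\<alpha> z)"
    then have A: "A \<in> sets sizes" by (simp add: s)
    have "emeasure (mix (count_space (UNIV :: bool set)) (\<lambda>b. if b then \<eta> z else d)) A = emeasure (\<eta> z) A + emeasure d A"
      using A s sd by (subst emeasure_mix) (auto simp: nn_integral_count_space_finite UNIV_bool add.commute)
    also have "\<dots> = emeasure (\<alpha> z) A"
      using kernel_leD[OF le A] unfolding d[OF A] by (simp add: add_diff_inverse_ennreal)
    finally show "emeasure (\<alpha> z) A = emeasure (mix (count_space (UNIV :: bool set)) (\<lambda>b. if b then \<eta> z else d)) A" by simp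
  qed (simp add: s)
  then have "(\<integral>\<^sup>+y. f y \<partial>\<alpha> z) = (\<integral>\<^sup>+y. f y \<partial>\<eta> z) + (\<integral>\<^sup>+y. f y \<partial>d)" if "f \<in> borel_measurable sizes" for f
    using s sd that by (simp, subst nn_integral_mix) (auto simp: nn_integral_count_space_finite UNIV_bool add.commute)
  then show ?thesis by (rule that[OF sd fd])
qed

text \<open>Only used for \<open>\<eta>\<close> below \<open>\<alpha>\<close>, where the subtraction is not truncated.\<close>

definition gap :: "'a kernel \<Rightarrow> 'a kernel \<Rightarrow> real \<times> 'a \<Rightarrow> ennreal" where
  "gap \<alpha> \<eta> z = (\<integral>\<^sup>+y. w y \<partial>\<alpha> z) - (\<integral>\<^sup>+y. w y \<partial>\<eta> z)"

abbreviation nrm :: "(real \<times> 'a \<Rightarrow> ennreal) \<Rightarrow> ennreal" where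
  "nrm e \<equiv> (\<integral>\<^sup>+z. e z \<partial>time_space)"

lemma gap_split:
  assumes "good \<eta>" and "(\<integral>\<^sup>+y. w y \<partial>\<alpha> z) = (\<integral>\<^sup>+y. w y \<partial>\<eta> z) + (\<integral>\<^sup>+y. w y \<partial>d)"
  shows "gap \<alpha> \<eta> z = (\<integral>\<^sup>+y. w y \<partial>d)"
  unfolding gap_def assms(2) using good_w_fin[OF assms(1)] by simp

lemma time_space_measurable: "borel_measurable time_space = (borel_measurable borel :: (real \<times> 'a \<Rightarrow> ennreal) set)"
  using ok_index_time_space unfolding ok_index_def borel_prod by (intro measurable_cong_sets) simp_all

lemma nice_w_measurable: "nice \<alpha> \<Longrightarrow> f \<in> borel_measurable sizes \<Longrightarrow> (\<lambda>z. \<integral>\<^sup>+y. f y \<partial>\<alpha> z) \<in> borel_measurable borel"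
  by (rule lfk_integral_measurable[OF nice_lfk]) auto

lemma gap_measurable: "good \<alpha> \<Longrightarrow> good \<eta> \<Longrightarrow> gap \<alpha> \<eta> \<in> borel_measurable borel"
  unfolding gap_def using nice_w_measurable[OF goodD(1) w_measurable] by measurable

lemma gap_add: "kernel_le \<eta> \<alpha> \<Longrightarrow> good \<alpha> \<Longrightarrow> good \<eta> \<Longrightarrow> (\<integral>\<^sup>+y. w y \<partial>\<alpha> z) = (\<integral>\<^sup>+y. w y \<partial>\<eta> z) + gap \<alpha> \<eta> z"
  unfolding gap_def using kernel_le_nn_integral[of \<eta> \<alpha> z w] nice_sets[OF goodD(1)]
  by (simp add: add_diff_inverse_ennreal)

lemma rate_gap:
  assumes \<beta>: "good \<beta>" and \<gamma>: "good \<gamma>" and le: "kernel_le \<gamma> \<beta>" and y: "0 < y"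
  shows "rate \<beta> z y \<le> rate \<gamma> z y + ennreal C * w y * gap \<beta> \<gamma> z"
proof -
  obtain d where d: "sets d = sets sizes" "finite_measure d"
    "\<And>f. f \<in> borel_measurable sizes \<Longrightarrow> (\<integral>\<^sup>+y. f y \<partial>\<beta> z) = (\<integral>\<^sup>+y. f y \<partial>\<gamma> z) + (\<integral>\<^sup>+y. f y \<partial>d)"
    by (rule good_split[OF \<beta> \<gamma> le, of z]) blast
  note [measurable_cong] = d(1)
  have [measurable]: "y \<in> space sizes" using y by (simp add: space_sizes)
  have "(\<integral>\<^sup>+y'. k y y' \<partial>d) \<le> (\<integral>\<^sup>+y'. ennreal C * w y * w y' \<partial>d)"
  proof (rule nn_integral_mono)
    fix y' assume "y' \<in> space d"
    then have "k y y' \<le> ennreal (C * (y powr (2/3) * y' powr (2/3)))"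
      using y sets_eq_imp_space_eq[OF d(1)] by (intro k_bound) (auto simp: space_sizes)
    also have "\<dots> = ennreal C * w y * w y'" using pos by (simp add: w_def ennreal_mult mult.assoc)
    finally show "k y y' \<le> ennreal C * w y * w y'" .
  qed
  also have "\<dots> = ennreal C * w y * gap \<beta> \<gamma> z"
    by (simp add: nn_integral_cmult gap_split[where \<alpha>=\<beta> and z=z, OF \<gamma> d(3)[OF w_measurable]])
  finally have "(\<integral>\<^sup>+y'. k y y' \<partial>d) \<le> ennreal C * w y * gap \<beta> \<gamma> z" .
  moreover have "rate \<beta> z y = rate \<gamma> z y + (\<integral>\<^sup>+y'. k y y' \<partial>d)"
    unfolding rate_def by (rule d(3)) measurable
  ultimately show ?thesis by (simp add: add_left_mono)
qed

text \<open>The first form is for a difference carried by the larger partner, whose own loss covers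
  \<open>w y * kk y y'\<close>. The second is for a difference carried by the smaller partner, where
  no loss is available and the whole gain is charged to \<open>phi\<close> of the larger
  one.\<close>

lemma bracket_w:
  assumes y: "0 < y" "0 < y'"
  shows "w (y + y') * kk y y' \<le> w y * kk y y' + ennreal C * w y * phi y'"
    and "w (y + y') * kk y y' \<le> ennreal (2 * C) * phi y * w y'"
proof -
  have "w (y + y') * kk y y' \<le> w y * kk y y' + ennreal C * w y * phi y' \<and> w (y + y') * kk y y' \<le> ennreal (2 * C) * phi y * w y'"
  proof (cases "kk y y' = 0")
    case False
    then have yy: "\<delta> \<le> y'" "y' \<le> y" using kk_support by auto
    let ?K = "ennreal (C * (y powr (2/3) * y' powr (2/3)))"
    \<comment> \<open>Subadditivity of the power 2/3: the fractions y/s and y'/s add up to 1, and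
      each is at most its power 2/3.\<close>
    have sub: "(y + y') powr (2/3) \<le> y powr (2/3) + y' powr (2/3)"
    proof -
      define s where "s = y + y'"
      have "y / s \<le> (y / s) powr (2/3)" "y' / s \<le> (y' / s) powr (2/3)"
        using y powr_mono'[of "2/3" 1 "y / s"] powr_mono'[of "2/3" 1 "y' / s"] by (auto simp: s_def)
      moreover have "y / s + y' / s = 1" using y by (simp add: s_def add_divide_distrib[symmetric])
      ultimately have "1 \<le> (y / s) powr (2/3) + (y' / s) powr (2/3)" by linarith
      then have "s powr (2/3) * 1 \<le> s powr (2/3) * ((y / s) powr (2/3) + (y' / s) powr (2/3))"
        by (rule mult_left_mono) simp
      also have "\<dots> = y powr (2/3) + y' powr (2/3)"
        using y by (simp add: distrib_left s_def powr_divide)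
      finally show ?thesis by (simp add: s_def)
    qed
    have w1: "w (y + y') \<le> w y + w y'"
      unfolding w_def using sub by (subst ennreal_plus[symmetric]) (auto intro: ennreal_leI simp del: ennreal_plus)
    have kK: "kk y y' \<le> ?K" by (rule kk_bound[OF y])
    have K: "?K = ennreal C * w y * w y'" using pos by (simp add: w_def ennreal_mult mult.assoc)
    have "w (y + y') * kk y y' \<le> w y * kk y y' + w y' * kk y y'"
      using mult_right_mono[OF w1, of "kk y y'"] by (simp add: distrib_right)
    also have "\<dots> \<le> w y * kk y y' + w y' * ?K" by (intro add_left_mono mult_left_mono kK) simp
    also have "w y' * ?K = ennreal C * w y * phi y'" unfolding K w_w[OF y(2), symmetric] by (simp only: ac_simps)
    finally have 1: "w (y + y') * kk y y' \<le> w y * kk y y' + ennreal C * w y * phi y'" .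
    have "w y' \<le> w y" unfolding w_def using yy y by (intro ennreal_leI powr_mono2) auto
    then have "w y + w y' \<le> 2 * w y" unfolding mult_2 by (rule add_left_mono)
    with w1 have "w (y + y') \<le> 2 * w y" by (rule order_trans)
    then have "w (y + y') * kk y y' \<le> (2 * w y) * ?K" by (intro mult_mono kK) auto
    also have "\<dots> = ennreal (2 * C) * phi y * w y'"
      using pos unfolding K w_w[OF y(1), symmetric] by (simp add: ennreal_mult ac_simps)
    finally show ?thesis using 1 by simp
  qed simp
  then show "w (y + y') * kk y y' \<le> w y * kk y y' + ennreal C * w y * phi y'"
    and "w (y + y') * kk y y' \<le> ennreal (2 * C) * phi y * w y'" by auto
qed

lemma rate_slice_measurable: "meas_rate W \<Longrightarrow> W z \<in> borel_measurable sizes"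
  unfolding meas_rate_def using measurable_compose[OF measurable_Pair1', of z borel "\<lambda>(z, y). W z y" sizes borel] by simp

text \<open>Write \<open>\<alpha>\<close> as \<open>\<eta>\<close> plus \<open>d\<close> and
  \<open>\<beta>\<close> as \<open>\<gamma>\<close> plus \<open>v\<close>. The gain of
  \<open>\<alpha>\<close> with \<open>\<beta>\<close> then exceeds that of \<open>\<eta>\<close>
  with \<open>\<gamma>\<close> by \<open>\<eta>\<close> against \<open>v\<close>, bounded by
  \<open>bracket_w(2)\<close>, and by \<open>d\<close> against \<open>\<beta>\<close>, bounded by
  \<open>bracket_w(1)\<close> and the loss of \<open>d\<close>. Replacing \<open>W2\<close> by
  \<open>W1\<close> on \<open>\<eta>\<close> costs \<open>C * w * w * e\<close>. Each error contains
  one \<open>phi\<close> moment, at most 2 \<open>g0\<close>; hence the factor 2 C g0.\<close>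

lemma stability_pointwise:
  assumes g: "good \<alpha>" "good \<beta>" "good \<eta>" "good \<gamma>"
    and W: "meas_rate W1" "meas_rate W2"
    and le: "kernel_le \<eta> \<alpha>" "kernel_le \<gamma> \<beta>"
    and W1: "\<And>y. 0 < y \<Longrightarrow> rate \<beta> z y \<le> W1 z y"
    and W2: "\<And>y. 0 < y \<Longrightarrow> W2 z y \<le> W1 z y + ennreal C * w y * e"
  shows "(\<integral>\<^sup>+y. w y \<partial>gain \<alpha> \<beta> z) + (\<integral>\<^sup>+y. w y * W2 z y \<partial>\<eta> z) \<le> (\<integral>\<^sup>+y. w y \<partial>gain \<eta> \<gamma> z) + (\<integral>\<^sup>+y. w y * W1 z y \<partial>\<alpha> z)
    + ennreal (2 * C * g0) * (gap \<alpha> \<eta> z + 2 * gap \<beta> \<gamma> z + e)"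
proof -
  obtain d where d: "sets d = sets sizes" "finite_measure d"
    "\<And>f. f \<in> borel_measurable sizes \<Longrightarrow> (\<integral>\<^sup>+y. f y \<partial>\<alpha> z) = (\<integral>\<^sup>+y. f y \<partial>\<eta> z) + (\<integral>\<^sup>+y. f y \<partial>d)"
    by (rule good_split[OF g(1,3) le(1), of z]) blast
  obtain v where v: "sets v = sets sizes" "finite_measure v"
    "\<And>f. f \<in> borel_measurable sizes \<Longrightarrow> (\<integral>\<^sup>+y. f y \<partial>\<beta> z) = (\<integral>\<^sup>+y. f y \<partial>\<gamma> z) + (\<integral>\<^sup>+y. f y \<partial>v)"
    by (rule good_split[OF g(2,4) le(2), of z]) blast
  interpret v: finite_measure v by fact
  note n = goodD(1)[OF g(1)] goodD(1)[OF g(2)] goodD(1)[OF g(3)] goodD(1)[OF g(4)]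
  note [measurable_cong] = d(1) v(1) n[THEN nice_sets]
  note [measurable] = W[THEN rate_slice_measurable]
  have sp: "space d = {0<..}" "space v = {0<..}" using sets_eq_imp_space_eq[OF d(1)] sets_eq_imp_space_eq[OF v(1)] by (simp_all add: space_sizes)
  note sp = sp n[THEN nice_lfk, THEN lfk_space]
  define F where "F M y = (\<integral>\<^sup>+y'. w (y + y') * kk y y' \<partial>M)" for M y
  have wm: "(\<lambda>y'. w (y + y') * kk y y') \<in> borel_measurable sizes" if "0 < y" for y
  proof -
    have [measurable]: "y \<in> space sizes" using that by (simp add: space_sizes)
    show ?thesis unfolding w_def by measurable
  qed
  have F1 [measurable]: "F (\<kappa> z) \<in> borel_measurable sizes" if "nice \<kappa>" for \<kappa>
    unfolding F_def by (rule lfk_integral_measurable[OF nice_lfk[OF that]]) (unfold w_def, measurable)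
  have F2 [measurable]: "F v \<in> borel_measurable sizes"
    unfolding F_def w_def by measurable
  have F\<beta>: "F (\<beta> z) y = F (\<gamma> z) y + F v y" if "0 < y" for y
    unfolding F_def by (rule v(3)[OF wm[OF that]])
  have G: "(\<integral>\<^sup>+y. w y \<partial>gain \<kappa> \<xi> z) = (\<integral>\<^sup>+y. F (\<xi> z) y \<partial>\<kappa> z)" if "nice \<kappa>" "nice \<xi>" for \<kappa> \<xi>
    unfolding F_def by (rule nn_integral_gain[OF that w_measurable])
  have dF: "(\<integral>\<^sup>+y. F (\<beta> z) y \<partial>d) \<le> (\<integral>\<^sup>+y. w y * W1 z y \<partial>d) + ennreal (2 * C * g0) * gap \<alpha> \<eta> z"
  proof -
    have "(\<integral>\<^sup>+y. F (\<beta> z) y \<partial>d) \<le> (\<integral>\<^sup>+y. w y * W1 z y + ennreal (2 * C * g0) * w y \<partial>d)"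
    proof (rule nn_integral_mono)
      fix y assume "y \<in> space d"
      then have y: "0 < y" and [measurable]: "y \<in> space sizes" by (simp_all add: sp space_sizes)
      have "F (\<beta> z) y \<le> (\<integral>\<^sup>+y'. w y * k y y' + ennreal C * w y * phi y' \<partial>\<beta> z)"
        unfolding F_def using y
        by (intro nn_integral_mono order_trans[OF bracket_w(1)] add_right_mono mult_left_mono kk_le_k) (auto simp: sp)
      also have "\<dots> = w y * rate \<beta> z y + ennreal C * w y * (\<integral>\<^sup>+y. phi y \<partial>\<beta> z)"
        unfolding rate_def by (subst nn_integral_add) (auto simp: nn_integral_cmult)
      also have "\<dots> \<le> w y * W1 z y + ennreal C * w y * ennreal (2 * g0)"
        using W1[OF y] goodD(2)[OF g(2), of z] by (intro add_mono mult_left_mono) auto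
      also have "ennreal C * w y * ennreal (2 * g0) = ennreal (2 * C * g0) * w y"
        using pos by (simp add: ennreal_mult ac_simps)
      finally show "F (\<beta> z) y \<le> w y * W1 z y + ennreal (2 * C * g0) * w y" .
    qed
    also have "\<dots> = (\<integral>\<^sup>+y. w y * W1 z y \<partial>d) + ennreal (2 * C * g0) * (\<integral>\<^sup>+y. w y \<partial>d)"
      by (simp add: nn_integral_add nn_integral_cmult)
    finally show ?thesis using gap_split[where \<alpha>=\<alpha> and z=z, OF g(3) d(3)[OF w_measurable]] by simp
  qed
  have lF: "(\<integral>\<^sup>+y. F v y \<partial>\<eta> z) \<le> ennreal (2 * C * g0) * (2 * gap \<beta> \<gamma> z)"
  proof -
    have "(\<integral>\<^sup>+y. F v y \<partial>\<eta> z) \<le> (\<integral>\<^sup>+y. (ennreal (2 * C) * gap \<beta> \<gamma> z) * phi y \<partial>\<eta> z)"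
    proof (rule nn_integral_mono)
      fix y assume "y \<in> space (\<eta> z)"
      then have "F v y \<le> (\<integral>\<^sup>+y'. ennreal (2 * C) * phi y * w y' \<partial>v)"
        unfolding F_def by (intro nn_integral_mono bracket_w(2)) (auto simp: sp)
      also have "\<dots> = ennreal (2 * C) * phi y * gap \<beta> \<gamma> z"
        by (simp add: nn_integral_cmult gap_split[where \<alpha>=\<beta> and z=z, OF g(4) v(3)[OF w_measurable]])
      finally show "F v y \<le> (ennreal (2 * C) * gap \<beta> \<gamma> z) * phi y" by (simp add: ac_simps)
    qed
    also have "\<dots> = (ennreal (2 * C) * gap \<beta> \<gamma> z) * (\<integral>\<^sup>+y. phi y \<partial>\<eta> z)" by (rule nn_integral_cmult) measurable
    also have "\<dots> \<le> (ennreal (2 * C) * gap \<beta> \<gamma> z) * ennreal (2 * g0)" by (intro mult_left_mono goodD(2)[OF g(3)]) simp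
    also have "\<dots> = ennreal (2 * C * g0) * (2 * gap \<beta> \<gamma> z)" using pos by (simp add: ennreal_mult ac_simps)
    finally show ?thesis .
  qed
  have l2: "(\<integral>\<^sup>+y. w y * W2 z y \<partial>\<eta> z) \<le> (\<integral>\<^sup>+y. w y * W1 z y \<partial>\<eta> z) + ennreal (2 * C * g0) * e"
  proof -
    have "(\<integral>\<^sup>+y. w y * W2 z y \<partial>\<eta> z) \<le> (\<integral>\<^sup>+y. w y * W1 z y + (ennreal C * e) * phi y \<partial>\<eta> z)"
    proof (rule nn_integral_mono)
      fix y assume "y \<in> space (\<eta> z)"
      then have y: "0 < y" by (simp add: sp)
      have "w y * W2 z y \<le> w y * (W1 z y + ennreal C * w y * e)" by (intro mult_left_mono W2[OF y]) simp
      also have "\<dots> = w y * W1 z y + (ennreal C * e) * phi y"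
        unfolding w_w[OF y, symmetric] distrib_left by (simp only: ac_simps)
      finally show "w y * W2 z y \<le> w y * W1 z y + (ennreal C * e) * phi y" .
    qed
    also have "\<dots> = (\<integral>\<^sup>+y. w y * W1 z y \<partial>\<eta> z) + (ennreal C * e) * (\<integral>\<^sup>+y. phi y \<partial>\<eta> z)"
      by (simp add: nn_integral_add nn_integral_cmult)
    also have "\<dots> \<le> (\<integral>\<^sup>+y. w y * W1 z y \<partial>\<eta> z) + (ennreal C * e) * ennreal (2 * g0)"
      by (intro add_left_mono mult_left_mono goodD(2)[OF g(3)]) simp
    also have "(ennreal C * e) * ennreal (2 * g0) = ennreal (2 * C * g0) * e" using pos by (simp add: ennreal_mult ac_simps)
    finally show ?thesis .
  qed
  have "(\<integral>\<^sup>+y. w y \<partial>gain \<alpha> \<beta> z) = (\<integral>\<^sup>+y. F (\<gamma> z) y \<partial>\<eta> z) + (\<integral>\<^sup>+y. F v y \<partial>\<eta> z) + (\<integral>\<^sup>+y. F (\<beta> z) y \<partial>d)"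
  proof -
    have "(\<integral>\<^sup>+y. F (\<beta> z) y \<partial>\<eta> z) = (\<integral>\<^sup>+y. F (\<gamma> z) y + F v y \<partial>\<eta> z)"
      by (intro nn_integral_cong F\<beta>) (simp add: sp)
    also have "\<dots> = (\<integral>\<^sup>+y. F (\<gamma> z) y \<partial>\<eta> z) + (\<integral>\<^sup>+y. F v y \<partial>\<eta> z)"
      using F1[OF n(4)] F2 measurable_cong_sets[OF nice_sets[OF n(3)] refl] by (intro nn_integral_add) simp_all
    finally show ?thesis unfolding G[OF n(1,2)] d(3)[OF F1[OF n(2)]] by simp
  qed
  also have "\<dots> + (\<integral>\<^sup>+y. w y * W2 z y \<partial>\<eta> z) \<le> (\<integral>\<^sup>+y. F (\<gamma> z) y \<partial>\<eta> z) + ennreal (2 * C * g0) * (2 * gap \<beta> \<gamma> z)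
     + ((\<integral>\<^sup>+y. w y * W1 z y \<partial>d) + ennreal (2 * C * g0) * gap \<alpha> \<eta> z) + ((\<integral>\<^sup>+y. w y * W1 z y \<partial>\<eta> z) + ennreal (2 * C * g0) * e)"
    by (intro add_mono order_refl dF lF l2)
  also have "\<dots> = (\<integral>\<^sup>+y. F (\<gamma> z) y \<partial>\<eta> z) + ((\<integral>\<^sup>+y. w y * W1 z y \<partial>\<eta> z) + (\<integral>\<^sup>+y. w y * W1 z y \<partial>d))
     + ennreal (2 * C * g0) * (gap \<alpha> \<eta> z + 2 * gap \<beta> \<gamma> z + e)"
    by (simp add: distrib_left ac_simps)
  also have "(\<integral>\<^sup>+y. w y * W1 z y \<partial>\<eta> z) + (\<integral>\<^sup>+y. w y * W1 z y \<partial>d) = (\<integral>\<^sup>+y. w y * W1 z y \<partial>\<alpha> z)"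
    by (rule d(3)[symmetric]) measurable
  finally show ?thesis by (simp add: G[OF n(3,4)])
qed

section \<open>Finiteness of w norms and stability of the linear problem\<close>

lemma w_le_id: "\<delta> \<le> y \<Longrightarrow> w y \<le> ennreal (\<delta> powr (- (1/3))) * ennreal y"
proof -
  assume y: "\<delta> \<le> y"
  then have "y powr (2/3) = y powr (- (1/3)) * y powr 1" using pos by (simp only: powr_add[symmetric]) simp
  also have "\<dots> \<le> \<delta> powr (- (1/3)) * y" using y pos by (auto intro!: mult_right_mono powr_mono2')
  finally show ?thesis unfolding w_def using y pos by (simp add: ennreal_leI flip: ennreal_mult)
qed

lemma supp_w_le:
  assumes s: "sets M = sets sizes" "emeasure M {0<..<\<delta>} = 0"
  shows "(\<integral>\<^sup>+y. w y \<partial>M) \<le> ennreal (\<delta> powr (- (1/3))) * (\<integral>\<^sup>+y. ennreal y \<partial>M)"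
proof -
  note [measurable_cong] = s(1)
  have "(\<integral>\<^sup>+y. w y \<partial>M) \<le> (\<integral>\<^sup>+y. ennreal (\<delta> powr (- (1/3))) * ennreal y \<partial>M)"
    using AE_size_ge[OF s] by (intro nn_integral_mono_AE) (auto elim!: eventually_mono intro: w_le_id)
  also have "\<dots> = ennreal (\<delta> powr (- (1/3))) * (\<integral>\<^sup>+y. ennreal y \<partial>M)" by (rule nn_integral_cmult) measurable
  finally show ?thesis .
qed

lemma good_w_total:
  assumes "good \<alpha>"
  shows "(\<integral>\<^sup>+x. \<integral>\<^sup>+y. w y \<partial>\<alpha> (t, x) \<partial>lborel) \<le> ennreal (\<delta> powr (- (1/3))) * ennreal (2 * m0)"
proof -
  note n = goodD(1)[OF assms]
  have "(\<integral>\<^sup>+x. \<integral>\<^sup>+y. w y \<partial>\<alpha> (t, x) \<partial>lborel) \<le> (\<integral>\<^sup>+x. ennreal (\<delta> powr (- (1/3))) * (\<integral>\<^sup>+y. ennreal y \<partial>\<alpha> (t, x)) \<partial>lborel)"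
    by (intro nn_integral_mono supp_w_le nice_sets[OF n] nice_supp[OF n])
  also have "\<dots> = ennreal (\<delta> powr (- (1/3))) * (\<integral>\<^sup>+x. \<integral>\<^sup>+y. ennreal y \<partial>\<alpha> (t, x) \<partial>lborel)"
    by (rule nn_integral_cmult) (simp, rule kernel_param_measurable[OF nice_lfk[OF n]], measurable)
  also have "\<dots> \<le> ennreal (\<delta> powr (- (1/3))) * ennreal (2 * m0)" by (intro mult_left_mono goodD(3)[OF assms]) simp
  finally show ?thesis .
qed

lemma nrm_eq:
  assumes "e \<in> borel_measurable borel"
  shows "nrm e = (\<integral>\<^sup>+s. \<integral>\<^sup>+x. e (s, x) \<partial>lborel \<partial>lborel)"
  using nn_integral_time_space[of "\<lambda>s x. e (s, x)"] assms by (simp add: case_prod_beta' borel_prod)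

lemma good_w_nrm:
  assumes g: "good \<alpha>"
  shows "nrm (\<lambda>z. \<integral>\<^sup>+y. w y \<partial>\<alpha> z) < \<infinity>"
proof -
  note n = goodD(1)[OF g]
  let ?D = "ennreal (\<delta> powr (- (1/3))) * ennreal (2 * m0)"
  have "nrm (\<lambda>z. \<integral>\<^sup>+y. w y \<partial>\<alpha> z) = (\<integral>\<^sup>+s. \<integral>\<^sup>+x. \<integral>\<^sup>+y. w y \<partial>\<alpha> (s, x) \<partial>lborel \<partial>lborel)"
    by (rule nrm_eq[OF nice_w_measurable[OF n w_measurable]])
  also have "\<dots> \<le> (\<integral>\<^sup>+s. ?D * indicator {0<..T} s \<partial>lborel)"
  proof (rule nn_integral_mono)
    fix s :: real
    show "(\<integral>\<^sup>+x. \<integral>\<^sup>+y. w y \<partial>\<alpha> (s, x) \<partial>lborel) \<le> ?D * indicator {0<..T} s"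
      using good_w_total[OF g, of s] by (cases "0 < s \<and> s \<le> T") (auto simp: nice_null[OF n])
  qed
  also have "\<dots> = ?D * ennreal T" using pos by (subst nn_integral_cmult_indicator) auto
  also have "\<dots> < \<infinity>" by (simp add: ennreal_mult_less_top)
  finally show ?thesis .
qed

lemma initial_w_finite: "0 < t \<Longrightarrow> (\<integral>\<^sup>+x. \<integral>\<^sup>+y. w y \<partial>evolve initial_space uno one ini t x \<partial>lborel) < \<infinity>"
proof -
  assume t: "0 < t"
  have "(\<integral>\<^sup>+x. \<integral>\<^sup>+y. w y \<partial>evolve initial_space uno one ini t x \<partial>lborel) \<le> (\<integral>\<^sup>+x. \<integral>\<^sup>+y. w y \<partial>\<mu>0 x \<partial>lborel)"
    using t by (intro evolve_initial_total uno_measurable) (auto simp: uno_def)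
  also have "\<dots> \<le> (\<integral>\<^sup>+x. ennreal (\<delta> powr (- (1/3))) * (\<integral>\<^sup>+y. ennreal y \<partial>\<mu>0 x) \<partial>lborel)"
    by (intro nn_integral_mono supp_w_le lfk_sets[OF \<mu>0_lfk] \<mu>0_supp)
  also have "\<dots> = ennreal (\<delta> powr (- (1/3))) * (\<integral>\<^sup>+x. \<integral>\<^sup>+y. ennreal y \<partial>\<mu>0 x \<partial>lborel)"
    using lfk_integral_measurable[OF \<mu>0_lfk, of "\<lambda>x. x" borel "\<lambda>x y. ennreal y"] by (intro nn_integral_cmult) auto
  also have "\<dots> \<le> ennreal (\<delta> powr (- (1/3))) * ennreal m0" by (intro mult_left_mono \<mu>0_mass) simp
  also have "\<dots> < \<infinity>" by (simp add: ennreal_mult_less_top)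
  finally show ?thesis .
qed

lemma weighted_measurable:
  assumes n: "nice \<alpha>" and W: "meas_rate W" and f [measurable]: "f \<in> borel_measurable sizes"
  shows "(\<lambda>z. \<integral>\<^sup>+y. f y * (indicator {..<t} (fst z) * W z y) \<partial>\<alpha> z) \<in> borel_measurable borel"
proof -
  have [measurable]: "(\<lambda>m. W (fst m) (snd m)) \<in> borel_measurable (borel \<Otimes>\<^sub>M sizes)"
    using W by (simp add: meas_rate_def case_prod_beta')
  show ?thesis unfolding indicator_if
    by (rule lfk_integral_measurable[OF nice_lfk[OF n]]) measurable
qed

text \<open>Both mild equations are tested with \<open>w\<close> and integrated over space, where
  their initial terms agree. By \<open>stability_pointwise\<close> the space integral of the gap is
  at most 2 C g0 times the space-time norms at each time. Integrating over (0,T] makes this 1/50,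
  and absorbing the gap of \<open>\<alpha>\<close> and \<open>\<eta>\<close> itself doubles it to
  1/25. The function \<open>e1\<close> makes the loss of \<open>\<alpha>\<close> finite.\<close>

lemma stability:
  assumes sol: "exp_sol \<beta> W1 \<alpha>" "exp_sol \<gamma> W2 \<eta>"
    and g: "good \<alpha>" "good \<beta>" "good \<eta>" "good \<gamma>"
    and le: "kernel_le \<eta> \<alpha>" "kernel_le \<gamma> \<beta>"
    and W1: "\<And>z y. 0 < y \<Longrightarrow> rate \<beta> z y \<le> W1 z y" "\<And>z y. 0 < y \<Longrightarrow> W1 z y \<le> ennreal C * w y * e1 z"
    and W2: "\<And>z y. 0 < y \<Longrightarrow> W2 z y \<le> W1 z y + ennreal C * w y * e z"
    and e: "e \<in> borel_measurable borel" "e1 \<in> borel_measurable borel" "nrm e1 < \<infinity>"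
  shows "nrm (gap \<alpha> \<eta>) \<le> ennreal (1/25) * (2 * nrm (gap \<beta> \<gamma>) + nrm e)"
proof -
  note n = goodD(1)[OF g(1)] goodD(1)[OF g(2)] goodD(1)[OF g(3)] goodD(1)[OF g(4)]
  have W: "ok_rate W1" "ok_rate W2" using sol by (auto simp: exp_sol_def)
  note mW = W[THEN ok_rate_meas]
  note mild = sol[THEN exp_sol_mild]
  note [measurable] = gap_measurable[OF g(1,3)] gap_measurable[OF g(2,4)] e(1,2)
  let ?X = "ennreal (2 * C * g0) * (nrm (gap \<alpha> \<eta>) + 2 * nrm (gap \<beta> \<gamma>) + nrm e)"
  have P: "(\<integral>\<^sup>+x. gap \<alpha> \<eta> (t, x) \<partial>lborel) \<le> ?X" if t: "0 < t" "t \<le> T" for t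
  proof -
    let ?loss = "\<lambda>W \<alpha> z. \<integral>\<^sup>+y. w y * (indicator {..<t} (fst z) * W z y) \<partial>\<alpha> z"
    let ?gain = "\<lambda>\<alpha> \<beta> z. \<integral>\<^sup>+y. w y * indicator {..<t} (fst z) \<partial>gain \<alpha> \<beta> z"
    have ml: "?loss W1 \<alpha> \<in> borel_measurable borel" "?loss W2 \<eta> \<in> borel_measurable borel"
      by (rule weighted_measurable[OF n(1) mW(1) w_measurable] weighted_measurable[OF n(3) mW(2) w_measurable])+
    have mg: "?gain \<alpha> \<beta> \<in> borel_measurable borel" "?gain \<eta> \<gamma> \<in> borel_measurable borel"
      using weighted_measurable[OF gain_nice[OF n(1,2)] _ w_measurable, of one] weighted_measurable[OF gain_nice[OF n(3,4)] _ w_measurable, of one]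
      by (simp_all add: meas_rate_def)
    note [measurable] = ml mg
    let ?A = "\<integral>\<^sup>+x. \<integral>\<^sup>+y. w y \<partial>\<alpha> (t, x) \<partial>lborel" and ?E = "\<integral>\<^sup>+x. \<integral>\<^sup>+y. w y \<partial>\<eta> (t, x) \<partial>lborel"
      and ?I = "\<integral>\<^sup>+x. \<integral>\<^sup>+y. w y \<partial>evolve initial_space uno one ini t x \<partial>lborel"
    have A: "?A + nrm (?loss W1 \<alpha>) = ?I + nrm (?gain \<alpha> \<beta>)"
      using mild_total[OF n(1,2) mW(1) mild(1) t w_measurable] by (simp add: case_prod_beta')
    have E: "?E + nrm (?loss W2 \<eta>) = ?I + nrm (?gain \<eta> \<gamma>)"
      using mild_total[OF n(3,4) mW(2) mild(2) t w_measurable] by (simp add: case_prod_beta')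
    have cmp: "nrm (?gain \<alpha> \<beta>) + nrm (?loss W2 \<eta>) \<le> nrm (?gain \<eta> \<gamma>) + nrm (?loss W1 \<alpha>) + ?X"
    proof -
      have "nrm (?gain \<alpha> \<beta>) + nrm (?loss W2 \<eta>) = nrm (\<lambda>z. ?gain \<alpha> \<beta> z + ?loss W2 \<eta> z)"
        by (rule nn_integral_add[symmetric]) (simp_all add: time_space_measurable)
      also have "\<dots> \<le> nrm (\<lambda>z. ?gain \<eta> \<gamma> z + ?loss W1 \<alpha> z + ennreal (2 * C * g0) * (gap \<alpha> \<eta> z + 2 * gap \<beta> \<gamma> z + e z))"
      proof (rule nn_integral_mono)
        fix z
        show "?gain \<alpha> \<beta> z + ?loss W2 \<eta> z \<le> ?gain \<eta> \<gamma> z + ?loss W1 \<alpha> z + ennreal (2 * C * g0) * (gap \<alpha> \<eta> z + 2 * gap \<beta> \<gamma> z + e z)"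
          using stability_pointwise[OF g mW le W1(1) W2, of z] by (cases "fst z < t") simp_all
      qed
      also have "\<dots> = nrm (?gain \<eta> \<gamma>) + nrm (?loss W1 \<alpha>) + ?X"
        by (simp add: nn_integral_add nn_integral_cmult time_space_measurable)
      finally show ?thesis .
    qed
    have fl: "nrm (?loss W1 \<alpha>) < \<infinity>"
    proof -
      have "nrm (?loss W1 \<alpha>) \<le> nrm (\<lambda>z. ennreal (2 * C * g0) * e1 z)"
      proof (rule nn_integral_mono)
        fix z
        note [measurable_cong] = nice_sets[OF n(1)]
        have "?loss W1 \<alpha> z \<le> (\<integral>\<^sup>+y. (ennreal C * e1 z) * phi y \<partial>\<alpha> z)"
        proof (rule nn_integral_mono)
          fix y assume "y \<in> space (\<alpha> z)"
          then have y: "0 < y" using lfk_space[OF nice_lfk[OF n(1)]] by simp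
          have "w y * (indicator {..<t} (fst z) * W1 z y) \<le> w y * (1 * (ennreal C * w y * e1 z))"
            by (intro mult_left_mono mult_mono W1(2)[OF y]) (auto split: split_indicator)
          also have "\<dots> = (ennreal C * e1 z) * phi y" unfolding w_w[OF y, symmetric] mult_1 by (simp only: ac_simps)
          finally show "w y * (indicator {..<t} (fst z) * W1 z y) \<le> (ennreal C * e1 z) * phi y" .
        qed
        also have "\<dots> = (ennreal C * e1 z) * (\<integral>\<^sup>+y. phi y \<partial>\<alpha> z)" by (rule nn_integral_cmult) measurable
        also have "\<dots> \<le> (ennreal C * e1 z) * ennreal (2 * g0)" by (intro mult_left_mono goodD(2)[OF g(1)]) simp
        also have "\<dots> = ennreal (2 * C * g0) * e1 z" using pos by (simp add: ennreal_mult ac_simps)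
        finally show "?loss W1 \<alpha> z \<le> ennreal (2 * C * g0) * e1 z" .
      qed
      also have "\<dots> = ennreal (2 * C * g0) * nrm e1" using e by (intro nn_integral_cmult) (simp add: time_space_measurable)
      also have "\<dots> < \<infinity>" using e(3) by (simp add: ennreal_mult_less_top)
      finally show ?thesis .
    qed
    have fg: "nrm (?gain \<eta> \<gamma>) < \<infinity>"
    proof -
      have "nrm (?gain \<eta> \<gamma>) \<le> nrm (\<lambda>z. ennreal (4 * C * g0) * (\<integral>\<^sup>+y. w y \<partial>\<gamma> z))"
      proof (rule nn_integral_mono)
        fix z
        note [measurable_cong] = nice_sets[OF n(3)] nice_sets[OF n(4)]
        have "?gain \<eta> \<gamma> z \<le> (\<integral>\<^sup>+y. w y \<partial>gain \<eta> \<gamma> z)" by (intro nn_integral_mono) (auto split: split_indicator)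
        also have "\<dots> = (\<integral>\<^sup>+y. \<integral>\<^sup>+y'. w (y + y') * kk y y' \<partial>\<gamma> z \<partial>\<eta> z)" by (rule nn_integral_gain[OF n(3,4) w_measurable])
        also have "\<dots> \<le> (\<integral>\<^sup>+y. \<integral>\<^sup>+y'. ennreal (2 * C) * phi y * w y' \<partial>\<gamma> z \<partial>\<eta> z)"
          by (intro nn_integral_mono bracket_w(2)) (auto simp: lfk_space[OF nice_lfk[OF n(3)]] lfk_space[OF nice_lfk[OF n(4)]])
        also have "\<dots> = (\<integral>\<^sup>+y. (ennreal (2 * C) * (\<integral>\<^sup>+y. w y \<partial>\<gamma> z)) * phi y \<partial>\<eta> z)"
          by (intro nn_integral_cong) (subst nn_integral_cmult, auto simp: ac_simps)
        also have "\<dots> = (ennreal (2 * C) * (\<integral>\<^sup>+y. w y \<partial>\<gamma> z)) * (\<integral>\<^sup>+y. phi y \<partial>\<eta> z)" by (rule nn_integral_cmult) measurable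
        also have "\<dots> \<le> (ennreal (2 * C) * (\<integral>\<^sup>+y. w y \<partial>\<gamma> z)) * ennreal (2 * g0)" by (intro mult_left_mono goodD(2)[OF g(3)]) simp
        also have "\<dots> = ennreal (4 * C * g0) * (\<integral>\<^sup>+y. w y \<partial>\<gamma> z)"
        proof -
          have "ennreal (4 * C * g0) = ennreal (2 * C) * ennreal (2 * g0)" using pos by (simp flip: ennreal_mult)
          then show ?thesis by (simp only: ac_simps)
        qed
        finally show "?gain \<eta> \<gamma> z \<le> ennreal (4 * C * g0) * (\<integral>\<^sup>+y. w y \<partial>\<gamma> z)" .
      qed
      also have "\<dots> = ennreal (4 * C * g0) * nrm (\<lambda>z. \<integral>\<^sup>+y. w y \<partial>\<gamma> z)"
        using nice_w_measurable[OF n(4) w_measurable] by (intro nn_integral_cmult) (simp add: time_space_measurable)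
      also have "\<dots> < \<infinity>" using good_w_nrm[OF g(4)] by (simp add: ennreal_mult_less_top)
      finally show ?thesis .
    qed
    \<comment> \<open>The two balances are added crosswise. All terms other than the moments at time
      \<open>t\<close> and the error \<open>?X\<close> are collected in \<open>?Z\<close> and
      cancelled because they are finite; the initial term is the same in both.\<close>
    let ?Z = "nrm (?loss W1 \<alpha>) + ?I + nrm (?gain \<eta> \<gamma>)"
    have "?Z + ?A = (?A + nrm (?loss W1 \<alpha>)) + (?I + nrm (?gain \<eta> \<gamma>))" by (simp only: ac_simps)
    also have "\<dots> = (?I + nrm (?gain \<alpha> \<beta>)) + (?E + nrm (?loss W2 \<eta>))" unfolding A E ..
    also have "\<dots> = ?I + ?E + (nrm (?gain \<alpha> \<beta>) + nrm (?loss W2 \<eta>))" by (simp only: ac_simps)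
    also have "\<dots> \<le> ?I + ?E + (nrm (?gain \<eta> \<gamma>) + nrm (?loss W1 \<alpha>) + ?X)" by (rule add_left_mono[OF cmp])
    also have "\<dots> = ?Z + (?E + ?X)" by (simp only: ac_simps)
    finally have "?Z + ?A \<le> ?Z + (?E + ?X)" .
    moreover have "?Z \<noteq> \<infinity>" using fl fg initial_w_finite[OF t(1)] by auto
    ultimately have AE: "?A \<le> ?E + ?X" by (auto simp: ennreal_add_left_cancel_le)
    have [measurable]: "(\<lambda>x. \<integral>\<^sup>+y. w y \<partial>\<eta> (t, x)) \<in> borel_measurable borel"
      by (rule kernel_param_measurable[OF nice_lfk[OF n(3)]]) measurable
    have "?A = ?E + (\<integral>\<^sup>+x. gap \<alpha> \<eta> (t, x) \<partial>lborel)"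
      unfolding gap_add[OF le(1) g(1,3)] by (rule nn_integral_add) measurable
    moreover have "?E \<noteq> \<infinity>"
    proof -
      have "ennreal (\<delta> powr (- (1/3))) * ennreal (2 * m0) < \<infinity>" by (simp add: ennreal_mult_less_top)
      then show ?thesis using good_w_total[OF g(3), of t] by (auto simp: top_unique)
    qed
    ultimately show ?thesis using AE by (auto simp: ennreal_add_left_cancel_le)
  qed
  have "nrm (gap \<alpha> \<eta>) = (\<integral>\<^sup>+s. \<integral>\<^sup>+x. gap \<alpha> \<eta> (s, x) \<partial>lborel \<partial>lborel)" by (rule nrm_eq) measurable
  also have "\<dots> \<le> (\<integral>\<^sup>+s. ?X * indicator {0<..T} s \<partial>lborel)"
  proof (rule nn_integral_mono)
    fix s :: real
    show "(\<integral>\<^sup>+x. gap \<alpha> \<eta> (s, x) \<partial>lborel) \<le> ?X * indicator {0<..T} s"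
      using P[of s] by (cases "0 < s \<and> s \<le> T") (auto simp: gap_def nice_null[OF n(1)] nice_null[OF n(3)])
  qed
  also have "\<dots> = ?X * ennreal T" using pos by (subst nn_integral_cmult_indicator) auto
  also have "\<dots> = ennreal (2 * C * g0 * T) * (nrm (gap \<alpha> \<eta>) + (2 * nrm (gap \<beta> \<gamma>) + nrm e))"
    using pos by (simp add: ennreal_mult ac_simps)
  also have "\<dots> \<le> ennreal (1/50) * (nrm (gap \<alpha> \<eta>) + (2 * nrm (gap \<beta> \<gamma>) + nrm e))"
    using small by (intro mult_right_mono ennreal_leI) auto
  finally have "nrm (gap \<alpha> \<eta>) \<le> ennreal (1/50) * (2 * nrm (gap \<beta> \<gamma>) + nrm e) + ennreal (1/50) * nrm (gap \<alpha> \<eta>)"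
    by (simp only: distrib_left ac_simps)
  moreover have "ennreal (1/50) \<le> ennreal (1/2)" by (rule ennreal_leI) simp
  moreover have "nrm (gap \<alpha> \<eta>) < \<infinity>"
    by (rule le_less_trans[OF nn_integral_mono good_w_nrm[OF g(1)]]) (simp add: gap_def diff_le_self_ennreal)
  ultimately have "nrm (gap \<alpha> \<eta>) \<le> 2 * (ennreal (1/50) * (2 * nrm (gap \<beta> \<gamma>) + nrm e))" by (rule ennreal_absorb)
  also have "\<dots> = (2 * ennreal (1/50)) * (2 * nrm (gap \<beta> \<gamma>) + nrm e)" by (simp only: mult.assoc)
  also have "2 * ennreal (1/50) = ennreal (1/25)"
    using ennreal_mult'[of 2 "1/50"] by simp
  finally show ?thesis .
qed

end

text \<open>The sum contracts by 3/25; the weaker factor 1/2 gives simple geometric sums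
  later.\<close>

lemma halving:
  fixes a b :: "nat \<Rightarrow> ennreal"
  assumes "\<And>k. a (Suc k) \<le> ennreal (1/25) * (2 * a k + b k)" "\<And>k. b (Suc k) \<le> ennreal (1/25) * (2 * b k + a k)"
  shows "a k + b k \<le> ennreal ((1/2) ^ k) * (a 0 + b 0)"
proof (induction k)
  case (Suc k)
  have "a (Suc k) + b (Suc k) \<le> ennreal (1/25) * (2 * a k + b k) + ennreal (1/25) * (2 * b k + a k)"
    by (intro add_mono assms)
  also have "\<dots> = ennreal (1/25) * (3 * (a k + b k))"
  proof -
    have "(3 :: ennreal) = 1 + 1 + 1" by simp
    then have "3 * (a k + b k) = a k + b k + (a k + b k) + (a k + b k)" by (simp only: distrib_right mult_1)
    then have "2 * a k + b k + (2 * b k + a k) = 3 * (a k + b k)" unfolding mult_2 by (simp only: ac_simps)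
    then show ?thesis by (simp only: distrib_left[symmetric])
  qed
  also have "\<dots> = (ennreal (1/25) * 3) * (a k + b k)" by (simp only: mult.assoc)
  also have "\<dots> \<le> ennreal (1/2) * (a k + b k)"
  proof (rule mult_right_mono)
    have "ennreal (1/25) * 3 = ennreal (3/25)" using ennreal_mult'[of "1/25" 3] by simp
    then show "ennreal (1/25) * 3 \<le> ennreal (1/2)" by (simp only:) (rule ennreal_leI, simp)
  qed simp
  also have "\<dots> \<le> ennreal (1/2) * (ennreal ((1/2) ^ k) * (a 0 + b 0))" by (rule mult_left_mono[OF Suc]) simp
  also have "\<dots> = ennreal ((1/2) ^ Suc k) * (a 0 + b 0)"
    using ennreal_mult'[of "1/2" "(1/2) ^ k"] by (simp add: mult.assoc)
  finally show ?case .
qed simp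

text \<open>How a small gap is used: for each single point the error can be made arbitrarily small
  along the sequence, while the factor \<open>c\<close> stays fixed.\<close>

lemma INF_zero_le:
  fixes a b c :: ennreal
  assumes le: "\<And>j::nat. a \<le> b + c * e j" and e: "(INF j. e j) = 0" and c: "c < \<infinity>"
  shows "a \<le> b"
proof (rule ennreal_le_epsilon)
  fix r :: real assume r: "0 < r"
  obtain d where d: "c = ennreal d" "0 \<le> d" using c by (cases c) auto
  have "(INF j. e j) < ennreal (r / (d + 1))" using e r d by simp
  then obtain j where j: "e j < ennreal (r / (d + 1))" by (auto simp: INF_less_iff)
  have "c * e j \<le> ennreal d * ennreal (r / (d + 1))" using j d by (intro mult_mono) auto
  also have "\<dots> = ennreal (d * (r / (d + 1)))" by (rule ennreal_mult'[symmetric]) (rule d)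
  also have "\<dots> \<le> ennreal r" using d r by (intro ennreal_leI) (simp add: field_simps)
  finally show "a \<le> b + ennreal r" using le[of j] by (meson add_left_mono order_trans)
qed

context coag_small
begin

section \<open>Lower bounds for a pair and uniqueness\<close>

lemma null_good: "good (\<lambda>_. null_measure sizes)"
  by (simp add: good_def null_nice)

lemma rate_mono:
  assumes "nice \<gamma>" "nice \<beta>" "kernel_le \<gamma> \<beta>"
  shows "rate \<gamma> z y \<le> rate \<beta> z y"
  unfolding rate_def using assms by (intro kernel_le_nn_integral nice_sets)

definition max_rate :: "'a kernel \<Rightarrow> 'a kernel \<Rightarrow> 'a rate" where
  "max_rate \<beta>1 \<beta>2 z y = max (rate \<beta>1 z y) (rate \<beta>2 z y)"

lemma max_rate_sym: "max_rate \<beta>1 \<beta>2 = max_rate \<beta>2 \<beta>1"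
  by (simp add: max_rate_def max.commute fun_eq_iff)

lemma max_rate_ok:
  assumes "good \<beta>1" "good \<beta>2" shows "ok_rate (max_rate \<beta>1 \<beta>2)"
proof -
  have [measurable]: "(\<lambda>m. rate \<beta>1 (fst m) (snd m)) \<in> borel_measurable (borel \<Otimes>\<^sub>M sizes)"
    "(\<lambda>m. rate \<beta>2 (fst m) (snd m)) \<in> borel_measurable (borel \<Otimes>\<^sub>M sizes)"
    using assms[THEN good_rate_ok] by (simp_all add: ok_rate_def case_prod_beta')
  have "(\<lambda>m. max_rate \<beta>1 \<beta>2 (fst m) (snd m)) \<in> borel_measurable (borel \<Otimes>\<^sub>M sizes)"
    unfolding max_rate_def by measurable
  then show ?thesis using assms[THEN good_rate_ok]
    by (simp add: ok_rate_def max_rate_def case_prod_beta')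
qed

text \<open>With the larger of the two rates and the common lower bound \<open>\<gamma>\<close>
  frozen, \<open>lin_least\<close> puts \<open>\<eta>\<close> below the solutions driven by
  \<open>\<beta>1\<close> and by \<open>\<beta>2\<close>. The larger rate exceeds
  \<open>rate \<beta>1\<close> by at most \<open>C * w y\<close> times the gap between
  \<open>\<beta>2\<close> and \<open>\<gamma>\<close>, because \<open>rate \<gamma>\<close> lies
  below both; this gap is the \<open>e\<close> of \<open>stability\<close>. The lemma speaks of
  \<open>\<beta>1\<close> only, the other case follows by symmetry of
  \<open>max_rate\<close>.\<close>

lemma pair_step:
  assumes g: "good \<beta>1" "good \<beta>2" "good \<gamma>" and le: "kernel_le \<gamma> \<beta>1" "kernel_le \<gamma> \<beta>2"
  defines "\<eta> \<equiv> lin \<gamma> (max_rate \<beta>1 \<beta>2)"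
  shows "good \<eta>"
    and "good \<alpha> \<Longrightarrow> exp_sol \<beta>1 (rate \<beta>1) \<alpha> \<Longrightarrow> kernel_le \<eta> \<alpha>"
    and "good \<alpha> \<Longrightarrow> exp_sol \<beta>1 (rate \<beta>1) \<alpha> \<Longrightarrow> nrm (gap \<alpha> \<eta>) \<le> ennreal (1/25) * (2 * nrm (gap \<beta>1 \<gamma>) + nrm (gap \<beta>2 \<gamma>))"
proof -
  note n = goodD(1)[OF g(1)] goodD(1)[OF g(2)] goodD(1)[OF g(3)]
  note W = max_rate_ok[OF g(1,2)]
  show \<eta>: "good \<eta>" unfolding \<eta>_def
    by (rule lin_good[OF g(3) W]) (auto simp: max_rate_def intro: max.coboundedI1 rate_mono n le)
  have sol: "exp_sol \<gamma> (max_rate \<beta>1 \<beta>2) \<eta>" unfolding \<eta>_def by (rule lin_exp_sol[OF n(3) W])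
  assume \<alpha>: "good \<alpha>" "exp_sol \<beta>1 (rate \<beta>1) \<alpha>"
  show le': "kernel_le \<eta> \<alpha>" unfolding \<eta>_def
    by (rule lin_least[OF n(3) W \<alpha>(2) le(1)]) (simp add: max_rate_def)
  show "nrm (gap \<alpha> \<eta>) \<le> ennreal (1/25) * (2 * nrm (gap \<beta>1 \<gamma>) + nrm (gap \<beta>2 \<gamma>))"
  proof (rule stability[OF \<alpha>(2) sol \<alpha>(1) g(1) \<eta> g(3) le' le(1)])
    show "rate \<beta>1 z y \<le> ennreal C * w y * (\<integral>\<^sup>+y. w y \<partial>\<beta>1 z)" if "0 < y" for z y by (rule rate_le_w[OF n(1) that])
    show "max_rate \<beta>1 \<beta>2 z y \<le> rate \<beta>1 z y + ennreal C * w y * gap \<beta>2 \<gamma> z" if "0 < y" for z y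
    proof -
      have "rate \<beta>2 z y \<le> rate \<gamma> z y + ennreal C * w y * gap \<beta>2 \<gamma> z" by (rule rate_gap[OF g(2,3) le(2) that])
      also have "\<dots> \<le> rate \<beta>1 z y + ennreal C * w y * gap \<beta>2 \<gamma> z" by (intro add_right_mono rate_mono n le)
      finally show ?thesis by (simp add: max_rate_def)
    qed
    show "gap \<beta>2 \<gamma> \<in> borel_measurable borel" by (rule gap_measurable[OF g(2,3)])
    show "(\<lambda>z. \<integral>\<^sup>+y. w y \<partial>\<beta>1 z) \<in> borel_measurable borel" by (rule nice_w_measurable[OF n(1) w_measurable])
    show "nrm (\<lambda>z. \<integral>\<^sup>+y. w y \<partial>\<beta>1 z) < \<infinity>" by (rule good_w_nrm[OF g(1)])
  qed simp
qed

lemma gap_nrm_finite: "good \<alpha> \<Longrightarrow> nrm (gap \<alpha> \<eta>) < \<infinity>"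
  by (rule le_less_trans[OF nn_integral_mono good_w_nrm]) (simp_all add: gap_def diff_le_self_ennreal)

text \<open>The infimum lies below every \<open>e k\<close>, so its norm is 0. It is the pointwise
  form of convergence that \<open>INF_zero_le\<close> consumes.\<close>

lemma AE_INF_zero:
  assumes [measurable]: "\<And>k. e k \<in> borel_measurable borel" and b: "\<And>k. nrm (e k) \<le> ennreal ((1/2) ^ k) * D" and D: "D < \<infinity>"
  shows "AE z in time_space. (INF k. e k z) = 0"
proof -
  have "nrm (\<lambda>z. INF k. e k z) \<le> 0"
  proof (rule ennreal_le_epsilon)
    fix r :: real assume "0 < r"
    obtain d where d: "D = ennreal d" "0 \<le> d" using D by (cases D) auto
    obtain k where k: "(1/2) ^ k < r / (d + 1)" using real_arch_pow_inv[of "r / (d + 1)" "1/2"] \<open>0 < r\<close> d by auto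
    then have "(1/2) ^ k * d \<le> r" using d \<open>0 < r\<close>
    proof -
      have "(1/2) ^ k * d \<le> (1/2) ^ k * (d + 1)" using d by (intro mult_left_mono) auto
      also have "\<dots> \<le> r" using k d by (simp add: field_simps)
      finally show ?thesis .
    qed
    have "nrm (\<lambda>z. INF k. e k z) \<le> nrm (e k)" by (intro nn_integral_mono INF_lower) simp
    also have "\<dots> \<le> ennreal ((1/2) ^ k) * D" by (rule b)
    also have "\<dots> = ennreal ((1/2) ^ k * d)" using d by (simp add: ennreal_mult')
    also have "\<dots> \<le> ennreal r" by (rule ennreal_leI) fact
    finally show "nrm (\<lambda>z. INF k. e k z) \<le> 0 + ennreal r" by simp
  qed
  then have "nrm (\<lambda>z. INF k. e k z) = 0" by simp
  then show ?thesis by (subst (asm) nn_integral_0_iff_AE) (simp_all add: time_space_measurable)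
qed

lemma evolve_AE_cong:
  assumes ok: "ok_source N c U \<kappa>" and ok': "ok_source N c U' \<kappa>'" and f: "f \<in> borel_measurable sizes"
    and AE: "AE z in N. \<kappa> z = \<kappa>' z \<and> (\<forall>y>0. U z y = U' z y)"
  shows "(\<integral>\<^sup>+y. f y \<partial>evolve N c U \<kappa> t x) = (\<integral>\<^sup>+y. f y \<partial>evolve N c U' \<kappa>' t x)"
  unfolding nn_integral_evolve[OF ok f] nn_integral_evolve[OF ok' f]
proof (rule nn_integral_cong_AE)
  show "AE z in N. (case z of (s, x') \<Rightarrow> \<integral>\<^sup>+y. f y * (indicator {..<t} s * c (t - s) y * U (s, x') y * p (t - s) x' x y) \<partial>\<kappa> (s, x'))
    = (case z of (s, x') \<Rightarrow> \<integral>\<^sup>+y. f y * (indicator {..<t} s * c (t - s) y * U' (s, x') y * p (t - s) x' x y) \<partial>\<kappa>' (s, x'))"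
    using AE by eventually_elim (auto simp: lfk_space[OF ok_sourceD(3)[OF ok']] intro!: nn_integral_cong)
qed

text \<open>\<open>step\<close> sees its arguments only through integrals over time and space. Fixed
  points that agree almost everywhere therefore agree everywhere.\<close>

lemma step_AE_cong:
  assumes n: "nice \<alpha>" "nice \<beta>" "nice \<alpha>'" "nice \<beta>'" and U: "ok_rate U" "ok_rate U'"
    and AE: "AE z in time_space. \<alpha> z = \<alpha>' z \<and> \<beta> z = \<beta>' z \<and> (\<forall>y>0. U z y = U' z y)"
  shows "step \<beta> U \<alpha> = step \<beta>' U' \<alpha>'"
proof (rule ext, rule measure_eqI)
  fix z A assume "A \<in> sets (step \<beta> U \<alpha> z)"
  then have A: "A \<in> sets sizes" by simp
  note f = borel_measurable_indicator[OF A]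
  obtain t x where z: "z = (t, x)" by (cases z)
  show "emeasure (step \<beta> U \<alpha> z) A = emeasure (step \<beta>' U' \<alpha>' z) A"
  proof (cases "0 < t \<and> t \<le> T")
    case True
    have 1: "(\<integral>\<^sup>+y. indicator A y \<partial>evolve time_space ee U \<alpha> t x) = (\<integral>\<^sup>+y. indicator A y \<partial>evolve time_space ee U' \<alpha>' t x)"
      using AE by (intro evolve_AE_cong ok_sources ee_measurable n U f) (auto elim!: eventually_mono)
    have 2: "(\<integral>\<^sup>+y. indicator A y \<partial>evolve time_space ee one (gain \<alpha> \<beta>) t x) = (\<integral>\<^sup>+y. indicator A y \<partial>evolve time_space ee one (gain \<alpha>' \<beta>') t x)"
      by (rule evolve_AE_cong[OF ok_sources(3)[OF ee_measurable n(1,2)] ok_sources(3)[OF ee_measurable n(3,4)] f])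
        (use AE in eventually_elim, simp add: gain_kernel_def)
    have "(\<integral>\<^sup>+y. indicator A y \<partial>step \<beta> U \<alpha> (t, x)) = (\<integral>\<^sup>+y. indicator A y \<partial>step \<beta>' U' \<alpha>' (t, x))"
      unfolding nn_integral_step[OF conjunct1[OF True] conjunct2[OF True] f] 1 2 ..
    then show ?thesis using A by (simp add: z)
  qed (auto simp: step_def z)
qed simp

text \<open>Above \<open>\<delta>\<close> the weight \<open>w\<close> is at least \<delta>^(2/3), so
  the gap controls the difference on each set of sizes.\<close>

lemma measure_le_of_gaps:
  assumes g: "good \<alpha>" "good \<eta>" and le: "kernel_le \<eta> \<alpha>" "kernel_le \<eta> \<beta>" and n: "nice \<beta>" and A: "A \<in> sets sizes"
  shows "emeasure (\<alpha> z) A \<le> emeasure (\<beta> z) A + ennreal (\<delta> powr (- (2/3))) * gap \<alpha> \<eta> z"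
proof -
  obtain d where d: "sets d = sets sizes" "finite_measure d"
    "\<And>f. f \<in> borel_measurable sizes \<Longrightarrow> (\<integral>\<^sup>+y. f y \<partial>\<alpha> z) = (\<integral>\<^sup>+y. f y \<partial>\<eta> z) + (\<integral>\<^sup>+y. f y \<partial>d)"
    by (rule good_split[OF g le(1), of z]) blast
  note s = nice_sets[OF goodD(1)[OF g(1)], of z] nice_sets[OF goodD(1)[OF g(2)], of z]
  note [measurable_cong] = d(1) s
  note [measurable] = A
  have "emeasure d {0<..<\<delta>} \<le> emeasure (\<alpha> z) {0<..<\<delta>}"
    using d(3)[OF borel_measurable_indicator[OF Ioc_sizes(2)[of \<delta>]]] s d(1) by simp
  then have "emeasure d {0<..<\<delta>} = 0" using nice_supp[OF goodD(1)[OF g(1)]] by simp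
  then have "(\<integral>\<^sup>+y. indicator A y \<partial>d) \<le> (\<integral>\<^sup>+y. ennreal (\<delta> powr (- (2/3))) * w y \<partial>d)"
  proof (intro nn_integral_mono_AE)
    assume "emeasure d {0<..<\<delta>} = 0"
    from AE_size_ge[OF d(1) this] show "AE y in d. indicator A y \<le> ennreal (\<delta> powr (- (2/3))) * w y"
    proof eventually_elim
      case (elim y)
      then have "1 \<le> \<delta> powr (- (2/3)) * y powr (2/3)"
        using pos powr_mono2[of "2/3" \<delta> y] by (simp add: powr_minus field_simps)
      then have "1 \<le> ennreal (\<delta> powr (- (2/3))) * w y" unfolding w_def by (simp add: ennreal_ge_1 flip: ennreal_mult)
      then show ?case by (auto split: split_indicator)
    qed
  qed
  also have "\<dots> = ennreal (\<delta> powr (- (2/3))) * gap \<alpha> \<eta> z"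
    using gap_split[where \<alpha>=\<alpha> and z=z, OF g(2) d(3)[OF w_measurable]] by (simp add: nn_integral_cmult)
  finally have 1: "(\<integral>\<^sup>+y. indicator A y \<partial>d) \<le> ennreal (\<delta> powr (- (2/3))) * gap \<alpha> \<eta> z" .
  have "emeasure (\<alpha> z) A = emeasure (\<eta> z) A + (\<integral>\<^sup>+y. indicator A y \<partial>d)"
    using d(3)[OF borel_measurable_indicator[OF A]] A by (simp add: s)
  also have "\<dots> \<le> emeasure (\<beta> z) A + ennreal (\<delta> powr (- (2/3))) * gap \<alpha> \<eta> z"
    by (intro add_mono 1 kernel_leD[OF le(2) A])
  finally show ?thesis .
qed

text \<open>A solution is driven by itself, so \<open>pair_step\<close> with
  \<open>\<beta>1 = \<alpha> = \<nu>1\<close>, and likewise for \<open>\<nu>2\<close>, improves a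
  common lower bound repeatedly, starting from 0. The lower bounds converge to both solutions in
  norm, which gives equality almost everywhere, and \<open>step_AE_cong\<close> makes it equality
  everywhere.\<close>

theorem solution_unique:
  assumes g: "good \<nu>1" "good \<nu>2" and sol: "exp_sol \<nu>1 (rate \<nu>1) \<nu>1" "exp_sol \<nu>2 (rate \<nu>2) \<nu>2"
  shows "\<nu>1 = \<nu>2"
proof -
  define l where "l = rec_nat (\<lambda>_. null_measure sizes) (\<lambda>_ \<gamma>. lin \<gamma> (max_rate \<nu>1 \<nu>2))"
  have l0: "l 0 = (\<lambda>_. null_measure sizes)" and lS: "l (Suc k) = lin (l k) (max_rate \<nu>1 \<nu>2)" for k
    by (simp_all add: l_def)
  have lS': "l (Suc k) = lin (l k) (max_rate \<nu>2 \<nu>1)" for k by (simp add: lS max_rate_sym)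
  have inv: "good (l k) \<and> kernel_le (l k) \<nu>1 \<and> kernel_le (l k) \<nu>2" for k
  proof (induction k)
    case 0
    then show ?case by (simp add: l0 null_good kernel_le_def)
  next
    case (Suc k)
    then show ?case
      using pair_step(1)[OF g, of "l k"] pair_step(2)[OF g, of "l k" \<nu>1] pair_step(2)[OF g(2,1), of "l k" \<nu>2] g sol
      by (simp add: lS max_rate_sym[of \<nu>2])
  qed
  let ?a = "\<lambda>k. nrm (gap \<nu>1 (l k))" and ?b = "\<lambda>k. nrm (gap \<nu>2 (l k))"
  have "?a (Suc k) \<le> ennreal (1/25) * (2 * ?a k + ?b k)" for k
    unfolding lS using inv[of k] g sol by (intro pair_step(3)) auto
  moreover have "?b (Suc k) \<le> ennreal (1/25) * (2 * ?b k + ?a k)" for k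
    unfolding lS' using inv[of k] g sol by (intro pair_step(3)) auto
  ultimately have h: "?a k + ?b k \<le> ennreal ((1/2) ^ k) * (?a 0 + ?b 0)" for k by (rule halving)
  have fin: "?a 0 + ?b 0 < \<infinity>" using gap_nrm_finite[OF g(1)] gap_nrm_finite[OF g(2)] by simp
  have m: "gap \<nu>1 (l k) \<in> borel_measurable borel" "gap \<nu>2 (l k) \<in> borel_measurable borel" for k
    using inv g by (auto intro: gap_measurable)
  have "AE z in time_space. (INF k. gap \<nu>1 (l k) z) = 0"
    by (rule AE_INF_zero[OF m(1) _ fin]) (rule order_trans[OF _ h], simp)
  moreover have "AE z in time_space. (INF k. gap \<nu>2 (l k) z) = 0"
    by (rule AE_INF_zero[OF m(2) _ fin]) (rule order_trans[OF _ h], simp)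
  ultimately have "AE z in time_space. \<nu>1 z = \<nu>2 z"
  proof eventually_elim
    case (elim z)
    show ?case
    proof (rule measure_eqI)
      fix A assume "A \<in> sets (\<nu>1 z)"
      then have A: "A \<in> sets sizes" by (simp add: nice_sets[OF goodD(1)[OF g(1)]])
      show "emeasure (\<nu>1 z) A = emeasure (\<nu>2 z) A"
      proof (rule antisym)
        show "emeasure (\<nu>1 z) A \<le> emeasure (\<nu>2 z) A"
          by (rule INF_zero_le[OF measure_le_of_gaps[OF g(1) _ _ _ goodD(1)[OF g(2)] A] elim(1)]) (use inv in auto)
        show "emeasure (\<nu>2 z) A \<le> emeasure (\<nu>1 z) A"
          by (rule INF_zero_le[OF measure_le_of_gaps[OF g(2) _ _ _ goodD(1)[OF g(1)] A] elim(2)]) (use inv in auto)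
      qed
    qed (simp add: nice_sets[OF goodD(1)[OF g(1)]] nice_sets[OF goodD(1)[OF g(2)]])
  qed
  then have "step \<nu>1 (res (rate \<nu>1)) \<nu>1 = step \<nu>2 (res (rate \<nu>2)) \<nu>2"
    by (intro step_AE_cong goodD(1) g res_rate good_rate_ok)
      (auto elim!: eventually_mono simp: res_def rate_def)
  then show ?thesis using sol by (simp add: exp_sol_def)
qed

end

section \<open>Existence\<close>

lemma kernel_sup_Suc:
  assumes s: "\<And>n z. sets (F n z) = sets sizes" and i: "\<And>n. kernel_le (F n) (F (Suc n))"
  shows "kernel_sup (\<lambda>n. F (Suc n)) = kernel_sup F"
proof (rule ext, rule measure_eqI)
  fix z A assume "A \<in> sets (kernel_sup (\<lambda>n. F (Suc n)) z)"
  then have A: "A \<in> sets sizes" by simp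
  have "(SUP n. emeasure (F (Suc n) z) A) = (SUP n. emeasure (F n z) A)"
    by (intro antisym SUP_mono) (auto intro: kernel_leD[OF i A])
  then show "emeasure (kernel_sup (\<lambda>n. F (Suc n)) z) A = emeasure (kernel_sup F z) A"
    using emeasure_kernel_sup[where F="\<lambda>n. F (Suc n)" and z=z, OF s i A] emeasure_kernel_sup[where F=F and z=z, OF s i A] by simp
qed simp

lemma suminf_half: "(\<Sum>i. ennreal ((1/2) ^ (j + i)) * D) = ennreal (2 * (1/2) ^ j) * D"
proof -
  have "(\<lambda>i. (1/2 :: real) ^ i * (1/2) ^ j) sums (1 / (1 - 1/2) * (1/2) ^ j)"
    by (intro sums_mult2 geometric_sums) simp
  then have "(\<lambda>i. (1/2 :: real) ^ (j + i)) sums (2 * (1/2) ^ j)" by (simp add: power_add mult.commute)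
  then have "(\<Sum>i. ennreal ((1/2) ^ (j + i))) = ennreal (2 * (1/2) ^ j)"
    by (intro suminf_ennreal_eq) auto
  then show ?thesis by (simp add: ennreal_suminf_multc)
qed

context coag_small
begin

text \<open>Of the Picard iterates \<open>mu\<close>, \<open>lo n\<close> lies below the \<open>n\<close>-th and the next one, and \<open>env n\<close> below all from
  the \<open>n\<close>-th on. Since \<open>sup_rate\<close> decreases, \<open>env\<close> increases.\<close>

primrec mu :: "nat \<Rightarrow> 'a kernel" where
  "mu 0 = (\<lambda>_. null_measure sizes)"
| "mu (Suc n) = lin (mu n) (rate (mu n))"

primrec lo :: "nat \<Rightarrow> 'a kernel" where
  "lo 0 = (\<lambda>_. null_measure sizes)"
| "lo (Suc n) = lin (lo n) (max_rate (mu n) (mu (Suc n)))"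

definition sup_rate :: "nat \<Rightarrow> 'a rate" where
  "sup_rate n z y = (SUP i. rate (mu (n + i)) z y)"

primrec env :: "nat \<Rightarrow> 'a kernel" where
  "env 0 = (\<lambda>_. null_measure sizes)"
| "env (Suc n) = lin (env n) (sup_rate n)"

lemma mu_good: "good (mu n)"
proof (induction n)
  case (Suc n)
  then show ?case by (simp add: lin_good good_rate_ok)
qed (simp add: null_good)

lemma mu_sol: "exp_sol (mu n) (rate (mu n)) (mu (Suc n))"
  by (simp add: lin_exp_sol goodD(1) mu_good good_rate_ok)

declare mu.simps(2) [simp del]

lemma lo_inv: "good (lo n) \<and> kernel_le (lo n) (mu n) \<and> kernel_le (lo n) (mu (Suc n))"
proof (induction n)
  case 0
  then show ?case by (simp add: null_good kernel_le_def)
next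
  case (Suc n)
  then have l: "kernel_le (lo n) (mu n)" "kernel_le (lo n) (mu (Suc n))" "good (lo n)" by auto
  show ?case
    using pair_step(1,2)[OF mu_good mu_good l(3,1,2)] pair_step(2)[OF mu_good mu_good l(3,2,1)] mu_good mu_sol
    by (simp add: max_rate_sym[of "mu (Suc n)"])
qed

definition gap_lo :: "nat \<Rightarrow> real \<times> 'a \<Rightarrow> ennreal" where "gap_lo n = gap (mu (Suc n)) (lo n)"

lemma gap_lo_measurable: "gap_lo n \<in> borel_measurable borel"
  unfolding gap_lo_def using gap_measurable mu_good lo_inv by blast

lemma gap_lo_nrm: obtains D where "D < \<infinity>" "\<And>n. nrm (gap_lo n) \<le> ennreal ((1/2) ^ n) * D"
proof -
  let ?a = "\<lambda>n. nrm (gap (mu n) (lo n))" and ?b = "\<lambda>n. nrm (gap (mu (Suc n)) (lo n))"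
  have "?a (Suc n) \<le> ennreal (1/25) * (2 * ?a n + ?b n)" for n
    unfolding lo.simps using lo_inv[of n] mu_good mu_sol by (intro pair_step(3)) auto
  moreover have "?b (Suc n) \<le> ennreal (1/25) * (2 * ?b n + ?a n)" for n
    unfolding lo.simps max_rate_sym[of "mu n"] using lo_inv[of n] mu_good mu_sol by (intro pair_step(3)) auto
  ultimately have "?a n + ?b n \<le> ennreal ((1/2) ^ n) * (?a 0 + ?b 0)" for n by (rule halving)
  then have "nrm (gap_lo n) \<le> ennreal ((1/2) ^ n) * (?a 0 + ?b 0)" for n
    unfolding gap_lo_def by (rule order_trans[rotated]) simp
  moreover have "?a 0 + ?b 0 < \<infinity>"
    using gap_nrm_finite[OF mu_good[of 0], of "lo 0"] gap_nrm_finite[OF mu_good[of "Suc 0"], of "lo 0"]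
    by (simp del: mu.simps lo.simps)
  ultimately show ?thesis by (rule that[rotated])
qed

lemma sup_rate_ok: "ok_rate (sup_rate n)"
proof -
  have [measurable]: "(\<lambda>m. rate (mu i) (fst m) (snd m)) \<in> borel_measurable (borel \<Otimes>\<^sub>M sizes)" for i
    using good_rate_ok[OF mu_good, of i] by (simp add: ok_rate_def case_prod_beta')
  have "(\<lambda>m. sup_rate n (fst m) (snd m)) \<in> borel_measurable (borel \<Otimes>\<^sub>M sizes)"
    unfolding sup_rate_def by measurable
  moreover have "rate (mu i) z y \<le> ennreal (vb y)" if "0 < y" for i z y
    using good_rate_ok[OF mu_good, of i] that unfolding ok_rate_def by blast
  ultimately show ?thesis by (auto simp: ok_rate_def sup_rate_def case_prod_beta' intro: SUP_least)
qed

lemma rate_le_sup_rate: "n \<le> j \<Longrightarrow> rate (mu j) z y \<le> sup_rate n z y"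
  unfolding sup_rate_def by (rule SUP_upper2[of "j - n"]) auto

lemma sup_rate_mono: "sup_rate (Suc n) z y \<le> sup_rate n z y"
  unfolding sup_rate_def[of "Suc n"] by (rule SUP_least) (simp add: rate_le_sup_rate)

text \<open>Every \<open>mu (Suc j)\<close> with \<open>j \<ge> n\<close> solves a linear problem
  whose frozen kernel \<open>mu j\<close> lies above \<open>env n\<close> and whose rate lies below
  \<open>sup_rate n\<close>; so \<open>lin_least\<close> applies to all of them at once.\<close>

lemma env_inv: "good (env n) \<and> (\<forall>j\<ge>n. kernel_le (env n) (mu j))"
proof (induction n)
  case 0
  then show ?case by (simp add: null_good kernel_le_def)
next
  case (Suc n)
  then have g: "good (env n)" and le: "\<And>j. n \<le> j \<Longrightarrow> kernel_le (env n) (mu j)" by auto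
  have "good (lin (env n) (sup_rate n))"
  proof (rule lin_good[OF g sup_rate_ok])
    show "rate (env n) z y \<le> sup_rate n z y" for z y
      by (rule order_trans[OF rate_mono[OF goodD(1)[OF g] goodD(1)[OF mu_good] le] rate_le_sup_rate]) auto
  qed
  moreover have "kernel_le (lin (env n) (sup_rate n)) (mu j)" if j: "Suc n \<le> j" for j
  proof -
    obtain i where i: "j = Suc i" "n \<le> i" using j by (cases j) auto
    show ?thesis unfolding i(1)
      by (rule lin_least[OF goodD(1)[OF g] sup_rate_ok mu_sol le[OF i(2)]]) (rule rate_le_sup_rate[OF i(2)])
  qed
  ultimately show ?case by simp
qed

lemma env_good: "good (env n)" and env_le: "n \<le> j \<Longrightarrow> kernel_le (env n) (mu j)"
  using env_inv by auto

lemma env_sol: "exp_sol (env n) (sup_rate n) (env (Suc n))"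
  by (simp add: lin_exp_sol goodD(1) env_good sup_rate_ok)

lemma env_incr: "kernel_le (env n) (env (Suc n))"
proof (induction n)
  case (Suc n)
  have "kernel_le (lin (env n) (sup_rate n)) (env (Suc (Suc n)))"
    by (rule lin_least[OF goodD(1)[OF env_good] sup_rate_ok env_sol Suc]) (rule sup_rate_mono)
  then show ?case by simp
qed (simp add: kernel_le_def)

declare env.simps(2) [simp del] lo.simps(2) [simp del]

definition tail :: "nat \<Rightarrow> real \<times> 'a \<Rightarrow> ennreal" where
  "tail n z = (\<Sum>i. gap_lo (n + i) z)"

text \<open>Telescoping along the iterates: \<open>lo j\<close> lies below \<open>mu j\<close> and
  \<open>mu (Suc j)\<close>, so by \<open>rate_gap\<close> the rate grows in one step by at most
  \<open>C * w y * gap_lo j z\<close>. Bounding by the sum of all later gaps makes the estimate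
  uniform in the number of steps.\<close>

lemma sup_rate_le: assumes y: "0 < y" shows "sup_rate n z y \<le> rate (mu n) z y + ennreal C * w y * tail n z"
  unfolding sup_rate_def
proof (rule SUP_least)
  fix i
  have "rate (mu (n + i)) z y \<le> rate (mu n) z y + ennreal C * w y * (\<Sum>j<i. gap_lo (n + j) z)"
  proof (induction i)
    case (Suc i)
    let ?n = "n + i"
    have "rate (mu (Suc ?n)) z y \<le> rate (lo ?n) z y + ennreal C * w y * gap_lo ?n z"
      unfolding gap_lo_def using lo_inv mu_good y by (intro rate_gap) auto
    also have "\<dots> \<le> rate (mu ?n) z y + ennreal C * w y * gap_lo ?n z"
      using lo_inv[of ?n] by (intro add_right_mono rate_mono goodD(1) mu_good) auto
    also have "\<dots> \<le> rate (mu n) z y + ennreal C * w y * (\<Sum>j<i. gap_lo (n + j) z) + ennreal C * w y * gap_lo ?n z"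
      by (intro add_right_mono Suc)
    finally show ?case by (simp add: distrib_left add.assoc)
  qed simp
  also have "\<dots> \<le> rate (mu n) z y + ennreal C * w y * tail n z"
    unfolding tail_def by (intro add_left_mono mult_left_mono sum_le_suminf) auto
  finally show "rate (mu (n + i)) z y \<le> rate (mu n) z y + ennreal C * w y * tail n z" .
qed

lemma tail_measurable: "tail n \<in> borel_measurable borel"
proof -
  note [measurable] = gap_lo_measurable
  show ?thesis unfolding tail_def by measurable
qed

lemma tail_nrm:
  assumes "\<And>n. nrm (gap_lo n) \<le> ennreal ((1/2) ^ n) * D"
  shows "nrm (tail n) \<le> ennreal (2 * (1/2) ^ n) * D"
proof -
  have "nrm (tail n) = (\<Sum>i. nrm (gap_lo (n + i)))"
    unfolding tail_def using gap_lo_measurable by (intro nn_integral_suminf) (simp add: time_space_measurable)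
  also have "\<dots> \<le> (\<Sum>i. ennreal ((1/2) ^ (n + i)) * D)" by (intro suminf_le assms) auto
  finally show ?thesis by (simp only: suminf_half)
qed

text \<open>\<open>stability\<close> compares \<open>mu (Suc n)\<close>, driven by
  \<open>mu n\<close>, with \<open>env (Suc n)\<close>, driven by \<open>env n\<close> at the rate
  \<open>sup_rate n\<close>. The rates differ by \<open>tail n\<close>, which decays geometrically
  by \<open>gap_lo_nrm\<close>, and so the gap does as well.\<close>

lemma env_nrm: obtains D where "D < \<infinity>" "\<And>n. nrm (\<lambda>z. gap (mu n) (env n) z + tail n z) \<le> ennreal ((1/2) ^ n) * D"
proof -
  obtain D where D: "D < \<infinity>" "\<And>n. nrm (gap_lo n) \<le> ennreal ((1/2) ^ n) * D" by (rule gap_lo_nrm) blast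
  let ?d = "\<lambda>n. nrm (gap (mu n) (env n))"
  \<comment> \<open>Adding \<open>D\<close> lets one constant dominate both the gap and the tail, so
    that the induction step costs 4/25, less than 1/2.\<close>
  let ?E = "?d 0 + D"
  have step: "?d (Suc n) \<le> ennreal (1/25) * (2 * ?d n + nrm (tail n))" for n
  proof (rule stability[OF mu_sol env_sol mu_good mu_good env_good env_good env_le env_le])
    show "rate (mu n) z y \<le> ennreal C * w y * (\<integral>\<^sup>+y. w y \<partial>mu n z)" if "0 < y" for z y
      by (rule rate_le_w[OF goodD(1)[OF mu_good] that])
    show "(\<lambda>z. \<integral>\<^sup>+y. w y \<partial>mu n z) \<in> borel_measurable borel" by (rule nice_w_measurable[OF goodD(1)[OF mu_good] w_measurable])
    show "nrm (\<lambda>z. \<integral>\<^sup>+y. w y \<partial>mu n z) < \<infinity>" by (rule good_w_nrm[OF mu_good])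
  qed (auto intro: sup_rate_le tail_measurable)
  have d: "?d n \<le> ennreal ((1/2) ^ n) * ?E" for n
  proof (induction n)
    case (Suc n)
    have "?d (Suc n) \<le> ennreal (1/25) * (2 * (ennreal ((1/2) ^ n) * ?E) + ennreal (2 * (1/2) ^ n) * ?E)"
      by (intro order_trans[OF step] mult_left_mono add_mono Suc order_trans[OF tail_nrm[OF D(2)]]) auto
    also have "ennreal (2 * (1/2) ^ n) = 2 * ennreal ((1/2) ^ n)" using ennreal_mult'[of 2 "(1/2) ^ n"] by simp
    also have "ennreal (1/25) * (2 * (ennreal ((1/2) ^ n) * ?E) + 2 * ennreal ((1/2) ^ n) * ?E)
       = (ennreal (1/25) * (2 + 2)) * (ennreal ((1/2) ^ n) * ?E)"
      by (simp only: mult.assoc distrib_right distrib_left add.assoc add.commute add.left_commute)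
    also have "\<dots> \<le> ennreal (1/2) * (ennreal ((1/2) ^ n) * ?E)"
    proof (rule mult_right_mono)
      have "ennreal (1/25) * (2 + 2) = ennreal (4/25)" using ennreal_mult'[of "1/25" 4] by simp
      then show "ennreal (1/25) * (2 + 2) \<le> ennreal (1/2)" by (simp only:) (rule ennreal_leI, simp)
    qed simp
    also have "\<dots> = ennreal ((1/2) ^ Suc n) * ?E" using ennreal_mult'[of "1/2" "(1/2) ^ n"] by (simp add: mult.assoc)
    finally show ?case .
  qed simp
  have "nrm (\<lambda>z. gap (mu n) (env n) z + tail n z) \<le> ennreal ((1/2) ^ n) * (?E + 2 * D)" for n
  proof -
    have "nrm (\<lambda>z. gap (mu n) (env n) z + tail n z) = ?d n + nrm (tail n)"
      using gap_measurable[OF mu_good env_good] tail_measurable by (intro nn_integral_add) (simp_all add: time_space_measurable)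
    also have "\<dots> \<le> ennreal ((1/2) ^ n) * ?E + ennreal (2 * (1/2) ^ n) * D" by (intro add_mono d tail_nrm D)
    also have "ennreal (2 * (1/2) ^ n) = ennreal ((1/2) ^ n) * 2" using ennreal_mult'[of 2 "(1/2) ^ n"] by (simp add: mult.commute)
    finally show ?thesis by (simp only: distrib_left mult.assoc)
  qed
  moreover have "?E + 2 * D < \<infinity>" using D(1) gap_nrm_finite[OF mu_good[of 0], of "env 0"] by (simp add: ennreal_mult_less_top del: mu.simps env.simps)
  ultimately show ?thesis by (rule that[rotated])
qed

section \<open>The limit of the lower bounds is a solution\<close>

definition sol :: "'a kernel" where "sol = kernel_sup env"

lemma nn_integral_sol: "f \<in> borel_measurable sizes \<Longrightarrow> (\<integral>\<^sup>+y. f y \<partial>sol z) = (SUP n. \<integral>\<^sup>+y. f y \<partial>env n z)"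
  unfolding sol_def by (rule nn_integral_kernel_sup[where F=env, OF nice_sets[OF goodD(1)[OF env_good]] env_incr])

lemma sol_good: "good sol"
  unfolding good_def
proof (intro conjI allI)
  have n: "nice (env n)" for n by (rule goodD(1)[OF env_good])
  show "nice sol"
    unfolding sol_def
  proof (rule kernel_sup_nice[where F=env, OF n env_incr])
    show "\<exists>B::real. \<forall>n z. emeasure (env n z) {0<..R} \<le> ennreal B" for R
    proof (intro exI allI)
      fix n' z
      note [measurable_cong] = nice_sets[OF n]
      have "emeasure (env n' z) {0<..R} = (\<integral>\<^sup>+y. indicator {0<..R} y \<partial>env n' z)" by (simp add: nice_sets[OF n])
      also have "\<dots> \<le> (\<integral>\<^sup>+y. ennreal (\<delta> powr (- (4/3))) * phi y \<partial>env n' z)"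
        using AE_size_ge[OF nice_sets[OF n] nice_supp[OF n], of n' z]
        by (intro nn_integral_mono_AE) (auto elim!: eventually_mono intro: le_phi split: split_indicator)
      also have "\<dots> = ennreal (\<delta> powr (- (4/3))) * (\<integral>\<^sup>+y. phi y \<partial>env n' z)" by (rule nn_integral_cmult) measurable
      also have "\<dots> \<le> ennreal (\<delta> powr (- (4/3))) * ennreal (2 * g0)" by (intro mult_left_mono goodD(2)[OF env_good]) simp
      also have "\<dots> = ennreal (\<delta> powr (- (4/3)) * (2 * g0))" by (rule ennreal_mult'[symmetric]) simp
      finally show "emeasure (env n' z) {0<..R} \<le> ennreal (\<delta> powr (- (4/3)) * (2 * g0))" .
    qed
  qed
  show "(\<integral>\<^sup>+y. phi y \<partial>sol z) \<le> ennreal (2 * g0)" for z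
    unfolding nn_integral_sol[OF phi_measurable] by (rule SUP_least) (rule goodD(2)[OF env_good])
  show "(\<integral>\<^sup>+x. \<integral>\<^sup>+y. ennreal y \<partial>sol (t, x) \<partial>lborel) \<le> ennreal (2 * m0)" for t
  proof -
    have m: "(\<lambda>y. ennreal y) \<in> borel_measurable sizes" by measurable
    have "(\<integral>\<^sup>+x. \<integral>\<^sup>+y. ennreal y \<partial>sol (t, x) \<partial>lborel) = (SUP n. \<integral>\<^sup>+x. \<integral>\<^sup>+y. ennreal y \<partial>env n (t, x) \<partial>lborel)"
      unfolding nn_integral_sol[OF m]
    proof (rule nn_integral_monotone_convergence_SUP)
      show "incseq (\<lambda>n x. \<integral>\<^sup>+y. ennreal y \<partial>env n (t, x))"
        using kernel_le_nn_integral[OF env_incr nice_sets[OF n] nice_sets[OF n]] by (intro incseq_SucI) (simp add: le_fun_def)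
      show "(\<lambda>x. \<integral>\<^sup>+y. ennreal y \<partial>env n' (t, x)) \<in> borel_measurable lborel" for n'
        by (simp, rule kernel_param_measurable[OF nice_lfk[OF n]], measurable)
    qed
    also have "\<dots> \<le> ennreal (2 * m0)" by (rule SUP_least) (rule goodD(3)[OF env_good])
    finally show ?thesis .
  qed
qed

text \<open>\<open>env\<close> increases and \<open>sup_rate\<close> decreases, so the damped
  equations pass to the limit monotonically; the limit rate \<open>W\<close> is the infimum of the
  \<open>sup_rate n\<close>. It remains to see that \<open>W\<close> is the loss rate of
  \<open>sol\<close> itself: the rates of \<open>env n\<close> lie below it, and those of
  \<open>sup_rate n\<close> exceed them by at most \<open>C * w y\<close> times a quantity whose
  infimum is 0 almost everywhere. \<open>step_AE_cong\<close> then exchanges the rates.\<close>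

theorem sol_exp_sol: "exp_sol sol (rate sol) sol"
proof -
  have n: "nice (env n)" for n by (rule goodD(1)[OF env_good])
  note ns = goodD(1)[OF sol_good]
  define W where "W z y = (INF n. sup_rate n z y)" for z y
  have W: "ok_rate W"
  proof -
    have [measurable]: "(\<lambda>m. sup_rate i (fst m) (snd m)) \<in> borel_measurable (borel \<Otimes>\<^sub>M sizes)" for i
      using sup_rate_ok[of i] by (simp add: ok_rate_def case_prod_beta')
    have "(\<lambda>m. W (fst m) (snd m)) \<in> borel_measurable (borel \<Otimes>\<^sub>M sizes)" unfolding W_def by measurable
    moreover have "W z y \<le> ennreal (vb y)" if "0 < y" for z y
    proof -
      have "sup_rate 0 z y \<le> ennreal (vb y)" using sup_rate_ok[of 0] that unfolding ok_rate_def by blast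
      then show ?thesis unfolding W_def by (intro INF_lower2[of 0]) auto
    qed
    ultimately show ?thesis by (auto simp: ok_rate_def case_prod_beta')
  qed
  have "step sol (res W) sol z = sol z" for z
  proof (rule measure_eqI)
    fix A assume "A \<in> sets (step sol (res W) sol z)"
    then have A: "A \<in> sets sizes" by simp
    have s1: "kernel_sup (\<lambda>n. env (Suc n)) = sol" unfolding sol_def by (rule kernel_sup_Suc[where F=env, OF nice_sets[OF n] env_incr])
    have s2: "kernel_sup (\<lambda>n. env n) = sol" by (simp add: sol_def)
    have "emeasure (step (kernel_sup (\<lambda>n. env n)) (res W) (kernel_sup (\<lambda>n. env (Suc n))) z) A
       = (SUP n. emeasure (step (env n) (res (sup_rate n)) (env (Suc n)) z) A)"
    proof (rule step_sup)
      show "incseq (\<lambda>n. res (sup_rate n) z y)" for z y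
        unfolding res_def by (intro incseq_SucI ennreal_minus_mono order_refl sup_rate_mono)
      show "res W z y = (SUP n. res (sup_rate n) z y)" for z y
        by (simp add: res_def W_def SUP_const_minus_ennreal)
    qed (use n env_incr ns A res_rate[OF W] res_rate[OF sup_rate_ok] s1 s2 in auto)
    also have "\<dots> = (SUP n. emeasure (env (Suc n) z) A)"
      using env_sol by (simp add: exp_sol_def)
    also have "\<dots> = emeasure (sol z) A"
      unfolding s1[symmetric] by (rule emeasure_kernel_sup[where F="\<lambda>n. env (Suc n)" and z=z, OF nice_sets[OF n] env_incr A, symmetric])
    finally show "emeasure (step sol (res W) sol z) A = emeasure (sol z) A" unfolding s1 s2 .
  qed (simp add: nice_sets[OF ns])
  then have fix_W: "step sol (res W) sol = sol" by auto
  have r: "rate sol z y = (SUP n. rate (env n) z y)" if "0 < y" for z y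
  proof -
    have [measurable]: "y \<in> space sizes" using that by (simp add: space_sizes)
    show ?thesis unfolding rate_def by (rule nn_integral_sol) measurable
  qed
  obtain D where D: "D < \<infinity>" "\<And>n. nrm (\<lambda>z. gap (mu n) (env n) z + tail n z) \<le> ennreal ((1/2) ^ n) * D" by (rule env_nrm) blast
  have "AE z in time_space. (INF n. gap (mu n) (env n) z + tail n z) = 0"
  proof (rule AE_INF_zero[OF _ D(2,1)])
    note [measurable] = gap_measurable[OF mu_good env_good] tail_measurable
    show "(\<lambda>z. gap (mu n) (env n) z + tail n z) \<in> borel_measurable borel" for n by measurable
  qed
  then have "AE z in time_space. \<forall>y>0. W z y = rate sol z y"
  proof eventually_elim
    case (elim z)
    show ?case
    proof (intro allI impI antisym)
      fix y :: real assume y: "0 < y"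
      show "W z y \<le> rate sol z y"
      proof (rule INF_zero_le[OF _ elim, of _ _ "ennreal C * w y"])
        fix j
        have "W z y \<le> sup_rate j z y" unfolding W_def by (rule INF_lower) simp
        also have "\<dots> \<le> rate (mu j) z y + ennreal C * w y * tail j z" by (rule sup_rate_le[OF y])
        also have "\<dots> \<le> (rate (env j) z y + ennreal C * w y * gap (mu j) (env j) z) + ennreal C * w y * tail j z"
          by (intro add_right_mono rate_gap mu_good env_good env_le y) simp
        also have "\<dots> = rate (env j) z y + ennreal C * w y * (gap (mu j) (env j) z + tail j z)"
          by (simp add: distrib_left add.assoc)
        also have "\<dots> \<le> rate sol z y + ennreal C * w y * (gap (mu j) (env j) z + tail j z)"
          unfolding r[OF y] by (intro add_right_mono SUP_upper) simp
        finally show "W z y \<le> rate sol z y + ennreal C * w y * (gap (mu j) (env j) z + tail j z)" .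
      qed (simp add: w_def ennreal_mult_less_top)
      show "rate sol z y \<le> W z y"
        unfolding r[OF y] W_def
      proof (intro SUP_least INF_greatest)
        fix i j
        have "rate (env i) z y \<le> rate (mu (max i j)) z y" by (intro rate_mono n goodD(1) mu_good env_le) simp
        also have "\<dots> \<le> sup_rate j z y" by (rule rate_le_sup_rate) simp
        finally show "rate (env i) z y \<le> sup_rate j z y" .
      qed
    qed
  qed
  then have "step sol (res (rate sol)) sol = step sol (res W) sol"
    by (intro step_AE_cong ns res_rate W good_rate_ok sol_good) (auto elim!: eventually_mono simp: res_def)
  then show ?thesis using fix_W ns good_rate_ok[OF sol_good] by (simp add: exp_sol_def)
qed

section \<open>The moment bound for the nonlinear equation\<close>

lemma Ioo_integral: "a \<le> b \<Longrightarrow> (\<integral>\<^sup>+s. indicator {a<..<b} s * c \<partial>lborel) = ennreal (b - a) * c" for a b :: real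
  by (subst mult.commute, subst nn_integral_cmult_indicator) (auto simp: mult.commute)

text \<open>With the solution as its own frozen kernel the moment inequality is quadratic, and the
  truncated moment is so far only bounded by some \<open>B\<close> that depends on the truncation,
  so it cannot be absorbed at once. The bound is continued in time steps of length \<open>h\<close>
  instead: the past contributes at most g0/2 by smallness of \<open>T\<close>, the current step at
  most g0/2 by the choice of \<open>h\<close>, and together with the initial \<open>g0\<close> this
  is again 2 \<open>g0\<close>.\<close>

lemma phi_bound_self:
  assumes n: "nice \<nu>" and m: "mild \<nu> (rate \<nu>) \<nu>"
    and fin: "\<And>R \<rho> x. 0 < \<rho> \<Longrightarrow> \<rho> \<le> T \<Longrightarrow> (\<integral>\<^sup>+y. cut_phi R y \<partial>evolve time_space uno (rate \<nu>) \<nu> \<rho> x) < \<infinity>"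
  shows "(\<integral>\<^sup>+y. phi y \<partial>\<nu> z) \<le> ennreal (2 * g0)"
proof (cases "0 < fst z \<and> fst z \<le> T")
  case False
  then show ?thesis using nice_null[OF n, of "fst z" "snd z"] by simp
next
  case z: True
  note mr = rate_measurable[OF n]
  have "observe \<nu> phi (fst z) 0 (snd z) \<le> ennreal (2 * g0)"
  proof (rule observe_sup[OF n])
    fix i :: nat
    let ?R = "real i"
    obtain S where S: "S < \<infinity>" "\<And>t r x. 0 \<le> r \<Longrightarrow> observe \<nu> (cut_phi ?R) t r x \<le> S" by (rule observe_bounded[OF n, of ?R]) blast
    obtain B where B: "S = ennreal B" "0 \<le> B" using S(1) by (cases S) auto
    \<comment> \<open>Chosen so that the quadratic term with the bound \<open>B\<close>, integrated
      over one step, is 7 C B^2 h \<le> g0/2. The added 1 covers \<open>B = 0\<close>.\<close>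
    define h where "h = g0 / (14 * C * (B\<^sup>2 + 1))"
    have B1: "0 < B\<^sup>2 + 1" by (simp add: add_nonneg_pos)
    have h: "0 < h" using pos B1 by (simp add: h_def)
    have hB: "h * (7 * C * (B * B)) \<le> g0 / 2"
    proof -
      have "h * (7 * C * (B * B)) \<le> h * (7 * C * (B\<^sup>2 + 1))" using h pos by (intro mult_left_mono) (auto simp: power2_eq_square)
      also have "\<dots> = g0 / 2"
      proof -
        have "g0 / (14 * C * q) * (7 * C * q) = g0 / 2" if "0 < q" for q
          using pos that by (simp add: field_simps)
        from this[OF B1] show ?thesis by (simp only: h_def)
      qed
      finally show ?thesis .
    qed
    have sm: "T * (7 * C * (2 * g0 * (2 * g0))) \<le> g0 / 2"
    proof -
      have "T * (7 * C * (2 * g0 * (2 * g0))) = 28 / 100 * ((100 * C * g0 * T) * g0)" by simp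
      also have "\<dots> \<le> 28 / 100 * (1 * g0)" using small pos by (intro mult_left_mono mult_right_mono) auto
      also have "28 / 100 * (1 * g0) \<le> g0 / 2" using pos by simp
      finally show ?thesis .
    qed
    \<comment> \<open>Finiteness of the loss is known only up to time \<open>T\<close>, hence the
      restriction \<open>t + r \<le> T\<close>. It is inherited: the earlier observation at
      \<open>s\<close> after diffusing for \<open>t + r - s\<close> ends at the same time.\<close>
    have main: "\<forall>t r x. 0 < t \<longrightarrow> t \<le> real j * h \<longrightarrow> 0 \<le> r \<longrightarrow> t + r \<le> T \<longrightarrow> observe \<nu> (cut_phi ?R) t r x \<le> ennreal (2 * g0)" for j
    proof (induction j)
      case (Suc j)
      show ?case
      proof (intro allI impI)
        fix t r x assume t: "0 < t" "t \<le> real (Suc j) * h" and r: "0 \<le> r" "t + r \<le> T"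
        let ?a = "real j * h"
        show "observe \<nu> (cut_phi ?R) t r x \<le> ennreal (2 * g0)"
        proof (cases "t \<le> ?a")
          case True
          then show ?thesis using Suc t r by blast
        next
          case False
          \<comment> \<open>The induction hypothesis applies up to the previous step; beyond it
            there is only the bound \<open>B\<close>.\<close>
          let ?b = "\<lambda>s. if s \<le> ?a then ennreal (2 * g0) else ennreal B"
          have ob: "observe \<nu> (cut_phi ?R) s r' x' \<le> ?b s" if "0 < s" "0 \<le> r'" "s + r' \<le> T" for s r' x'
            using Suc S(2)[OF that(2), of s x'] that B by auto
          have tT: "t \<le> T" using r by simp
          have "observe \<nu> (cut_phi ?R) t r x \<le> ennreal g0 + (\<integral>\<^sup>+s. indicator {0<..<t} s * (ennreal (7 * C) * ?b s * ?b s) \<partial>lborel)"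
          proof (rule moment_phi[OF n n mr m order_refl t(1) tT r(1)])
            show "flow time_space (rate \<nu>) \<nu> (cut_phi ?R) t (t + r) x < \<infinity>"
              by (rule le_less_trans[OF flow_le_evolve[OF ok_source_meas[OF uno_measurable n mr] cut_measurable(1)] fin]) (use t r in auto)
            show "(\<integral>\<^sup>+y. cut_phi ?R y \<partial>\<nu> (s, x')) \<le> ?b s" if "0 < s" "s < t" for s x'
              using ob[of s 0 x'] that tT by (simp add: observe_def)
            show "observe \<nu> (cut_phi ?R) s (t + r - s) x \<le> ?b s" if "0 < s" "s < t" for s
              using ob[of s "t + r - s" x] that r by simp
          qed
          \<comment> \<open>The past is enlarged to (0,T), and the bound \<open>B\<close> is paid
            only on the current step.\<close>
          also have "(\<integral>\<^sup>+s. indicator {0<..<t} s * (ennreal (7 * C) * ?b s * ?b s) \<partial>lborel)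
            \<le> (\<integral>\<^sup>+s. indicator {0<..<T} s * ennreal (7 * C * (2 * g0 * (2 * g0))) + indicator {?a<..<t} s * ennreal (7 * C * (B * B)) \<partial>lborel)"
            using tT pos B by (intro nn_integral_mono) (auto split: split_indicator simp: mult.assoc simp flip: ennreal_mult)
          also have "\<dots> = ennreal T * ennreal (7 * C * (2 * g0 * (2 * g0))) + ennreal (t - ?a) * ennreal (7 * C * (B * B))"
            using pos False by (subst nn_integral_add) (auto simp: Ioo_integral)
          also have "ennreal T * ennreal (7 * C * (2 * g0 * (2 * g0))) \<le> ennreal (g0 / 2)"
            using sm pos by (simp add: ennreal_leI flip: ennreal_mult')
          also have "ennreal (t - ?a) * ennreal (7 * C * (B * B)) \<le> ennreal (g0 / 2)"
          proof -
            have "(t - ?a) * (7 * C * (B * B)) \<le> h * (7 * C * (B * B))"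
            proof (rule mult_right_mono)
              show "t - ?a \<le> h" using t by (simp add: algebra_simps)
              show "0 \<le> 7 * C * (B * B)" using pos B by simp
            qed
            then show ?thesis using hB False by (subst ennreal_mult'[symmetric]) (auto intro!: ennreal_leI)
          qed
          also have "ennreal g0 + (ennreal (g0 / 2) + ennreal (g0 / 2)) = ennreal (2 * g0)"
            using pos by (simp flip: ennreal_plus)
          finally show ?thesis by (simp add: add_left_mono add_mono)
        qed
      qed
    qed simp
    obtain j where "T / h \<le> real j" using real_arch_simple by blast
    then have "T \<le> real j * h" using h by (simp add: field_simps)
    then have "fst z \<le> real j * h" using z by simp
    then show "observe \<nu> (cut_phi ?R) (fst z) 0 (snd z) \<le> ennreal (2 * g0)" using main[of j] z by simp
  qed
  then show ?thesis by (simp add: observe_def)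
qed

theorem mild_solution_good:
  assumes n: "nice \<nu>" and m: "mild \<nu> (rate \<nu>) \<nu>"
    and fin: "\<And>R \<rho> x. 0 < \<rho> \<Longrightarrow> \<rho> \<le> T \<Longrightarrow> (\<integral>\<^sup>+y. cut_phi R y \<partial>evolve time_space uno (rate \<nu>) \<nu> \<rho> x) < \<infinity>"
    and mass: "\<And>t. (\<integral>\<^sup>+x. \<integral>\<^sup>+y. ennreal y \<partial>\<nu> (t, x) \<partial>lborel) \<le> ennreal M"
  shows "good \<nu>" "exp_sol \<nu> (rate \<nu>) \<nu>"
proof -
  note b = phi_bound_self[OF n m fin]
  have r: "ok_rate (rate \<nu>)" by (rule rate_ok[OF n b])
  have "(\<integral>\<^sup>+x. \<integral>\<^sup>+y. ennreal y \<partial>\<nu> (t, x) \<partial>lborel) \<le> ennreal (2 * m0)" for t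
  proof (rule mass_bound[OF n n r m order_refl b])
    show "\<exists>B::real. \<forall>t. (\<integral>\<^sup>+x. \<integral>\<^sup>+y. cut_id R y \<partial>\<nu> (t, x) \<partial>lborel) \<le> ennreal B" for R
    proof (intro exI allI)
      show "(\<integral>\<^sup>+x. \<integral>\<^sup>+y. cut_id R y \<partial>\<nu> (t, x) \<partial>lborel) \<le> ennreal M" for t
        by (rule order_trans[OF _ mass[of t]], intro nn_integral_mono) (auto simp: cut_id_def split: split_indicator)
    qed
  qed
  with b n show "good \<nu>" by (simp add: good_def)
  show "exp_sol \<nu> (rate \<nu>) \<nu>" by (rule mild_exp_sol[OF n n r m])
qed

end

section \<open>The Gaussian heat kernel\<close>

text \<open>Factorising over the coordinates reduces unit mass and the semigroup law to
  one-dimensional normal densities.\<close>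

lemma diffusion_density_prod:
  fixes x x' :: "'a::euclidean_space"
  assumes v: "0 < a y * t"
  shows "diffusion_density a t x' x y = (\<Prod>b\<in>Basis. normal_density (x \<bullet> b) (sqrt (a y * t)) (x' \<bullet> b))"
proof -
  let ?v = "a y * t"
  let ?n = "DIM('a)"
  have "(\<Prod>b\<in>Basis. normal_density (x \<bullet> b) (sqrt ?v) (x' \<bullet> b)) = (1 / sqrt (2 * pi * ?v)) ^ ?n * exp (\<Sum>b\<in>Basis. - ((x' \<bullet> b - x \<bullet> b)\<^sup>2 / (2 * ?v)))"
    using v by (simp add: normal_density_def prod_dividef exp_sum power_one_over)
  also have "(\<Sum>b\<in>Basis. - ((x' \<bullet> b - x \<bullet> b)\<^sup>2 / (2 * ?v))) = - ((norm (x' - x))\<^sup>2 / (2 * ?v))"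
    unfolding power2_norm_eq_inner euclidean_inner[of "x' - x" "x' - x"]
    by (simp add: sum_negf sum_divide_distrib inner_diff_left power2_eq_square)
  also have "(1 / sqrt (2 * pi * ?v)) ^ ?n = (2 * pi * ?v) powr (- (real ?n / 2))"
  proof -
    define q where "q = 2 * pi * ?v"
    have q: "0 < q" using v by (simp add: q_def)
    then have "1 / sqrt q = q powr (- (1/2))" by (simp only: powr_minus powr_half_sqrt less_imp_le inverse_eq_divide)
    then have "(1 / sqrt q) ^ ?n = (q powr (- (1/2))) ^ ?n" by simp
    also have "\<dots> = (q powr (- (1/2))) powr real ?n" using q by (subst powr_realpow) auto
    also have "\<dots> = q powr (- (real ?n / 2))" by (simp add: powr_powr)
    finally show ?thesis unfolding q_def .
  qed
  finally show ?thesis by (simp add: diffusion_density_def mult.assoc)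
qed

lemma nn_integral_normal_density: "0 < \<sigma> \<Longrightarrow> (\<integral>\<^sup>+x. ennreal (normal_density \<mu> \<sigma> x) \<partial>lborel) = 1"
  using prob_space.emeasure_space_1[OF prob_space_normal_density[of \<sigma> \<mu>]] by (simp add: emeasure_density)

lemma normal_density_convolution:
  assumes "0 < \<sigma>" "0 < \<tau>"
  shows "(\<integral>\<^sup>+u. ennreal (normal_density m \<sigma> u * normal_density u \<tau> q) \<partial>lborel) = ennreal (normal_density m (sqrt (\<sigma>\<^sup>2 + \<tau>\<^sup>2)) q)"
proof -
  have "(\<integral>\<^sup>+u. ennreal (normal_density m \<sigma> u * normal_density u \<tau> q) \<partial>lborel)
      = (\<integral>\<^sup>+u. ennreal (normal_density m \<sigma> (m + u) * normal_density (m + u) \<tau> q) \<partial>lborel)"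
    by (subst nn_integral_real_affine[where c=1 and t=m]) (auto simp: normal_density_def)
  also have "\<dots> = (\<integral>\<^sup>+u. ennreal (normal_density 0 \<tau> ((q - m) - u) * normal_density 0 \<sigma> u) \<partial>lborel)"
    by (intro nn_integral_cong) (simp add: normal_density_def algebra_simps)
  also have "\<dots> = ennreal (normal_density 0 (sqrt (\<tau>\<^sup>2 + \<sigma>\<^sup>2)) (q - m))"
    using conv_normal_density_zero_mean[OF assms(2,1)] by (rule fun_cong)
  also have "\<dots> = ennreal (normal_density m (sqrt (\<sigma>\<^sup>2 + \<tau>\<^sup>2)) q)"
    by (simp add: normal_density_def add.commute)
  finally show ?thesis .
qed

lemma diffusion_density_nonneg: "0 \<le> diffusion_density a t x' x y"
  by (simp add: diffusion_density_def)

lemma diffusion_density_sym: "diffusion_density a t x' x y = diffusion_density a t x x' y"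
  by (simp add: diffusion_density_def norm_minus_commute)

lemma diffusion_density_int:
  fixes x :: "'a::euclidean_space"
  assumes "0 < a y * t"
  shows "(\<integral>\<^sup>+x'. ennreal (diffusion_density a t x' x y) \<partial>lborel) = 1"
proof -
  have "(\<integral>\<^sup>+x'. ennreal (diffusion_density a t x' x y) \<partial>lborel)
      = (\<integral>\<^sup>+x'. (\<Prod>b\<in>(Basis::'a set). ennreal (normal_density (x \<bullet> b) (sqrt (a y * t)) (x' \<bullet> b))) \<partial>lborel)"
    by (simp add: diffusion_density_prod[where 'a='a and a=a and y=y and t=t, OF assms] prod_ennreal)
  also have "\<dots> = (\<Prod>b\<in>(Basis::'a set). \<integral>\<^sup>+u. ennreal (normal_density (x \<bullet> b) (sqrt (a y * t)) u) \<partial>lborel)"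
    by (intro nn_integral_lborel_prod) auto
  also have "\<dots> = 1" using assms by (simp add: nn_integral_normal_density)
  finally show ?thesis .
qed

lemma diffusion_density_semigroup:
  fixes x x'' :: "'a::euclidean_space"
  assumes "0 < a y" "0 < t" "0 < r"
  shows "(\<integral>\<^sup>+x'. ennreal (diffusion_density a r x' x y) * ennreal (diffusion_density a t x'' x' y) \<partial>lborel)
    = ennreal (diffusion_density a (t + r) x'' x y)"
proof -
  let ?s = "sqrt (a y * r)" and ?t = "sqrt (a y * t)"
  have p: "0 < a y * r" "0 < a y * t" "0 < a y * (t + r)" using assms by simp_all
  have "(\<integral>\<^sup>+x'. ennreal (diffusion_density a r x' x y) * ennreal (diffusion_density a t x'' x' y) \<partial>lborel)
    = (\<integral>\<^sup>+x'. (\<Prod>b\<in>(Basis::'a set). ennreal (normal_density (x \<bullet> b) ?s (x' \<bullet> b) * normal_density (x' \<bullet> b) ?t (x'' \<bullet> b))) \<partial>lborel)"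
    unfolding diffusion_density_prod[where a=a and y=y and t=r, OF p(1)] diffusion_density_prod[where a=a and y=y and t=t, OF p(2)]
    by (intro nn_integral_cong) (simp add: prod_ennreal prod.distrib prod_nonneg flip: ennreal_mult)
  also have "\<dots> = (\<Prod>b\<in>(Basis::'a set). \<integral>\<^sup>+u. ennreal (normal_density (x \<bullet> b) ?s u * normal_density u ?t (x'' \<bullet> b)) \<partial>lborel)"
    by (intro nn_integral_lborel_prod) (auto simp: normal_density_def)
  also have "\<dots> = (\<Prod>b\<in>(Basis::'a set). ennreal (normal_density (x \<bullet> b) (sqrt (a y * (t + r))) (x'' \<bullet> b)))"
    using p by (intro prod.cong refl, subst normal_density_convolution) (auto simp: distrib_left add.commute)
  also have "\<dots> = ennreal (diffusion_density a (t + r) x'' x y)"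
    unfolding diffusion_density_prod[where a=a and y=y and t="t + r", OF p(3)] by (simp add: prod_ennreal)
  finally show ?thesis .
qed

text \<open>The exponential decreases in the size, as larger particles diffuse more slowly. The
  prefactor grows like y^(3c/2), which is at most linear growth because c \<le> 2/3.\<close>

lemma diffusion_density_mono:
  fixes x x' :: "real ^ 3"
  assumes c: "0 < c" "c \<le> 2/3" and t: "0 < t" and y: "0 < y" "y \<le> z"
  defines "a \<equiv> \<lambda>y. y powr (- c)"
  shows "y * diffusion_density a t x' x z \<le> z * diffusion_density a t x' x y"
proof -
  have a: "0 < a y" "0 < a z" "a z \<le> a y" using y c by (auto simp: a_def intro!: powr_mono2')
  have pre: "(2 * pi * a u * t) powr (- (3/2)) = (2 * pi * t) powr (- (3/2)) * u powr (3 * c / 2)" if "0 < u" for u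
  proof -
    have "(2 * pi * a u * t) powr (- (3/2)) = ((2 * pi * t) * a u) powr (- (3/2))" by (simp add: ac_simps)
    also have "\<dots> = (2 * pi * t) powr (- (3/2)) * (a u) powr (- (3/2))" using t by (subst powr_mult) (auto simp: a_def)
    also have "(a u) powr (- (3/2)) = u powr (3 * c / 2)" by (simp add: a_def powr_powr mult.commute)
    finally show ?thesis .
  qed
  have e: "exp (- ((norm (x' - x))\<^sup>2 / (2 * a z * t))) \<le> exp (- ((norm (x' - x))\<^sup>2 / (2 * a y * t)))"
    using a t by (auto intro!: divide_left_mono mult_right_mono)
  have b: "y * z powr (3 * c / 2) \<le> z * y powr (3 * c / 2)"
  proof -
    have "(z / y) powr (3 * c / 2) \<le> (z / y) powr 1" using c y by (intro powr_mono) auto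
    then have "z powr (3 * c / 2) / y powr (3 * c / 2) \<le> z / y" using y by (simp add: powr_divide)
    then show ?thesis using y by (simp add: field_simps)
  qed
  have "y * diffusion_density a t x' x z = (2 * pi * t) powr (- (3/2)) * ((y * z powr (3 * c / 2)) * exp (- ((norm (x' - x))\<^sup>2 / (2 * a z * t))))"
    using pre[of z] y by (simp add: diffusion_density_def ac_simps)
  also have "\<dots> \<le> (2 * pi * t) powr (- (3/2)) * ((z * y powr (3 * c / 2)) * exp (- ((norm (x' - x))\<^sup>2 / (2 * a y * t))))"
    using y by (intro mult_left_mono mult_mono[OF b e]) auto
  also have "\<dots> = z * diffusion_density a t x' x y"
    using pre[of y] y by (simp add: diffusion_density_def ac_simps)
  finally show ?thesis .
qed

lemma heat_gaussian:
  assumes c: "0 < c" "c \<le> 2/3"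
  shows "heat (\<lambda>t (x' :: real ^ 3) x y. ennreal (diffusion_density (\<lambda>y. y powr (- c)) t x' x y))"
proof
  let ?a = "\<lambda>y :: real. y powr (- c)"
  show "(\<lambda>(\<tau>, x' :: real ^ 3, x, y). ennreal (diffusion_density ?a \<tau> x' x y)) \<in> borel_measurable (borel \<Otimes>\<^sub>M borel \<Otimes>\<^sub>M borel \<Otimes>\<^sub>M borel)"
    unfolding diffusion_density_def by measurable
  fix \<tau> r :: real and x' x x'' :: "real ^ 3" and y z :: real assume \<tau>: "0 < \<tau>" and y: "0 < y"
  have v: "0 < ?a y * \<tau>" "0 < ?a y" using \<tau> y by simp_all
  show "(\<integral>\<^sup>+x'. ennreal (diffusion_density ?a \<tau> x' x y) \<partial>lborel) = 1" by (rule diffusion_density_int[where a="?a" and y=y and t=\<tau>, OF v(1)])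
  show "(\<integral>\<^sup>+x. ennreal (diffusion_density ?a \<tau> x' x y) \<partial>lborel) = 1"
    unfolding diffusion_density_sym[of ?a \<tau> x'] by (rule diffusion_density_int[where a="?a" and y=y and t=\<tau>, OF v(1)])
  show "0 < r \<Longrightarrow> (\<integral>\<^sup>+x'. ennreal (diffusion_density ?a r x' x y) * ennreal (diffusion_density ?a \<tau> x'' x' y) \<partial>lborel) = ennreal (diffusion_density ?a (\<tau> + r) x'' x y)"
    by (rule diffusion_density_semigroup[where a="?a" and y=y, OF v(2) \<tau>])
  show "y \<le> z \<Longrightarrow> ennreal y * ennreal (diffusion_density ?a \<tau> x' x z) \<le> ennreal z * ennreal (diffusion_density ?a \<tau> x' x y)"
    using diffusion_density_mono[OF c \<tau> y, of z x' x] y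
    by (simp add: diffusion_density_nonneg ennreal_leI flip: ennreal_mult)
qed

text \<open>Continuity of the heat kernel and Fatou's lemma upgrade an almost everywhere bound.\<close>

lemma AE_bound_everywhere:
  fixes \<mu> :: "real ^ 3 \<Rightarrow> real measure"
  assumes \<mu>: "locally_finite_kernel \<mu>" and f [measurable]: "f \<in> borel_measurable sizes" and c: "0 < c" "c \<le> 2/3" and t: "0 < t"
  defines "p \<equiv> \<lambda>x' x y. ennreal (diffusion_density (\<lambda>y. y powr (- c)) t x' x y)"
  assumes AE: "AE x in lborel. (\<integral>\<^sup>+x'. \<integral>\<^sup>+y. f y * p x' x y \<partial>\<mu> x' \<partial>lborel) \<le> B"
  shows "(\<integral>\<^sup>+x'. \<integral>\<^sup>+y. f y * p x' x y \<partial>\<mu> x' \<partial>lborel) \<le> B"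
proof -
  note [measurable_cong] = lfk_sets[OF \<mu>]
  let ?F = "\<lambda>x. \<integral>\<^sup>+x'. \<integral>\<^sup>+y. f y * p x' x y \<partial>\<mu> x' \<partial>lborel"
  obtain N where N: "{x \<in> space lborel. \<not> ?F x \<le> B} \<subseteq> N" "emeasure lborel N = 0" "N \<in> sets lborel"
    using AE by (rule AE_E)
  \<comment> \<open>Balls have positive measure, so points outside the exceptional null set come
    arbitrarily close to \<open>x\<close>.\<close>
  have "\<exists>u. u \<in> ball x (1 / real (Suc n)) \<and> u \<notin> N" for n
  proof (rule ccontr)
    assume "\<not> ?thesis"
    then have "ball x (1 / real (Suc n)) \<subseteq> N" by blast
    then have "emeasure lborel (ball x (1 / real (Suc n))) \<le> emeasure lborel N" using N by (intro emeasure_mono) auto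
    then have "emeasure lborel (ball x (1 / real (Suc n))) = 0" using N by simp
    moreover have "emeasure lborel (ball x (1 / real (Suc n))) > 0"
      using open_not_negligible[of "ball x (1 / real (Suc n))"] by (auto simp: negligible_iff_emeasure0 zero_less_iff_neq_zero)
    ultimately show False by simp
  qed
  then obtain u where u: "\<And>n. u n \<in> ball x (1 / real (Suc n))" "\<And>n. u n \<notin> N" by metis
  have "u \<longlonglongrightarrow> x"
  proof (rule metric_LIMSEQ_I)
    fix r :: real assume "0 < r"
    then obtain M where M: "inverse (real (Suc M)) < r" using reals_Archimedean by blast
    have "dist (u n) x < r" if "M \<le> n" for n
    proof -
      have "dist (u n) x < 1 / real (Suc n)" using u(1)[of n] by (simp add: dist_commute)
      also have "\<dots> \<le> 1 / real (Suc M)" using that by (simp add: frac_le)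
      finally show ?thesis using M by (simp add: inverse_eq_divide)
    qed
    then show "\<exists>no. \<forall>n\<ge>no. dist (u n) x < r" by blast
  qed
  then have lim: "(\<lambda>n. p x' (u n) y) \<longlonglongrightarrow> p x' x y" for x' y
    unfolding p_def diffusion_density_def divide_inverse by (intro tendsto_intros)
  have Fn: "?F (u n) \<le> B" for n using u(2)[of n] N(1) by auto
  have pm [measurable]: "(\<lambda>m. p (g m) (h m) (i m)) \<in> borel_measurable M"
    if [measurable]: "g \<in> borel_measurable M" "h \<in> borel_measurable M" "i \<in> borel_measurable M" for g h i and M :: "'c measure"
    unfolding p_def diffusion_density_def by measurable
  have inner: "(\<integral>\<^sup>+y. f y * p x' x y \<partial>\<mu> x') \<le> liminf (\<lambda>n. \<integral>\<^sup>+y. f y * p x' (u n) y \<partial>\<mu> x')" for x'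
  proof -
    have "(\<integral>\<^sup>+y. f y * p x' x y \<partial>\<mu> x') \<le> (\<integral>\<^sup>+y. liminf (\<lambda>n. f y * p x' (u n) y) \<partial>\<mu> x')"
    proof (rule nn_integral_mono)
      fix y
      have "p x' x y \<noteq> \<infinity>" by (simp add: p_def)
      show "f y * p x' x y \<le> liminf (\<lambda>n. f y * p x' (u n) y)"
      proof (cases "f y = \<infinity>")
        case False
        then have "(\<lambda>n. f y * p x' (u n) y) \<longlonglongrightarrow> f y * p x' x y" by (intro ennreal_tendsto_cmult lim) (simp add: less_top)
        then show ?thesis by (simp add: lim_imp_Liminf)
      next
        \<comment> \<open>Multiplication by \<infinity> is not continuous at 0. If the limit is 0
          the left side vanishes, and if it is positive the products are eventually
          infinite.\<close>
        case True
        show ?thesis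
        proof (cases "p x' x y = 0")
          case False
          then have "eventually (\<lambda>n. 0 < p x' (u n) y) sequentially" using lim by (intro order_tendstoD) (auto simp: zero_less_iff_neq_zero)
          then have "eventually (\<lambda>n. f y * p x' (u n) y = \<infinity>) sequentially" by eventually_elim (auto simp: True ennreal_top_mult)
          then have "liminf (\<lambda>n. f y * p x' (u n) y) = \<infinity>"
            by (subst Liminf_eq[where g="\<lambda>_. \<infinity>"]) (auto simp: Liminf_const)
          then show ?thesis by simp
        qed simp
      qed
    qed
    also have "\<dots> \<le> liminf (\<lambda>n. \<integral>\<^sup>+y. f y * p x' (u n) y \<partial>\<mu> x')" by (intro nn_integral_liminf) measurable
    finally show ?thesis .
  qed
  have "?F x \<le> (\<integral>\<^sup>+x'. liminf (\<lambda>n. \<integral>\<^sup>+y. f y * p x' (u n) y \<partial>\<mu> x') \<partial>lborel)" by (intro nn_integral_mono inner)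
  also have "\<dots> \<le> liminf (\<lambda>n. ?F (u n))"
    by (intro nn_integral_liminf) (simp, rule lfk_integral_measurable[OF \<mu>], measurable)
  also have "\<dots> \<le> liminf (\<lambda>_::nat. B)" by (intro Liminf_mono always_eventually allI Fn)
  also have "\<dots> = B" by (simp add: Liminf_const)
  finally show ?thesis .
qed

section \<open>The coagulation-diffusion equation\<close>

text \<open>Both sides are mixtures over the two booleans, so equality on sets is an equality of
  measures, and no term has to be finite.\<close>

lemma measure_sum_eq_extend:
  assumes s: "sets M1 = sets sizes" "sets M2 = sets sizes" "sets M3 = sets sizes" "sets M4 = sets sizes"
    and eq: "\<And>A. A \<in> sets sizes \<Longrightarrow> emeasure M1 A + emeasure M2 A = emeasure M3 A + emeasure M4 A"
    and f: "f \<in> borel_measurable sizes"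
  shows "(\<integral>\<^sup>+y. f y \<partial>M1) + (\<integral>\<^sup>+y. f y \<partial>M2) = (\<integral>\<^sup>+y. f y \<partial>M3) + (\<integral>\<^sup>+y. f y \<partial>M4)"
proof -
  let ?m = "\<lambda>M M' :: real measure. mix (count_space (UNIV :: bool set)) (\<lambda>b. if b then M else M')"
  have e: "emeasure (?m M M') A = emeasure M A + emeasure M' A" if "sets M = sets sizes" "sets M' = sets sizes" "A \<in> sets sizes" for M M' A
    using that by (subst emeasure_mix) (auto simp: nn_integral_count_space_finite UNIV_bool add.commute)
  have i: "(\<integral>\<^sup>+y. f y \<partial>?m M M') = (\<integral>\<^sup>+y. f y \<partial>M) + (\<integral>\<^sup>+y. f y \<partial>M')" if "sets M = sets sizes" "sets M' = sets sizes" for M M'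
    using that f by (subst nn_integral_mix) (auto simp: nn_integral_count_space_finite UNIV_bool add.commute)
  have "?m M1 M2 = ?m M3 M4"
    by (rule measure_eqI) (simp_all add: e s eq)
  then show ?thesis using i[OF s(1,2)] i[OF s(3,4)] by simp
qed

text \<open>The set function inside \<open>diffuse\<close> coincides with that of a mixture and is
  therefore countably additive, whatever \<open>\<kappa>\<close> does on a null set of
  positions.\<close>

lemma diffuse_eq_mix:
  assumes t: "t \<noteq> 0" and s: "\<And>z. sets (M z) = sets sizes"
    and AE: "AE x' in lborel. \<forall>A\<in>sets sizes. (\<integral>\<^sup>+y\<in>A. ennreal (diffusion_density a t x' x y) \<partial>\<kappa> x') = emeasure (M x') A"
  shows "diffuse a t \<kappa> x = mix lborel M"
  unfolding diffuse_def mix_def using t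
proof (simp, intro measure_of_eq sets.space_closed)
  fix A assume "A \<in> sigma_sets (space sizes) (sets sizes)"
  then have A: "A \<in> sets sizes" by (simp add: sets.sigma_sets_eq)
  show "(\<integral>\<^sup>+x'. (\<integral>\<^sup>+y\<in>A. ennreal (diffusion_density a t x' x y) \<partial>\<kappa> x') \<partial>lborel) = (\<integral>\<^sup>+z. emeasure (M z) A \<partial>lborel)"
    using AE A by (intro nn_integral_cong_AE) (auto elim!: eventually_mono)
qed

lemma coag_loss_eq:
  assumes s: "sets M = sets sizes" "sigma_finite_measure M" and K: "(\<lambda>(y, y'). K y y') \<in> borel_measurable (sizes \<Otimes>\<^sub>M sizes)"
  shows "coag_loss K (\<lambda>_. M) x = density M (\<lambda>y. \<integral>\<^sup>+y'. ennreal (K y y') \<partial>M)"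
proof (rule measure_eqI)
  interpret sigma_finite_measure M by fact
  note [measurable_cong] = s(1) and [measurable] = K
  have m: "(\<lambda>y. \<integral>\<^sup>+y'. ennreal (K y y') \<partial>M) \<in> borel_measurable M" by measurable
  fix A assume "A \<in> sets (coag_loss K (\<lambda>_. M) x)"
  then have A: "A \<in> sets sizes" by (simp add: coag_loss_def)
  show "emeasure (coag_loss K (\<lambda>_. M) x) A = emeasure (density M (\<lambda>y. \<integral>\<^sup>+y'. ennreal (K y y') \<partial>M)) A"
    using A s emeasure_coag_loss[where \<mu>="\<lambda>_. M", OF A s K] by (simp add: emeasure_density[OF m] mult.commute)
qed (simp add: coag_loss_def s)

lemma coag_loss_cong: "\<mu> x = \<nu> x' \<Longrightarrow> coag_loss K \<mu> x = coag_loss K \<nu> x'"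
  by (simp add: coag_loss_def)

lemma coag_gain_cong: "\<mu> x = \<nu> x' \<Longrightarrow> coag_gain K \<mu> x = coag_gain K \<nu> x'"
  by (simp add: coag_gain_def)

lemma coag_gain_eq:
  assumes \<kappa>: "locally_finite_kernel \<kappa>" and K: "(\<lambda>(y, y'). K y y') \<in> borel_measurable (sizes \<Otimes>\<^sub>M sizes)"
    and sym: "\<And>y y'. K y y' = K y' y"
  shows "coag_gain K (\<lambda>_. \<kappa> z) x = gain_kernel (\<lambda>y y'. ennreal (K y y') / 2) \<kappa> \<kappa> z"
proof (rule measure_eqI)
  note s = lfk_sets[OF \<kappa>, of z] lfk_sigma_finite[OF \<kappa>, of z]
  interpret sigma_finite_measure "\<kappa> z" by (rule s)
  note [measurable_cong] = s(1) and [measurable] = K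
  have h: "(\<lambda>(y, y'). ennreal (K y y') / 2) \<in> borel_measurable (sizes \<Otimes>\<^sub>M sizes)" by measurable
  fix A assume "A \<in> sets (coag_gain K (\<lambda>_. \<kappa> z) x)"
  then have A [measurable]: "A \<in> sets sizes" by (simp add: coag_gain_def)
  have "emeasure (gain_kernel (\<lambda>y y'. ennreal (K y y') / 2) \<kappa> \<kappa> z) A
    = (\<integral>\<^sup>+y. \<integral>\<^sup>+y'. indicator A (y + y') * (ennreal (K y y') / 2) \<partial>\<kappa> z \<partial>\<kappa> z)"
    using nn_integral_gain_kernel[OF \<kappa> \<kappa> h, of "indicator A" z] A by simp
  also have "\<dots> = (\<integral>\<^sup>+y. \<integral>\<^sup>+y'. (1 / 2) * (indicator A (y' + y) * ennreal (K y' y)) \<partial>\<kappa> z \<partial>\<kappa> z)"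
    by (intro nn_integral_cong) (simp add: add.commute sym divide_ennreal_def ac_simps)
  also have "\<dots> = 1 / 2 * (\<integral>\<^sup>+y. \<integral>\<^sup>+y'. indicator A (y' + y) * ennreal (K y' y) \<partial>\<kappa> z \<partial>\<kappa> z)"
  proof -
    have m: "(\<lambda>(y, y'). indicator A (y' + y) * ennreal (K y' y)) \<in> borel_measurable (sizes \<Otimes>\<^sub>M sizes)"
    proof -
      have [measurable]: "(\<lambda>m. K (snd m) (fst m)) \<in> borel_measurable (sizes \<Otimes>\<^sub>M sizes)"
        using measurable_pair_swap[OF K] by (simp add: case_prod_beta')
      show ?thesis unfolding case_prod_beta' by measurable
    qed
    have m1: "(\<lambda>y'. indicator A (y' + y) * ennreal (K y' y)) \<in> borel_measurable (\<kappa> z)" if "y \<in> space (\<kappa> z)" for y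
      using measurable_compose[OF measurable_Pair1' m, of y] that lfk_space[OF \<kappa>] s(1)
      by (simp add: space_sizes cong: measurable_cong_sets)
    have "(\<integral>\<^sup>+y. \<integral>\<^sup>+y'. (1 / 2) * (indicator A (y' + y) * ennreal (K y' y)) \<partial>\<kappa> z \<partial>\<kappa> z)
      = (\<integral>\<^sup>+y. (1 / 2) * (\<integral>\<^sup>+y'. (indicator A (y' + y) * ennreal (K y' y)) \<partial>\<kappa> z) \<partial>\<kappa> z)"
      by (intro nn_integral_cong nn_integral_cmult m1)
    also have "\<dots> = 1 / 2 * (\<integral>\<^sup>+y. \<integral>\<^sup>+y'. indicator A (y' + y) * ennreal (K y' y) \<partial>\<kappa> z \<partial>\<kappa> z)"
    proof (rule nn_integral_cmult)
      note [measurable] = m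
      show "(\<lambda>y. \<integral>\<^sup>+y'. indicator A (y' + y) * ennreal (K y' y) \<partial>\<kappa> z) \<in> borel_measurable (\<kappa> z)" by measurable
    qed
    finally show ?thesis .
  qed
  also have "\<dots> = emeasure (coag_gain K (\<lambda>_. \<kappa> z) x) A"
    by (rule emeasure_coag_gain[where \<mu>="\<lambda>_. \<kappa> z", OF A s K, symmetric])
  finally show "emeasure (coag_gain K (\<lambda>_. \<kappa> z) x) A = emeasure (gain_kernel (\<lambda>y y'. ennreal (K y y') / 2) \<kappa> \<kappa> z) A" by simp
qed (simp add: coag_gain_def)

lemma (in heat) nn_integral_diffuse:
  assumes p_eq: "\<And>t x' x y. p t x' x y = ennreal (diffusion_density a t x' x y)"
    and l: "locally_finite_kernel \<kappa>" and AE: "AE x in lborel. \<mu> x = \<kappa> x" and t: "0 < t" and f: "f \<in> borel_measurable sizes"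
  shows "(\<integral>\<^sup>+y. f y \<partial>diffuse a t \<mu> x) = (\<integral>\<^sup>+x'. \<integral>\<^sup>+y. f y * p t x' x y \<partial>\<kappa> x' \<partial>lborel)"
proof -
  note [measurable_cong] = lfk_sets[OF l]
  let ?M = "\<lambda>x'. density (\<kappa> x') (\<lambda>y. p t x' x y)"
  have em: "emeasure (?M x') A = (\<integral>\<^sup>+y. indicator A y * p t x' x y \<partial>\<kappa> x')" if [measurable]: "A \<in> sets sizes" for x' A
    by (simp add: emeasure_density mult.commute)
  have "diffuse a t \<mu> x = mix lborel ?M"
  proof (rule diffuse_eq_mix)
    show "AE x' in lborel. \<forall>A\<in>sets sizes. (\<integral>\<^sup>+y\<in>A. ennreal (diffusion_density a t x' x y) \<partial>\<mu> x') = emeasure (?M x') A"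
      using AE by eventually_elim (auto simp: em p_eq[symmetric] mult.commute)
  qed (use t in \<open>simp_all add: lfk_sets[OF l]\<close>)
  also have "(\<integral>\<^sup>+y. f y \<partial>mix lborel ?M) = (\<integral>\<^sup>+x'. \<integral>\<^sup>+y. f y \<partial>?M x' \<partial>lborel)"
  proof (subst nn_integral_mix[OF _ _ f])
    show "(\<lambda>x'. emeasure (?M x') A) \<in> borel_measurable lborel" if [measurable]: "A \<in> sets sizes" for A
      unfolding em[OF that] by (simp, rule lfk_integral_measurable[OF l], measurable)
  qed (simp_all add: lfk_sets[OF l])
  also have "\<dots> = (\<integral>\<^sup>+x'. \<integral>\<^sup>+y. f y * p t x' x y \<partial>\<kappa> x' \<partial>lborel)"
    using f by (intro nn_integral_cong) (simp add: nn_integral_density mult.commute)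
  finally show ?thesis .
qed

text \<open>This locale ties the cut-off data to the original equation: \<open>k\<close> agrees with
  \<open>K\<close> only above \<open>\<delta>\<close>, since \<open>K\<close> may be unbounded near
  0, and \<open>\<mu>'\<close> is a locally finite version of the initial kernel, which may behave
  badly at a null set of positions.\<close>

locale coag_problem = coag_small p k \<delta> C g0 m0 T \<mu>'
  for p :: "real \<Rightarrow> 'x::euclidean_space \<Rightarrow> 'x \<Rightarrow> real \<Rightarrow> ennreal" and k \<delta> C g0 m0 T \<mu>' +
  fixes a :: "real \<Rightarrow> real" and K :: "real \<Rightarrow> real \<Rightarrow> real" and \<mu>\<^sub>0 :: "'x \<Rightarrow> real measure"
  assumes p_eq: "\<And>t x' x y. p t x' x y = ennreal (diffusion_density a t x' x y)"
    and k_eq: "\<And>y y'. \<delta> \<le> y \<Longrightarrow> \<delta> \<le> y' \<Longrightarrow> k y y' = ennreal (K y y')"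
    and K_measurable': "(\<lambda>(y, y'). K y y') \<in> borel_measurable (sizes \<Otimes>\<^sub>M sizes)"
    and K_sym: "\<And>y y'. K y y' = K y' y"
    and \<mu>\<^sub>0_kernel: "measurable_kernel borel \<mu>\<^sub>0"
    and \<mu>\<^sub>0_AE: "AE x in lborel. \<mu>\<^sub>0 x = \<mu>' x"
begin

lemma K_measurable [measurable (raw)]:
  "f \<in> M \<rightarrow>\<^sub>M sizes \<Longrightarrow> g \<in> M \<rightarrow>\<^sub>M sizes \<Longrightarrow> (\<lambda>m. K (f m) (g m)) \<in> borel_measurable M"
  using measurable_compose[OF measurable_Pair K_measurable'] by simp

lemma K_half_measurable: "(\<lambda>(y, y'). ennreal (K y y') / 2) \<in> borel_measurable (sizes \<Otimes>\<^sub>M sizes)"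
  by measurable

lemma diffuse_initial:
  assumes t: "0 < t"
  shows "diffuse a t \<mu>\<^sub>0 x = evolve initial_space uno one ini t x"
proof (rule measure_eqI)
  show s: "sets (diffuse a t \<mu>\<^sub>0 x) = sets (evolve initial_space uno one ini t x)"
    using t by (simp add: diffuse_def)
  fix A assume "A \<in> sets (diffuse a t \<mu>\<^sub>0 x)"
  then have A: "A \<in> sets sizes" using s by simp
  then show "emeasure (diffuse a t \<mu>\<^sub>0 x) A = emeasure (evolve initial_space uno one ini t x) A"
    using nn_integral_diffuse[OF p_eq \<mu>0_lfk \<mu>\<^sub>0_AE t borel_measurable_indicator[OF A], of x] s
      nn_integral_evolve_initial[OF uno_measurable borel_measurable_indicator[OF A] t, of x]
    by (simp add: uno_def[abs_def] uno_def)
qed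

text \<open>The mass bound makes a solution locally finite only at almost every position, which is enough because
  diffusion integrates over the position.\<close>

definition represents :: "(real \<Rightarrow> 'x \<Rightarrow> real measure) \<Rightarrow> 'x kernel \<Rightarrow> bool" where
  "represents \<nu> \<kappa> \<longleftrightarrow> locally_finite_kernel \<kappa> \<and> (\<forall>s. 0 < s \<longrightarrow> s \<le> T \<longrightarrow> (AE x in lborel. \<nu> s x = \<kappa> (s, x)))"

text \<open>The loss rate of the original kernel \<open>K\<close>. It is needed as long as small
  sizes are not excluded and may then be infinite; above \<open>\<delta>\<close> and for a
  \<open>nice\<close> kernel it coincides with \<open>rate\<close>.\<close>

definition rateK :: "'x kernel \<Rightarrow> 'x rate" where
  "rateK \<kappa> z y = (\<integral>\<^sup>+y'. ennreal (K y y') \<partial>\<kappa> z)"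

lemma rateK_measurable [measurable (raw)]:
  assumes l: "locally_finite_kernel \<kappa>" and [measurable]: "g \<in> borel_measurable M" "h \<in> M \<rightarrow>\<^sub>M sizes"
  shows "(\<lambda>m. rateK \<kappa> (g m) (h m)) \<in> borel_measurable M"
  unfolding rateK_def by (rule lfk_integral_measurable[OF l]) measurable

lemma total_loss_eq:
  assumes r: "represents \<nu> \<kappa>" and t: "0 < t" "t \<le> T" and A [measurable]: "A \<in> sets sizes"
  shows "total_loss a K \<nu> t x A = (\<integral>\<^sup>+s. indicator {0<..<t} s *
    (\<integral>\<^sup>+x'. \<integral>\<^sup>+y. indicator A y * (rateK \<kappa> (s, x') y * p (t - s) x' x y) \<partial>\<kappa> (s, x') \<partial>lborel) \<partial>lborel)"
proof -
  have l: "locally_finite_kernel \<kappa>" using r by (simp add: represents_def)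
  note [measurable_cong] = lfk_sets[OF l] and [measurable (raw)] = rateK_measurable[OF l]
  have main: "emeasure (diffuse a (t - s) (coag_loss K (\<nu> s)) x) A =
     (\<integral>\<^sup>+x'. \<integral>\<^sup>+y. indicator A y * (rateK \<kappa> (s, x') y * p (t - s) x' x y) \<partial>\<kappa> (s, x') \<partial>lborel)" if s: "0 < s" "s < t" for s
  proof -
    let ?M = "\<lambda>x'. density (\<kappa> (s, x')) (\<lambda>y. rateK \<kappa> (s, x') y * p (t - s) x' x y)"
    have em: "emeasure (?M x') B = (\<integral>\<^sup>+y. indicator B y * (rateK \<kappa> (s, x') y * p (t - s) x' x y) \<partial>\<kappa> (s, x'))"
      if [measurable]: "B \<in> sets sizes" for B x'
      by (simp add: emeasure_density mult.commute)
    have "AE x' in lborel. \<nu> s x' = \<kappa> (s, x')" using r s t by (simp add: represents_def)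
    then have "AE x' in lborel. \<forall>B\<in>sets sizes. (\<integral>\<^sup>+y\<in>B. ennreal (diffusion_density a (t - s) x' x y) \<partial>coag_loss K (\<nu> s) x') = emeasure (?M x') B"
    proof eventually_elim
      case (elim x')
      have c: "coag_loss K (\<nu> s) x' = density (\<kappa> (s, x')) (rateK \<kappa> (s, x'))"
        using coag_loss_cong[of "\<nu> s" x' "\<lambda>_. \<kappa> (s, x')" x' K] coag_loss_eq[OF lfk_sets[OF l] lfk_sigma_finite[OF l] K_measurable', of "(s, x')" x'] elim
        unfolding rateK_def[abs_def] by simp
      show ?case
        unfolding c
      proof
        fix B assume B [measurable]: "B \<in> sets sizes"
        have "(\<integral>\<^sup>+y. p (t - s) x' x y * indicator B y \<partial>density (\<kappa> (s, x')) (rateK \<kappa> (s, x'))) =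
          (\<integral>\<^sup>+y. rateK \<kappa> (s, x') y * (p (t - s) x' x y * indicator B y) \<partial>\<kappa> (s, x'))"
          by (rule nn_integral_density) measurable
        then show "(\<integral>\<^sup>+y\<in>B. ennreal (diffusion_density a (t - s) x' x y) \<partial>density (\<kappa> (s, x')) (rateK \<kappa> (s, x'))) = emeasure (?M x') B"
          unfolding em[OF B] unfolding p_eq by (simp add: ac_simps)
      qed
    qed
    then have "diffuse a (t - s) (coag_loss K (\<nu> s)) x = mix lborel ?M"
      using s by (intro diffuse_eq_mix) (auto simp: lfk_sets[OF l])
    also have "emeasure (mix lborel ?M) A = (\<integral>\<^sup>+x'. \<integral>\<^sup>+y. indicator A y * (rateK \<kappa> (s, x') y * p (t - s) x' x y) \<partial>\<kappa> (s, x') \<partial>lborel)"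
    proof (subst emeasure_mix[OF _ _ A])
      show "(\<lambda>x'. emeasure (?M x') B) \<in> borel_measurable lborel" if [measurable]: "B \<in> sets sizes" for B
        unfolding em[OF that] by (simp, rule lfk_integral_measurable[OF l], measurable)
    qed (auto simp: em lfk_sets[OF l])
    finally show ?thesis .
  qed
  show ?thesis
    unfolding total_loss_def
  proof (rule nn_integral_cong_AE)
    \<comment> \<open>At \<open>s = t\<close> the operator \<open>diffuse\<close> is the identity
      instead of an integral, and at \<open>s = 0\<close> the kernel \<open>\<kappa>\<close>
      represents nothing. Both times form a null set.\<close>
    have "AE v in lborel. v \<noteq> (0::real)" "AE v in lborel. v \<noteq> t" by (simp_all add: AE_lborel_singleton)
    then show "AE s in lborel. emeasure (diffuse a (t - s) (coag_loss K (\<nu> s)) x) A * indicator {0..t} s = indicator {0<..<t} s *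
      (\<integral>\<^sup>+x'. \<integral>\<^sup>+y. indicator A y * (rateK \<kappa> (s, x') y * p (t - s) x' x y) \<partial>\<kappa> (s, x') \<partial>lborel)"
      by eventually_elim (auto simp: main split: split_indicator)
  qed
qed

lemma total_gain_eq:
  assumes r: "represents \<nu> \<kappa>" and t: "0 < t" "t \<le> T" and A [measurable]: "A \<in> sets sizes"
  shows "total_gain a K \<nu> t x A = (\<integral>\<^sup>+s. indicator {0<..<t} s *
    (\<integral>\<^sup>+x'. \<integral>\<^sup>+y. \<integral>\<^sup>+y'. (indicator A (y + y') * p (t - s) x' x (y + y')) * (ennreal (K y y') / 2) \<partial>\<kappa> (s, x') \<partial>\<kappa> (s, x') \<partial>lborel) \<partial>lborel)"
proof -
  have l: "locally_finite_kernel \<kappa>" using r by (simp add: represents_def)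
  note [measurable_cong] = lfk_sets[OF l]
  let ?G = "gain_kernel (\<lambda>y y'. ennreal (K y y') / 2) \<kappa> \<kappa>"
  have main: "emeasure (diffuse a (t - s) (coag_gain K (\<nu> s)) x) A =
     (\<integral>\<^sup>+x'. \<integral>\<^sup>+y. \<integral>\<^sup>+y'. (indicator A (y + y') * p (t - s) x' x (y + y')) * (ennreal (K y y') / 2) \<partial>\<kappa> (s, x') \<partial>\<kappa> (s, x') \<partial>lborel)" if s: "0 < s" "s < t" for s
  proof -
    let ?M = "\<lambda>x'. density (?G (s, x')) (\<lambda>y. p (t - s) x' x y)"
    have em: "emeasure (?M x') B = (\<integral>\<^sup>+y. \<integral>\<^sup>+y'. (indicator B (y + y') * p (t - s) x' x (y + y')) * (ennreal (K y y') / 2) \<partial>\<kappa> (s, x') \<partial>\<kappa> (s, x'))"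
      if B [measurable]: "B \<in> sets sizes" for B x'
    proof -
      have "emeasure (?M x') B = (\<integral>\<^sup>+y. indicator B y * p (t - s) x' x y \<partial>?G (s, x'))"
        by (simp add: emeasure_density mult.commute)
      also have "\<dots> = (\<integral>\<^sup>+y. \<integral>\<^sup>+y'. (indicator B (y + y') * p (t - s) x' x (y + y')) * (ennreal (K y y') / 2) \<partial>\<kappa> (s, x') \<partial>\<kappa> (s, x'))"
        by (rule nn_integral_gain_kernel[OF l l K_half_measurable]) measurable
      finally show ?thesis .
    qed
    have "AE x' in lborel. \<nu> s x' = \<kappa> (s, x')" using r s t by (simp add: represents_def)
    then have "AE x' in lborel. \<forall>B\<in>sets sizes. (\<integral>\<^sup>+y\<in>B. ennreal (diffusion_density a (t - s) x' x y) \<partial>coag_gain K (\<nu> s) x') = emeasure (?M x') B"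
    proof eventually_elim
      case (elim x')
      have c: "coag_gain K (\<nu> s) x' = ?G (s, x')"
        using coag_gain_cong[of "\<nu> s" x' "\<lambda>_. \<kappa> (s, x')" x' K] coag_gain_eq[OF l K_measurable' K_sym, of "(s, x')" x'] elim by simp
      show ?case unfolding c by (auto simp: emeasure_density p_eq[symmetric])
    qed
    then have "diffuse a (t - s) (coag_gain K (\<nu> s)) x = mix lborel ?M"
      using s by (intro diffuse_eq_mix) auto
    also have "emeasure (mix lborel ?M) A = (\<integral>\<^sup>+x'. \<integral>\<^sup>+y. \<integral>\<^sup>+y'. (indicator A (y + y') * p (t - s) x' x (y + y')) * (ennreal (K y y') / 2) \<partial>\<kappa> (s, x') \<partial>\<kappa> (s, x') \<partial>lborel)"
    proof (subst emeasure_mix[OF _ _ A])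
      show "(\<lambda>x'. emeasure (?M x') B) \<in> borel_measurable lborel" if [measurable]: "B \<in> sets sizes" for B
        unfolding em[OF that]
      proof (simp, rule lfk_integral_measurable[OF l])
        have "(\<lambda>m. \<integral>\<^sup>+y'. (indicator B (snd m + y') * p (t - s) (fst m) x (snd m + y')) * (ennreal (K (snd m) y') / 2) \<partial>\<kappa> (s, fst m)) \<in> borel_measurable (borel \<Otimes>\<^sub>M sizes)"
          by (rule lfk_integral_measurable[OF l]) measurable
        then show "(\<lambda>(x', y). \<integral>\<^sup>+y'. (indicator B (y + y') * p (t - s) x' x (y + y')) * (ennreal (K y y') / 2) \<partial>\<kappa> (s, x')) \<in> borel_measurable (borel \<Otimes>\<^sub>M sizes)"
          by (simp add: case_prod_beta')
      qed measurable
    qed (auto simp: em)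
    finally show ?thesis .
  qed
  show ?thesis
    unfolding total_gain_def
  proof (rule nn_integral_cong_AE)
    have "AE v in lborel. v \<noteq> (0::real)" "AE v in lborel. v \<noteq> t" by (simp_all add: AE_lborel_singleton)
    then show "AE s in lborel. emeasure (diffuse a (t - s) (coag_gain K (\<nu> s)) x) A * indicator {0..t} s = indicator {0<..<t} s *
      (\<integral>\<^sup>+x'. \<integral>\<^sup>+y. \<integral>\<^sup>+y'. (indicator A (y + y') * p (t - s) x' x (y + y')) * (ennreal (K y y') / 2) \<partial>\<kappa> (s, x') \<partial>\<kappa> (s, x') \<partial>lborel)"
      by eventually_elim (auto simp: main split: split_indicator)
  qed
qed

end

section \<open>Symmetric against ordered gain\<close>

lemma ennreal_double_eq: "a + a = b + b \<Longrightarrow> a = b" for a b :: ennreal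
  by (cases a; cases b) (auto simp flip: ennreal_plus)

lemma ennreal_half_double: "a / 2 + a / 2 = a" for a :: ennreal
  by (cases a) (auto simp: divide_ennreal ennreal_top_divide simp flip: ennreal_plus ennreal_numeral)

lemma nn_integral_double_add:
  assumes s: "sets M = sets sizes" "sigma_finite_measure M"
    and f: "(\<lambda>(y, y'). f y y') \<in> borel_measurable (sizes \<Otimes>\<^sub>M sizes)" and g: "(\<lambda>(y, y'). g y y') \<in> borel_measurable (sizes \<Otimes>\<^sub>M sizes)"
  shows "(\<integral>\<^sup>+y. \<integral>\<^sup>+y'. f y y' + g y y' \<partial>M \<partial>M) = (\<integral>\<^sup>+y. \<integral>\<^sup>+y'. f y y' \<partial>M \<partial>M) + (\<integral>\<^sup>+y. \<integral>\<^sup>+y'. g y y' \<partial>M \<partial>M)"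
proof -
  interpret sigma_finite_measure M by (rule s)
  note [measurable_cong] = s(1) and [measurable] = f g
  have "f y \<in> borel_measurable M" "g y \<in> borel_measurable M" if "y \<in> space M" for y
    using measurable_compose[OF measurable_Pair1' f, of y] measurable_compose[OF measurable_Pair1' g, of y] that sets_eq_imp_space_eq[OF s(1)]
    by (simp_all cong: measurable_cong_sets)
  then have "(\<integral>\<^sup>+y. \<integral>\<^sup>+y'. f y y' + g y y' \<partial>M \<partial>M) = (\<integral>\<^sup>+y. (\<integral>\<^sup>+y'. f y y' \<partial>M) + (\<integral>\<^sup>+y'. g y y' \<partial>M) \<partial>M)"
    by (intro nn_integral_cong nn_integral_add)
  also have "\<dots> = (\<integral>\<^sup>+y. \<integral>\<^sup>+y'. f y y' \<partial>M \<partial>M) + (\<integral>\<^sup>+y. \<integral>\<^sup>+y'. g y y' \<partial>M \<partial>M)"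
    by (rule nn_integral_add) measurable
  finally show ?thesis .
qed

context coag_problem
begin

lemma AE_pair_size_ge:
  assumes "nice \<kappa>"
  shows "AE y in \<kappa> z. \<delta> \<le> y"
  by (rule AE_size_ge[OF nice_sets[OF assms] nice_supp[OF assms]])

lemma rateK_eq_rate:
  assumes n: "nice \<kappa>" and y: "\<delta> \<le> y"
  shows "rateK \<kappa> z y = rate \<kappa> z y"
  unfolding rateK_def rate_def using AE_pair_size_ge[OF n, of z] y
  by (intro nn_integral_cong_AE) (auto simp: k_eq)

lemma total_loss_evolve:
  assumes r: "represents \<nu> \<kappa>" and n: "nice \<kappa>" and t: "0 < t" "t \<le> T" and A [measurable]: "A \<in> sets sizes"
  shows "total_loss a K \<nu> t x A = emeasure (evolve time_space uno (rate \<kappa>) \<kappa> t x) A"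
proof -
  note ok = ok_source_meas[OF uno_measurable n rate_measurable[OF n]]
  have m: "(\<lambda>m. \<integral>\<^sup>+y. indicator A y * (indicator {..<t} (fst m) * uno (t - fst m) y * rate \<kappa> (fst m, snd m) y * p (t - fst m) (snd m) x y)
     \<partial>\<kappa> (fst m, snd m)) \<in> borel_measurable (borel \<Otimes>\<^sub>M borel)"
    by (rule evolve_density_measurable[OF ok]) measurable
  show ?thesis
    unfolding total_loss_eq[OF r t A] emeasure_evolve[OF ok A]
  proof (subst nn_integral_time_space, use m in \<open>simp add: case_prod_beta'\<close>, intro nn_integral_cong)
    fix s :: real
    show "indicator {0<..<t} s * (\<integral>\<^sup>+x'. \<integral>\<^sup>+y. indicator A y * (rateK \<kappa> (s, x') y * p (t - s) x' x y) \<partial>\<kappa> (s, x') \<partial>lborel) =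
      (\<integral>\<^sup>+x'. \<integral>\<^sup>+y. indicator A y * (indicator {..<t} s * uno (t - s) y * rate \<kappa> (s, x') y * p (t - s) x' x y) \<partial>\<kappa> (s, x') \<partial>lborel)"
    proof (cases "0 < s \<and> s < t")
      case True
      have "(\<integral>\<^sup>+y. indicator A y * (rateK \<kappa> (s, x') y * p (t - s) x' x y) \<partial>\<kappa> (s, x')) =
        (\<integral>\<^sup>+y. indicator A y * (rate \<kappa> (s, x') y * p (t - s) x' x y) \<partial>\<kappa> (s, x'))" for x'
        using AE_pair_size_ge[OF n, of "(s, x')"]
        by (intro nn_integral_cong_AE) (auto simp: rateK_eq_rate[OF n] elim!: eventually_mono)
      then show ?thesis using True by (simp add: uno_def)
    next
      case False
      then show ?thesis using nice_zero[OF n, of s] by (cases "s \<le> 0") auto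
    qed
  qed
qed

text \<open>Since ties count half, \<open>kk y y' + kk y' y = k y y'\<close>. Doubling the symmetric
  gain and exchanging the partners in one half gives twice the ordered gain, and doubling is
  injective on [0,\<infinity>].\<close>

lemma symmetrize:
  assumes n: "nice \<kappa>" and f [measurable]: "f \<in> borel_measurable sizes"
  shows "(\<integral>\<^sup>+y. \<integral>\<^sup>+y'. f (y + y') * (ennreal (K y y') / 2) \<partial>\<kappa> z \<partial>\<kappa> z) = (\<integral>\<^sup>+y. f y \<partial>gain \<kappa> \<kappa> z)"
proof -
  note [measurable_cong] = nice_sets[OF n]
  let ?X = "\<integral>\<^sup>+y. \<integral>\<^sup>+y'. f (y + y') * (ennreal (K y y') / 2) \<partial>\<kappa> z \<partial>\<kappa> z"
  let ?I = "\<integral>\<^sup>+y. \<integral>\<^sup>+y'. f (y + y') * kk y y' \<partial>\<kappa> z \<partial>\<kappa> z"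
  have s: "sigma_finite_measure (\<kappa> z)" by (rule lfk_sigma_finite[OF nice_lfk[OF n]])
  interpret sigma_finite_measure "\<kappa> z" by (rule s)
  have "?X + ?X = (\<integral>\<^sup>+y. \<integral>\<^sup>+y'. f (y + y') * (ennreal (K y y') / 2) + f (y + y') * (ennreal (K y y') / 2) \<partial>\<kappa> z \<partial>\<kappa> z)"
    by (rule nn_integral_double_add[symmetric, OF nice_sets[OF n] s]) measurable
  also have "\<dots> = (\<integral>\<^sup>+y. \<integral>\<^sup>+y'. f (y + y') * kk y y' + f (y' + y) * kk y' y \<partial>\<kappa> z \<partial>\<kappa> z)"
  proof (rule nn_integral_cong_AE)
    show "AE y in \<kappa> z. (\<integral>\<^sup>+y'. f (y + y') * (ennreal (K y y') / 2) + f (y + y') * (ennreal (K y y') / 2) \<partial>\<kappa> z) =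
       (\<integral>\<^sup>+y'. f (y + y') * kk y y' + f (y' + y) * kk y' y \<partial>\<kappa> z)"
      using AE_pair_size_ge[OF n, of z]
    proof eventually_elim
      case (elim y)
      show ?case
      proof (rule nn_integral_cong_AE)
        show "AE y' in \<kappa> z. f (y + y') * (ennreal (K y y') / 2) + f (y + y') * (ennreal (K y y') / 2) = f (y + y') * kk y y' + f (y' + y) * kk y' y"
          using AE_pair_size_ge[OF n, of z]
        proof eventually_elim
          fix y' assume "\<delta> \<le> y'"
          with elim have "k y y' = ennreal (K y y')" by (rule k_eq)
          moreover have "kk y y' + kk y' y = k y y'"
            using k_sym[of y' y] by (auto simp: kk_def ennreal_half_double)
          ultimately show "f (y + y') * (ennreal (K y y') / 2) + f (y + y') * (ennreal (K y y') / 2) = f (y + y') * kk y y' + f (y' + y) * kk y' y"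
            by (simp add: add.commute[of y'] ennreal_half_double flip: distrib_left)
        qed
      qed
    qed
  qed
  also have "\<dots> = ?I + (\<integral>\<^sup>+y. \<integral>\<^sup>+y'. f (y' + y) * kk y' y \<partial>\<kappa> z \<partial>\<kappa> z)"
    by (rule nn_integral_double_add[OF nice_sets[OF n] s]) measurable
  also have "(\<integral>\<^sup>+y. \<integral>\<^sup>+y'. f (y' + y) * kk y' y \<partial>\<kappa> z \<partial>\<kappa> z) = ?I"
    by (rule nn_integral_swap[OF s s]) measurable
  finally have "?X = ?I" by (rule ennreal_double_eq)
  then show ?thesis by (simp add: nn_integral_gain[OF n n f])
qed

lemma total_gain_evolve:
  assumes r: "represents \<nu> \<kappa>" and n: "nice \<kappa>" and t: "0 < t" "t \<le> T" and A [measurable]: "A \<in> sets sizes"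
  shows "total_gain a K \<nu> t x A = emeasure (evolve time_space uno one (gain \<kappa> \<kappa>) t x) A"
proof -
  note ok = ok_sources(3)[OF uno_measurable n n]
  note g = gain_nice[OF n n]
  have m: "(\<lambda>m. \<integral>\<^sup>+y. indicator A y * (indicator {..<t} (fst m) * uno (t - fst m) y * one (fst m, snd m) y * p (t - fst m) (snd m) x y)
     \<partial>gain \<kappa> \<kappa> (fst m, snd m)) \<in> borel_measurable (borel \<Otimes>\<^sub>M borel)"
    by (rule evolve_density_measurable[OF ok]) measurable
  show ?thesis
    unfolding total_gain_eq[OF r t A] emeasure_evolve[OF ok A]
  proof (subst nn_integral_time_space, use m in \<open>simp add: case_prod_beta'\<close>, intro nn_integral_cong)
    fix s :: real
    have sy: "(\<integral>\<^sup>+y. \<integral>\<^sup>+y'. (indicator A (y + y') * p (t - s) x' x (y + y')) * (ennreal (K y y') / 2) \<partial>\<kappa> (s, x') \<partial>\<kappa> (s, x')) =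
      (\<integral>\<^sup>+y. indicator A y * p (t - s) x' x y \<partial>gain \<kappa> \<kappa> (s, x'))" for x'
      by (rule symmetrize[OF n]) measurable
    show "indicator {0<..<t} s * (\<integral>\<^sup>+x'. \<integral>\<^sup>+y. \<integral>\<^sup>+y'. (indicator A (y + y') * p (t - s) x' x (y + y')) * (ennreal (K y y') / 2) \<partial>\<kappa> (s, x') \<partial>\<kappa> (s, x') \<partial>lborel) =
      (\<integral>\<^sup>+x'. \<integral>\<^sup>+y. indicator A y * (indicator {..<t} s * uno (t - s) y * one (s, x') y * p (t - s) x' x y) \<partial>gain \<kappa> \<kappa> (s, x') \<partial>lborel)"
      unfolding sy
    proof (cases "0 < s \<and> s < t")
      case False
      then show "indicator {0<..<t} s * (\<integral>\<^sup>+x'. \<integral>\<^sup>+y. indicator A y * p (t - s) x' x y \<partial>gain \<kappa> \<kappa> (s, x') \<partial>lborel) =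
        (\<integral>\<^sup>+x'. \<integral>\<^sup>+y. indicator A y * (indicator {..<t} s * uno (t - s) y * one (s, x') y * p (t - s) x' x y) \<partial>gain \<kappa> \<kappa> (s, x') \<partial>lborel)"
        using nice_zero[OF g, of s] by (cases "s \<le> 0") auto
    qed (simp add: uno_def)
  qed
qed

text \<open>The weights y/(y + y') and y'/(y + y') add up to 1, and \<open>p_mono\<close> bounds
  each weighted copy of the left side by the heat kernel of one partner.\<close>

lemma p_split:
  assumes "0 < \<tau>" "0 < y" "0 < y'"
  shows "p \<tau> x' x (y + y') \<le> p \<tau> x' x y + p \<tau> x' x y'"
proof -
  have frac: "ennreal (u / (y + y')) * p \<tau> x' x (y + y') \<le> p \<tau> x' x u" if "0 < u" "u \<le> y + y'" for u
  proof -
    have "ennreal (1 / (y + y')) * (ennreal u * p \<tau> x' x (y + y')) \<le> ennreal (1 / (y + y')) * (ennreal (y + y') * p \<tau> x' x u)"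
      using p_mono[OF assms(1) that, of x' x] by (rule mult_left_mono) simp
    then show ?thesis using that assms by (simp add: mult.assoc[symmetric] del: ennreal_plus flip: ennreal_mult)
  qed
  have "p \<tau> x' x (y + y') = ennreal (y / (y + y') + y' / (y + y')) * p \<tau> x' x (y + y')"
    using assms by (simp flip: add_divide_distrib)
  also have "\<dots> = ennreal (y / (y + y')) * p \<tau> x' x (y + y') + ennreal (y' / (y + y')) * p \<tau> x' x (y + y')"
    using assms by (simp add: distrib_right)
  also have "\<dots> \<le> p \<tau> x' x y + p \<tau> x' x y'" using assms by (intro add_mono frac) auto
  finally show ?thesis .
qed

text \<open>The only estimate available before the support of a solution is known.\<close>

lemma total_gain_le_loss:
  assumes r: "represents \<nu> \<kappa>" and t: "0 < t" "t \<le> T" and A [measurable]: "A \<in> sets sizes"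
    and down: "\<And>y z. z \<in> A \<Longrightarrow> 0 < y \<Longrightarrow> y \<le> z \<Longrightarrow> y \<in> A"
  shows "total_gain a K \<nu> t x A \<le> total_loss a K \<nu> t x A"
  unfolding total_gain_eq[OF r t A] total_loss_eq[OF r t A]
proof (intro nn_integral_mono)
  have l: "locally_finite_kernel \<kappa>" using r by (simp add: represents_def)
  note [measurable_cong] = lfk_sets[OF l]
  fix s :: real
  have "(\<integral>\<^sup>+y. \<integral>\<^sup>+y'. (indicator A (y + y') * p (t - s) x' x (y + y')) * (ennreal (K y y') / 2) \<partial>\<kappa> (s, x') \<partial>\<kappa> (s, x'))
    \<le> (\<integral>\<^sup>+y. indicator A y * (rateK \<kappa> (s, x') y * p (t - s) x' x y) \<partial>\<kappa> (s, x'))" if s: "s < t" for x'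
  proof -
    let ?\<kappa> = "\<kappa> (s, x')" and ?q = "\<lambda>y. indicator A y * p (t - s) x' x y"
    have sf: "sigma_finite_measure ?\<kappa>" by (rule lfk_sigma_finite[OF l])
    interpret sigma_finite_measure ?\<kappa> by (rule sf)
    have "(\<integral>\<^sup>+y. \<integral>\<^sup>+y'. ?q (y + y') * (ennreal (K y y') / 2) \<partial>?\<kappa> \<partial>?\<kappa>)
      \<le> (\<integral>\<^sup>+y. \<integral>\<^sup>+y'. ?q y * (ennreal (K y y') / 2) + ?q y' * (ennreal (K y' y) / 2) \<partial>?\<kappa> \<partial>?\<kappa>)"
    proof (intro nn_integral_mono)
      fix y y' assume y: "y \<in> space ?\<kappa>" "y' \<in> space ?\<kappa>"
      then have y: "0 < y" "0 < y'" by (simp_all add: lfk_space[OF l])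
      have "?q (y + y') \<le> ?q y + ?q y'"
      proof (cases "y + y' \<in> A")
        \<comment> \<open>Downward closedness puts both partners into \<open>A\<close>, so the
          particle leaving the pair is paid for by either of them.\<close>
        case True
        then have "y \<in> A" "y' \<in> A" using y by (auto intro: down[OF True])
        then show ?thesis using p_split[of "t - s" y y' x' x] s y True by simp
      qed simp
      then have "?q (y + y') * (ennreal (K y y') / 2) \<le> (?q y + ?q y') * (ennreal (K y y') / 2)"
        by (rule mult_right_mono) simp
      then show "?q (y + y') * (ennreal (K y y') / 2) \<le> ?q y * (ennreal (K y y') / 2) + ?q y' * (ennreal (K y' y) / 2)"
        by (simp only: distrib_right K_sym[of y' y])
    qed
    also have "\<dots> = (\<integral>\<^sup>+y. \<integral>\<^sup>+y'. ?q y * (ennreal (K y y') / 2) \<partial>?\<kappa> \<partial>?\<kappa>) + (\<integral>\<^sup>+y. \<integral>\<^sup>+y'. ?q y' * (ennreal (K y' y) / 2) \<partial>?\<kappa> \<partial>?\<kappa>)"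
      by (rule nn_integral_double_add[OF lfk_sets[OF l] sf]) measurable
    also have "(\<integral>\<^sup>+y. \<integral>\<^sup>+y'. ?q y' * (ennreal (K y' y) / 2) \<partial>?\<kappa> \<partial>?\<kappa>) = (\<integral>\<^sup>+y. \<integral>\<^sup>+y'. ?q y * (ennreal (K y y') / 2) \<partial>?\<kappa> \<partial>?\<kappa>)"
      by (rule nn_integral_swap[OF sf sf]) measurable
    also have "(\<integral>\<^sup>+y. \<integral>\<^sup>+y'. ?q y * (ennreal (K y y') / 2) \<partial>?\<kappa> \<partial>?\<kappa>) + (\<integral>\<^sup>+y. \<integral>\<^sup>+y'. ?q y * (ennreal (K y y') / 2) \<partial>?\<kappa> \<partial>?\<kappa>)
      = (\<integral>\<^sup>+y. \<integral>\<^sup>+y'. ?q y * (ennreal (K y y') / 2) + ?q y * (ennreal (K y y') / 2) \<partial>?\<kappa> \<partial>?\<kappa>)"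
      by (rule nn_integral_double_add[symmetric, OF lfk_sets[OF l] sf]) measurable
    also have "\<dots> = (\<integral>\<^sup>+y. \<integral>\<^sup>+y'. ?q y * ennreal (K y y') \<partial>?\<kappa> \<partial>?\<kappa>)"
      by (simp only: ennreal_half_double flip: distrib_left)
    also have "\<dots> = (\<integral>\<^sup>+y. ?q y * rateK \<kappa> (s, x') y \<partial>?\<kappa>)"
      unfolding rateK_def
    proof (intro nn_integral_cong nn_integral_cmult)
      fix y assume "y \<in> space ?\<kappa>"
      then have [measurable]: "y \<in> space sizes" by (simp add: lfk_space[OF l] space_sizes)
      show "(\<lambda>y'. ennreal (K y y')) \<in> borel_measurable ?\<kappa>" by measurable
    qed
    finally show ?thesis by (simp add: ac_simps)
  qed
  then show "indicator {0<..<t} s * (\<integral>\<^sup>+x'. \<integral>\<^sup>+y. \<integral>\<^sup>+y'. (indicator A (y + y') * p (t - s) x' x (y + y')) * (ennreal (K y y') / 2) \<partial>\<kappa> (s, x') \<partial>\<kappa> (s, x') \<partial>lborel)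
    \<le> indicator {0<..<t} s * (\<integral>\<^sup>+x'. \<integral>\<^sup>+y. indicator A y * (rateK \<kappa> (s, x') y * p (t - s) x' x y) \<partial>\<kappa> (s, x') \<partial>lborel)"
    by (cases "s < t") (rule mult_left_mono[OF nn_integral_mono], simp_all)
qed

end

text \<open>On the n-th window \<open>(n + 1) * y \<ge> 1\<close>, so a finite first moment bounds
  the mass there. Erasing the positions with infinite first moment gives local finiteness
  everywhere.\<close>

lemma finite_mass_lfk:
  assumes \<kappa>: "measurable_kernel borel \<kappa>"
  shows "locally_finite_kernel (\<lambda>z. if (\<integral>\<^sup>+y. ennreal y \<partial>\<kappa> z) < \<infinity> then \<kappa> z else null_measure sizes)"
proof -
  have s [simp]: "sets (\<kappa> z) = sets sizes" for z using \<kappa> by (simp add: measurable_kernel_def)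
  have m: "(\<lambda>z. emeasure (\<kappa> z) A) \<in> borel_measurable borel" if "A \<in> sets sizes" for A
    using \<kappa> that by (simp add: measurable_kernel_def)
  have [measurable]: "(\<lambda>z. \<integral>\<^sup>+y. ennreal y \<partial>\<kappa> z) \<in> borel_measurable borel"
    by (rule kernel_nn_integral_measurable) (auto intro: m)
  have "emeasure (\<kappa> z) (size_window n) < \<infinity>" if "(\<integral>\<^sup>+y. ennreal y \<partial>\<kappa> z) < \<infinity>" for z n
  proof -
    note [measurable_cong] = s[of z]
    have "emeasure (\<kappa> z) (size_window n) = (\<integral>\<^sup>+y. indicator (size_window n) y \<partial>\<kappa> z)" by simp
    also have "\<dots> \<le> (\<integral>\<^sup>+y. ennreal (real (Suc n)) * ennreal y \<partial>\<kappa> z)"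
    proof (rule nn_integral_mono)
      fix y
      show "indicator (size_window n) y \<le> ennreal (real (Suc n)) * ennreal y"
      proof (cases "y \<in> size_window n")
        case True
        then have "1 \<le> real (Suc n) * y" by (simp add: size_window_def field_simps)
        then show ?thesis using True by (simp add: ennreal_ge_1 del: of_nat_Suc flip: ennreal_mult')
      qed simp
    qed
    also have "\<dots> = ennreal (real (Suc n)) * (\<integral>\<^sup>+y. ennreal y \<partial>\<kappa> z)" by (rule nn_integral_cmult) measurable
    also have "\<dots> < \<infinity>" using that by (simp add: ennreal_mult_less_top)
    finally show ?thesis .
  qed
  moreover have "(\<lambda>z. emeasure (if (\<integral>\<^sup>+y. ennreal y \<partial>\<kappa> z) < \<infinity> then \<kappa> z else null_measure sizes) A) \<in> borel_measurable borel"
    if A: "A \<in> sets sizes" for A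
  proof -
    note [measurable] = m[OF A]
    have "(\<lambda>z. emeasure (if (\<integral>\<^sup>+y. ennreal y \<partial>\<kappa> z) < \<infinity> then \<kappa> z else null_measure sizes) A) =
      (\<lambda>z. if (\<integral>\<^sup>+y. ennreal y \<partial>\<kappa> z) < \<infinity> then emeasure (\<kappa> z) A else 0)" by auto
    also have "\<dots> \<in> borel_measurable borel" by measurable
    finally show ?thesis .
  qed
  ultimately show ?thesis by (auto simp: locally_finite_kernel_def measurable_kernel_def)
qed

section \<open>From an arbitrary solution to a good one\<close>

definition extend :: "real \<Rightarrow> (real \<Rightarrow> 'x \<Rightarrow> real measure) \<Rightarrow> 'x kernel" where
  "extend T \<nu> z = (if 0 < fst z \<and> fst z \<le> T then \<nu> (fst z) (snd z) else null_measure sizes)"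

lemma time_kernels_sets: "\<nu> \<in> time_kernels T \<Longrightarrow> 0 \<le> t \<Longrightarrow> t \<le> T \<Longrightarrow> sets (\<nu> t x) = sets sizes"
  by (auto simp: time_kernels_def measurable_kernel_def space_pair_measure space_restrict_space)

lemma extend_measurable_kernel:
  fixes \<nu> :: "real \<Rightarrow> 'x::euclidean_space \<Rightarrow> real measure"
  assumes \<nu>: "\<nu> \<in> time_kernels T" and T: "0 < T"
  shows "measurable_kernel borel (extend T \<nu>)"
  unfolding measurable_kernel_def
proof (intro conjI ballI)
  show "sets (extend T \<nu> z) = sets sizes" for z using time_kernels_sets[OF \<nu>] by (simp add: extend_def)
  fix A assume A: "A \<in> sets sizes"
  \<comment> \<open>Clamping the time to [0,T] makes the composition defined everywhere; the values
    outside are discarded afterwards.\<close>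
  let ?c = "\<lambda>z :: real \<times> 'x. (max 0 (min T (fst z)), snd z)"
  have "(\<lambda>(t, x). emeasure (\<nu> t x) A) \<in> borel_measurable (restrict_space borel {0..T} \<Otimes>\<^sub>M borel)"
    using \<nu> A by (simp add: time_kernels_def measurable_kernel_def case_prod_beta')
  moreover have "?c \<in> borel \<rightarrow>\<^sub>M restrict_space borel {0..T} \<Otimes>\<^sub>M borel"
    using T by (intro measurable_Pair measurable_restrict_space2) (auto, measurable)
  ultimately have [measurable]: "(\<lambda>z. emeasure (\<nu> (max 0 (min T (fst z))) (snd z)) A) \<in> borel_measurable borel"
    using measurable_compose[of ?c borel _ "\<lambda>(t, x). emeasure (\<nu> t x) A"] by simp
  have "(\<lambda>z. emeasure (extend T \<nu> z) A) =
    (\<lambda>z. if 0 < fst z \<and> fst z \<le> T then emeasure (\<nu> (max 0 (min T (fst z))) (snd z)) A else 0)"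
    by (auto simp: extend_def)
  also have "\<dots> \<in> borel_measurable borel" by measurable
  finally show "(\<lambda>z. emeasure (extend T \<nu> z) A) \<in> borel_measurable borel" .
qed

context coag_problem
begin

definition solves :: "(real \<Rightarrow> 'x \<Rightarrow> real measure) \<Rightarrow> bool" where
  "solves \<nu> \<longleftrightarrow> coag_diffusion_solution a K \<mu>\<^sub>0 T \<nu>"

lemma solvesD:
  assumes "solves \<nu>"
  shows "\<nu> \<in> time_kernels T"
    and "0 \<le> t \<Longrightarrow> t \<le> T \<Longrightarrow> total_loss a K \<nu> t x (space sizes) < \<infinity>"
    and "0 \<le> t \<Longrightarrow> t \<le> T \<Longrightarrow> A \<in> sets sizes \<Longrightarrow>
      emeasure (\<nu> t x) A + total_loss a K \<nu> t x A = emeasure (diffuse a t \<mu>\<^sub>0 x) A + total_gain a K \<nu> t x A"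
    and "(SUP t\<in>{0..T}. \<integral>\<^sup>+x. \<integral>\<^sup>+y. ennreal y \<partial>\<nu> t x \<partial>lborel) < \<infinity>"
  using assms by (auto simp: solves_def coag_diffusion_solution_def coag_diffusion_eq_def moment_def)

lemma extend_mass:
  assumes \<nu>: "solves \<nu>"
  obtains M where "\<And>t. (\<integral>\<^sup>+x. \<integral>\<^sup>+y. ennreal y \<partial>extend T \<nu> (t, x) \<partial>lborel) \<le> ennreal M"
proof -
  obtain M where M: "(SUP t\<in>{0..T}. \<integral>\<^sup>+x. \<integral>\<^sup>+y. ennreal y \<partial>\<nu> t x \<partial>lborel) = ennreal M"
    using solvesD(4)[OF \<nu>] by (auto simp: less_top_ennreal)
  have "(\<integral>\<^sup>+x. \<integral>\<^sup>+y. ennreal y \<partial>extend T \<nu> (t, x) \<partial>lborel) \<le> ennreal M" for t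
  proof (cases "0 < t \<and> t \<le> T")
    case True
    then show ?thesis unfolding M[symmetric] by (auto simp: extend_def intro: SUP_upper)
  next
    case False
    then have "extend T \<nu> (t, x) = null_measure sizes" for x by (auto simp: extend_def)
    then show ?thesis by simp
  qed
  then show ?thesis using that by blast
qed

lemma solves_represents:
  assumes \<nu>: "solves \<nu>"
  obtains \<kappa> where "represents \<nu> \<kappa>"
proof -
  note m = extend_measurable_kernel[OF solvesD(1)[OF \<nu>] pos(5)]
  let ?\<kappa> = "\<lambda>z. if (\<integral>\<^sup>+y. ennreal y \<partial>extend T \<nu> z) < \<infinity> then extend T \<nu> z else null_measure sizes"
  have "AE x in lborel. \<nu> s x = ?\<kappa> (s, x)" if s: "0 < s" "s \<le> T" for s
  proof -
    obtain M where M: "(\<integral>\<^sup>+x. \<integral>\<^sup>+y. ennreal y \<partial>extend T \<nu> (s, x) \<partial>lborel) \<le> ennreal M"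
      using extend_mass[OF \<nu>] by metis
    have ms: "(\<lambda>z. \<integral>\<^sup>+y. ennreal y \<partial>extend T \<nu> z) \<in> borel_measurable borel"
      using m by (intro kernel_nn_integral_measurable) (auto simp: measurable_kernel_def)
    have "(\<lambda>x. \<integral>\<^sup>+y. ennreal y \<partial>extend T \<nu> (s, x)) \<in> borel_measurable lborel"
      using measurable_compose[OF _ ms, of "\<lambda>x. (s, x)" lborel] by (simp add: borel_prod[symmetric])
    then have "AE x in lborel. (\<integral>\<^sup>+y. ennreal y \<partial>extend T \<nu> (s, x)) \<noteq> \<infinity>"
      using M by (intro nn_integral_PInf_AE) (auto simp: top_unique)
    then show ?thesis by eventually_elim (use s in \<open>auto simp: extend_def less_top\<close>)
  qed
  then have "represents \<nu> ?\<kappa>" unfolding represents_def using finite_mass_lfk[OF m] by blast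
  then show ?thesis by (rule that)
qed

lemma total_loss_mono:
  assumes r: "represents \<nu> \<kappa>" and t: "0 < t" "t \<le> T" and A: "A \<in> sets sizes"
  shows "total_loss a K \<nu> t x A \<le> total_loss a K \<nu> t x (space sizes)"
  unfolding total_loss_eq[OF r t A] total_loss_eq[OF r t sets.top] using sets.sets_into_space[OF A]
  by (intro nn_integral_mono mult_left_mono mult_right_mono) (auto split: split_indicator)

text \<open>For a downward closed \<open>A\<close> the gain is at most the loss, and the loss is
  finite by the definition of a solution, so it can be cancelled. With \<open>A\<close> below
  \<open>\<delta>\<close> this yields the support, with \<open>A\<close> below \<open>R\<close> the
  local bound at every position and not only almost everywhere.\<close>

lemma solves_le_initial:
  assumes \<nu>: "solves \<nu>" and t: "0 < t" "t \<le> T" and A: "A \<in> sets sizes"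
    and down: "\<And>y z. z \<in> A \<Longrightarrow> 0 < y \<Longrightarrow> y \<le> z \<Longrightarrow> y \<in> A"
  shows "emeasure (\<nu> t x) A \<le> emeasure (evolve initial_space uno one ini t x) A"
proof -
  obtain \<kappa> where r: "represents \<nu> \<kappa>" using solves_represents[OF \<nu>] by blast
  have fin: "total_loss a K \<nu> t x A < \<infinity>"
    using total_loss_mono[OF r t A, of x] solvesD(2)[OF \<nu>, of t x] t by (simp add: le_less_trans)
  have "total_loss a K \<nu> t x A + emeasure (\<nu> t x) A = emeasure (diffuse a t \<mu>\<^sub>0 x) A + total_gain a K \<nu> t x A"
    using solvesD(3)[OF \<nu>, of t A x] t A by (simp add: add.commute)
  also have "\<dots> \<le> total_loss a K \<nu> t x A + emeasure (evolve initial_space uno one ini t x) A"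
    using total_gain_le_loss[where x=x, OF r t A down] by (simp add: diffuse_initial[OF t(1)] add.commute add_left_mono)
  finally show ?thesis using fin by (auto simp: ennreal_add_left_cancel_le)
qed

lemma initial_uno_crude:
  assumes t: "0 < t"
  shows "emeasure (evolve initial_space uno one ini t x) {0<..R} \<le> ennreal (\<delta> powr (- (4/3)) * g0)"
proof -
  let ?M = "evolve initial_space uno one ini t x"
  have "emeasure ?M {0<..R} = (\<integral>\<^sup>+y. indicator {0<..R} y \<partial>?M)" by simp
  also have "\<dots> \<le> (\<integral>\<^sup>+y. ennreal (\<delta> powr (- (4/3))) * phi y \<partial>?M)"
    using AE_size_ge[OF sets_evolve evolve_supp[OF ok_sources(1)[OF uno_measurable] ini_supp], of t x]
    by (intro nn_integral_mono_AE) (auto elim!: eventually_mono intro: le_phi split: split_indicator)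
  also have "\<dots> = ennreal (\<delta> powr (- (4/3))) * (\<integral>\<^sup>+y. phi y \<partial>?M)" by (rule nn_integral_cmult) measurable
  also have "(\<integral>\<^sup>+y. phi y \<partial>?M) \<le> ennreal g0"
    unfolding nn_integral_evolve_initial[OF uno_measurable phi_measurable t] using \<mu>0_phi[OF t, of x] by (simp add: uno_def)
  finally show ?thesis using pos by (simp add: ennreal_mult' mult_left_mono)
qed

lemma extend_nice:
  assumes \<nu>: "solves \<nu>"
  shows "nice (extend T \<nu>)"
  unfolding nice_def
proof (intro conjI allI impI)
  show "measurable_kernel borel (extend T \<nu>)" by (rule extend_measurable_kernel[OF solvesD(1)[OF \<nu>] pos(5)])
  show "extend T \<nu> (t, x) = null_measure sizes" if "\<not> (0 < t \<and> t \<le> T)" for t x using that by (auto simp: extend_def)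
  show "emeasure (extend T \<nu> z) {0<..<\<delta>} = 0" for z
  proof (cases "0 < fst z \<and> fst z \<le> T")
    case True
    have "emeasure (\<nu> (fst z) (snd z)) {0<..<\<delta>} \<le> emeasure (evolve initial_space uno one ini (fst z) (snd z)) {0<..<\<delta>}"
      by (rule solves_le_initial[OF \<nu>]) (use True in auto)
    then show ?thesis using True evolve_supp[OF ok_sources(1)[OF uno_measurable] ini_supp] by (simp add: extend_def)
  next
    case False
    then have "extend T \<nu> z = null_measure sizes" by (auto simp: extend_def)
    then show ?thesis by simp
  qed
  show "\<exists>B::real. \<forall>z. emeasure (extend T \<nu> z) {0<..R} \<le> ennreal B" for R
  proof (intro exI allI)
    fix z
    show "emeasure (extend T \<nu> z) {0<..R} \<le> ennreal (\<delta> powr (- (4/3)) * g0)"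
    proof (cases "0 < fst z \<and> fst z \<le> T")
      case True
      have "emeasure (\<nu> (fst z) (snd z)) {0<..R} \<le> emeasure (evolve initial_space uno one ini (fst z) (snd z)) {0<..R}"
        by (rule solves_le_initial[OF \<nu>]) (use True in auto)
      also have "\<dots> \<le> ennreal (\<delta> powr (- (4/3)) * g0)" using True by (intro initial_uno_crude) simp
      finally show ?thesis using True by (simp add: extend_def)
    next
      case False
      then have "extend T \<nu> z = null_measure sizes" by (auto simp: extend_def)
      then show ?thesis by simp
    qed
  qed
qed

lemma nice_represents: "nice \<kappa> \<Longrightarrow> (\<And>t x. 0 < t \<Longrightarrow> t \<le> T \<Longrightarrow> \<nu> t x = \<kappa> (t, x)) \<Longrightarrow> represents \<nu> \<kappa>"
  by (auto simp: represents_def nice_lfk)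

lemma extend_represents: "solves \<nu> \<Longrightarrow> represents \<nu> (extend T \<nu>)"
  by (rule nice_represents[OF extend_nice]) (auto simp: extend_def)

lemma extend_mild:
  assumes \<nu>: "solves \<nu>"
  shows "mild (extend T \<nu>) (rate (extend T \<nu>)) (extend T \<nu>)"
  unfolding mild_def
proof (intro allI impI)
  note n = extend_nice[OF \<nu>] and r = extend_represents[OF \<nu>]
  fix t x and f :: "real \<Rightarrow> ennreal" assume t: "0 < t" "t \<le> T" and f: "f \<in> borel_measurable sizes"
  let ?\<kappa> = "extend T \<nu>"
  show "(\<integral>\<^sup>+y. f y \<partial>?\<kappa> (t, x)) + (\<integral>\<^sup>+y. f y \<partial>evolve time_space uno (rate ?\<kappa>) ?\<kappa> t x)
     = (\<integral>\<^sup>+y. f y \<partial>evolve initial_space uno one ini t x) + (\<integral>\<^sup>+y. f y \<partial>evolve time_space uno one (gain ?\<kappa> ?\<kappa>) t x)"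
  proof (rule measure_sum_eq_extend[OF _ _ _ _ _ f])
    fix A assume A: "A \<in> sets sizes"
    show "emeasure (?\<kappa> (t, x)) A + emeasure (evolve time_space uno (rate ?\<kappa>) ?\<kappa> t x) A
      = emeasure (evolve initial_space uno one ini t x) A + emeasure (evolve time_space uno one (gain ?\<kappa> ?\<kappa>) t x) A"
      using solvesD(3)[OF \<nu>, of t A x] t A
      by (simp add: diffuse_initial total_loss_evolve[OF r n t A] total_gain_evolve[OF r n t A]) (simp add: extend_def)
  qed (simp_all add: nice_sets[OF n])
qed

lemma solves_eq_sol:
  assumes \<nu>: "solves \<nu>" and t: "0 < t" "t \<le> T"
  shows "\<nu> t x = sol (t, x)"
proof -
  note n = extend_nice[OF \<nu>] and r = extend_represents[OF \<nu>] and m = extend_mild[OF \<nu>]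
  obtain M where M: "\<And>t. (\<integral>\<^sup>+x. \<integral>\<^sup>+y. ennreal y \<partial>extend T \<nu> (t, x) \<partial>lborel) \<le> ennreal M" using extend_mass[OF \<nu>] by metis
  \<comment> \<open>The truncated weight is bounded, so the finite total loss required of a solution
    suffices.\<close>
  have fin: "(\<integral>\<^sup>+y. cut_phi R y \<partial>evolve time_space uno (rate (extend T \<nu>)) (extend T \<nu>) \<rho> x) < \<infinity>" if \<rho>: "0 < \<rho>" "\<rho> \<le> T" for R \<rho> x
  proof -
    let ?E = "evolve time_space uno (rate (extend T \<nu>)) (extend T \<nu>) \<rho> x"
    have "(\<integral>\<^sup>+y. cut_phi R y \<partial>?E) \<le> (\<integral>\<^sup>+y. ennreal (R powr (4/3)) * indicator (space sizes) y \<partial>?E)"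
      by (intro nn_integral_mono order_trans[OF cut_phi_le] mult_left_mono) (auto simp: space_sizes split: split_indicator)
    also have "\<dots> = ennreal (R powr (4/3)) * total_loss a K \<nu> \<rho> x (space sizes)"
      by (simp add: total_loss_evolve[OF r n \<rho>] nn_integral_cmult_indicator)
    also have "\<dots> < \<infinity>" using solvesD(2)[OF \<nu>, of \<rho> x] \<rho> by (simp add: ennreal_mult_less_top)
    finally show ?thesis .
  qed
  have "extend T \<nu> = sol"
    by (rule solution_unique[OF mild_solution_good(1)[OF n m fin M] sol_good mild_solution_good(2)[OF n m fin M] sol_exp_sol])
  then have "sol (t, x) = extend T \<nu> (t, x)" by simp
  then show ?thesis using t by (simp add: extend_def)
qed

section \<open>The constructed kernel solves the original equation\<close>

lemma total_at_0: "total_loss a K \<nu> 0 x A = 0" "total_gain a K \<nu> 0 x A = 0"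
proof -
  have "(\<integral>\<^sup>+s. f s * indicator {0..0} s \<partial>lborel) = (\<integral>\<^sup>+(s::real). 0 \<partial>lborel)" for f :: "real \<Rightarrow> ennreal"
  proof (rule nn_integral_cong_AE)
    show "AE s in lborel. f s * indicator {0..0} s = 0"
      using AE_lborel_singleton[of "0::real"] by eventually_elim simp
  qed
  then show "total_loss a K \<nu> 0 x A = 0" "total_gain a K \<nu> 0 x A = 0" by (simp_all add: total_loss_def total_gain_def)
qed

lemma solves_initial:
  assumes \<nu>: "solves \<nu>"
  shows "\<nu> 0 x = \<mu>\<^sub>0 x"
proof (rule measure_eqI)
  have s: "sets (\<nu> 0 x) = sets sizes" using time_kernels_sets[OF solvesD(1)[OF \<nu>], of 0] pos by simp
  show "sets (\<nu> 0 x) = sets (\<mu>\<^sub>0 x)" using s \<mu>\<^sub>0_kernel by (simp add: measurable_kernel_def)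
  show "emeasure (\<nu> 0 x) A = emeasure (\<mu>\<^sub>0 x) A" if "A \<in> sets (\<nu> 0 x)" for A
    using solvesD(3)[OF \<nu>, of 0 A x] pos that s by (simp add: total_at_0 diffuse_def)
qed

text \<open>\<open>sol\<close> is null at time 0, since \<open>nice\<close> excludes that time, so
  the initial kernel itself has to be inserted there.\<close>

definition solution :: "real \<Rightarrow> 'x \<Rightarrow> real measure" where
  "solution t x = (if t = 0 then \<mu>\<^sub>0 x else sol (t, x))"

text \<open>Above \<open>\<delta>\<close> the loss rate is at most a constant times
  \<open>phi\<close>. The loss emitted at \<open>s\<close> and observed at \<open>t\<close> is then
  a \<open>phi\<close> moment after diffusing for \<open>t - s\<close>, which
  \<open>phi_bound\<close> limits by 2 \<open>g0\<close>.\<close>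

lemma solution_loss_finite:
  assumes t: "0 < t" "t \<le> T"
  shows "emeasure (evolve time_space uno (rate sol) sol t x) (space sizes) < \<infinity>"
proof -
  note g = sol_good and n = goodD(1)[OF sol_good]
  note ok = ok_source_meas[OF uno_measurable n rate_measurable[OF n]]
  note [measurable_cong] = nice_sets[OF n]
  let ?c = "\<delta> powr (- (2/3))"
  define D where "D = C * ?c * (?c * (2 * g0))"
  have le: "rate sol z y \<le> ennreal D * phi y" if y: "\<delta> \<le> y" for z y
  proof -
    have "rate sol z y \<le> ennreal C * w y * (\<integral>\<^sup>+y. w y \<partial>sol z)" using y pos by (intro rate_le_w n) simp
    also have "\<dots> \<le> ennreal C * (ennreal ?c * phi y) * (ennreal ?c * ennreal (2 * g0))"
      by (intro mult_mono w_le_phi y order_trans[OF nice_w_le[OF n]] goodD(2)[OF g]) auto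
    also have "\<dots> = (ennreal C * ennreal ?c * (ennreal ?c * ennreal (2 * g0))) * phi y" by (simp only: ac_simps)
    also have "ennreal C * ennreal ?c * (ennreal ?c * ennreal (2 * g0)) = ennreal D" using pos unfolding D_def by (simp only: ennreal_mult'[symmetric] powr_ge_zero mult_nonneg_nonneg less_imp_le)
    finally show ?thesis .
  qed
  have m: "(\<lambda>m. \<integral>\<^sup>+y. indicator (space sizes) y * (indicator {..<t} (fst m) * uno (t - fst m) y * rate sol (fst m, snd m) y * p (t - fst m) (snd m) x y)
     \<partial>sol (fst m, snd m)) \<in> borel_measurable (borel \<Otimes>\<^sub>M borel)"
    by (rule evolve_density_measurable[OF ok]) measurable
  have "emeasure (evolve time_space uno (rate sol) sol t x) (space sizes) = (\<integral>\<^sup>+s. \<integral>\<^sup>+x'. \<integral>\<^sup>+y. indicator (space sizes) y *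
     (indicator {..<t} s * uno (t - s) y * rate sol (s, x') y * p (t - s) x' x y) \<partial>sol (s, x') \<partial>lborel \<partial>lborel)"
    unfolding emeasure_evolve[OF ok sets.top] by (rule nn_integral_time_space) (use m in \<open>simp add: case_prod_beta'\<close>)
  also have "\<dots> \<le> (\<integral>\<^sup>+s. indicator {0<..<t} s * (ennreal D * ennreal (2 * g0)) \<partial>lborel)"
  proof (rule nn_integral_mono)
    fix s :: real
    show "(\<integral>\<^sup>+x'. \<integral>\<^sup>+y. indicator (space sizes) y * (indicator {..<t} s * uno (t - s) y * rate sol (s, x') y * p (t - s) x' x y) \<partial>sol (s, x') \<partial>lborel)
      \<le> indicator {0<..<t} s * (ennreal D * ennreal (2 * g0))"
    proof (cases "0 < s \<and> s < t")
      case False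
      then show ?thesis using nice_zero[OF n, of s] by (cases "s \<le> 0") auto
    next
      case True
      have "(\<integral>\<^sup>+x'. \<integral>\<^sup>+y. indicator (space sizes) y * (indicator {..<t} s * uno (t - s) y * rate sol (s, x') y * p (t - s) x' x y) \<partial>sol (s, x') \<partial>lborel)
        \<le> (\<integral>\<^sup>+x'. ennreal D * (\<integral>\<^sup>+y. phi y * p (t - s) x' x y \<partial>sol (s, x')) \<partial>lborel)"
      proof (rule nn_integral_mono)
        fix x'
        have "(\<integral>\<^sup>+y. indicator (space sizes) y * (indicator {..<t} s * uno (t - s) y * rate sol (s, x') y * p (t - s) x' x y) \<partial>sol (s, x'))
          \<le> (\<integral>\<^sup>+y. ennreal D * (phi y * p (t - s) x' x y) \<partial>sol (s, x'))"
          using AE_pair_size_ge[OF n, of "(s, x')"]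
          by (intro nn_integral_mono_AE) (auto elim!: eventually_mono split: split_indicator simp: uno_def True mult.assoc[symmetric] intro!: mult_right_mono le)
        also have "\<dots> = ennreal D * (\<integral>\<^sup>+y. phi y * p (t - s) x' x y \<partial>sol (s, x'))" by (rule nn_integral_cmult) measurable
        finally show "(\<integral>\<^sup>+y. indicator (space sizes) y * (indicator {..<t} s * uno (t - s) y * rate sol (s, x') y * p (t - s) x' x y) \<partial>sol (s, x'))
          \<le> ennreal D * (\<integral>\<^sup>+y. phi y * p (t - s) x' x y \<partial>sol (s, x'))" .
      qed
      also have "\<dots> = ennreal D * observe sol phi s (t - s) x"
        using True unfolding observe_def
        by (simp, intro nn_integral_cmult) (simp, rule kernel_param_measurable[OF nice_lfk[OF n]], measurable)
      also have "\<dots> \<le> ennreal D * ennreal (2 * g0)"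
        by (rule mult_left_mono[OF phi_bound[OF n n good_rate_ok[OF g] exp_sol_mild[OF sol_exp_sol] order_refl goodD(2)[OF g]]])
          (use True t in auto)
      finally show ?thesis using True by simp
    qed
  qed
  also have "\<dots> = ennreal t * (ennreal D * ennreal (2 * g0))" using t by (intro const_integral) simp
  also have "\<dots> < \<infinity>" by (simp add: ennreal_mult_less_top)
  finally show ?thesis .
qed

lemma solution_solves: "solves solution"
  unfolding solves_def coag_diffusion_solution_def
proof (intro conjI ballI)
  note n = goodD(1)[OF sol_good]
  have r: "represents solution sol" by (rule nice_represents[OF n]) (simp add: solution_def)
  have sets: "sets (\<mu>\<^sub>0 x) = sets sizes" for x using \<mu>\<^sub>0_kernel by (simp add: measurable_kernel_def)
  show "solution \<in> time_kernels T"
    unfolding time_kernels_def measurable_kernel_def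
  proof (intro CollectI conjI ballI)
    show "sets (case z of (t, x) \<Rightarrow> solution t x) = sets sizes" for z :: "real \<times> 'x"
      by (cases z) (simp add: solution_def sets nice_sets[OF n])
    fix A assume A: "A \<in> sets sizes"
    have f: "fst \<in> borel_measurable (restrict_space borel {0..T} \<Otimes>\<^sub>M (borel :: 'x measure))"
      using measurable_compose[OF measurable_fst measurable_restrict_space1[OF measurable_ident]] by (simp add: id_def)
    have [measurable]: "(\<lambda>z. emeasure (sol (fst z, snd z)) A) \<in> borel_measurable (restrict_space borel {0..T} \<Otimes>\<^sub>M borel)"
      by (rule lfk_emeasure_measurable[OF nice_lfk[OF n] A]) (use f in \<open>measurable\<close>)
    have [measurable]: "(\<lambda>z. emeasure (\<mu>\<^sub>0 (snd z)) A) \<in> borel_measurable (restrict_space borel {0..T} \<Otimes>\<^sub>M borel)"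
      using \<mu>\<^sub>0_kernel A by (intro measurable_compose[OF measurable_snd]) (simp add: measurable_kernel_def)
    note [measurable] = f
    have "(\<lambda>z. emeasure (case z of (t, x) \<Rightarrow> solution t x) A) = (\<lambda>z. if fst z = 0 then emeasure (\<mu>\<^sub>0 (snd z)) A else emeasure (sol (fst z, snd z)) A)"
      by (auto simp: solution_def)
    also have "\<dots> \<in> borel_measurable (restrict_space borel {0..T} \<Otimes>\<^sub>M borel)" by measurable
    finally show "(\<lambda>z. emeasure (case z of (t, x) \<Rightarrow> solution t x) A) \<in> borel_measurable (restrict_space borel {0..T} \<Otimes>\<^sub>M borel)" .
  qed
  fix t assume t: "t \<in> {0..T}"
  show "coag_diffusion_eq a K \<mu>\<^sub>0 solution t"
  proof (cases "t = 0")
    case True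
    then show ?thesis by (simp add: coag_diffusion_eq_def total_at_0 diffuse_def solution_def)
  next
    case False
    then have t: "0 < t" "t \<le> T" using t by auto
    show ?thesis
      unfolding coag_diffusion_eq_def
    proof (intro allI conjI ballI)
      fix x
      show "total_loss a K solution t x (space sizes) < \<infinity>"
        unfolding total_loss_evolve[OF r n t sets.top] by (rule solution_loss_finite[OF t])
      fix A assume A: "A \<in> sets sizes"
      have "mild sol (rate sol) sol" by (rule exp_sol_mild[OF sol_exp_sol])
      then have "(\<integral>\<^sup>+y. indicator A y \<partial>sol (t, x)) + (\<integral>\<^sup>+y. indicator A y \<partial>evolve time_space uno (rate sol) sol t x)
        = (\<integral>\<^sup>+y. indicator A y \<partial>evolve initial_space uno one ini t x) + (\<integral>\<^sup>+y. indicator A y \<partial>evolve time_space uno one (gain sol sol) t x)"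
        unfolding mild_def using t A borel_measurable_indicator[OF A] by blast
      then show "emeasure (solution t x) A + total_loss a K solution t x A = emeasure (diffuse a t \<mu>\<^sub>0 x) A + total_gain a K solution t x A"
        using t A by (simp add: total_loss_evolve[OF r n t A] total_gain_evolve[OF r n t A] diffuse_initial solution_def nice_sets[OF n])
    qed
  qed
next
  have "(\<integral>\<^sup>+x. moment (\<lambda>y. y) (solution t x) \<partial>lborel) \<le> ennreal (2 * m0)" for t
  proof (cases "t = 0")
    case True
    have "(\<integral>\<^sup>+x. moment (\<lambda>y. y) (\<mu>\<^sub>0 x) \<partial>lborel) = (\<integral>\<^sup>+x. \<integral>\<^sup>+y. ennreal y \<partial>\<mu>' x \<partial>lborel)"
      using \<mu>\<^sub>0_AE by (intro nn_integral_cong_AE) (auto simp: moment_def elim!: eventually_mono)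
    also have "\<dots> \<le> ennreal (2 * m0)" using \<mu>0_mass pos by (elim order_trans) (auto intro!: ennreal_leI)
    finally show ?thesis using True by (simp add: solution_def)
  next
    case False
    then show ?thesis using goodD(3)[OF sol_good, of t] by (simp add: solution_def moment_def)
  qed
  then have "(SUP t\<in>{0..T}. \<integral>\<^sup>+x. moment (\<lambda>y. y) (solution t x) \<partial>lborel) \<le> ennreal (2 * m0)" by (intro SUP_least)
  then show "(SUP t\<in>{0..T}. \<integral>\<^sup>+x. moment (\<lambda>y. y) (solution t x) \<partial>lborel) < \<infinity>" by (rule le_less_trans) simp
qed

theorem exists_unique_solution:
  "\<exists>\<mu>. coag_diffusion_solution a K \<mu>\<^sub>0 T \<mu> \<and>
     (\<forall>\<nu>. coag_diffusion_solution a K \<mu>\<^sub>0 T \<nu> \<longrightarrow> (\<forall>t\<in>{0..T}. \<forall>x. \<nu> t x = \<mu> t x))"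
proof (intro exI[of _ solution] conjI allI impI ballI)
  show "coag_diffusion_solution a K \<mu>\<^sub>0 T solution" using solution_solves by (simp add: solves_def)
  fix \<nu> t x assume "coag_diffusion_solution a K \<mu>\<^sub>0 T \<nu>" and t: "t \<in> {0..T}"
  then have "solves \<nu>" by (simp add: solves_def)
  then show "\<nu> t x = solution t x" using t by (simp add: solution_def solves_initial solves_eq_sol)
qed

end

text \<open>With \<open>u\<close>, \<open>v\<close> the cube roots of the sizes and \<open>d\<close>
  that of \<open>\<delta>\<close>, both \<open>u\<close> and \<open>v\<close> are at least
  \<open>d\<close>, so d (u + v) \<le> 2 u v. Squared, this bounds the first factor by a product;
  the square root is largest at y = y' = \<delta>.\<close>

lemma kernel_bound:
  fixes \<delta> y y' :: real
  assumes "0 < \<delta>" "\<delta> \<le> y" "\<delta> \<le> y'"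
  shows "(y powr (1/3) + y' powr (1/3))\<^sup>2 * sqrt (1 / y + 1 / y')
    \<le> 4 * \<delta> powr (- (2/3)) * sqrt (2 / \<delta>) * (y powr (2/3) * y' powr (2/3))"
proof -
  define u v d where "u = y powr (1/3)" and "v = y' powr (1/3)" and "d = \<delta> powr (1/3)"
  have d: "0 < d" "d \<le> u" "d \<le> v" using assms by (auto simp: u_def v_def d_def intro: powr_mono2)
  have sq: "z powr (2/3) = (z powr (1/3))\<^sup>2" for z :: real by (simp add: power2_eq_square flip: powr_add)
  have "d * (u + v) \<le> 2 * (u * v)"
  proof -
    have "d * u \<le> v * u" "d * v \<le> u * v" using d by (auto intro: mult_right_mono)
    then show ?thesis by (simp add: algebra_simps)
  qed
  then have "(d * (u + v))\<^sup>2 \<le> (2 * (u * v))\<^sup>2" using d by (intro power_mono) auto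
  then have "(u + v)\<^sup>2 \<le> 4 * inverse (d\<^sup>2) * (u\<^sup>2 * v\<^sup>2)"
    using d by (simp only: power_mult_distrib) (simp add: divide_simps mult_ac)
  also have "inverse (d\<^sup>2) = \<delta> powr (- (2/3))" by (simp add: d_def sq powr_minus)
  finally have 1: "(u + v)\<^sup>2 \<le> 4 * \<delta> powr (- (2/3)) * (u\<^sup>2 * v\<^sup>2)" .
  have "1 / y + 1 / y' \<le> 1 / \<delta> + 1 / \<delta>" using assms by (intro add_mono frac_le) auto
  then have 2: "sqrt (1 / y + 1 / y') \<le> sqrt (2 / \<delta>)" by simp
  have "(u + v)\<^sup>2 * sqrt (1 / y + 1 / y') \<le> 4 * \<delta> powr (- (2/3)) * (u\<^sup>2 * v\<^sup>2) * sqrt (2 / \<delta>)"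
    using assms by (intro mult_mono 1 2) auto
  then show ?thesis unfolding sq[of y] sq[of y'] u_def[symmetric] v_def[symmetric] by (simp add: mult_ac)
qed

theorem corollary2p7:
  fixes K :: "real \<Rightarrow> real \<Rightarrow> real" and a :: "real \<Rightarrow> real"
    and \<mu>\<^sub>0 :: "real ^ 3 \<Rightarrow> real measure" and \<delta> :: real
  assumes K: "K = (\<lambda>y\<^sub>1 y\<^sub>2. (y\<^sub>1 powr (1/3) + y\<^sub>2 powr (1/3))\<^sup>2 * sqrt (1 / y\<^sub>1 + 1 / y\<^sub>2))"
    and a: "a = (\<lambda>y. y powr (- 1/3)) \<or> a = (\<lambda>y. y powr (- 2/3))"
    and kernel: "measurable_kernel borel \<mu>\<^sub>0"
    and \<delta>: "\<delta> > 0" "\<forall>x. emeasure (\<mu>\<^sub>0 x) {0<..<\<delta>} = 0"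
    and moment_4_3: "(SUP t\<in>{0<..}. esssup lborel (\<lambda>x. moment (\<lambda>y. y powr (4/3)) (diffuse a t \<mu>\<^sub>0 x))) < \<infinity>"
    and mass: "(\<integral>\<^sup>+ x. moment (\<lambda>y. y) (\<mu>\<^sub>0 x) \<partial>lborel) < \<infinity>"
  shows "\<exists>T>0. \<exists>\<mu>. coag_diffusion_solution a K \<mu>\<^sub>0 T \<mu> \<and>
           (\<forall>\<nu>. coag_diffusion_solution a K \<mu>\<^sub>0 T \<nu> \<longrightarrow> (\<forall>t\<in>{0..T}. \<forall>x. \<nu> t x = \<mu> t x))"
proof -
  \<comment> \<open>Both diffusivities have the form \<open>y powr (- c)\<close> with
    \<open>c\<close> in (0,2/3], the range in which the heat kernel is monotone in the required
    sense.\<close>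
  obtain c where c: "0 < c" "c \<le> 2/3" and ac: "a = (\<lambda>y. y powr (- c))"
    using a that[of "1/3"] that[of "2/3"] by auto
  define p where "p t x' x y = ennreal (diffusion_density a t x' x y)" for t and x' x :: "real ^ 3" and y
  interpret heat p unfolding p_def ac by (rule heat_gaussian[OF c])
  \<comment> \<open>The positions with infinite first moment form a null set, so erasing the kernel
    there leaves the diffused kernels at positive times unchanged.\<close>
  define \<mu>' where "\<mu>' x = (if (\<integral>\<^sup>+y. ennreal y \<partial>\<mu>\<^sub>0 x) < \<infinity> then \<mu>\<^sub>0 x else null_measure sizes)" for x
  have l: "locally_finite_kernel \<mu>'" unfolding \<mu>'_def by (rule finite_mass_lfk[OF kernel])
  have AE: "AE x in lborel. \<mu>\<^sub>0 x = \<mu>' x"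
  proof -
    have "(\<lambda>x. \<integral>\<^sup>+y. ennreal y \<partial>\<mu>\<^sub>0 x) \<in> borel_measurable lborel"
      using kernel by (intro kernel_nn_integral_measurable) (auto simp: measurable_kernel_def)
    then have "AE x in lborel. (\<integral>\<^sup>+y. ennreal y \<partial>\<mu>\<^sub>0 x) \<noteq> \<infinity>"
      using mass by (intro nn_integral_PInf_AE) (auto simp: moment_def)
    then show ?thesis by eventually_elim (auto simp: \<mu>'_def less_top)
  qed
  define S where "S = (SUP t\<in>{0<..}. esssup lborel (\<lambda>x. moment (\<lambda>y. y powr (4/3)) (diffuse a t \<mu>\<^sub>0 x)))"
  \<comment> \<open>The added 1, here and in \<open>m0\<close>, keeps the constants positive when
    the moments vanish.\<close>
  define g0 where "g0 = enn2real S + 1"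
  define m0 where "m0 = enn2real (\<integral>\<^sup>+x. moment (\<lambda>y. y) (\<mu>\<^sub>0 x) \<partial>lborel) + 1"
  define C where "C = 4 * \<delta> powr (- (2/3)) * sqrt (2 / \<delta>)"
  define T where "T = 1 / (100 * C * g0)"
  define k where "k y y' = (if y < \<delta> \<or> y' < \<delta> then 0 else ennreal (K y y'))" for y y'
  have g0: "0 < g0" and m0: "0 < m0" and C: "0 < C" using \<delta>(1) by (simp_all add: g0_def m0_def C_def add_nonneg_pos)
  then have T: "0 < T" by (simp add: T_def)
  have mK: "(\<lambda>(y, y'). K y y') \<in> borel_measurable (sizes \<Otimes>\<^sub>M sizes)" unfolding K by measurable
  have K_sym: "K y y' = K y' y" for y y' by (simp add: K add.commute)
  interpret coag_problem p k \<delta> C g0 m0 T \<mu>' a K \<mu>\<^sub>0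
  proof
    show "0 < \<delta>" "0 < C" "0 < g0" "0 < m0" "0 < T" by (fact \<delta>(1) C g0 m0 T)+
    show "(\<lambda>(y, y'). k y y') \<in> borel_measurable (sizes \<Otimes>\<^sub>M sizes)" unfolding k_def K by measurable
    show "k y y' = k y' y" for y y' by (auto simp: k_def K_sym[of y'])
    show "k y y' \<le> ennreal (C * (y powr (2/3) * y' powr (2/3)))" for y y'
      using kernel_bound[OF \<delta>(1), of y y'] by (auto simp: k_def K C_def intro!: ennreal_leI)
    show "y < \<delta> \<Longrightarrow> k y y' = 0" for y y' by (simp add: k_def)
    show "locally_finite_kernel \<mu>'" by (rule l)
    show "emeasure (\<mu>' x) {0<..<\<delta>} = 0" for x using \<delta>(2) by (simp add: \<mu>'_def)
    show "(\<integral>\<^sup>+x'. \<integral>\<^sup>+y. phi y * p t x' x y \<partial>\<mu>' x' \<partial>lborel) \<le> ennreal g0" if t: "0 < t" for t x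
    proof -
      have "esssup lborel (\<lambda>x. moment (\<lambda>y. y powr (4/3)) (diffuse a t \<mu>\<^sub>0 x)) \<le> S"
        unfolding S_def using t by (intro SUP_upper) simp
      moreover have "S \<le> ennreal g0" using moment_4_3 unfolding S_def[symmetric] g0_def
        by (cases S) (auto intro!: ennreal_leI)
      ultimately have e: "esssup lborel (\<lambda>x. moment (\<lambda>y. y powr (4/3)) (diffuse a t \<mu>\<^sub>0 x)) \<le> ennreal g0" by (rule order_trans)
      \<comment> \<open>The hypothesis bounds an essential supremum and so yields the bound almost
        everywhere for each \<open>t\<close>; \<open>AE_bound_everywhere\<close> removes the
        exceptional positions.\<close>
      have "AE x in lborel. moment (\<lambda>y. y powr (4/3)) (diffuse a t \<mu>\<^sub>0 x) \<le> ennreal g0"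
        using esssup_AE[of "\<lambda>x. moment (\<lambda>y. y powr (4/3)) (diffuse a t \<mu>\<^sub>0 x)" lborel]
        by eventually_elim (rule order_trans[OF _ e])
      moreover have "moment (\<lambda>y. y powr (4/3)) (diffuse a t \<mu>\<^sub>0 x) = (\<integral>\<^sup>+x'. \<integral>\<^sup>+y. phi y * p t x' x y \<partial>\<mu>' x' \<partial>lborel)" for x
        using nn_integral_diffuse[OF p_def l AE t phi_measurable, of x] by (simp add: moment_def phi_def)
      ultimately have "AE x in lborel. (\<integral>\<^sup>+x'. \<integral>\<^sup>+y. phi y * p t x' x y \<partial>\<mu>' x' \<partial>lborel) \<le> ennreal g0" by simp
      then show ?thesis unfolding p_def ac by (rule AE_bound_everywhere[OF l phi_measurable c t])
    qed
    show "(\<integral>\<^sup>+x. \<integral>\<^sup>+y. ennreal y \<partial>\<mu>' x \<partial>lborel) \<le> ennreal m0"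
    proof -
      have "(\<integral>\<^sup>+x. \<integral>\<^sup>+y. ennreal y \<partial>\<mu>' x \<partial>lborel) = (\<integral>\<^sup>+x. moment (\<lambda>y. y) (\<mu>\<^sub>0 x) \<partial>lborel)"
        using AE by (intro nn_integral_cong_AE) (auto simp: moment_def elim!: eventually_mono)
      also have "\<dots> \<le> ennreal m0" using mass unfolding m0_def
        by (cases "\<integral>\<^sup>+x. moment (\<lambda>y. y) (\<mu>\<^sub>0 x) \<partial>lborel") (auto intro!: ennreal_leI)
      finally show ?thesis .
    qed
    show "100 * C * g0 * T \<le> 1" using C g0 by (simp add: T_def)
    show "p t x' x y = ennreal (diffusion_density a t x' x y)" for t x' x y by (rule p_def)
    show "\<delta> \<le> y \<Longrightarrow> \<delta> \<le> y' \<Longrightarrow> k y y' = ennreal (K y y')" for y y' by (simp add: k_def)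
    show "(\<lambda>(y, y'). K y y') \<in> borel_measurable (sizes \<Otimes>\<^sub>M sizes)" by (rule mK)
    show "K y y' = K y' y" for y y' by (rule K_sym)
    show "measurable_kernel borel \<mu>\<^sub>0" by (rule kernel)
    show "AE x in lborel. \<mu>\<^sub>0 x = \<mu>' x" by (rule AE)
  qed
  show ?thesis using T exists_unique_solution by blast
qed

end
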